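(* Let $N$ be a $d$-dimensional nonexplosive counting process with intensity $\lambda$, where $\lambda$ is a $d$-dimensional nonnegative, predictable and locally bounded process, and let $\mu$ be another $d$-dimensional nonnegative, predictable and locally bounded process. Assume that $\mu$ is $\lambda$-compatible. Put $M^i_t=N^i_t-\int_0^t\lambda^i_s\,\mathrm{d}s$, $\gamma^i_t=\mu^i_t(\lambda^i_t)^{-1}$, $H^i_t=\gamma^i_t-1$ and $(H\cdot M)_t=\sum_{i=1}^d\int_0^t H^i_s\,\mathrm{d}M^i_s$. Assume that there is an $\varepsilon>0$ such that whenever $0\le u\le t$ with $t-u\le\varepsilon$, one of the following two conditions is satisfied: $$E\exp\left(\sum_{i=1}^d\int_u^t\bigl(\gamma^i_s\log\gamma^i_s-(\gamma^i_s-1)\bigr)\lambda^i_s\,\mathrm{d}s\right)<\infty$$ or $$E\exp\left(\sum_{i=1}^d\left(\int_u^t\lambda^i_s\,\mathrm{d}s+\int_u^t\log_+\gamma^i_s\,\mathrm{d}N^i_s\right)\right)<\infty.$$ Then the Doléans-Dade exponential $\mathcal{E}(H\cdot M)$ is a martingale.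
   Context: All processes are defined on a filtered probability space $(\Omega,\mathcal{F},(\mathcal{F}_t)_{t\ge0},P)$ satisfying the usual conditions; expectations are under $P$. A nonexplosive $d$-dimensional counting process $N$ is a càdlàg, piecewise constant process with jumps of size one such that no two coordinates jump at the same time. A process $X$ is locally bounded if there are stopping times $T_n$ increasing almost surely to infinity such that $X^{T_n}1_{(T_n>0)}$ is bounded for each $n$. For a nonnegative, predictable, locally bounded $d$-dimensional process $\lambda$, $N$ has intensity $\lambda$ if $N^i_t-\int_0^t\lambda^i_s\,\mathrm{d}s$ is a local martingale for each $i$ (predictability and local martingales are with respect to $(\mathcal{F}_t)$, which may be larger than the filtration generated by $N$). $\mu$ is $\lambda$-compatible if for all $\omega\in\Omega$, $\mu^i_t(\omega)=0$ whenever $\lambda^i_t(\omega)=0$, and the process $\gamma$ given by $\gamma^i_t=\mu^i_t(\lambda^i_t)^{-1}$, $i\le d$, is locally bounded. Convention: zero divided by zero equals one. For a semimartingale $X$ with initial value zero, $\mathcal{E}(X)$ is the unique càdlàg adapted solution of $Z_t=1+\int_0^tZ_{s-}\,\mathrm{d}X_s$. Further, $\log_+x=\max\{0,\log x\}$ for $x\ge0$, with $\log 0=-\infty$, and $0\log0=0$. *)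

theory Defs
  imports "HOL-Probability.Probability"
begin

section \<open>Filtered probability spaces and processes\<close>

text \<open>
  Time is \<open>[0,\<infinity>)\<close>; a process is a function of type \<open>real \<Rightarrow> 'a \<Rightarrow> 'b\<close> of which only the values at
  times \<open>t \<ge> 0\<close> matter. The filtration is indexed by \<^typ>\<open>ennreal\<close>, i.e. by \<open>[0,\<infinity>]\<close>, so that
  \<^const>\<open>stopping_time\<close> is available for stopping times with values in \<open>[0,\<infinity>]\<close>. The extra
  member \<open>F \<infinity>\<close> is an arbitrary \<open>\<sigma>\<close>-algebra between all the \<open>F t\<close> and \<open>P\<close>, and it places no
  restriction on stopping times.
\<close>

locale usual_filtered_prob_space =
  prob_space P + complete_measure P + filtration "space P" F
  for P :: "'a measure" and F :: "ennreal \<Rightarrow> 'a measure" +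
  assumes sets_F_subset: "sets (F t) \<subseteq> sets P"
    and null_sets_F0: "null_sets P \<subseteq> sets (F 0)"
    and F_right_continuous: "t < \<infinity> \<Longrightarrow> sets (F t) = (\<Inter>s\<in>{t<..}. sets (F s))"

definition adapted :: "(ennreal \<Rightarrow> 'a measure) \<Rightarrow> (real \<Rightarrow> 'a \<Rightarrow> 'b::topological_space) \<Rightarrow> bool" where
  "adapted F X \<longleftrightarrow> (\<forall>t\<ge>0. X t \<in> borel_measurable (F (ennreal t)))"

definition predictable_sigma :: "'a measure \<Rightarrow> (ennreal \<Rightarrow> 'a measure) \<Rightarrow> (real \<times> 'a) measure" where
  "predictable_sigma P F = sigma ({0..} \<times> space P)
     ({{0} \<times> A |A. A \<in> sets (F 0)} \<union>
      {{s<..t} \<times> A |s t A. 0 \<le> s \<and> s \<le> t \<and> A \<in> sets (F (ennreal s))})"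

definition predictable ::
    "'a measure \<Rightarrow> (ennreal \<Rightarrow> 'a measure) \<Rightarrow> (real \<Rightarrow> 'a \<Rightarrow> 'b::topological_space) \<Rightarrow> bool" where
  "predictable P F X \<longleftrightarrow> (\<lambda>(t, \<omega>). X t \<omega>) \<in> borel_measurable (predictable_sigma P F)"

definition stopped :: "('a \<Rightarrow> ennreal) \<Rightarrow> (real \<Rightarrow> 'a \<Rightarrow> 'b) \<Rightarrow> real \<Rightarrow> 'a \<Rightarrow> 'b" where
  "stopped T X t \<omega> = X (enn2real (min (ennreal t) (T \<omega>))) \<omega>"

definition stopped_pos ::
    "('a \<Rightarrow> ennreal) \<Rightarrow> (real \<Rightarrow> 'a \<Rightarrow> 'b::real_vector) \<Rightarrow> real \<Rightarrow> 'a \<Rightarrow> 'b" where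
  "stopped_pos T X t \<omega> = (if 0 < T \<omega> then stopped T X t \<omega> else 0)"

definition localizing ::
    "'a measure \<Rightarrow> (ennreal \<Rightarrow> 'a measure) \<Rightarrow> (nat \<Rightarrow> 'a \<Rightarrow> ennreal) \<Rightarrow> bool" where
  "localizing P F T \<longleftrightarrow> (\<forall>n. stopping_time F (T n)) \<and>
     (AE \<omega> in P. incseq (\<lambda>n. T n \<omega>) \<and> (\<lambda>n. T n \<omega>) \<longlonglongrightarrow> \<infinity>)"

definition locally_bounded ::
    "'a measure \<Rightarrow> (ennreal \<Rightarrow> 'a measure) \<Rightarrow> (real \<Rightarrow> 'a \<Rightarrow> 'b::real_normed_vector) \<Rightarrow> bool" where
  "locally_bounded P F X \<longleftrightarrow> (\<exists>T. localizing P F T \<and>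
     (\<forall>n. bounded ((\<lambda>(t, \<omega>). stopped_pos (T n) X t \<omega>) ` ({0..} \<times> space P))))"

definition martingale ::
    "'a measure \<Rightarrow> (ennreal \<Rightarrow> 'a measure) \<Rightarrow> (real \<Rightarrow> 'a \<Rightarrow> real) \<Rightarrow> bool" where
  "martingale P F X \<longleftrightarrow> adapted F X \<and> (\<forall>t\<ge>0. integrable P (X t)) \<and>
     (\<forall>s t. 0 \<le> s \<and> s \<le> t \<longrightarrow> (AE \<omega> in P. real_cond_exp P (F (ennreal s)) (X t) \<omega> = X s \<omega>))"

definition cadlag :: "(real \<Rightarrow> real) \<Rightarrow> bool" where
  "cadlag f \<longleftrightarrow> (\<forall>t\<ge>0. (f \<longlongrightarrow> f t) (at_right t)) \<and> (\<forall>t>0. \<exists>l. (f \<longlongrightarrow> l) (at_left t))"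

text \<open>
  The path property is required only almost surely: local boundedness controls the paths of
  \<open>\<integral>\<^sub>0\<^sup>t \<lambda>\<^sub>s ds\<close> only outside a null set.
\<close>

definition local_martingale ::
    "'a measure \<Rightarrow> (ennreal \<Rightarrow> 'a measure) \<Rightarrow> (real \<Rightarrow> 'a \<Rightarrow> real) \<Rightarrow> bool" where
  "local_martingale P F X \<longleftrightarrow> adapted F X \<and> (AE \<omega> in P. cadlag (\<lambda>t. X t \<omega>)) \<and>
     (\<exists>T. localizing P F T \<and> (\<forall>n. martingale P F (stopped_pos (T n) X)))"

section \<open>Counting processes and intensities\<close>

text \<open>Being constant across \<open>u < v\<close> unless \<open>D\<close> meets \<open>{u<..v}\<close> forces right continuity at the
  points of \<open>D\<close>. Finiteness of \<open>D\<close> on every bounded interval is nonexplosiveness.\<close>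

definition piecewise_constant :: "(real \<Rightarrow> real) \<Rightarrow> bool" where
  "piecewise_constant f \<longleftrightarrow> (\<forall>t\<ge>0. \<exists>D. finite D \<and>
     (\<forall>u v. 0 \<le> u \<and> u \<le> v \<and> v \<le> t \<and> {u<..v} \<inter> D = {} \<longrightarrow> f u = f v))"

definition left_lim :: "(real \<Rightarrow> real) \<Rightarrow> real \<Rightarrow> real" where
  "left_lim f t = Lim (at_left t) f"

definition jump :: "(real \<Rightarrow> real) \<Rightarrow> real \<Rightarrow> real" where
  "jump f t = f t - left_lim f t"

definition counting_process ::
    "'a measure \<Rightarrow> (ennreal \<Rightarrow> 'a measure) \<Rightarrow> (real \<Rightarrow> 'a \<Rightarrow> real^'d) \<Rightarrow> bool" where
  "counting_process P F N \<longleftrightarrow> adapted F N \<and>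
     (\<forall>\<omega>\<in>space P.
        (\<forall>i. cadlag (\<lambda>t. N t \<omega> $ i) \<and> piecewise_constant (\<lambda>t. N t \<omega> $ i) \<and>
             (\<forall>t>0. jump (\<lambda>t. N t \<omega> $ i) t \<in> {0, 1})) \<and>
        (\<forall>i j. i \<noteq> j \<longrightarrow> (\<forall>t>0. jump (\<lambda>t. N t \<omega> $ i) t = 0 \<or> jump (\<lambda>t. N t \<omega> $ j) t = 0)))"

definition nonneg_process :: "'a measure \<Rightarrow> (real \<Rightarrow> 'a \<Rightarrow> real^'d) \<Rightarrow> bool" where
  "nonneg_process P X \<longleftrightarrow> (\<forall>t\<ge>0. \<forall>\<omega>\<in>space P. \<forall>i. 0 \<le> X t \<omega> $ i)"

definition compensated ::
    "(real \<Rightarrow> 'a \<Rightarrow> real^'d) \<Rightarrow> (real \<Rightarrow> 'a \<Rightarrow> real^'d) \<Rightarrow> real \<Rightarrow> 'a \<Rightarrow> real^'d" where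
  "compensated N l t \<omega> = (\<chi> i. N t \<omega> $ i - (LINT s:{0..t}|lborel. l s \<omega> $ i))"

definition has_intensity ::
    "'a measure \<Rightarrow> (ennreal \<Rightarrow> 'a measure) \<Rightarrow> (real \<Rightarrow> 'a \<Rightarrow> real^'d) \<Rightarrow> (real \<Rightarrow> 'a \<Rightarrow> real^'d) \<Rightarrow> bool"
  where
  "has_intensity P F N l \<longleftrightarrow> (\<forall>i. local_martingale P F (\<lambda>t \<omega>. compensated N l t \<omega> $ i))"

text \<open>The quotient \<open>\<mu> \<lambda>\<^sup>-\<^sup>1\<close>, with \<open>0/0 = 1\<close>.\<close>

definition intensity_ratio ::
    "(real \<Rightarrow> 'a \<Rightarrow> real^'d) \<Rightarrow> (real \<Rightarrow> 'a \<Rightarrow> real^'d) \<Rightarrow> real \<Rightarrow> 'a \<Rightarrow> real^'d" where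
  "intensity_ratio m l t \<omega> =
     (\<chi> i. if m t \<omega> $ i = 0 \<and> l t \<omega> $ i = 0 then 1 else m t \<omega> $ i / l t \<omega> $ i)"

definition compatible ::
    "'a measure \<Rightarrow> (ennreal \<Rightarrow> 'a measure) \<Rightarrow> (real \<Rightarrow> 'a \<Rightarrow> real^'d) \<Rightarrow> (real \<Rightarrow> 'a \<Rightarrow> real^'d) \<Rightarrow> bool"
  where
  "compatible P F m l \<longleftrightarrow>
     (\<forall>\<omega>\<in>space P. \<forall>t\<ge>0. \<forall>i. l t \<omega> $ i = 0 \<longrightarrow> m t \<omega> $ i = 0) \<and>
     locally_bounded P F (intensity_ratio m l)"

section \<open>Stieltjes integrals and the Dol\'eans-Dade exponential\<close>

text \<open>
  \<open>has_stieltjes_integral f A a b I\<close>: the Lebesgue-Stieltjes integral of \<open>f\<close> over \<open>(a,b]\<close> against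
  \<open>A\<close>, a right-continuous function of finite variation on \<open>[a,b]\<close>, exists and equals \<open>I\<close>. The
  value does not depend on the decomposition of \<open>A\<close> into monotone functions.
\<close>

definition has_stieltjes_integral ::
    "(real \<Rightarrow> real) \<Rightarrow> (real \<Rightarrow> real) \<Rightarrow> real \<Rightarrow> real \<Rightarrow> real \<Rightarrow> bool" where
  "has_stieltjes_integral f A a b I \<longleftrightarrow> (\<exists>B C.
     mono B \<and> mono C \<and>
     (\<forall>s. continuous (at_right s) B) \<and> (\<forall>s. continuous (at_right s) C) \<and>
     (\<forall>s\<in>{a..b}. A s = B s - C s) \<and>
     set_integrable (interval_measure B) {a<..b} f \<and>
     set_integrable (interval_measure C) {a<..b} f \<and>
     I = (LINT s:{a<..b}|interval_measure B. f s) - (LINT s:{a<..b}|interval_measure C. f s))"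

definition stieltjes_integral ::
    "(real \<Rightarrow> real) \<Rightarrow> (real \<Rightarrow> real) \<Rightarrow> real \<Rightarrow> real \<Rightarrow> real" where
  "stieltjes_integral f A a b = (THE I. has_stieltjes_integral f A a b I)"

text \<open>
  \<open>\<Sum>\<^sub>i \<integral>\<^sub>0\<^sup>t H\<^sup>i dM\<^sup>i\<close> for an integrator whose paths are almost surely of finite variation; for
  predictable, locally bounded \<open>H\<close> the stochastic integral is the pathwise Stieltjes integral.
\<close>

definition integral_process ::
    "(real \<Rightarrow> 'a \<Rightarrow> real^'d) \<Rightarrow> (real \<Rightarrow> 'a \<Rightarrow> real^'d) \<Rightarrow> real \<Rightarrow> 'a \<Rightarrow> real" where
  "integral_process H M t \<omega> =
     (\<Sum>i\<in>UNIV. stieltjes_integral (\<lambda>s. H s \<omega> $ i) (\<lambda>s. M s \<omega> $ i) 0 t)"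

text \<open>
  \<open>Z\<close> is a version of \<open>\<E>(X)\<close>, i.e. a cadlag adapted solution of \<open>Z\<^sub>t = 1 + \<integral>\<^sub>0\<^sup>t Z\<^sub>s\<^sub>- dX\<^sub>s\<close>, for
  \<open>X\<close> of finite variation. Solutions are unique only up to indistinguishability, hence a predicate.
\<close>

definition doleans_dade ::
    "'a measure \<Rightarrow> (ennreal \<Rightarrow> 'a measure) \<Rightarrow> (real \<Rightarrow> 'a \<Rightarrow> real) \<Rightarrow> (real \<Rightarrow> 'a \<Rightarrow> real) \<Rightarrow> bool"
  where
  "doleans_dade P F X Z \<longleftrightarrow> adapted F Z \<and> (\<forall>\<omega>\<in>space P. cadlag (\<lambda>t. Z t \<omega>)) \<and>
     (AE \<omega> in P. \<forall>t\<ge>0.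
        has_stieltjes_integral (left_lim (\<lambda>s. Z s \<omega>)) (\<lambda>s. X s \<omega>) 0 t (Z t \<omega> - 1))"

text \<open>Here \<^term>\<open>ln 0 = (0::real)\<close>, so the value at \<open>0\<close> is \<open>0\<close>, as with \<open>log 0 = -\<infinity>\<close>.\<close>

definition log_plus :: "real \<Rightarrow> real" where
  "log_plus x = max 0 (ln x)"

end

theory Submission
  imports Defs
begin

text \<open>
  Write \<open>Z g\<close> for the explicit exponential
  \<open>exp (- \<Sum>\<^sub>i \<integral>\<^sub>0\<^sup>t (g\<^sub>i - 1) lam\<^sub>i ds) * \<Prod>\<^sub>i \<Prod>\<^sub>s g\<^sub>i s\<close>, the inner product running over the jump times of the
  \<open>i\<close>-th coordinate in \<open>{0<..t}\<close>, of a predictable factor \<open>g \<ge> 0\<close>. Along almost every path the integrator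
  \<open>H \<bullet> M\<close> has finitely many jumps and a bounded drift on bounded intervals, so that \<open>Z \<gamma>\<close> is the only cadlag solution
  of \<open>dZ = Z\<^sub>- d(H \<bullet> M)\<close> (\<open>Z_solves\<close>, \<open>solution_unique\<close>). It remains to show that \<open>Z \<gamma>\<close> is a martingale.

  The probabilistic input is the compensation formula: the integrals of a nonnegative predictable process against
  \<open>N\<^sub>i\<close> and against \<open>lam\<^sub>i dt\<close> have the same expectation (\<open>compensation_formula\<close>). On predictable rectangles it is
  optional stopping for the local martingale \<open>N\<^sub>i - \<integral>lam\<^sub>i\<close>; Dynkin's lemma and monotone convergence do the rest. Where
  a factor, the intensity or the number of earlier jumps exceeds \<open>n\<close>, replace the factor by \<open>1\<close>. The exponential of the
  truncated factor is bounded, and its equation and the compensation formula give it expectation \<open>1\<close>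
  (\<open>tame_expectation\<close>). Hence \<open>E (Z g) \<le> 1\<close> by Fatou's lemma, and only \<open>E (Z g) \<ge> 1\<close> is in question.

  Under the condition on \<open>log\<^sub>+ \<gamma>\<close> all truncated exponentials have a common integrable majorant
  (\<open>start_log_bound\<close>). Under the entropy condition, let \<open>Y\<close> be its integrable exponential and \<open>0 < a < 1\<close>. The
  inequality \<open>a (x - 1) - (1 - a) (x ln x - (x - 1)) \<le> x\<^sup>a - 1\<close> gives \<open>Z (g\<^sup>a) \<le> (Z g)\<^sup>a Y\<^sup>1\<^sup>-\<^sup>a\<close> for truncated \<open>g\<close>
  as well. Young's inequality bounds the right-hand side by \<open>a Z g + (1 - a) Y\<close>, and the event where truncation
  changes \<open>Z g\<close> contributes arbitrarily little because \<open>Y\<close> is integrable. So \<open>1 \<le> a E (Z g) + (1 - a) E Y\<close>, and \<open>a\<close> may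
  tend to \<open>1\<close> (\<open>Z_expectation_entropy\<close>).

  For \<open>t - u \<le> \<epsilon>\<close> this applies to the factor that equals \<open>\<gamma>\<close> after time \<open>u\<close> on an event \<open>A \<in> F u\<close> and \<open>1\<close> elsewhere.
  Its expectation \<open>1\<close> says that the integral of the quotient of \<open>Z \<gamma>\<close> at \<open>t\<close> and \<open>u\<close> over \<open>A\<close> is the probability of \<open>A\<close>; hence
  \<open>Z \<gamma>\<close> is a martingale over steps of length at most \<open>\<epsilon>\<close> (\<open>Z_step\<close>), and the steps are chained
  (\<open>martingale_of_steps\<close>).
\<close>

section \<open>Lebesgue-Stieltjes integrals\<close>

lemma interval_measure_eqI:
  fixes G :: "real \<Rightarrow> real"
  assumes G: "mono G" "\<And>s. continuous (at_right s) G"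
    and sets_M: "sets M = sets borel"
    and M: "\<And>u v. u \<le> v \<Longrightarrow> emeasure M {u<..v} = ennreal (G v - G u)"
  shows "interval_measure G = M"
proof (rule measure_eqI_generator_eq_countable)
  let ?E = "range (\<lambda>(a, b). {a <.. b::real})"
  show "Int_stable ?E"
    by (auto simp: Int_stable_def Int_greaterThanAtMost)
  show "?E \<subseteq> Pow UNIV" by auto
  show "sets (interval_measure G) = sigma_sets UNIV ?E" "sets M = sigma_sets UNIV ?E"
    by (simp_all add: sets_M borel_sigma_sets_Ioc)
  have mG: "\<And>x y. x \<le> y \<Longrightarrow> G x \<le> G y" using G(1) by (auto simp: mono_def)
  have ioc: "emeasure (interval_measure G) {u<..v} = ennreal (G v - G u)" if "u \<le> v" for u v
    using emeasure_interval_measure_Ioc[OF that mG G(2)] by simp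
  show "emeasure (interval_measure G) X = emeasure M X" if "X \<in> ?E" for X
  proof -
    from that obtain u v where X: "X = {u<..v}" by (auto simp: image_iff)
    then show ?thesis using ioc[of u v] M[of u v] by (cases "u \<le> v") auto
  qed
  let ?A = "(\<lambda>n::nat. {- real n <.. real n}) ` UNIV"
  show "countable ?A" by auto
  show "?A \<subseteq> ?E" by auto
  show "\<Union>?A = UNIV"
  proof -
    have "x \<in> \<Union>?A" for x :: real
    proof -
      obtain n where "\<bar>x\<bar> < real n" using reals_Archimedean2 by blast
      then show ?thesis by (auto intro!: bexI[of _ n] exI[of _ n])
    qed
    then show ?thesis by blast
  qed
  show "emeasure (interval_measure G) a \<noteq> \<infinity>" if "a \<in> ?A" for a
    using that ioc by auto
qed

text \<open>A measure that is the sum of two given ones, used to identify the measure of a sum of integrators.\<close>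

lemma sum_measure_exists:
  assumes "sets M1 = sets borel" "sets M2 = (sets borel :: 'b::topological_space set set)"
  obtains M where "sets M = sets borel"
    "\<And>X. X \<in> sets borel \<Longrightarrow> emeasure M X = emeasure M1 X + emeasure M2 X"
proof -
  define M where "M = measure_of UNIV (sets borel) (\<lambda>X. emeasure M1 X + emeasure M2 X)"
  have sets_M: "sets M = sets (borel :: 'b measure)"
    unfolding M_def by (metis sets.sigma_sets_eq sets.space_closed sets_measure_of space_borel)
  have em: "emeasure M X = emeasure M1 X + emeasure M2 X" if "X \<in> sets borel" for X
  proof (rule emeasure_measure_of[OF M_def])
    show "(sets borel :: 'b set set) \<subseteq> Pow UNIV" by simp
    show "X \<in> sets M" using that sets_M by simp
    show "positive (sets M) (\<lambda>X. emeasure M1 X + emeasure M2 X)"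
      by (auto simp: positive_def)
    show "countably_additive (sets M) (\<lambda>X. emeasure M1 X + emeasure M2 X)"
      unfolding countably_additive_def
    proof safe
      fix A :: "nat \<Rightarrow> 'b set" assume A: "range A \<subseteq> sets M" "disjoint_family A"
      have "(\<Sum>i. emeasure M1 (A i) + emeasure M2 (A i)) = (\<Sum>i. emeasure M1 (A i)) + (\<Sum>i. emeasure M2 (A i))"
        by (rule suminf_add[symmetric]) auto
      also have "\<dots> = emeasure M1 (\<Union>(range A)) + emeasure M2 (\<Union>(range A))"
        using A sets_M assms by (simp add: suminf_emeasure)
      finally show "(\<Sum>i. emeasure M1 (A i) + emeasure M2 (A i)) = emeasure M1 (\<Union>(range A)) + emeasure M2 (\<Union>(range A))" .
    qed
  qed
  show ?thesis using that[OF sets_M em] by blast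
qed

lemma nn_integral_sum_measure:
  fixes f :: "'b \<Rightarrow> ennreal"
  assumes sM: "sets M1 = sets M" "sets M2 = sets M"
    and em: "\<And>X. X \<in> sets M \<Longrightarrow> emeasure M X = emeasure M1 X + emeasure M2 X"
    and f: "f \<in> borel_measurable M"
  shows "(\<integral>\<^sup>+x. f x \<partial>M) = (\<integral>\<^sup>+x. f x \<partial>M1) + (\<integral>\<^sup>+x. f x \<partial>M2)"
  using f
proof induction
  have m [simp]: "borel_measurable M1 = (borel_measurable M :: ('b \<Rightarrow> ennreal) set)" "borel_measurable M2 = (borel_measurable M :: ('b \<Rightarrow> ennreal) set)"
    using sM by (auto intro: measurable_cong_sets)
  have sp: "space M1 = space M" "space M2 = space M" using sM by (auto dest: sets_eq_imp_space_eq)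
  {
    case (cong f g)
    then show ?case using sp by (metis nn_integral_cong)
  next
    case (set A) then show ?case using em sM by simp
  next
    case (mult u c) then show ?case by (simp add: nn_integral_cmult distrib_left)
  next
    case (add u v) then show ?case by (simp add: nn_integral_add ac_simps)
  next
    case (seq U)
    have inc: "incseq (\<lambda>i. integral\<^sup>N M1 (U i))" "incseq (\<lambda>i. integral\<^sup>N M2 (U i))"
      using seq by (auto simp: incseq_def le_fun_def intro!: nn_integral_mono)
    have "integral\<^sup>N M (SUP i. U i) = (SUP i. integral\<^sup>N M (U i))"
      using seq by (subst nn_integral_monotone_convergence_SUP[symmetric]) (auto simp: image_comp intro!: nn_integral_cong)
    moreover have "integral\<^sup>N M1 (SUP i. U i) = (SUP i. integral\<^sup>N M1 (U i))"
      using seq by (subst nn_integral_monotone_convergence_SUP[symmetric]) (auto simp: image_comp intro!: nn_integral_cong)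
    moreover have "integral\<^sup>N M2 (SUP i. U i) = (SUP i. integral\<^sup>N M2 (U i))"
      using seq by (subst nn_integral_monotone_convergence_SUP[symmetric]) (auto simp: image_comp intro!: nn_integral_cong)
    moreover have "(\<Squnion>i. integral\<^sup>N M (U i)) = (\<Squnion>i. integral\<^sup>N M1 (U i)) + (\<Squnion>i. integral\<^sup>N M2 (U i))"
      using seq inc by (simp add: ennreal_SUP_add)
    ultimately have "integral\<^sup>N M (SUP i. U i) = integral\<^sup>N M1 (SUP i. U i) + integral\<^sup>N M2 (SUP i. U i)"
      by simp
    moreover have "f = (SUP i. U i)" by fact
    ultimately show ?case by metis
  }
qed

lemma interval_measure_add:
  fixes f :: "real \<Rightarrow> real"
  assumes B: "mono B" "\<And>s. continuous (at_right s) B"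
    and C: "mono C" "\<And>s. continuous (at_right s) C"
    and f [measurable]: "f \<in> borel_measurable borel"
  shows integrable_interval_measure_add:
      "integrable (interval_measure (\<lambda>x. B x + C x)) f \<longleftrightarrow>
         integrable (interval_measure B) f \<and> integrable (interval_measure C) f"
    and integral_interval_measure_add:
      "integrable (interval_measure B) f \<Longrightarrow> integrable (interval_measure C) f \<Longrightarrow>
        (LINT x|interval_measure (\<lambda>x. B x + C x). f x) = (LINT x|interval_measure B. f x) + (LINT x|interval_measure C. f x)"
proof -
  obtain M where sM: "sets M = sets borel" and
    em: "\<And>X. X \<in> sets borel \<Longrightarrow> emeasure M X = emeasure (interval_measure B) X + emeasure (interval_measure C) X"
    using sum_measure_exists[of "interval_measure B" "interval_measure C"] by auto
  have mB: "\<And>x y. x \<le> y \<Longrightarrow> B x \<le> B y" and mC: "\<And>x y. x \<le> y \<Longrightarrow> C x \<le> C y"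
    using B(1) C(1) by (auto simp: mono_def)
  have eq: "interval_measure (\<lambda>x. B x + C x) = M"
  proof (rule interval_measure_eqI[OF _ _ sM])
    show "mono (\<lambda>x. B x + C x)" using mB mC by (auto simp: mono_def intro!: add_mono)
    show "continuous (at_right s) (\<lambda>x. B x + C x)" for s using B(2) C(2) by (intro continuous_intros)
    show "emeasure M {u<..v} = ennreal (B v + C v - (B u + C u))" if "u \<le> v" for u v
      using that mB[OF that] mC[OF that]
      by (simp add: em emeasure_interval_measure_Ioc[OF that mB B(2)] emeasure_interval_measure_Ioc[OF that mC C(2)]
          ennreal_plus[symmetric] del: ennreal_plus)
  qed
  have nn: "(\<integral>\<^sup>+x. g x \<partial>M) = (\<integral>\<^sup>+x. g x \<partial>interval_measure B) + (\<integral>\<^sup>+x. g x \<partial>interval_measure C)"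
    if "g \<in> borel_measurable borel" for g :: "real \<Rightarrow> ennreal"
    by (rule nn_integral_sum_measure)
       (use sM em that in \<open>auto simp: measurable_cong_sets[OF sM refl]\<close>)
  have fM: "f \<in> borel_measurable M" using f by (simp add: measurable_cong_sets[OF sM refl])
  show "integrable (interval_measure (\<lambda>x. B x + C x)) f \<longleftrightarrow>
         integrable (interval_measure B) f \<and> integrable (interval_measure C) f"
    unfolding eq using nn[of "\<lambda>x. ennreal (norm (f x))"] fM
    by (auto simp: integrable_iff_bounded)
  assume i: "integrable (interval_measure B) f" "integrable (interval_measure C) f"
  then have iM: "integrable M f"
    using nn[of "\<lambda>x. ennreal (norm (f x))"] fM by (auto simp: integrable_iff_bounded)
  have fin: "integral\<^sup>N K (\<lambda>x. ennreal (s * f x)) < \<infinity>" if "integrable K f" "s = 1 \<or> s = -1" for s K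
  proof -
    have "integral\<^sup>N K (\<lambda>x. ennreal (s * f x)) \<le> integral\<^sup>N K (\<lambda>x. ennreal (norm (f x)))"
      using that(2) by (intro nn_integral_mono ennreal_leI) auto
    also have "\<dots> < \<infinity>" using that(1) by (simp add: integrable_iff_bounded)
    finally show ?thesis .
  qed
  show "(LINT x|interval_measure (\<lambda>x. B x + C x). f x) = (LINT x|interval_measure B. f x) + (LINT x|interval_measure C. f x)"
    unfolding eq real_lebesgue_integral_def[OF iM] real_lebesgue_integral_def[OF i(1)] real_lebesgue_integral_def[OF i(2)]
    using nn[of "\<lambda>x. ennreal (f x)"] nn[of "\<lambda>x. ennreal (- f x)"]
      fin[OF i(1), of 1] fin[OF i(1), of "-1"] fin[OF i(2), of 1] fin[OF i(2), of "-1"]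
    by (simp add: enn2real_plus less_top)
qed

text \<open>The integral over \<open>{a<..b}\<close> sees the integrator only on \<open>{a..b}\<close>: restricting the measure to
  \<open>{a<..b}\<close> amounts to stopping the integrator at \<open>a\<close> and \<open>b\<close>.\<close>

lemma interval_measure_restrict_cong:
  fixes f :: "real \<Rightarrow> real"
  assumes B: "mono B" "\<And>s. continuous (at_right s) B"
    and C: "mono C" "\<And>s. continuous (at_right s) C"
    and eq: "\<And>s. s \<in> {a..b} \<Longrightarrow> B s = C s"
    and f [measurable]: "(\<lambda>x. indicator {a<..b} x * f x) \<in> borel_measurable borel"
  shows "(LINT x:{a<..b}|interval_measure B. f x) = (LINT x:{a<..b}|interval_measure C. f x)"
proof -
  define cl where "cl x = max a (min b x)" for x :: real
  have restr: "density (interval_measure G) (indicator {a<..b}) = interval_measure (\<lambda>x. G (cl x))"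
    if G: "mono G" "\<And>s. continuous (at_right s) G" and ab: "a \<le> b" for G
  proof (rule interval_measure_eqI[symmetric])
    show "mono (\<lambda>x. G (cl x))" using G(1) unfolding mono_def cl_def by (smt (verit) )
    show "sets (density (interval_measure G) (indicator {a<..b})) = sets borel" by simp
    have mG: "\<And>x y. x \<le> y \<Longrightarrow> G x \<le> G y" using G(1) by (auto simp: mono_def)
    show "emeasure (density (interval_measure G) (indicator {a<..b})) {u<..v} = ennreal (G (cl v) - G (cl u))" if "u \<le> v" for u v
    proof -
      have "emeasure (density (interval_measure G) (indicator {a<..b})) {u<..v}
        = emeasure (interval_measure G) ({a<..b} \<inter> {u<..v})"
        by (subst emeasure_density) (auto simp: indicator_inter_arith[symmetric])
      also have "{a<..b} \<inter> {u<..v} = {cl u<..cl v}" using that ab unfolding cl_def by auto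
      also have "emeasure (interval_measure G) \<dots> = ennreal (G (cl v) - G (cl u))"
        by (rule emeasure_interval_measure_Ioc[OF _ mG G(2)]) (use that in \<open>auto simp: cl_def\<close>)
      finally show ?thesis .
    qed
    show "continuous (at_right s) (\<lambda>x. G (cl x))" for s
    proof -
      consider "s < a" | "a \<le> s" "s < b" | "b \<le> s" by linarith
      then show ?thesis
      proof cases
        case 1
        have "eventually (\<lambda>x. G (cl x) = G a) (at_right s)"
          using eventually_at_right_real[OF 1] by eventually_elim (use ab in \<open>auto simp: cl_def\<close>)
        then show ?thesis unfolding continuous_within using 1 ab
          by (simp add: cl_def tendsto_eventually)
      next
        case 2
        have e: "eventually (\<lambda>x. G (cl x) = G x) (at_right s)"
          using eventually_at_right_real[OF 2(2)] by eventually_elim (use 2 in \<open>auto simp: cl_def\<close>)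
        have "(G \<longlongrightarrow> G s) (at_right s)" using G(2)[of s] by (simp add: continuous_within)
        moreover have "cl s = s" using 2 by (auto simp: cl_def)
        ultimately show ?thesis unfolding continuous_within using tendsto_cong[OF e] by simp
      next
        case 3
        have "eventually (\<lambda>x. G (cl x) = G b) (at_right s)"
          using eventually_at_right_less[of s] by eventually_elim (use 3 ab in \<open>auto simp: cl_def\<close>)
        then show ?thesis unfolding continuous_within using 3 ab
          by (simp add: cl_def tendsto_eventually)
      qed
    qed
  qed
  show ?thesis
  proof (cases "a \<le> b")
    case True
    define g where "g x = indicator {a<..b} x * f x" for x
    have [measurable]: "g \<in> borel_measurable borel" using f unfolding g_def .
    have "(\<lambda>x. B (cl x)) = (\<lambda>x. C (cl x))" using eq True by (auto simp: cl_def)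
    then have "density (interval_measure B) (indicator {a<..b}) = density (interval_measure C) (indicator {a<..b})"
      using restr[OF B True] restr[OF C True] by simp
    then have *: "density (interval_measure B) (\<lambda>x. ennreal (indicator {a<..b} x)) = density (interval_measure C) (\<lambda>x. ennreal (indicator {a<..b} x))"
      by (simp add: ennreal_indicator)
    have "(LINT x|density (interval_measure G) (\<lambda>x. ennreal (indicator {a<..b} x)). g x) = (LINT x:{a<..b}|interval_measure G. f x)" for G
      unfolding set_lebesgue_integral_def
      by (subst integral_density) (auto simp: g_def indicator_def intro!: Bochner_Integration.integral_cong)
    from this[of B] this[of C] * show ?thesis by simp
  qed (simp add: set_lebesgue_integral_def)
qed

lemma set_integrable_measurable_part:
  fixes f :: "real \<Rightarrow> real"
  shows "set_integrable (interval_measure B) A f \<Longrightarrow> (\<lambda>x. indicator A x * f x) \<in> borel_measurable borel"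
  unfolding set_integrable_def
  by (auto dest!: borel_measurable_integrable simp: measurable_cong_sets[OF sets_interval_measure refl])

lemma mono_right_continuous_add:
  fixes B C :: "real \<Rightarrow> real"
  assumes "mono B" "\<And>s. continuous (at_right s) B" "mono C" "\<And>s. continuous (at_right s) C"
  shows "mono (\<lambda>x. B x + C x)" "\<And>s. continuous (at_right s) (\<lambda>x. B x + C x)"
  using assms by (auto simp: mono_def intro!: add_mono continuous_intros)

text \<open>If \<open>B - C = B' - C'\<close> on \<open>{a..b}\<close>, then \<open>B + C'\<close> and \<open>B' + C\<close> agree there, and integrals are additive
  in the integrator.\<close>

lemma has_stieltjes_integral_unique:
  assumes 1: "has_stieltjes_integral f A a b I1" and 2: "has_stieltjes_integral f A a b I2"
  shows "I1 = I2"
proof -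
  obtain B C where BC: "mono B" "mono C" "\<And>s. continuous (at_right s) B" "\<And>s. continuous (at_right s) C"
    "\<And>s. s\<in>{a..b} \<Longrightarrow> A s = B s - C s" "set_integrable (interval_measure B) {a<..b} f"
    "set_integrable (interval_measure C) {a<..b} f"
    "I1 = (LINT s:{a<..b}|interval_measure B. f s) - (LINT s:{a<..b}|interval_measure C. f s)"
    using 1 unfolding has_stieltjes_integral_def by blast
  obtain B' C' where BC': "mono B'" "mono C'" "\<And>s. continuous (at_right s) B'" "\<And>s. continuous (at_right s) C'"
    "\<And>s. s\<in>{a..b} \<Longrightarrow> A s = B' s - C' s" "set_integrable (interval_measure B') {a<..b} f"
    "set_integrable (interval_measure C') {a<..b} f"
    "I2 = (LINT s:{a<..b}|interval_measure B'. f s) - (LINT s:{a<..b}|interval_measure C'. f s)"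
    using 2 unfolding has_stieltjes_integral_def by blast
  have m: "(\<lambda>x. indicator {a<..b} x * f x) \<in> borel_measurable borel"
    using BC(6) by (rule set_integrable_measurable_part)
  have add: "(LINT s:{a<..b}|interval_measure (\<lambda>x. D x + E x). f s) = (LINT s:{a<..b}|interval_measure D. f s) + (LINT s:{a<..b}|interval_measure E. f s)"
    if "mono D" "mono E" "\<And>s. continuous (at_right s) D" "\<And>s. continuous (at_right s) E"
      "set_integrable (interval_measure D) {a<..b} f" "set_integrable (interval_measure E) {a<..b} f" for D E
    using integral_interval_measure_add[of D E, OF that(1,3,2,4) m] that(5,6)
    unfolding set_integrable_def set_lebesgue_integral_def by simp
  have "(LINT s:{a<..b}|interval_measure (\<lambda>x. B x + C' x). f s) = (LINT s:{a<..b}|interval_measure (\<lambda>x. B' x + C x). f s)"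
  proof (rule interval_measure_restrict_cong[OF _ _ _ _ _ m])
    show "B s + C' s = B' s + C s" if "s \<in> {a..b}" for s
      using BC(5)[OF that] BC'(5)[OF that] by simp
  qed (use mono_right_continuous_add BC BC' in auto)
  then show ?thesis
    using add[of B C'] add[of B' C] BC BC' by simp
qed

lemma stieltjes_integral_eqI: "has_stieltjes_integral f A a b I \<Longrightarrow> stieltjes_integral f A a b = I"
  unfolding stieltjes_integral_def by (blast intro: has_stieltjes_integral_unique)

text \<open>The pair of the integrator \<open>G\<close> and its integral, so that integrators can be added up.\<close>

definition integrates_to :: "(real \<Rightarrow> real) \<Rightarrow> (real \<Rightarrow> real) \<Rightarrow> real \<Rightarrow> bool" where
  "integrates_to g G I \<longleftrightarrow> mono G \<and> (\<forall>s. continuous (at_right s) G) \<and>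
     integrable (interval_measure G) g \<and> (LINT x|interval_measure G. g x) = I"

lemma integrates_to_add:
  assumes "g \<in> borel_measurable borel" "integrates_to g G I" "integrates_to g G' I'"
  shows "integrates_to g (\<lambda>x. G x + G' x) (I + I')"
  using assms mono_right_continuous_add[of G G'] interval_measure_add[of G G' g]
  unfolding integrates_to_def by auto

lemma integrates_to_const:
  assumes "g \<in> borel_measurable borel"
  shows "integrates_to g (\<lambda>_. c) 0"
proof -
  have "interval_measure (\<lambda>_. c) = null_measure borel"
    by (rule interval_measure_eqI) (auto simp: mono_def)
  moreover have ae: "AE x in null_measure borel. g x = 0"
    by (auto simp: eventually_ae_filter null_sets_def intro!: exI[of _ UNIV])
  have "integrable (null_measure borel) g"
    by (subst integrable_cong_AE[OF _ _ ae]) (use assms in \<open>auto simp: measurable_cong_sets[OF sets_null_measure refl]\<close>)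
  moreover have "(LINT x|null_measure borel. g x) = 0"
    by (rule integral_eq_zero_AE[OF ae])
  ultimately show ?thesis by (auto simp: integrates_to_def mono_def)
qed

lemma integrates_to_step:
  assumes [measurable]: "g \<in> borel_measurable borel" and c: "0 \<le> c"
  shows "integrates_to g (\<lambda>x. c * indicator {r..} x) (c * g r)"
proof -
  let ?G = "\<lambda>x. c * indicator {r..} x :: real"
  let ?M = "density (return borel r) (\<lambda>_. ennreal c)"
  have m: "mono ?G" using c by (auto simp: mono_def indicator_def)
  have rc: "continuous (at_right s) ?G" for s
  proof (cases "r \<le> s")
    case True
    have "eventually (\<lambda>x. ?G x = c) (at_right s)"
      using eventually_at_right_less[of s] by eventually_elim (use True in auto)
    then show ?thesis unfolding continuous_within using True by (simp add: tendsto_eventually)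
  next
    case False
    then have "s < r" by simp
    have "eventually (\<lambda>x. ?G x = 0) (at_right s)"
      using eventually_at_right_real[OF \<open>s < r\<close>] by eventually_elim auto
    then show ?thesis unfolding continuous_within using False by (simp add: tendsto_eventually)
  qed
  have eq: "interval_measure ?G = ?M"
  proof (rule interval_measure_eqI[OF m rc])
    show "emeasure ?M {u<..v} = ennreal (?G v - ?G u)" if "u \<le> v" for u v
      using that c by (subst emeasure_density) (auto simp: nn_integral_return indicator_def)
  qed simp
  have "integrable ?M g"
    by (subst integrable_density) (use c in \<open>auto simp: integrable_iff_bounded nn_integral_return\<close>)
  moreover have "(LINT x|?M. g x) = c * g r"
    by (subst integral_density) (use c in \<open>auto simp: integral_return\<close>)
  ultimately show ?thesis using m rc by (auto simp: integrates_to_def eq)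
qed

lemma integrates_to_density:
  assumes [measurable]: "g \<in> borel_measurable borel" and k: "integrable lborel k" "\<And>x. 0 \<le> k x"
    and gk: "integrable lborel (\<lambda>x. k x * g x)"
  shows "integrates_to g (\<lambda>x. LINT y:{..x}|lborel. k y) (LINT x|lborel. k x * g x)"
proof -
  let ?G = "\<lambda>x. LINT y:{..x}|lborel. k y"
  let ?M = "density lborel (\<lambda>x. ennreal (k x))"
  have [measurable]: "k \<in> borel_measurable borel" using k(1) by auto
  have ki: "set_integrable lborel A k" if "A \<in> sets borel" for A
    using integrable_mult_indicator[of A lborel k] that k(1) by (simp add: set_integrable_def)
  have diff: "?G v - ?G u = (LINT y:{u<..v}|lborel. k y)" if "u \<le> v" for u v
  proof -
    have "{..v} = {..u} \<union> {u<..v}" using that by auto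
    then have "?G v = ?G u + (LINT y:{u<..v}|lborel. k y)"
      using set_integral_Un[of "{..u}" "{u<..v}" lborel k] ki by fastforce
    then show ?thesis by simp
  qed
  have nonneg: "0 \<le> (LINT y:{u<..v}|lborel. k y)" for u v
    unfolding set_lebesgue_integral_def using k(2) by (auto intro!: integral_nonneg_AE)
  have m: "mono ?G"
  proof (rule monoI)
    fix x y :: real assume "x \<le> y"
    then show "?G x \<le> ?G y" using diff[of x y] nonneg[of x y] by simp
  qed
  have rc: "continuous (at_right s) ?G" for s
  proof -
    have "((\<lambda>x. LINT y|lborel. indicator {..x} y * k y) \<longlongrightarrow> (LINT y|lborel. indicator {..s} y * k y)) (at_right s)"
    proof (rule tendsto_at_right_sequentially[of s "s+1"])
      fix X :: "nat \<Rightarrow> real"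
      assume X: "\<And>n. s < X n" "decseq X" "X \<longlonglongrightarrow> s"
      show "(\<lambda>n. LINT y|lborel. indicator {..X n} y * k y) \<longlonglongrightarrow> (LINT y|lborel. indicator {..s} y * k y)"
      proof (rule integral_dominated_convergence[where w="\<lambda>y. k y"])
        show "AE x in lborel. (\<lambda>n. indicator {..X n} x * k x) \<longlonglongrightarrow> indicator {..s} x * k x"
        proof (rule AE_I2)
          fix x
          have "(\<lambda>n. indicator {..X n} x :: real) \<longlonglongrightarrow> indicator {..s} x"
          proof (cases "x \<le> s")
            case True
            then have "\<And>n. x \<le> X n" using X(1) by (meson less_imp_le order_trans)
            then show ?thesis using True by simp
          next
            case False
            then have "eventually (\<lambda>n. X n < x) sequentially"
              using X(3) by (simp add: order_tendstoD)
            then have "eventually (\<lambda>n. indicator {..X n} x = (0::real)) sequentially"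
              by eventually_elim auto
            then show ?thesis using False by (simp add: tendsto_eventually)
          qed
          then show "(\<lambda>n. indicator {..X n} x * k x) \<longlonglongrightarrow> indicator {..s} x * k x"
            by (intro tendsto_intros)
        qed
      qed (use k in \<open>auto simp: indicator_def\<close>)
    qed simp
    then show ?thesis by (simp add: continuous_within set_lebesgue_integral_def)
  qed
  have eq: "interval_measure ?G = ?M"
  proof (rule interval_measure_eqI[OF m rc])
    show "emeasure ?M {u<..v} = ennreal (?G v - ?G u)" if "u \<le> v" for u v
    proof -
      have "emeasure ?M {u<..v} = (\<integral>\<^sup>+x. ennreal (indicator {u<..v} x * k x) \<partial>lborel)"
        by (subst emeasure_density) (auto simp: indicator_def intro!: nn_integral_cong)
      also have "\<dots> = ennreal (LINT y:{u<..v}|lborel. k y)"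
        using ki[of "{u<..v}"] k(2) unfolding set_integrable_def set_lebesgue_integral_def
        by (subst nn_integral_eq_integral) (auto simp: indicator_def)
      finally show ?thesis using diff[OF that] by simp
    qed
  qed simp
  have "integrable ?M g"
    by (subst integrable_density) (use k gk in auto)
  moreover have "(LINT x|?M. g x) = (LINT x|lborel. k x * g x)"
    by (subst integral_density) (use k in auto)
  ultimately show ?thesis using m rc by (auto simp: integrates_to_def eq)
qed

lemma integrates_to_steps:
  assumes "g \<in> borel_measurable borel" "finite S" "\<And>r. r \<in> S \<Longrightarrow> 0 \<le> c r"
  shows "integrates_to g (\<lambda>x. \<Sum>r\<in>S. c r * indicator {r..} x) (\<Sum>r\<in>S. c r * g r)"
  using assms(2,3)
proof (induction S rule: finite_induct)
  case empty then show ?case using integrates_to_const[OF assms(1)] by simp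
next
  case (insert r S)
  have "integrates_to g (\<lambda>x. c r * indicator {r..} x + (\<Sum>r\<in>S. c r * indicator {r..} x)) (c r * g r + (\<Sum>r\<in>S. c r * g r))"
    using insert by (intro integrates_to_add integrates_to_step assms(1)) auto
  then show ?case
    by (simp only: sum.insert[OF insert.hyps])
qed

text \<open>Integration against a finite sum of jumps minus an absolutely continuous part.\<close>

lemma has_stieltjes_integral_jumps_density:
  assumes S: "finite S" "S \<subseteq> {a<..b}"
    and h: "set_integrable lborel {a..b} h"
    and f [measurable]: "(\<lambda>x. indicator {a<..b} x * f x) \<in> borel_measurable borel"
    and K: "\<And>x. x \<in> {a<..b} \<Longrightarrow> \<bar>f x\<bar> \<le> K"
    and A: "\<And>s. s \<in> {a..b} \<Longrightarrow> A s = A0 + (\<Sum>r\<in>S \<inter> {..s}. c r) - (LINT r:{a..s}|lborel. h r)"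
  shows "has_stieltjes_integral f A a b ((\<Sum>r\<in>S. c r * f r) - (LINT r:{a..b}|lborel. f r * h r))"
proof -
  define g where "g x = indicator {a<..b} x * f x" for x
  have g [measurable]: "g \<in> borel_measurable borel" using f unfolding g_def .
  have gK: "\<bar>g x\<bar> \<le> \<bar>K\<bar>" for x using K[of x] by (auto simp: g_def indicator_def)
  define k where "k x = indicator {a..b} x * h x" for x
  have k: "integrable lborel k" using h by (simp add: set_integrable_def k_def[abs_def])
  have kpn: "integrable lborel (\<lambda>x. max 0 (k x))" "integrable lborel (\<lambda>x. max 0 (- k x))"
    using k by (auto intro!: integrable_max)
  have km: "k \<in> borel_measurable lborel" using k by (rule borel_measurable_integrable)
  have prod: "integrable lborel (\<lambda>x. q x * g x)" if q: "integrable lborel q" for q :: "real \<Rightarrow> real"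
  proof (rule Bochner_Integration.integrable_bound)
    show "integrable lborel (\<lambda>x. \<bar>K\<bar> * q x)" using q by simp
    show "(\<lambda>x. q x * g x) \<in> borel_measurable lborel" using borel_measurable_integrable[OF q] by measurable
    show "AE x in lborel. norm (q x * g x) \<le> norm (\<bar>K\<bar> * q x)"
      using gK by (auto simp: abs_mult intro!: AE_I2 mult_mono simp: mult.commute[of "\<bar>K\<bar>"])
  qed
  let ?B1 = "\<lambda>x. \<Sum>r\<in>S. max 0 (c r) * indicator {r..} x" and ?C1 = "\<lambda>x. \<Sum>r\<in>S. max 0 (- c r) * indicator {r..} x"
  let ?B2 = "\<lambda>x. LINT y:{..x}|lborel. max 0 (- k y)" and ?C2 = "\<lambda>x. LINT y:{..x}|lborel. max 0 (k y)"
  let ?B = "\<lambda>x. A0 + (?B1 x + ?B2 x)" and ?C = "\<lambda>x. ?C1 x + ?C2 x"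
  have 1: "integrates_to g ?B (0 + ((\<Sum>r\<in>S. max 0 (c r) * g r) + (LINT x|lborel. max 0 (- k x) * g x)))"
    by (intro integrates_to_add integrates_to_const integrates_to_steps integrates_to_density prod kpn S g) auto
  have 2: "integrates_to g ?C ((\<Sum>r\<in>S. max 0 (- c r) * g r) + (LINT x|lborel. max 0 (k x) * g x))"
    by (intro integrates_to_add integrates_to_const integrates_to_steps integrates_to_density prod kpn S g) auto
  have AB: "A s = ?B s - ?C s" if s: "s \<in> {a..b}" for s
  proof -
    have "(\<Sum>r\<in>S \<inter> {..s}. c r) = (\<Sum>r\<in>S. c r * indicator {r..} s)"
      unfolding sum.inter_restrict[OF S(1)] by (intro sum.cong) (auto simp: indicator_def)
    also have "\<dots> = ?B1 s - ?C1 s"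
      unfolding sum_subtractf[symmetric] by (intro sum.cong) (auto simp: max_def indicator_def)
    finally have e1: "(\<Sum>r\<in>S \<inter> {..s}. c r) = ?B1 s - ?C1 s" .
    have si: "set_integrable lborel {..s} q" if "integrable lborel q" for q :: "real \<Rightarrow> real"
      using that integrable_mult_indicator[of "{..s}" lborel q] by (simp add: set_integrable_def)
    have "?C2 s - ?B2 s = (LINT y:{..s}|lborel. max 0 (k y) - max 0 (- k y))"
      using si[OF kpn(1)] si[OF kpn(2)] by (simp add: set_integral_diff)
    also have "\<dots> = (LINT r:{a..s}|lborel. h r)"
      unfolding set_lebesgue_integral_def using s
      by (intro Bochner_Integration.integral_cong) (auto simp: k_def indicator_def max_def)
    finally show ?thesis using A[OF s] e1 by simp
  qed
  have "(\<Sum>r\<in>S. c r * f r) = (\<Sum>r\<in>S. max 0 (c r) * g r) - (\<Sum>r\<in>S. max 0 (- c r) * g r)"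
    unfolding sum_subtractf[symmetric] using S(2) by (intro sum.cong) (auto simp: max_def g_def)
  moreover have "(LINT r:{a..b}|lborel. f r * h r) = (LINT x|lborel. max 0 (k x) * g x) - (LINT x|lborel. max 0 (- k x) * g x)"
  proof -
    have "(LINT x|lborel. max 0 (k x) * g x) - (LINT x|lborel. max 0 (- k x) * g x) = (LINT x|lborel. max 0 (k x) * g x - max 0 (- k x) * g x)"
      by (rule Bochner_Integration.integral_diff[symmetric]) (intro prod kpn)+
    also have "\<dots> = (LINT x|lborel. k x * g x)"
      by (intro Bochner_Integration.integral_cong) (auto simp: max_def)
    also have "\<dots> = (LINT r:{a..b}|lborel. f r * h r)"
      unfolding set_lebesgue_integral_def
    proof (rule integral_cong_AE)
      have eq: "(\<lambda>x. indicator {a..b} x *\<^sub>R (f x * h x)) = (\<lambda>x. if x = a then indicator {a..b} x *\<^sub>R (f x * h x) else k x * g x)"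
        by (auto simp: fun_eq_iff k_def g_def indicator_def)
      show "(\<lambda>x. indicator {a..b} x *\<^sub>R (f x * h x)) \<in> borel_measurable lborel"
      proof -
        have "(\<lambda>x. if x = a then indicator {a..b} a *\<^sub>R (f a * h a) else k x * g x) \<in> borel_measurable lborel"
          using km by measurable
        then show ?thesis unfolding eq by (rule measurable_cong[THEN iffD1, rotated]) auto
      qed
      show "(\<lambda>x. k x * g x) \<in> borel_measurable lborel" using km by measurable
      show "AE x in lborel. k x * g x = indicator {a..b} x *\<^sub>R (f x * h x)"
        using AE_lborel_singleton[of a] by eventually_elim (auto simp: k_def g_def indicator_def)
    qed
    finally show ?thesis by simp
  qed
  ultimately have val: "(\<Sum>r\<in>S. c r * f r) - (LINT r:{a..b}|lborel. f r * h r) =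
     (LINT s:{a<..b}|interval_measure ?B. f s) - (LINT s:{a<..b}|interval_measure ?C. f s)"
    using 1 2 unfolding integrates_to_def set_lebesgue_integral_def g_def[symmetric]
    by (simp add: g_def[symmetric])
  have 3: "mono ?B" "\<forall>s. continuous (at_right s) ?B" "integrable (interval_measure ?B) g"
    using 1 unfolding integrates_to_def by blast+
  have 4: "mono ?C" "\<forall>s. continuous (at_right s) ?C" "integrable (interval_measure ?C) g"
    using 2 unfolding integrates_to_def by blast+
  have 5: "set_integrable (interval_measure ?B) {a<..b} f" "set_integrable (interval_measure ?C) {a<..b} f"
    using 3(3) 4(3) by (simp_all add: set_integrable_def g_def[abs_def])
  show ?thesis
    unfolding has_stieltjes_integral_def
    by (rule exI[of _ ?B], rule exI[of _ ?C]) (use 3 4 5 AB val in blast)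
qed

section \<open>Paths of counting processes\<close>

text \<open>The jump times of a path whose jumps have size one; time \<open>0\<close> is never one.\<close>

definition jump_times :: "(real \<Rightarrow> real) \<Rightarrow> real set" where
  "jump_times f = {t. 0 < t \<and> jump f t = 1}"

lemma left_limI: "(f \<longlongrightarrow> l) (at_left t) \<Longrightarrow> left_lim f t = (l::real)"
  unfolding left_lim_def by (rule tendsto_Lim) simp_all

lemma left_lim_tendsto:
  "cadlag f \<Longrightarrow> 0 < t \<Longrightarrow> (f \<longlongrightarrow> left_lim f t) (at_left t)"
  unfolding cadlag_def using left_limI by metis

lemma gap_right_left:
  fixes D :: "real set"
  assumes "finite D"
  obtains e where "0 < e" "{x<..<x + e} \<inter> D = {}" "{x - e<..<x} \<inter> D = {}"
proof -
  obtain d where d: "d > 0" "\<forall>y\<in>D. y \<noteq> x \<longrightarrow> d \<le> dist x y"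
    using finite_set_avoid[OF assms, of x] by blast
  show ?thesis
  proof (rule that[of d])
    have "y \<notin> {x<..<x + d} \<union> {x - d<..<x}" if "y \<in> D" for y
      using d(2)[rule_format, OF that] by (auto simp: dist_real_def)
    then show "{x<..<x + d} \<inter> D = {}" "{x - d<..<x} \<inter> D = {}" by blast+
  qed fact
qed

lemma eventually_no_jump_before:
  fixes J :: "real set"
  assumes fin: "finite (J \<inter> {0<..t})" and t: "0 < t"
  shows "eventually (\<lambda>s. 0 < s \<and> s < t \<and> J \<inter> {0<..s} = J \<inter> {0<..<t}) (at_left t)"
proof -
  obtain d where d: "0 < d" "{t<..<t + d} \<inter> (J \<inter> {0<..t}) = {}" "{t - d<..<t} \<inter> (J \<inter> {0<..t}) = {}"
    by (rule gap_right_left[OF fin, of t])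
  have "max 0 (t - d) < t" using d t by auto
  from eventually_at_left_real[OF this] show ?thesis
  proof eventually_elim
    case (elim s)
    have "r \<in> J \<inter> {0<..s} \<longleftrightarrow> r \<in> J \<inter> {0<..<t}" for r
    proof
      assume r: "r \<in> J \<inter> {0<..<t}"
      then have "r \<in> J \<inter> {0<..t}" by auto
      then have "r \<notin> {t - d<..<t}" using d(3) by blast
      then show "r \<in> J \<inter> {0<..s}" using r elim by auto
    qed (use elim in auto)
    then have "J \<inter> {0<..s} = J \<inter> {0<..<t}" by blast
    moreover have "0 < s" "s < t" using elim by simp_all
    ultimately show ?case by (intro conjI)
  qed
qed

text \<open>A counting path minus its number of jumps is locally constant at every point: off the jumps by
  piecewise constancy, at a jump because its size is one.\<close>

lemma counting_path:
  assumes cad: "cadlag f" and pc: "piecewise_constant f"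
    and j01: "\<And>t. 0 < t \<Longrightarrow> jump f t \<in> {0, 1}"
  shows finite_jump_times: "finite (jump_times f \<inter> {0<..t})"
    and counting_path_increment: "0 \<le> s \<Longrightarrow> s \<le> t \<Longrightarrow> f t - f s = card (jump_times f \<inter> {s<..t})"
proof -
  have key: "finite (jump_times f \<inter> {0<..t}) \<and> (\<forall>s\<in>{0..t}. f t - f s = card (jump_times f \<inter> {s<..t}))" if t: "0 \<le> t" for t
  proof -
    obtain D where D0: "finite D \<and> (\<forall>u v. 0 \<le> u \<and> u \<le> v \<and> v \<le> t \<and> {u<..v} \<inter> D = {} \<longrightarrow> f u = f v)"
      using pc t unfolding piecewise_constant_def by (elim allE impE exE) assumption+
    have finD: "finite D" using D0 ..
    have constD: "f u = f v" if "0 \<le> u" "u \<le> v" "v \<le> t" "{u<..v} \<inter> D = {}" for u v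
      by (rule D0[THEN conjunct2, THEN spec, THEN spec, THEN mp]) (intro conjI that)
    note D = finD constD
    have left: "\<exists>e>0. \<forall>y. x - e < y \<and> y < x \<and> 0 \<le> y \<longrightarrow> f y = left_lim f x \<and> {y<..<x} \<inter> D = {}" if x: "0 < x" "x \<le> t" for x
    proof -
      obtain e where e: "0 < e" "{x<..<x + e} \<inter> D = {}" "{x - e<..<x} \<inter> D = {}"
        by (rule gap_right_left[OF D(1), of x])
      define y0 where "y0 = max 0 (x - e / 2)"
      have y0: "x - e < y0" "y0 < x" "0 \<le> y0" using x e by (auto simp: y0_def)
      have eq: "f y = f y0" if "x - e < y" "y < x" "0 \<le> y" for y
      proof (cases "y \<le> y0")
        case True
        have "{y<..y0} \<subseteq> {x - e<..<x}" using that y0 by auto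
        then have "{y<..y0} \<inter> D = {}" using e(3) by blast
        moreover have "y0 \<le> t" using y0 x by simp
        ultimately show ?thesis using D(2)[of y y0] that(3) True by blast
      next
        case False
        have "{y0<..y} \<subseteq> {x - e<..<x}" using that y0 by auto
        then have "{y0<..y} \<inter> D = {}" using e(3) by blast
        moreover have "y \<le> t" "y0 \<le> y" using that x False by simp_all
        ultimately show ?thesis using D(2)[OF y0(3), of y] by metis
      qed
      have "eventually (\<lambda>y. f y = f y0) (at_left x)"
        using eventually_at_left_real[OF y0(2)]
      proof eventually_elim
        case (elim y)
        then show ?case using y0 by (intro eq) simp_all
      qed
      then have "left_lim f x = f y0" by (intro left_limI tendsto_eventually)
      then have ll: "f y = left_lim f x" if "x - e < y" "y < x" "0 \<le> y" for y
        using eq[OF that] \<open>left_lim f x = f y0\<close> by metis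
      have "{y<..<x} \<inter> D = {}" if "x - e < y" for y
        using e(3) that by (auto simp: disjoint_iff)
      with ll e(1) show ?thesis by blast
    qed
    have sub: "jump_times f \<inter> {0<..t} \<subseteq> D"
    proof
      fix x assume "x \<in> jump_times f \<inter> {0<..t}"
      then have x: "0 < x" "x \<le> t" "jump f x = 1" by (auto simp: jump_times_def)
      show "x \<in> D"
      proof (rule ccontr)
        assume nx: "x \<notin> D"
        obtain e where e0: "e > 0 \<and> (\<forall>y. x - e < y \<and> y < x \<and> 0 \<le> y \<longrightarrow> f y = left_lim f x \<and> {y<..<x} \<inter> D = {})"
          using left[OF x(1,2)] by (elim exE)
        have e: "e > 0" using e0 ..
        define y where "y = max 0 (x - e / 2)"
        have y: "x - e < y" "y < x" "0 \<le> y" using x e by (auto simp: y_def)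
        have "{y<..x} = insert x {y<..<x}" using y(2) by auto
        have g: "f y = left_lim f x" "{y<..<x} \<inter> D = {}"
          using e0[THEN conjunct2, rule_format, of y] y by blast+
        then have "{y<..x} \<inter> D = {}" using \<open>{y<..x} = insert x {y<..<x}\<close> nx by simp
        then have "f y = f x" using D(2)[of y x] y x by (meson less_imp_le)
        then have "jump f x = 0" using g(1) unfolding jump_def by simp
        then show False using x(3) by simp
      qed
    qed
    then have fin: "finite (jump_times f \<inter> {0<..t})" using D(1) finite_subset by blast
    define c where "c s = card (jump_times f \<inter> {0<..s})" for s
    have c_diff: "real (c v) - real (c u) = card (jump_times f \<inter> {u<..v})" if "0 \<le> u" "u \<le> v" "v \<le> t" for u v
    proof -
      have e: "jump_times f \<inter> {0<..v} = (jump_times f \<inter> {0<..u}) \<union> (jump_times f \<inter> {u<..v})"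
        using that by auto
      have "finite (jump_times f \<inter> {0<..u})" "finite (jump_times f \<inter> {u<..v})"
        using that by (auto intro!: finite_subset[OF _ fin])
      then have "c v = c u + card (jump_times f \<inter> {u<..v})"
        unfolding c_def e by (intro card_Un_disjoint) auto
      then show ?thesis by simp
    qed
    have "\<exists>k. \<forall>x\<in>{0..t}. f x - c x = k"
    proof (rule has_field_derivative_zero_constant)
      fix x assume x: "x \<in> {0..t}"
      obtain e1 where e1: "0 < e1" "{x<..<x + e1} \<inter> D = {}" "{x - e1<..<x} \<inter> D = {}"
        by (rule gap_right_left[OF D(1), of x])
      have "\<exists>e>0. \<forall>y. 0 < x \<and> x - e < y \<and> y < x \<and> 0 \<le> y \<longrightarrow> f y = left_lim f x \<and> {y<..<x} \<inter> D = {}"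
      proof (cases "0 < x")
        case True
        have "x \<le> t" using x by simp
        obtain e where "e > 0 \<and> (\<forall>y. x - e < y \<and> y < x \<and> 0 \<le> y \<longrightarrow> f y = left_lim f x \<and> {y<..<x} \<inter> D = {})"
          using left[OF True \<open>x \<le> t\<close>] by (elim exE)
        then show ?thesis by (intro exI[of _ e]) blast
      next
        case False then show ?thesis by (intro exI[of _ 1]) simp
      qed
      then obtain e2 where e20: "e2 > 0 \<and> (\<forall>y. 0 < x \<and> x - e2 < y \<and> y < x \<and> 0 \<le> y \<longrightarrow> f y = left_lim f x \<and> {y<..<x} \<inter> D = {})"
        by (elim exE)
      have e2: "0 < e2" using e20 ..
      have loc: "f y - c y = f x - c x" if y: "y \<in> {0..t}" "dist y x < min e1 e2" for y
      proof (cases y x rule: linorder_cases)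
        case less
        then have x0: "0 < x" using y by auto
        have g: "f y = left_lim f x" "{y<..<x} \<inter> D = {}"
        proof -
          have "0 < x \<and> x - e2 < y \<and> y < x \<and> 0 \<le> y" using x0 y less by (auto simp: dist_real_def)
          then show "f y = left_lim f x" "{y<..<x} \<inter> D = {}"
            using e20[THEN conjunct2, rule_format, of y] by blast+
        qed
        have "jump_times f \<inter> {y<..x} = (if jump f x = 1 then {x} else {})"
        proof -
          have "jump_times f \<inter> {y<..<x} \<subseteq> jump_times f \<inter> {0<..t}" using x y by auto
          then have "jump_times f \<inter> {y<..<x} = {}" using sub g(2) by blast
          moreover have "{y<..x} = insert x {y<..<x}" using less by auto
          ultimately show ?thesis using x0 by (auto simp: jump_times_def)
        qed
        then have "real (c x) - real (c y) = jump f x"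
          using c_diff[of y x] y x less j01[OF x0] by auto
        then show ?thesis using g(1) by (simp add: jump_def)
      next
        case greater
        have ne: "{x<..y} \<inter> D = {}" using e1(2) greater y(2) by (auto simp: dist_real_def disjoint_iff)
        moreover have "0 \<le> x" "x \<le> y" "y \<le> t" using x y greater by auto
        ultimately have fxy: "f x = f y" using D(2)[of x y] by blast
        have "jump_times f \<inter> {x<..y} \<subseteq> jump_times f \<inter> {0<..t}" using x y by auto
        then have "jump_times f \<inter> {x<..y} = {}" using sub ne by blast
        then have "c y = c x" using c_diff[of x y] x y greater by simp
        with fxy show ?thesis by simp
      qed simp
      show "((\<lambda>x. f x - c x) has_field_derivative 0) (at x within {0..t})"
      proof (rule has_field_derivative_transform_within)
        show "((\<lambda>_. f x - c x) has_field_derivative 0) (at x within {0..t})" by simp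
        show "0 < min e1 e2" using e1 e2 by simp
        show "x \<in> {0..t}" by fact
        show "f x - c x = f y - c y" if "y \<in> {0..t}" "dist y x < min e1 e2" for y
          using loc[OF that] by simp
      qed
    qed simp
    then obtain k where k: "\<And>x. x \<in> {0..t} \<Longrightarrow> f x - c x = k" by blast
    have "f t - f s = card (jump_times f \<inter> {s<..t})" if "s \<in> {0..t}" for s
      using k[of t] k[of s] c_diff[of s t] that by auto
    then show ?thesis using fin by blast
  qed
  show "finite (jump_times f \<inter> {0<..t})" using key[of t] by (cases "0 \<le> t") auto
  show "0 \<le> s \<Longrightarrow> s \<le> t \<Longrightarrow> f t - f s = card (jump_times f \<inter> {s<..t})" using key[of t] by auto
qed

text \<open>Cadlag paths are bounded on compact intervals, by bisection.\<close>

lemma cadlag_bounded: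
  assumes "cadlag f"
  obtains K where "\<And>t. t \<in> {0..T} \<Longrightarrow> \<bar>f t\<bar> \<le> K"
proof (cases "0 \<le> T")
  case True
  (* the intersection with the half line is needed because cadlag says nothing about negative times *)
  define Q where "Q a b \<longleftrightarrow> (\<exists>K. \<forall>t\<in>{a..b} \<inter> {0..}. \<bar>f t\<bar> \<le> K)" for a b
  have "Q 0 T"
  using True proof (induction rule: Bolzano)
    case (trans a b c)
    then obtain K1 K2 where K: "\<forall>t\<in>{a..b} \<inter> {0..}. \<bar>f t\<bar> \<le> K1" "\<forall>t\<in>{b..c} \<inter> {0..}. \<bar>f t\<bar> \<le> K2" unfolding Q_def by blast
    have "\<forall>t\<in>{a..c} \<inter> {0..}. \<bar>f t\<bar> \<le> max K1 K2"
    proof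
      fix t assume "t \<in> {a..c} \<inter> {0..}"
      then show "\<bar>f t\<bar> \<le> max K1 K2" using K by (cases "t \<le> b") (force simp: le_max_iff_disj)+
    qed
    then show ?case unfolding Q_def by blast
  next
    case (local x)
    have r: "\<exists>d>0. \<forall>t. x < t \<and> t < x + d \<longrightarrow> \<bar>f t\<bar> \<le> \<bar>f x\<bar> + 1"
    proof -
      have "(f \<longlongrightarrow> f x) (at_right x)" using assms local unfolding cadlag_def by auto
      then have "eventually (\<lambda>t. dist (f t) (f x) < 1) (at_right x)" by (rule tendstoD) simp
      then obtain d where d: "d > x" "\<forall>t>x. t < d \<longrightarrow> dist (f t) (f x) < 1"
        unfolding eventually_at_right[OF less_add_one[of x]] by blast
      have "\<bar>f t\<bar> \<le> \<bar>f x\<bar> + 1" if "x < t" "t < x + (d - x)" for t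
        using d(2)[rule_format, of t] that by (auto simp: dist_real_def)
      then show ?thesis using d(1) by (intro exI[of _ "d - x"]) auto
    qed
    have l: "\<exists>d>0. \<exists>K. \<forall>t. x - d < t \<and> t < x \<and> 0 \<le> t \<longrightarrow> \<bar>f t\<bar> \<le> K"
    proof (cases "0 < x")
      case True
      then obtain l where "(f \<longlongrightarrow> l) (at_left x)" using assms unfolding cadlag_def by auto
      then have "eventually (\<lambda>t. dist (f t) l < 1) (at_left x)" by (rule tendstoD) simp
      then obtain d where d: "d < x" "\<forall>t<x. t > d \<longrightarrow> dist (f t) l < 1"
        unfolding eventually_at_left[OF True] by blast
      have "\<bar>f t\<bar> \<le> \<bar>l\<bar> + 1" if "x - (x - d) < t" "t < x" for t
        using d(2)[rule_format, of t] that by (auto simp: dist_real_def)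
      then show ?thesis using d(1) by (intro exI[of _ "x - d"]) (auto intro!: exI[of _ "\<bar>l\<bar> + 1"])
    next
      case False then show ?thesis by (intro exI[of _ 1]) auto
    qed
    obtain d1 where d1: "d1 > 0" "\<And>t. x < t \<Longrightarrow> t < x + d1 \<Longrightarrow> \<bar>f t\<bar> \<le> \<bar>f x\<bar> + 1" using r by blast
    obtain d2 K where d2: "d2 > 0" "\<And>t. x - d2 < t \<Longrightarrow> t < x \<Longrightarrow> 0 \<le> t \<Longrightarrow> \<bar>f t\<bar> \<le> K" using l by blast
    show ?case
    proof (intro exI[of _ "min d1 d2"] conjI allI impI)
      show "0 < min d1 d2" using d1 d2 by simp
      fix a b assume ab: "a \<le> x \<and> x \<le> b \<and> b - a < min d1 d2"
      have "\<bar>f t\<bar> \<le> max (\<bar>f x\<bar> + 1) K" if t: "t \<in> {a..b} \<inter> {0..}" for t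
      proof (cases t x rule: linorder_cases)
        case less then show ?thesis using d2(2)[of t] ab t by auto
      next
        case greater then show ?thesis using d1(2)[of t] ab t by auto
      qed simp
      then show "Q a b" unfolding Q_def by blast
    qed
  qed
  then obtain K where "\<forall>t\<in>{0..T} \<inter> {0..}. \<bar>f t\<bar> \<le> K" unfolding Q_def by blast
  then show ?thesis by (intro that[of K]) auto
next
  case False then show ?thesis using that[of 0] by auto
qed

section \<open>Linear equations driven by jumps and a drift\<close>

lemma bounded_set_integrable:
  fixes h :: "real \<Rightarrow> real"
  assumes [measurable]: "h \<in> borel_measurable borel" and "\<And>x. x \<in> {a..b} \<Longrightarrow> \<bar>h x\<bar> \<le> C"
  shows "set_integrable lborel {a..b} h"
  unfolding set_integrable_def
proof (rule Bochner_Integration.integrable_bound)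
  show "integrable lborel (\<lambda>x. C * indicator {a..b} x)"
    by (intro integrable_mult_right integrable_real_indicator) (auto simp: emeasure_lborel_Icc_eq)
  show "AE x in lborel. norm (indicat_real {a..b} x *\<^sub>R h x) \<le> norm (C * indicator {a..b} x)"
    using assms(2) by (intro AE_I2) (force simp: indicator_def)
qed simp

lemma set_integral_split:
  fixes h :: "real \<Rightarrow> real"
  assumes "set_integrable lborel {a..c} h" "a \<le> b" "b \<le> c"
  shows "(LINT s:{a..c}|lborel. h s) = (LINT s:{a..b}|lborel. h s) + (LINT s:{b..c}|lborel. h s)"
proof -
  have 1: "set_integrable lborel {a..b} h" "set_integrable lborel {b<..c} h"
    using assms by (auto intro: set_integrable_subset)
  have "{a..c} = {a..b} \<union> {b<..c}" using assms by auto
  then have "(LINT s:{a..c}|lborel. h s) = (LINT s:{a..b}|lborel. h s) + (LINT s:{b<..c}|lborel. h s)"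
    using set_integral_Un[of "{a..b}" "{b<..c}" lborel h] 1 by fastforce
  also have "(LINT s:{b<..c}|lborel. h s) = (LINT s:{b..c}|lborel. h s)"
  proof (rule set_integral_cong_set)
    have "set_integrable lborel {b..c} h" using assms by (auto intro: set_integrable_subset)
    then show "set_borel_measurable lborel {b..c} h" "set_borel_measurable lborel {b<..c} h"
      using 1(2) by (auto simp: set_integrable_def set_borel_measurable_def dest: borel_measurable_integrable)
    show "AE x in lborel. (x \<in> {b..c}) = (x \<in> {b<..c})"
      using AE_lborel_singleton[of b] by eventually_elim auto
  qed
  finally show ?thesis .
qed

lemma set_integral_abs_bound:
  fixes h :: "real \<Rightarrow> real"
  assumes "\<And>x. x \<in> {a..b} \<Longrightarrow> \<bar>h x\<bar> \<le> C" "a \<le> b"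
  shows "\<bar>LINT s:{a..b}|lborel. h s\<bar> \<le> C * (b - a)"
proof -
  have "norm (LINT s:{a..b}|lborel. h s) \<le> (LINT x|lborel. C * indicator {a..b} x)"
    unfolding set_lebesgue_integral_def
  proof (rule order.trans[OF integral_norm_bound], rule integral_mono')
    show "norm (indicat_real {a..b} x *\<^sub>R h x) \<le> C * indicator {a..b} x" for x
      using assms(1)[of x] by (auto simp: indicator_def)
    show "0 \<le> C * indicator {a..b} x" for x
      using assms(1)[of a] assms(2) by (auto simp: indicator_def)
    show "integrable lborel (\<lambda>x. C * indicator {a..b} x)"
      by (intro integrable_mult_right integrable_real_indicator) (auto simp: emeasure_lborel_Icc_eq)
  qed
  also have "\<dots> = C * (b - a)" using assms(2) by simp
  finally show ?thesis by simp
qed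

lemma exp_increment_bounds:
  fixes z :: real
  assumes "\<bar>z\<bar> \<le> 1"
  shows "\<bar>exp z - 1\<bar> \<le> 3 * \<bar>z\<bar>" "\<bar>exp z - 1 - z\<bar> \<le> 3 * z\<^sup>2"
proof -
  have a: "exp z \<ge> 1 + z" "exp (- z) \<ge> 1 - z" using exp_ge_add_one_self[of z] exp_ge_add_one_self[of "-z"] by auto
  have e3: "exp z \<le> 3" using assms exp_le by (smt (verit) exp_le_cancel_iff)
  have "exp z * (1 - z) \<le> exp z * exp (- z)" using a(2) by (intro mult_left_mono) auto
  then have b: "exp z - 1 \<le> z * exp z" by (simp add: exp_minus algebra_simps)
  show 1: "\<bar>exp z - 1\<bar> \<le> 3 * \<bar>z\<bar>"
  proof (cases "0 \<le> z")
    case True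
    have "z * exp z \<le> z * 3" using True e3 by (intro mult_left_mono)
    then show ?thesis using a(1) b True by simp
  next
    case False
    then have "exp z \<le> 1" by simp
    then have "\<bar>exp z - 1\<bar> = 1 - exp z" by simp
    then show ?thesis using a(1) False by linarith
  qed
  have "exp z - 1 - z \<le> z * (exp z - 1)" using b by (simp add: algebra_simps)
  also have "\<dots> \<le> \<bar>z\<bar> * \<bar>exp z - 1\<bar>" by (simp add: abs_mult[symmetric])
  also have "\<dots> \<le> \<bar>z\<bar> * (3 * \<bar>z\<bar>)" using 1 by (intro mult_left_mono) auto
  also have "\<dots> = 3 * z\<^sup>2" by (simp add: power2_eq_square)
  finally show "\<bar>exp z - 1 - z\<bar> \<le> 3 * z\<^sup>2" using a(1) by linarith
qed

text \<open>The chain rule for \<open>exp \<circ> (\<lambda>t. - \<integral>\<^sub>0\<^sup>t h)\<close>, where \<open>h\<close> is merely bounded and measurable. The two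
  sides differ by \<open>O((v - u)\<^sup>2)\<close> on short intervals, so their difference has derivative zero.\<close>

lemma exp_integral_increment:
  fixes h :: "real \<Rightarrow> real"
  assumes [measurable]: "h \<in> borel_measurable borel" and C: "\<And>x. \<bar>h x\<bar> \<le> C" and uv: "0 \<le> u" "u \<le> v"
  defines "e \<equiv> (\<lambda>t. exp (- (LINT s:{0..t}|lborel. h s)))"
  shows "set_integrable lborel {u..v} (\<lambda>s. e s * h s)"
    and "(LINT s:{u..v}|lborel. e s * h s) = e u - e v"
proof -
  define L where "L t = (LINT s:{0..t}|lborel. h s)" for t
  have C0: "0 \<le> C" using C[of 0] by simp
  have hi: "set_integrable lborel {a..b} h" for a b using bounded_set_integrable[of h a b C] C by simp
  have Ld: "L b - L a = (LINT s:{a..b}|lborel. h s)" if "0 \<le> a" "a \<le> b" for a b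
    using set_integral_split[OF hi[of 0 b], of a] that by (simp add: L_def)
  have Lip: "\<bar>L b - L a\<bar> \<le> C * (b - a)" if "0 \<le> a" "a \<le> b" for a b
    unfolding Ld[OF that] by (rule set_integral_abs_bound) (use C that in auto)
  have eL: "e t = exp (- L t)" for t by (simp add: e_def L_def)
  have em [measurable]: "e \<in> borel_measurable borel"
  proof -
    have "(\<lambda>t. LINT s|lborel. (if 0 \<le> s \<and> s \<le> t then h s else 0)) \<in> borel_measurable borel"
      by measurable
    moreover have "(LINT s|lborel. (if 0 \<le> s \<and> s \<le> t then h s else 0)) = L t" for t
      unfolding L_def set_lebesgue_integral_def by (intro Bochner_Integration.integral_cong) auto
    ultimately have "L \<in> borel_measurable borel" by (simp cong: measurable_cong)
    then show ?thesis unfolding eL[abs_def] by measurable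
  qed
  have e_bd: "e t \<le> exp (C * v)" if "0 \<le> t" "t \<le> v" for t
  proof -
    have "L 0 = 0"
    proof -
      have "\<bar>L 0\<bar> \<le> C * (0 - 0)" unfolding L_def by (rule set_integral_abs_bound) (use C in auto)
      then show ?thesis by simp
    qed
    then have "\<bar>L t\<bar> \<le> C * t" using Lip[of 0 t] that by simp
    also have "\<dots> \<le> C * v" using that C0 by (intro mult_left_mono)
    finally show ?thesis unfolding eL by simp
  qed
  have epos: "0 < e t" for t unfolding e_def by simp
  have prod_int: "set_integrable lborel {a..b} (\<lambda>s. e s * h s)" if "0 \<le> a" "b \<le> v" for a b
  proof (rule bounded_set_integrable[where C="exp (C * v) * C"])
    show "\<bar>e x * h x\<bar> \<le> exp (C * v) * C" if "x \<in> {a..b}" for x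
      unfolding abs_mult using e_bd[of x] epos[of x] C[of x] that \<open>0 \<le> a\<close> \<open>b \<le> v\<close> by (intro mult_mono) auto
  qed simp
  show "set_integrable lborel {u..v} (\<lambda>s. e s * h s)" using prod_int uv by simp
  define G where "G t = e t + (LINT s:{0..t}|lborel. e s * h s)" for t
  define K where "K = 6 * C\<^sup>2 * exp (C * v)"
  have quad: "\<bar>G b - G a\<bar> \<le> K * (b - a)\<^sup>2" if ab: "0 \<le> a" "a \<le> b" "b \<le> v" "C * (b - a) \<le> 1" for a b
  proof -
    have "G b - G a = e b - e a + (LINT s:{a..b}|lborel. e s * h s)"
      using set_integral_split[OF prod_int[of 0 b], of a] ab by (simp add: G_def)
    also have "(LINT s:{a..b}|lborel. e s * h s) = (LINT s:{a..b}|lborel. (e s - e a) * h s + e a * h s)"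
      by (simp add: algebra_simps)
    also have "\<dots> = (LINT s:{a..b}|lborel. (e s - e a) * h s) + (LINT s:{a..b}|lborel. e a * h s)"
    proof (rule set_integral_add)
      have "set_integrable lborel {a..b} (\<lambda>s. e s * h s - e a * h s)"
        using prod_int[of a b] hi[of a b] ab by (intro set_integral_diff set_integrable_mult_right) auto
      then show "set_integrable lborel {a..b} (\<lambda>s. (e s - e a) * h s)" by (simp add: algebra_simps)
    qed (use hi in auto)
    also have "(LINT s:{a..b}|lborel. e a * h s) = e a * (L b - L a)" using Ld ab by simp
    finally have eq: "G b - G a = (e b - e a + e a * (L b - L a)) + (LINT s:{a..b}|lborel. (e s - e a) * h s)"
      by simp
    have fac: "e x = e a * exp (- (L x - L a))" for x by (simp add: eL exp_add[symmetric])
    have small: "\<bar>- (L x - L a)\<bar> \<le> C * (b - a)" "\<bar>- (L x - L a)\<bar> \<le> 1" if "a \<le> x" "x \<le> b" for x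
    proof -
      have "\<bar>L x - L a\<bar> \<le> C * (x - a)" using Lip[of a x] that ab by simp
      also have "\<dots> \<le> C * (b - a)" using that C0 by (intro mult_left_mono) auto
      finally show "\<bar>- (L x - L a)\<bar> \<le> C * (b - a)" "\<bar>- (L x - L a)\<bar> \<le> 1" using ab by auto
    qed
    have "\<bar>e b - e a + e a * (L b - L a)\<bar> = e a * \<bar>exp (- (L b - L a)) - 1 - (- (L b - L a))\<bar>"
    proof -
      have "e b - e a + e a * (L b - L a) = e a * (exp (- (L b - L a)) - 1 - (- (L b - L a)))"
        using fac[of b] by (simp add: algebra_simps)
      then show ?thesis using epos[of a] by (simp add: abs_mult)
    qed
    also have "\<dots> \<le> exp (C * v) * (3 * (- (L b - L a))\<^sup>2)"
      using exp_increment_bounds(2)[OF small(2)[of b]] e_bd[of a] epos[of a] ab by (intro mult_mono) auto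
    also have "\<dots> \<le> exp (C * v) * (3 * (C * (b - a))\<^sup>2)"
      using small(1)[of b] ab by (intro mult_left_mono) (auto simp: abs_le_square_iff[symmetric] intro: order.trans)
    finally have 1: "\<bar>e b - e a + e a * (L b - L a)\<bar> \<le> exp (C * v) * (3 * (C * (b - a))\<^sup>2)" .
    have 2: "\<bar>LINT s:{a..b}|lborel. (e s - e a) * h s\<bar> \<le> (exp (C * v) * (3 * (C * (b - a))) * C) * (b - a)"
    proof (rule set_integral_abs_bound)
      fix x assume x: "x \<in> {a..b}"
      have "\<bar>e x - e a\<bar> = e a * \<bar>exp (- (L x - L a)) - 1\<bar>"
      proof -
        have "e x - e a = e a * (exp (- (L x - L a)) - 1)" using fac[of x] by (simp add: algebra_simps)
        then show ?thesis using epos[of a] by (simp add: abs_mult)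
      qed
      also have "\<dots> \<le> exp (C * v) * (3 * \<bar>- (L x - L a)\<bar>)"
        using exp_increment_bounds(1)[OF small(2)[of x]] e_bd[of a] epos[of a] ab x by (intro mult_mono) auto
      also have "\<dots> \<le> exp (C * v) * (3 * (C * (b - a)))"
        using small(1)[of x] x by (intro mult_left_mono) auto
      finally have *: "\<bar>e x - e a\<bar> \<le> exp (C * v) * (3 * (C * (b - a)))" .
      then show "\<bar>(e x - e a) * h x\<bar> \<le> exp (C * v) * (3 * (C * (b - a))) * C"
        unfolding abs_mult using C[of x] C0 ab by (intro mult_mono) auto
    qed fact
    show ?thesis unfolding eq using abs_triangle_ineq[THEN order.trans, OF add_mono[OF 1 2]]
      by (rule order.trans) (simp add: K_def power2_eq_square algebra_simps)
  qed
  have "\<exists>k. \<forall>x\<in>{0..v}. G x = k"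
  proof (rule has_field_derivative_zero_constant)
    fix x assume x: "x \<in> {0..v}"
    have K0: "0 \<le> K" by (simp add: K_def)
    have "((\<lambda>y. (G y - G x) / (y - x)) \<longlongrightarrow> 0) (at x within {0..v})"
    proof (rule Lim_null_comparison[where g="\<lambda>y. K * \<bar>y - x\<bar>"])
      have "eventually (\<lambda>y. dist y x < 1 / (C + 1)) (at x within {0..v})"
        using C0 by (auto simp: eventually_at intro!: exI[of _ "1 / (C + 1)"])
      moreover have "eventually (\<lambda>y. y \<in> {0..v} \<and> y \<noteq> x) (at x within {0..v})"
        by (auto simp: eventually_at intro!: exI[of _ 1])
      ultimately show "eventually (\<lambda>y. norm ((G y - G x) / (y - x)) \<le> K * \<bar>y - x\<bar>) (at x within {0..v})"
      proof eventually_elim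
        case (elim y)
        have "C * \<bar>y - x\<bar> \<le> (C + 1) * (1 / (C + 1))"
          using elim C0 by (intro mult_mono) (auto simp: dist_real_def)
        then have s: "C * \<bar>y - x\<bar> \<le> 1" using C0 by simp
        have "\<bar>G y - G x\<bar> \<le> K * (y - x)\<^sup>2"
          using quad[of x y] quad[of y x] s elim x by (cases "x \<le> y") (auto simp: abs_minus_commute power2_commute)
        also have "\<dots> = (K * \<bar>y - x\<bar>) * \<bar>y - x\<bar>" by (simp add: power2_eq_square abs_mult_self_eq mult.assoc)
        finally have "\<bar>G y - G x\<bar> / \<bar>y - x\<bar> \<le> K * \<bar>y - x\<bar>"
          using elim by (simp add: divide_le_eq)
        then show ?case by simp
      qed
      have "((\<lambda>y. K * \<bar>y - x\<bar>) \<longlongrightarrow> K * \<bar>x - x\<bar>) (at x within {0..v})"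
        by (intro tendsto_intros)
      then show "((\<lambda>y. K * \<bar>y - x\<bar>) \<longlongrightarrow> 0) (at x within {0..v})" by simp
    qed
    then show "(G has_field_derivative 0) (at x within {0..v})"
      by (simp add: has_field_derivative_iff)
  qed simp
  then obtain k where "\<And>x. x \<in> {0..v} \<Longrightarrow> G x = k" by blast
  then have "G v = G u" using uv by simp
  then show "(LINT s:{u..v}|lborel. e s * h s) = e u - e v"
    using set_integral_split[OF prod_int[of 0 v], of u] uv by (simp add: G_def)
qed

text \<open>\<open>path_exp J f h\<close> solves \<open>dz = z\<^sub>- dx\<close>, \<open>z 0 = 1\<close>, for the path \<open>x\<close> with drift \<open>- h\<close> and with a jump
  \<open>f s - 1\<close> at each \<open>s \<in> J\<close>; \<open>path_exp_left\<close> is its left-limit path.\<close>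

definition path_exp :: "real set \<Rightarrow> (real \<Rightarrow> real) \<Rightarrow> (real \<Rightarrow> real) \<Rightarrow> real \<Rightarrow> real" where
  "path_exp J f h t = exp (- (LINT s:{0..t}|lborel. h s)) * (\<Prod>s\<in>J \<inter> {0<..t}. f s)"

definition path_exp_left :: "real set \<Rightarrow> (real \<Rightarrow> real) \<Rightarrow> (real \<Rightarrow> real) \<Rightarrow> real \<Rightarrow> real" where
  "path_exp_left J f h t = exp (- (LINT s:{0..t}|lborel. h s)) * (\<Prod>s\<in>J \<inter> {0<..<t}. f s)"

lemma set_integral_finite_sum:
  fixes g :: "'i \<Rightarrow> 'b \<Rightarrow> real"
  assumes "\<And>i. i \<in> I \<Longrightarrow> set_integrable M A (g i)"
  shows "set_integrable M A (\<lambda>x. \<Sum>i\<in>I. g i x)"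
    "(LINT x:A|M. (\<Sum>i\<in>I. g i x)) = (\<Sum>i\<in>I. LINT x:A|M. g i x)"
  using assms unfolding set_integrable_def set_lebesgue_integral_def scaleR_sum_right
  by (auto intro!: Bochner_Integration.integrable_sum Bochner_Integration.integral_sum)

text \<open>A product over a finite ordered set, written as the sum of its increments.\<close>

lemma prod_telescope:
  fixes f :: "'b::linorder \<Rightarrow> 'c::comm_ring_1"
  assumes "finite S"
  shows "(\<Prod>s\<in>S. f s) = 1 + (\<Sum>s\<in>S. (\<Prod>r\<in>S \<inter> {..<s}. f r) * (f s - 1))"
  using assms
proof (induction S rule: finite_linorder_max_induct)
  case empty then show ?case by simp
next
  case (insert b A)
  have nb: "b \<notin> A" using insert by auto
  have 1: "insert b A \<inter> {..<b} = A" using insert by auto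
  have 2: "insert b A \<inter> {..<s} = A \<inter> {..<s}" if "s \<in> A" for s using insert that by force
  show ?case using insert nb by (simp add: 1 2 algebra_simps)
qed

context
  fixes h :: "real \<Rightarrow> real" and C T :: real and J :: "real set" and f :: "real \<Rightarrow> real"
  assumes hm [measurable]: "h \<in> borel_measurable borel"
    and C: "\<And>x. x \<in> {0..T} \<Longrightarrow> \<bar>h x\<bar> \<le> C"
    and J: "finite (J \<inter> {0<..T})"
begin

lemma exp_integral_increment_on:
  assumes uv: "0 \<le> u" "u \<le> v" "v \<le> T"
  shows "set_integrable lborel {u..v} (\<lambda>s. exp (- (LINT r:{0..s}|lborel. h r)) * h s)" (is ?A)
    and "(LINT s:{u..v}|lborel. exp (- (LINT r:{0..s}|lborel. h r)) * h s) =
      exp (- (LINT r:{0..u}|lborel. h r)) - exp (- (LINT r:{0..v}|lborel. h r))" (is ?B)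
proof -
  define h' where "h' x = indicator {0..T} x * h x" for x
  have [measurable]: "h' \<in> borel_measurable borel" unfolding h'_def by measurable
  have C': "\<bar>h' x\<bar> \<le> \<bar>C\<bar>" for x using C[of x] by (auto simp: h'_def indicator_def)
  have eq: "(LINT r:{0..s}|lborel. h' r) = (LINT r:{0..s}|lborel. h r)" if "s \<le> T" for s
    using that by (intro set_lebesgue_integral_cong) (auto simp: h'_def)
  note * = exp_integral_increment[OF \<open>h' \<in> _\<close> C' uv(1,2)]
  have eq2: "exp (- (LINT r:{0..s}|lborel. h' r)) * h' s = exp (- (LINT r:{0..s}|lborel. h r)) * h s" if "s \<in> {u..v}" for s
  proof -
    have "s \<le> T" "h' s = h s" using that uv by (auto simp: h'_def)
    then show ?thesis by (simp only: eq)
  qed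
  show ?A using *(1) by (rule set_integrable_cong[THEN iffD1, rotated -1]) (use eq2 in auto)
  have "(LINT s:{u..v}|lborel. exp (- (LINT r:{0..s}|lborel. h r)) * h s) = (LINT s:{u..v}|lborel. exp (- (LINT r:{0..s}|lborel. h' r)) * h' s)"
    by (rule set_lebesgue_integral_cong) (use eq2 in auto)
  then show ?B using *(2) eq[of u] eq[of v] uv by simp
qed

lemma drift_lipschitz:
  assumes "0 \<le> a" "a \<le> b" "b \<le> T"
  shows "\<bar>(LINT r:{0..b}|lborel. h r) - (LINT r:{0..a}|lborel. h r)\<bar> \<le> C * (b - a)"
proof -
  have "set_integrable lborel {0..b} h" by (rule bounded_set_integrable[OF hm, of 0 b C]) (use C assms in auto)
  from set_integral_split[OF this assms(1,2)]
  have "(LINT r:{0..b}|lborel. h r) - (LINT r:{0..a}|lborel. h r) = (LINT r:{a..b}|lborel. h r)" by simp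
  then show ?thesis using set_integral_abs_bound[of a b h C] C assms by simp
qed

lemma drift_continuous: "continuous_on {0..T} (\<lambda>t. LINT r:{0..t}|lborel. h r)"
proof -
  have "\<bar>C\<bar>-lipschitz_on {0..T} (\<lambda>t. LINT r:{0..t}|lborel. h r)"
  proof (rule lipschitz_onI)
    fix x y assume xy: "x \<in> {0..T}" "y \<in> {0..T}"
    have 1: "C * (b - a) \<le> \<bar>C\<bar> * (b - a)" if "a \<le> b" for a b
      using that by (intro mult_right_mono) auto
    show "dist (LINT r:{0..x}|lborel. h r) (LINT r:{0..y}|lborel. h r) \<le> \<bar>C\<bar> * dist x y"
    proof (cases "x \<le> y")
      case True
      then show ?thesis using drift_lipschitz[of x y] xy 1[of x y] by (simp add: dist_real_def abs_minus_commute)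
    next
      case False
      then show ?thesis using order.trans[OF drift_lipschitz[of y x] 1[of y x]] xy by (simp add: dist_real_def)
    qed
  qed simp
  then show ?thesis by (rule lipschitz_on_continuous_on)
qed

text \<open>An algebraic proof: expand the product of jump factors by telescoping and integrate the continuous
  factor \<open>e = exp \<circ> (\<lambda>t. - \<integral>\<^sub>0\<^sup>t h)\<close> from each jump time to \<open>t\<close>.\<close>

lemma path_exp_equation:
  assumes t: "0 \<le> t" "t \<le> T"
  shows "set_integrable lborel {0..t} (\<lambda>s. path_exp_left J f h s * h s)" (is ?A)
    and "path_exp J f h t = 1 + (\<Sum>s\<in>J \<inter> {0<..t}. path_exp_left J f h s * (f s - 1))
       - (LINT s:{0..t}|lborel. path_exp_left J f h s * h s)" (is ?B)
proof -
  define e where "e s = exp (- (LINT r:{0..s}|lborel. h r))" for s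
  define S where "S = J \<inter> {0<..t}"
  have S: "finite S" using J t by (auto simp: S_def intro: finite_subset[rotated])
  define c where "c s = (\<Prod>r\<in>S \<inter> {..<s}. f r) * (f s - 1)" for s
  have Sl: "J \<inter> {0<..<s} = S \<inter> {..<s}" if "s \<le> t" for s using that by (auto simp: S_def)
  have left: "path_exp_left J f h s = e s * (1 + (\<Sum>r\<in>S. c r * indicator {r<..} s))" if s: "s \<in> {0..t}" for s
  proof -
    have "(\<Prod>r\<in>S \<inter> {..<s}. f r) = 1 + (\<Sum>r\<in>S \<inter> {..<s}. (\<Prod>q\<in>S \<inter> {..<s} \<inter> {..<r}. f q) * (f r - 1))"
      by (rule prod_telescope) (use S in auto)
    also have "(\<Sum>r\<in>S \<inter> {..<s}. (\<Prod>q\<in>S \<inter> {..<s} \<inter> {..<r}. f q) * (f r - 1)) = (\<Sum>r\<in>S \<inter> {..<s}. c r)"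
      unfolding c_def by (intro sum.cong refl arg_cong2[of _ _ _ _ "(*)"] prod.cong) auto
    also have "\<dots> = (\<Sum>r\<in>S. c r * indicator {r<..} s)"
      unfolding sum.inter_restrict[OF S] by (intro sum.cong) (auto simp: indicator_def)
    finally show ?thesis using Sl[of s] s by (simp add: path_exp_left_def e_def)
  qed
  have eh: "set_integrable lborel {u..v} (\<lambda>s. e s * h s)" "(LINT s:{u..v}|lborel. e s * h s) = e u - e v"
    if "0 \<le> u" "u \<le> v" "v \<le> T" for u v
    using exp_integral_increment_on[OF that] unfolding e_def by auto
  have step: "set_integrable lborel {0..t} (\<lambda>s. c r * (indicator {r<..} s * (e s * h s)))"
    "(LINT s:{0..t}|lborel. c r * (indicator {r<..} s * (e s * h s))) = c r * (e r - e t)" if r: "r \<in> S" for r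
  proof -
    have r0: "0 < r" "r \<le> t" using r by (auto simp: S_def)
    have "set_integrable lborel {r<..t} (\<lambda>s. e s * h s)"
      by (rule set_integrable_subset[OF eh(1)[of 0 t]]) (use t r0 in auto)
    then have 1: "set_integrable lborel {0..t} (\<lambda>s. indicator {r<..} s * (e s * h s))"
      unfolding set_integrable_def
      by (rule Bochner_Integration.integrable_cong[THEN iffD1, rotated -1]) (use r0 in \<open>auto simp: indicator_def\<close>)
    then show "set_integrable lborel {0..t} (\<lambda>s. c r * (indicator {r<..} s * (e s * h s)))" by simp
    have "(LINT s:{0..t}|lborel. indicator {r<..} s * (e s * h s)) = (LINT s:{r..t}|lborel. e s * h s)"
      unfolding set_lebesgue_integral_def
    proof (rule integral_cong_AE)
      show "(\<lambda>x. indicat_real {0..t} x *\<^sub>R (indicat_real {r<..} x * (e x * h x))) \<in> borel_measurable lborel"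
        using 1 by (auto simp: set_integrable_def dest: borel_measurable_integrable)
      show "(\<lambda>x. indicat_real {r..t} x *\<^sub>R (e x * h x)) \<in> borel_measurable lborel"
        using eh(1)[of r t] r0 t by (auto simp: set_integrable_def dest: borel_measurable_integrable)
      show "AE x in lborel. indicat_real {0..t} x *\<^sub>R (indicat_real {r<..} x * (e x * h x)) = indicat_real {r..t} x *\<^sub>R (e x * h x)"
        using AE_lborel_singleton[of r] by eventually_elim (use r0 in \<open>auto simp: indicator_def\<close>)
    qed
    then show "(LINT s:{0..t}|lborel. c r * (indicator {r<..} s * (e s * h s))) = c r * (e r - e t)"
      using eh(2)[of r t] r0 t by simp
  qed
  have sumi: "set_integrable lborel {0..t} (\<lambda>s. \<Sum>r\<in>S. c r * (indicator {r<..} s * (e s * h s)))"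
    using step(1) by (intro set_integral_finite_sum(1))
  have int_eq: "path_exp_left J f h s * h s = e s * h s + (\<Sum>r\<in>S. c r * (indicator {r<..} s * (e s * h s)))" if "s \<in> {0..t}" for s
    unfolding left[OF that] by (simp add: algebra_simps sum_distrib_left sum_distrib_right)
  have tot: "set_integrable lborel {0..t} (\<lambda>s. e s * h s + (\<Sum>r\<in>S. c r * (indicator {r<..} s * (e s * h s))))"
    using eh(1)[of 0 t] t sumi by (intro set_integral_add) auto
  show ?A
    using tot by (rule set_integrable_cong[THEN iffD1, rotated -1]) (use int_eq in auto)
  have "(LINT s:{0..t}|lborel. path_exp_left J f h s * h s) = (LINT s:{0..t}|lborel. e s * h s + (\<Sum>r\<in>S. c r * (indicator {r<..} s * (e s * h s))))"
    by (rule set_lebesgue_integral_cong) (use int_eq in auto)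
  also have "\<dots> = (e 0 - e t) + (\<Sum>r\<in>S. c r * (e r - e t))"
  proof -
    have "(LINT s:{0..t}|lborel. (\<Sum>r\<in>S. c r * (indicator {r<..} s * (e s * h s)))) = (\<Sum>r\<in>S. c r * (e r - e t))"
      using step by (subst set_integral_finite_sum(2)) (auto intro!: sum.cong)
    then show ?thesis using eh[of 0 t] t sumi by (subst set_integral_add(2)) auto
  qed
  finally have I: "(LINT s:{0..t}|lborel. path_exp_left J f h s * h s) = (e 0 - e t) + (\<Sum>r\<in>S. c r * (e r - e t))" .
  have e0: "e 0 = 1"
  proof -
    have "\<bar>LINT r:{0..0::real}|lborel. h r\<bar> \<le> C * (0 - 0)"
      by (rule set_integral_abs_bound) (use C t in auto)
    then show ?thesis by (simp add: e_def)
  qed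
  have "(\<Sum>s\<in>S. path_exp_left J f h s * (f s - 1)) = (\<Sum>s\<in>S. c s * e s)"
  proof (intro sum.cong refl)
    fix s assume "s \<in> S"
    then have "s \<le> t" by (auto simp: S_def)
    then show "path_exp_left J f h s * (f s - 1) = c s * e s"
      by (simp add: path_exp_left_def Sl e_def c_def)
  qed
  moreover have "path_exp J f h t = e t * (1 + (\<Sum>s\<in>S. c s))"
    unfolding path_exp_def S_def[symmetric] e_def[symmetric] c_def prod_telescope[OF S, of f] ..
  ultimately show ?B
    unfolding S_def[symmetric] I e0
    by (simp add: algebra_simps sum_subtractf sum_distrib_left)
qed

lemma path_exp_left_limit:
  assumes t: "0 < t" "t \<le> T"
  shows "(path_exp J f h \<longlongrightarrow> path_exp_left J f h t) (at_left t)"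
proof -
  have fin: "finite (J \<inter> {0<..t})" by (rule finite_subset[OF _ J]) (use t in auto)
  have ev: "eventually (\<lambda>s. exp (- (LINT r:{0..s}|lborel. h r)) * (\<Prod>s\<in>J \<inter> {0<..<t}. f s) = path_exp J f h s) (at_left t)"
    using eventually_no_jump_before[OF fin t(1)] by eventually_elim (simp add: path_exp_def)
  have "((\<lambda>t. LINT r:{0..t}|lborel. h r) \<longlongrightarrow> (LINT r:{0..t}|lborel. h r)) (at t within {0..T})"
    using drift_continuous t by (auto simp: continuous_on_def)
  then have "((\<lambda>t. LINT r:{0..t}|lborel. h r) \<longlongrightarrow> (LINT r:{0..t}|lborel. h r)) (at_left t)"
  proof (rule tendsto_mono[rotated])
    have "at_left t = at t within {0<..<t}" using t by (intro at_within_nhd[of _ "{0<..}"]) auto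
    also have "\<dots> \<le> at t within {0..T}" using t by (intro at_le) auto
    finally show "at_left t \<le> at t within {0..T}" .
  qed
  then have "((\<lambda>s. exp (- (LINT r:{0..s}|lborel. h r)) * (\<Prod>s\<in>J \<inter> {0<..<t}. f s)) \<longlongrightarrow> path_exp_left J f h t) (at_left t)"
    unfolding path_exp_left_def by (intro tendsto_intros)
  then show ?thesis using tendsto_cong[OF ev] by simp
qed

lemma path_exp_right_limit:
  assumes t: "0 \<le> t" "t < T"
  shows "(path_exp J f h \<longlongrightarrow> path_exp J f h t) (at_right t)"
proof -
  obtain d where d: "0 < d" "{t<..<t + d} \<inter> (J \<inter> {0<..T}) = {}" "{t - d<..<t} \<inter> (J \<inter> {0<..T}) = {}"
    by (rule gap_right_left[OF J, of t])
  have "t < min T (t + d)" using d t by auto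
  from eventually_at_right_real[OF this]
  have ev: "eventually (\<lambda>s. exp (- (LINT r:{0..s}|lborel. h r)) * (\<Prod>s\<in>J \<inter> {0<..t}. f s) = path_exp J f h s) (at_right t)"
  proof eventually_elim
    case (elim s)
    have "r \<in> J \<inter> {0<..s} \<longleftrightarrow> r \<in> J \<inter> {0<..t}" for r
    proof
      assume r: "r \<in> J \<inter> {0<..s}"
      then have "r \<in> J \<inter> {0<..T}" using elim by auto
      then have "r \<notin> {t<..<t + d}" using d(2) by blast
      then show "r \<in> J \<inter> {0<..t}" using r elim by auto
    qed (use elim in auto)
    then have "J \<inter> {0<..s} = J \<inter> {0<..t}" by blast
    then show ?case by (simp add: path_exp_def)
  qed
  have "((\<lambda>t. LINT r:{0..t}|lborel. h r) \<longlongrightarrow> (LINT r:{0..t}|lborel. h r)) (at t within {0..T})"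
    using drift_continuous t by (auto simp: continuous_on_def)
  then have "((\<lambda>t. LINT r:{0..t}|lborel. h r) \<longlongrightarrow> (LINT r:{0..t}|lborel. h r)) (at_right t)"
  proof (rule tendsto_mono[rotated])
    have "at_right t = at t within {t<..<T}" using t by (intro at_within_nhd[of _ "{..<T}"]) auto
    also have "\<dots> \<le> at t within {0..T}" using t by (intro at_le) auto
    finally show "at_right t \<le> at t within {0..T}" .
  qed
  then have "((\<lambda>s. exp (- (LINT r:{0..s}|lborel. h r)) * (\<Prod>s\<in>J \<inter> {0<..t}. f s)) \<longlongrightarrow> path_exp J f h t) (at_right t)"
    unfolding path_exp_def by (intro tendsto_intros)
  then show ?thesis using tendsto_cong[OF ev] by simp
qed

text \<open>Only the zero path solves the homogeneous equation: up to the first jump at which \<open>ym\<close> does not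
  vanish, iterating the equation halves the constant in the bound \<open>\<bar>ym s\<bar> \<le> K * exp (2 * D * s)\<close>,
  where \<open>D\<close> dominates \<open>\<bar>h\<bar>\<close>.\<close>

lemma homogeneous_equation_zero:
  fixes y ym c :: "real \<Rightarrow> real"
  assumes eq: "\<And>t. 0 \<le> t \<Longrightarrow> t \<le> T \<Longrightarrow> y t = (\<Sum>s\<in>J \<inter> {0<..t}. ym s * c s) - (LINT s:{0..t}|lborel. ym s * h s)"
    and left: "\<And>t. 0 < t \<Longrightarrow> t \<le> T \<Longrightarrow> (y \<longlongrightarrow> ym t) (at_left t)"
    and K: "\<And>t. 0 < t \<Longrightarrow> t \<le> T \<Longrightarrow> \<bar>ym t\<bar> \<le> K"
    and t: "0 \<le> t" "t \<le> T"
  shows "y t = 0"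
proof -
  define D where "D = \<bar>C\<bar> + 1"
  have D: "0 < D" "\<And>x. x \<in> {0..T} \<Longrightarrow> \<bar>h x\<bar> \<le> D" using C by (auto simp: D_def) (smt (verit))
  have expint: "set_integrable lborel {0..r} (\<lambda>s. D * exp (2 * D * s))"
    "(LINT s:{0..r}|lborel. D * exp (2 * D * s)) \<le> exp (2 * D * r) / 2" if "0 \<le> r" for r
  proof -
    have "((\<lambda>x. exp (2 * D * x) / 2) has_vector_derivative (D * exp (2 * D * x))) (at x within {0..r})" for x
      by (auto intro!: derivative_eq_intros simp: has_real_derivative_iff_has_vector_derivative[symmetric])
    moreover have "continuous_on {0..r} (\<lambda>x. D * exp (2 * D * x))" by (intro continuous_intros)
    ultimately have "has_bochner_integral lborel (\<lambda>x. indicator {0..r} x *\<^sub>R (D * exp (2 * D * x))) (exp (2 * D * r) / 2 - exp (2 * D * 0) / 2)"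
      using that by (intro has_bochner_integral_FTC_Icc) auto
    then show "set_integrable lborel {0..r} (\<lambda>s. D * exp (2 * D * s))"
      "(LINT s:{0..r}|lborel. D * exp (2 * D * s)) \<le> exp (2 * D * r) / 2"
      unfolding set_integrable_def set_lebesgue_integral_def by (auto simp: has_bochner_integral_iff)
  qed
  have zero: "ym s = 0 \<and> y r = 0" if r: "0 \<le> r" "r \<le> T" and jz: "\<And>s. s \<in> J \<inter> {0<..r} \<Longrightarrow> ym s = 0" and s: "0 < s" "s \<le> r" for r s
  proof -
    have yq: "y q = - (LINT s:{0..q}|lborel. ym s * h s)" if "0 \<le> q" "q \<le> r" for q
    proof -
      have "(\<Sum>s\<in>J \<inter> {0<..q}. ym s * c s) = 0" using jz that by (intro sum.neutral) auto
      then show ?thesis using eq[of q] that r by simp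
    qed
    have dbl: "\<bar>y q\<bar> \<le> (k / 2) * exp (2 * D * q)"
      if k: "0 \<le> k" "\<And>s. 0 < s \<Longrightarrow> s \<le> r \<Longrightarrow> \<bar>ym s\<bar> \<le> k * exp (2 * D * s)" and q: "0 \<le> q" "q \<le> r" for k q
    proof -
      have ae: "AE s in lborel. norm (indicator {0..q} s *\<^sub>R (ym s * h s)) \<le> k * (indicator {0..q} s *\<^sub>R (D * exp (2 * D * s)))"
        using AE_lborel_singleton[of 0]
      proof eventually_elim
        case (elim s)
        show ?case
        proof (cases "s \<in> {0..q}")
          case True
          then have s: "0 < s" "s \<le> r" using elim q by auto
          have "\<bar>ym s * h s\<bar> \<le> (k * exp (2 * D * s)) * D"
            unfolding abs_mult using k(2)[OF s] D(2)[of s] s r by (intro mult_mono) (auto intro: order.trans)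
          then show ?thesis using True by (simp add: ac_simps)
        qed (simp add: k D)
      qed
      have g: "integrable lborel (\<lambda>s. k * (indicator {0..q} s *\<^sub>R (D * exp (2 * D * s))))"
        using expint(1)[OF q(1)] by (simp add: set_integrable_def)
      have "\<bar>y q\<bar> = norm (LINT s|lborel. indicator {0..q} s *\<^sub>R (ym s * h s))"
        using yq[OF q] by (simp add: set_lebesgue_integral_def)
      also have "\<dots> \<le> (LINT s|lborel. norm (indicator {0..q} s *\<^sub>R (ym s * h s)))"
        by (rule integral_norm_bound)
      also have "\<dots> \<le> (LINT s|lborel. k * (indicator {0..q} s *\<^sub>R (D * exp (2 * D * s))))"
        by (rule integral_mono_AE'[OF g ae], rule AE_I2) (use k(1) D(1) in \<open>simp add: indicator_def\<close>)
      also have "\<dots> = k * (LINT s:{0..q}|lborel. D * exp (2 * D * s))"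
        unfolding set_lebesgue_integral_def by (rule integral_mult_right_zero)
      also have "\<dots> \<le> k * (exp (2 * D * q) / 2)" using expint(2)[OF q(1)] k(1) by (intro mult_left_mono)
      finally show ?thesis by simp
    qed
    have iter: "\<bar>ym s\<bar> \<le> (\<bar>K\<bar> * (1/2) ^ n) * exp (2 * D * s)" if "0 < s" "s \<le> r" for n s
      using that
    proof (induction n arbitrary: s)
      case 0
      have "\<bar>K\<bar> * 1 \<le> \<bar>K\<bar> * exp (2 * D * s)" using 0 D by (intro mult_left_mono) auto
      then show ?case using K[of s] 0 r by auto
    next
      case (Suc n)
      have yb: "\<bar>y q\<bar> \<le> (\<bar>K\<bar> * (1/2) ^ n / 2) * exp (2 * D * q)" if "0 \<le> q" "q \<le> r" for q
        by (rule dbl) (use Suc.IH that in auto)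
      have ev: "eventually (\<lambda>q. \<bar>y q\<bar> \<le> (\<bar>K\<bar> * (1/2) ^ n / 2) * exp (2 * D * q)) (at_left s)"
        using eventually_at_left_real[OF Suc.prems(1)] by eventually_elim (rule yb, use Suc.prems in auto)
      have l1: "((\<lambda>q. \<bar>y q\<bar>) \<longlongrightarrow> \<bar>ym s\<bar>) (at_left s)"
        using left[of s] Suc.prems r by (intro tendsto_intros) auto
      have l2: "((\<lambda>q. (\<bar>K\<bar> * (1/2) ^ n / 2) * exp (2 * D * q)) \<longlongrightarrow> (\<bar>K\<bar> * (1/2) ^ n / 2) * exp (2 * D * s)) (at_left s)"
        by (intro tendsto_intros)
      have "\<bar>ym s\<bar> \<le> (\<bar>K\<bar> * (1/2) ^ n / 2) * exp (2 * D * s)"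
        by (rule tendsto_le[OF _ l2 l1 ev]) simp
      then show ?case by simp
    qed
    have ymz: "ym s = 0" if "0 < s" "s \<le> r" for s
    proof -
      have "(\<lambda>n. (\<bar>K\<bar> * (1/2) ^ n) * exp (2 * D * s)) \<longlonglongrightarrow> (\<bar>K\<bar> * 0) * exp (2 * D * s)"
        by (intro tendsto_intros LIMSEQ_power_zero) auto
      then have "\<bar>ym s\<bar> \<le> (\<bar>K\<bar> * 0) * exp (2 * D * s)"
        by (rule LIMSEQ_le_const) (use iter that in auto)
      then show ?thesis by simp
    qed
    have "\<bar>y r\<bar> \<le> (0 / 2) * exp (2 * D * r)"
      by (rule dbl) (use ymz r in auto)
    then show ?thesis using ymz s by auto
  qed
  define B where "B = {s \<in> J \<inter> {0<..T}. ym s \<noteq> 0}"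
  have finB: "finite B" by (rule finite_subset[OF _ J]) (auto simp: B_def)
  have "B = {}"
  proof (rule ccontr)
    assume ne: "B \<noteq> {}"
    define s where "s = Min B"
    have sB: "s \<in> B" using ne finB by (simp add: s_def)
    have smin: "\<And>r. r \<in> B \<Longrightarrow> s \<le> r" using finB by (simp add: s_def)
    have s: "0 < s" "s \<le> T" "ym s \<noteq> 0" using sB by (auto simp: B_def)
    have "eventually (\<lambda>q. y q = 0) (at_left s)"
      using eventually_at_left_real[OF s(1)]
    proof eventually_elim
      case (elim q)
      have "ym r = 0" if "r \<in> J \<inter> {0<..q}" for r
        using smin[of r] that elim s by (force simp: B_def)
      then show ?case using zero[of q q] elim s by auto
    qed
    then have "(y \<longlongrightarrow> 0) (at_left s)" by (rule tendsto_eventually)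
    then have "ym s = 0" using left[OF s(1,2)] by (intro tendsto_unique[of "at_left s"]) auto
    then show False using s by simp
  qed
  then have jz: "ym s = 0" if "s \<in> J \<inter> {0<..T}" for s using that by (auto simp: B_def)
  show ?thesis
  proof (cases "t = 0")
    case True
    have "(LINT s:{0..0::real}|lborel. ym s * h s) = 0"
    proof -
      have "AE x in lborel. indicator {0..0::real} x *\<^sub>R (ym x * h x) = 0"
        using AE_lborel_singleton[of 0] by eventually_elim auto
      then show ?thesis unfolding set_lebesgue_integral_def by (rule integral_eq_zero_AE)
    qed
    then show ?thesis using eq[of 0] t True by simp
  next
    case False
    then show ?thesis using zero[of t t] jz t by auto
  qed
qed

end

section \<open>Predictable processes\<close>

context usual_filtered_prob_space
begin

text \<open>The predictable \<open>\<sigma>\<close>-algebra, on \<open>{0..} \<times> space P\<close>, and its generating rectangles.\<close>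

abbreviation PS :: "(real \<times> 'a) measure" where
  "PS \<equiv> predictable_sigma P F"

definition predictable_rectangles :: "(real \<times> 'a) set set" where
  "predictable_rectangles = {{0} \<times> A |A. A \<in> sets (F 0)} \<union>
      {{s<..t} \<times> A |s t A. 0 \<le> s \<and> s \<le> t \<and> A \<in> sets (F (ennreal s))}"

lemma sets_F_P: "A \<in> sets (F t) \<Longrightarrow> A \<in> sets P"
  using sets_F_subset[of t] by (rule subsetD)

lemma sets_F_mono': "A \<in> sets (F s) \<Longrightarrow> s \<le> t \<Longrightarrow> A \<in> sets (F t)"
  using sets_F_mono[of s t] by auto

lemma measurable_F_P: "f \<in> measurable (F t) M \<Longrightarrow> f \<in> measurable P M"
  using sets_F_subset[of t] space_F[of t] by (auto simp: measurable_def)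

lemma measurable_F_mono: "f \<in> measurable (F s) M \<Longrightarrow> s \<le> t \<Longrightarrow> f \<in> measurable (F t) M"
  using sets_F_mono[of s t] space_F[of t] space_F[of s] by (auto simp: measurable_def)

lemma subalgebra_F: "subalgebra P (F t)"
  using sets_F_subset[of t] space_F[of t] by (simp add: subalgebra_def)

lemma predictable_rectangles_Pow: "predictable_rectangles \<subseteq> Pow ({0..} \<times> space P)"
proof
  fix R assume "R \<in> predictable_rectangles"
  then consider A where "R = {0::real} \<times> A" "A \<in> sets (F 0)" | a b A where "R = {a<..b::real} \<times> A" "0 \<le> a" "A \<in> sets (F (ennreal a))"
    unfolding predictable_rectangles_def by blast
  then obtain I A t where R: "R = I \<times> A" "I \<subseteq> {0..}" "A \<in> sets (F t)"
  proof cases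
    case 1 then show ?thesis using that[of "{0}" A 0] by simp
  next
    case 2
    then have "{a<..b} \<subseteq> {0..}" by auto
    then show ?thesis using that[of "{a<..b}" A "ennreal a"] 2 by simp
  qed
  then have "A \<subseteq> space P" using sets.sets_into_space[OF R(3)] by (simp add: space_F)
  then show "R \<in> Pow ({0..} \<times> space P)" using R by auto
qed

lemma space_PS [simp]: "space PS = {0..} \<times> space P"
  unfolding predictable_sigma_def predictable_rectangles_def[symmetric]
  by (rule space_measure_of[OF predictable_rectangles_Pow])

lemma sets_PS: "sets PS = sigma_sets ({0..} \<times> space P) predictable_rectangles"
  unfolding predictable_sigma_def predictable_rectangles_def[symmetric]
  by (rule sets_measure_of[OF predictable_rectangles_Pow])

lemma rectangle_in_PS: "R \<in> predictable_rectangles \<Longrightarrow> R \<in> sets PS"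
  unfolding sets_PS by (rule sigma_sets.Basic)

lemma Int_stable_predictable_rectangles: "Int_stable predictable_rectangles"
proof (rule Int_stableI)
  fix a b assume ab: "a \<in> predictable_rectangles" "b \<in> predictable_rectangles"
  have empty: "{} \<in> predictable_rectangles" unfolding predictable_rectangles_def by force
  have ioc: "{s<..t} \<times> A \<inter> {s'<..t'} \<times> B \<in> predictable_rectangles"
    if "0 \<le> s" "s \<le> t" "A \<in> sets (F (ennreal s))" "0 \<le> s'" "s' \<le> t'" "B \<in> sets (F (ennreal s'))" for s t A s' t' B
  proof (cases "max s s' \<le> min t t'")
    case True
    have "A \<in> sets (F (ennreal (max s s')))" "B \<in> sets (F (ennreal (max s s')))"
      using that by (auto intro: sets_F_mono' ennreal_leI)
    moreover have "{s<..t} \<times> A \<inter> {s'<..t'} \<times> B = {max s s'<..min t t'} \<times> (A \<inter> B)" by auto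
    ultimately have "{s<..t} \<times> A \<inter> {s'<..t'} \<times> B = {max s s'<..min t t'} \<times> (A \<inter> B) \<and>
      0 \<le> max s s' \<and> max s s' \<le> min t t' \<and> A \<inter> B \<in> sets (F (ennreal (max s s')))"
      using True that(1) by (intro conjI sets.Int) (assumption | simp add: le_max_iff_disj)+
    then show ?thesis unfolding predictable_rectangles_def by blast
  next
    case False
    then have "{s<..t} \<times> A \<inter> {s'<..t'} \<times> B = {}" by auto
    then show ?thesis using empty by simp
  qed
  have sing: "{0} \<times> A \<inter> {0} \<times> B \<in> predictable_rectangles" if "A \<in> sets (F 0)" "B \<in> sets (F 0)" for A B
  proof -
    have "{0} \<times> A \<inter> {0} \<times> B = {0} \<times> (A \<inter> B)" by auto
    then show ?thesis using that unfolding predictable_rectangles_def by blast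
  qed
  have mix: "{0} \<times> A \<inter> {s<..t} \<times> B \<in> predictable_rectangles" "{s<..t} \<times> B \<inter> {0} \<times> A \<in> predictable_rectangles" if "0 \<le> s" for s t :: real and A B
  proof -
    have "{0} \<times> A \<inter> {s<..t} \<times> B = {}" "{s<..t} \<times> B \<inter> {0} \<times> A = {}" using that by auto
    then show "{0} \<times> A \<inter> {s<..t} \<times> B \<in> predictable_rectangles" "{s<..t} \<times> B \<inter> {0} \<times> A \<in> predictable_rectangles"
      using empty by simp_all
  qed
  consider (1) A where "a = {0} \<times> A" "A \<in> sets (F 0)"
    | (2) s t A where "a = {s<..t} \<times> A" "0 \<le> s" "s \<le> t" "A \<in> sets (F (ennreal s))"
    using ab(1) unfolding predictable_rectangles_def by blast
  note a = this
  consider (1) A where "b = {0} \<times> A" "A \<in> sets (F 0)"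
    | (2) s t A where "b = {s<..t} \<times> A" "0 \<le> s" "s \<le> t" "A \<in> sets (F (ennreal s))"
    using ab(2) unfolding predictable_rectangles_def by blast
  note b = this
  show "a \<inter> b \<in> predictable_rectangles"
    by (cases rule: a; cases rule: b) (simp_all only: ioc sing mix)
qed

lemma predictable_section:
  assumes K: "(\<lambda>(s, \<omega>). K s \<omega>) \<in> borel_measurable PS" and \<omega>: "\<omega> \<in> space P"
  shows "(\<lambda>s. if 0 \<le> s then K s \<omega> else (0::'b::real_normed_vector)) \<in> borel_measurable borel"
proof -
  have "(\<lambda>s. (s, \<omega>)) \<in> restrict_space borel {0..} \<rightarrow>\<^sub>M PS"
    unfolding predictable_sigma_def predictable_rectangles_def[symmetric]
  proof (rule measurable_sigma_sets[OF sets_measure_of[OF predictable_rectangles_Pow] predictable_rectangles_Pow])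
    show "(\<lambda>s. (s, \<omega>)) \<in> space (restrict_space borel {0..}) \<rightarrow> {0..} \<times> space P"
      using \<omega> by (auto simp: space_restrict_space)
    fix R assume "R \<in> predictable_rectangles"
    then consider A where "R = {0::real} \<times> A" | s t A where "R = {s<..t::real} \<times> A"
      unfolding predictable_rectangles_def by blast
    then have "(\<lambda>s. (s, \<omega>)) -` R \<in> sets borel"
    proof cases
      case 1
      then have "(\<lambda>s. (s, \<omega>)) -` R = (if \<omega> \<in> A then {0} else {})" by auto
      then show ?thesis by simp
    next
      case 2
      then have "(\<lambda>s. (s, \<omega>)) -` R = (if \<omega> \<in> A then {s<..t} else {})" by auto
      then show ?thesis by simp
    qed
    then show "(\<lambda>s. (s, \<omega>)) -` R \<inter> space (restrict_space borel {0..}) \<in> sets (restrict_space borel {0..})"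
      by (auto simp: space_restrict_space sets_restrict_space)
  qed
  from measurable_compose[OF this K] have "(\<lambda>s. K s \<omega>) \<in> borel_measurable (restrict_space borel {0..})"
    by simp
  then have "(\<lambda>s. indicator {0..} s *\<^sub>R K s \<omega>) \<in> borel_measurable borel"
    by (subst (asm) borel_measurable_restrict_space_iff) auto
  moreover have "(\<lambda>s. indicator {0..} s *\<^sub>R K s \<omega>) = (\<lambda>s. if 0 \<le> s then K s \<omega> else 0)"
    by (auto simp: indicator_def)
  ultimately show ?thesis by simp
qed

text \<open>Up to time \<open>t\<close> a predictable process is measurable in both variables with respect to \<open>F t\<close>.\<close>

lemma predictable_progressive_map:
  assumes t: "0 \<le> t"
  shows "(\<lambda>x. x) \<in> restrict_space (borel \<Otimes>\<^sub>M F (ennreal t)) ({0..t} \<times> space P) \<rightarrow>\<^sub>M PS"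
  unfolding predictable_sigma_def predictable_rectangles_def[symmetric]
proof (rule measurable_sigma_sets[OF sets_measure_of[OF predictable_rectangles_Pow] predictable_rectangles_Pow])
  let ?M = "borel \<Otimes>\<^sub>M F (ennreal t)"
  have sp: "space ?M = UNIV \<times> space P" by (simp add: space_pair_measure space_F)
  show "(\<lambda>x. x) \<in> space (restrict_space ?M ({0..t} \<times> space P)) \<rightarrow> {0..} \<times> space P"
    by (auto simp: space_restrict_space sp)
  fix R assume R: "R \<in> predictable_rectangles"
  then consider A where "R = {0::real} \<times> A" "A \<in> sets (F 0)" | a b A where "R = {a<..b::real} \<times> A" "0 \<le> a" "A \<in> sets (F (ennreal a))"
    unfolding predictable_rectangles_def by blast
  then have "R \<inter> ({0..t} \<times> space P) \<in> sets ?M"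
  proof cases
    case 1
    then have "A \<in> sets (F (ennreal t))" by (auto intro: sets_F_mono')
    moreover have "A \<subseteq> space P" using sets.sets_into_space[OF calculation] by (simp add: space_F)
    then have "R \<inter> ({0..t} \<times> space P) = {0} \<times> A" using 1 t by auto
    ultimately show ?thesis by simp
  next
    case 2
    show ?thesis
    proof (cases "a \<le> t")
      case True
      then have "A \<in> sets (F (ennreal t))" using 2 by (auto intro: sets_F_mono' ennreal_leI)
      moreover have "A \<subseteq> space P" using sets.sets_into_space[OF calculation] by (simp add: space_F)
      then have "R \<inter> ({0..t} \<times> space P) = {a<..min b t} \<times> A" using 2 True by auto
      ultimately show ?thesis by simp
    next
      case False
      then have "R \<inter> ({0..t} \<times> space P) = {}" using 2 by auto
      then show ?thesis by simp
    qed
  qed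
  then show "(\<lambda>x. x) -` R \<inter> space (restrict_space ?M ({0..t} \<times> space P)) \<in> sets (restrict_space ?M ({0..t} \<times> space P))"
    unfolding sets_restrict_space space_restrict_space sp by (auto intro!: image_eqI[of _ _ "R \<inter> ({0..t} \<times> space P)"])
qed

lemma progressive_dom: "{0..t} \<times> space P \<inter> space (borel \<Otimes>\<^sub>M F (ennreal t)) \<in> sets (borel \<Otimes>\<^sub>M F (ennreal t))"
proof -
  have "{0..t} \<times> space P \<inter> space (borel \<Otimes>\<^sub>M F (ennreal t)) = {0..t} \<times> space (F (ennreal t))"
    by (auto simp: space_pair_measure space_F)
  then show ?thesis by simp
qed

lemma predictable_progressive_real:
  assumes K: "(\<lambda>(s, \<omega>). K s \<omega>) \<in> borel_measurable PS" and t: "0 \<le> t"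
  shows "(\<lambda>(s, \<omega>). if s \<in> {0..t} then K s \<omega> else (0::real)) \<in> borel_measurable (borel \<Otimes>\<^sub>M F (ennreal t))"
proof -
  let ?M = "borel \<Otimes>\<^sub>M F (ennreal t)"
  from measurable_compose[OF predictable_progressive_map[OF t] K]
  have "(\<lambda>x. indicator ({0..t} \<times> space P) x *\<^sub>R (case x of (s, \<omega>) \<Rightarrow> K s \<omega>)) \<in> borel_measurable ?M"
    by (subst (asm) borel_measurable_restrict_space_iff[OF progressive_dom]) auto
  then show ?thesis
    by (rule measurable_cong[THEN iffD1, rotated]) (auto simp: space_pair_measure space_F indicator_def split: if_splits)
qed

lemma predictable_progressive_ennreal:
  assumes K: "(\<lambda>(s, \<omega>). K s \<omega>) \<in> borel_measurable PS" and t: "0 \<le> t"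
  shows "(\<lambda>(s, \<omega>). if s \<in> {0..t} then K s \<omega> else (0::ennreal)) \<in> borel_measurable (borel \<Otimes>\<^sub>M F (ennreal t))"
proof -
  let ?M = "borel \<Otimes>\<^sub>M F (ennreal t)"
  from measurable_compose[OF predictable_progressive_map[OF t] K]
  have "(\<lambda>x. indicator ({0..t} \<times> space P) x * (case x of (s, \<omega>) \<Rightarrow> K s \<omega>)) \<in> borel_measurable ?M"
    by (subst (asm) borel_measurable_restrict_space_iff_ennreal[OF progressive_dom]) (auto simp: mult.commute)
  then show ?thesis
    by (rule measurable_cong[THEN iffD1, rotated]) (auto simp: space_pair_measure space_F indicator_def split: if_splits)
qed

lemma predictable_lebesgue_integral_measurable:
  assumes K: "(\<lambda>(s, \<omega>). K s \<omega>) \<in> borel_measurable PS" and t: "0 \<le> t" and u: "0 \<le> u"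
  shows "(\<lambda>\<omega>. LINT s:{u..t}|lborel. (K s \<omega> :: real)) \<in> borel_measurable (F (ennreal t))"
proof -
  have [measurable]: "(\<lambda>(s, \<omega>). if s \<in> {0..t} then K s \<omega> else 0) \<in> borel_measurable (borel \<Otimes>\<^sub>M F (ennreal t))"
    by (rule predictable_progressive_real[OF K t])
  have "(\<lambda>\<omega>. LINT s|lborel. indicator {u..t} s * (case (s, \<omega>) of (s, \<omega>) \<Rightarrow> if s \<in> {0..t} then K s \<omega> else 0)) \<in> borel_measurable (F (ennreal t))"
    by measurable
  moreover have "(LINT s|lborel. indicator {u..t} s * (case (s, \<omega>) of (s, \<omega>) \<Rightarrow> if s \<in> {0..t} then K s \<omega> else 0)) = (LINT s:{u..t}|lborel. K s \<omega>)" for \<omega>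
    unfolding set_lebesgue_integral_def using u by (intro Bochner_Integration.integral_cong) (auto simp: indicator_def)
  ultimately show ?thesis by simp
qed

lemma predictable_nn_integral_measurable:
  assumes K: "(\<lambda>(s, \<omega>). K s \<omega>) \<in> borel_measurable PS" and t: "0 \<le> t"
  shows "(\<lambda>\<omega>. \<integral>\<^sup>+s\<in>{0..t}. (K s \<omega> :: ennreal) \<partial>lborel) \<in> borel_measurable (F (ennreal t))"
proof -
  have [measurable]: "(\<lambda>(s, \<omega>). if s \<in> {0..t} then K s \<omega> else 0) \<in> borel_measurable (borel \<Otimes>\<^sub>M F (ennreal t))"
    by (rule predictable_progressive_ennreal[OF K t])
  have "(\<lambda>\<omega>. \<integral>\<^sup>+s. (case (s, \<omega>) of (s, \<omega>) \<Rightarrow> if s \<in> {0..t} then K s \<omega> else 0) \<partial>lborel) \<in> borel_measurable (F (ennreal t))"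
    by measurable
  moreover have "(\<integral>\<^sup>+s. (case (s, \<omega>) of (s, \<omega>) \<Rightarrow> if s \<in> {0..t} then K s \<omega> else 0) \<partial>lborel) = (\<integral>\<^sup>+s\<in>{0..t}. K s \<omega> \<partial>lborel)" for \<omega>
    by (intro nn_integral_cong) (auto simp: indicator_def)
  ultimately show ?thesis by simp
qed

lemma rectangle_after_in_PS:
  assumes "0 \<le> a" "A \<in> sets (F (ennreal a))"
  shows "{a<..} \<times> A \<in> sets PS"
proof -
  have "{a<..} \<times> A = (\<Union>n. {a<..a + real n} \<times> A)"
  proof -
    have "\<exists>n. x \<le> a + real n" for x
      using real_arch_simple[of "x - a"] by (auto simp: algebra_simps)
    then show ?thesis by auto
  qed
  moreover have "{a<..a + real n} \<times> A \<in> sets PS" for n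
    using assms by (intro rectangle_in_PS) (auto simp: predictable_rectangles_def intro!: exI)
  ultimately show ?thesis by auto
qed

lemma predictable_const_after:
  assumes a: "0 \<le> a" and g: "g \<in> borel_measurable (F (ennreal a))"
  shows "(\<lambda>(s, \<omega>). if a < s then g \<omega> else (0::real)) \<in> borel_measurable PS"
proof -
  have P: "{a<..} \<times> space P \<in> sets PS"
    using rectangle_after_in_PS[OF a, of "space P"] sets.top[of "F (ennreal a)"] by (simp add: space_F)
  have "(\<lambda>x. (case x of (s, \<omega>) \<Rightarrow> g \<omega>)) \<in> borel_measurable (restrict_space PS ({a<..} \<times> space P))"
  proof (rule measurableI)
    fix B :: "real set" assume B: "B \<in> sets borel"
    have "g -` B \<inter> space P \<in> sets (F (ennreal a))" using measurable_sets[OF g B] by (simp add: space_F)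
    from rectangle_after_in_PS[OF a this]
    have 1: "{a<..} \<times> (g -` B \<inter> space P) \<in> sets PS" .
    have "(\<lambda>x. case x of (s, \<omega>) \<Rightarrow> g \<omega>) -` B \<inter> space (restrict_space PS ({a<..} \<times> space P)) = {a<..} \<times> (g -` B \<inter> space P)"
      using a by (auto simp: space_restrict_space)
    moreover have "{a<..} \<times> (g -` B \<inter> space P) \<in> sets (restrict_space PS ({a<..} \<times> space P))"
      unfolding sets_restrict_space by (rule image_eqI[OF _ 1]) auto
    ultimately show "(\<lambda>x. case x of (s, \<omega>) \<Rightarrow> g \<omega>) -` B \<inter> space (restrict_space PS ({a<..} \<times> space P)) \<in> sets (restrict_space PS ({a<..} \<times> space P))"
      by simp
  qed simp
  then have "(\<lambda>x. indicator ({a<..} \<times> space P) x *\<^sub>R (case x of (s, \<omega>) \<Rightarrow> g \<omega>)) \<in> borel_measurable PS"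
    by (subst (asm) borel_measurable_restrict_space_iff[OF sets.Int[OF P sets.top]])
  then show ?thesis
    by (rule measurable_cong[THEN iffD1, rotated]) (auto simp: indicator_def split: if_splits)
qed

lemma predictable_time: "(\<lambda>(s, \<omega>). s) \<in> borel_measurable PS"
proof (rule measurableI)
  have "fst \<in> PS \<rightarrow>\<^sub>M (borel :: real measure)"
  proof (rule borel_measurableI_greater)
    fix y :: real
    show "{x \<in> space PS. y < fst x} \<in> sets PS"
    proof (cases "0 \<le> y")
      case True
      have "{x \<in> space PS. y < fst x} = {y<..} \<times> space P" using True by auto
      then show ?thesis using rectangle_after_in_PS[OF True, of "space P"] sets.top[of "F (ennreal y)"] by (simp add: space_F)
    next
      case False
      then have "{x \<in> space PS. y < fst x} = space PS" by auto
      then show ?thesis by (metis sets.top)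
    qed
  qed
  then show "(\<lambda>(s, \<omega>). s) -` B \<inter> space PS \<in> sets PS" if "B \<in> sets borel" for B
    using measurable_sets[OF _ that, of fst PS] by (simp add: case_prod_beta' fst_def[symmetric] vimage_def)
qed simp

text \<open>The left-limit process of an adapted process is predictable: it is the limit of its values at the last
  dyadic time strictly before \<open>t\<close>.\<close>

lemma predictable_left_limit:
  fixes Y L :: "real \<Rightarrow> 'a \<Rightarrow> real"
  assumes Y: "\<And>t. 0 \<le> t \<Longrightarrow> Y t \<in> borel_measurable (F (ennreal t))"
    and lim: "\<And>\<omega> t. \<omega> \<in> space P \<Longrightarrow> 0 < t \<Longrightarrow> ((\<lambda>s. Y s \<omega>) \<longlongrightarrow> L t \<omega>) (at_left t)"
    and L0: "\<And>\<omega>. \<omega> \<in> space P \<Longrightarrow> L 0 \<omega> = c"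
  shows "(\<lambda>(t, \<omega>). L t \<omega>) \<in> borel_measurable PS"
proof -
  define idx where "idx k t = nat (\<lceil>t * 2 ^ k\<rceil> - 1)" for k :: nat and t :: real
  define a where "a k j = real j / 2 ^ k" for k j :: nat
  have grid: "a k (idx k t) < t" "t - 1 / 2 ^ k \<le> a k (idx k t)" if "0 < t" for k t
  proof -
    have c: "0 < \<lceil>t * 2 ^ k\<rceil>" using that by simp
    then have r: "real (idx k t) = real_of_int \<lceil>t * 2 ^ k\<rceil> - 1" by (simp add: idx_def)
    have "real_of_int \<lceil>t * 2 ^ k\<rceil> - 1 < t * 2 ^ k" "t * 2 ^ k \<le> real_of_int \<lceil>t * 2 ^ k\<rceil>" by linarith+
    then show "a k (idx k t) < t" "t - 1 / 2 ^ k \<le> a k (idx k t)"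
      unfolding a_def r by (auto simp: field_simps)
  qed
  define Z where "Z k t \<omega> = (\<lambda>j (t, \<omega>). if a k j < t then Y (a k j) \<omega> else 0) (idx k t) (t, \<omega>)" for k t \<omega>
  have time: "fst \<in> borel_measurable PS" using predictable_time by (simp add: case_prod_beta' fst_def[symmetric])
  have Zm: "(\<lambda>x. Z k (fst x) (snd x)) \<in> borel_measurable PS" for k
  proof -
    have i: "(\<lambda>x. idx k (fst x)) \<in> PS \<rightarrow>\<^sub>M count_space UNIV"
      unfolding idx_def using time by measurable
    have f: "(\<lambda>(t, \<omega>). if a k j < t then Y (a k j) \<omega> else 0) \<in> borel_measurable PS" for j
      by (rule predictable_const_after) (auto simp: a_def intro!: Y)
    have "(\<lambda>x. (\<lambda>j (t, \<omega>). if a k j < t then Y (a k j) \<omega> else 0) (idx k (fst x)) x) \<in> borel_measurable PS"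
      by (rule measurable_compose_countable[OF f i])
    then show ?thesis by (simp add: Z_def case_prod_beta')
  qed
  have "(\<lambda>x. if fst x = 0 then c else L (fst x) (snd x)) \<in> borel_measurable PS"
  proof (rule borel_measurable_LIMSEQ_real)
    show "(\<lambda>x. if fst x = 0 then c else Z k (fst x) (snd x)) \<in> borel_measurable PS" for k
      using time Zm[of k] by measurable
    fix x assume x: "x \<in> space PS"
    show "(\<lambda>k. if fst x = 0 then c else Z k (fst x) (snd x)) \<longlonglongrightarrow> (if fst x = 0 then c else L (fst x) (snd x))"
    proof (cases "fst x = 0")
      case False
      then have t: "0 < fst x" and w: "snd x \<in> space P" using x by auto
      have "(\<lambda>k. a k (idx k (fst x))) \<longlonglongrightarrow> fst x"
      proof (rule tendsto_sandwich)
        have "(\<lambda>k. fst x - (1 / 2) ^ k) \<longlonglongrightarrow> fst x - 0"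
          by (intro tendsto_intros LIMSEQ_power_zero) auto
        then show "(\<lambda>k. fst x - 1 / 2 ^ k) \<longlonglongrightarrow> fst x" by (simp add: power_divide)
        show "(\<lambda>k. fst x) \<longlonglongrightarrow> fst x" by simp
      qed (use grid[OF t] in \<open>auto intro!: always_eventually less_imp_le\<close>)
      then have "filterlim (\<lambda>k. a k (idx k (fst x))) (at_left (fst x)) sequentially"
        using grid(1)[OF t, THEN less_imp_neq] grid(1)[OF t] by (auto simp: filterlim_at intro!: always_eventually)
      from filterlim_compose[OF lim[OF w t] this]
      have "(\<lambda>k. Y (a k (idx k (fst x))) (snd x)) \<longlonglongrightarrow> L (fst x) (snd x)" .
      then show ?thesis using False grid(1)[OF t] by (simp add: Z_def case_prod_beta')
    qed simp
  qed
  then show ?thesis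
    by (rule measurable_cong[THEN iffD1, rotated]) (use L0 in \<open>auto simp: case_prod_beta'\<close>)
qed

lemma predictable_before_stopping_time:
  assumes T: "stopping_time F T"
  shows "{(r, \<omega>). 0 \<le> r \<and> \<omega> \<in> space P \<and> ennreal r \<le> T \<omega>} \<in> sets PS"
proof -
  have 1: "{(q::real)<..} \<times> {\<omega> \<in> space P. T \<omega> \<le> ennreal q} \<in> sets PS" if "0 \<le> q" for q
    by (rule rectangle_after_in_PS[OF that])
       (use stopping_timeD[OF T, of "ennreal q"] in \<open>simp add: pred_def space_F\<close>)
  have "{(r, \<omega>). 0 \<le> r \<and> \<omega> \<in> space P \<and> ennreal r \<le> T \<omega>} = space PS - (\<Union>q\<in>\<rat> \<inter> {0..}. {q<..} \<times> {\<omega> \<in> space P. T \<omega> \<le> ennreal q})"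
  proof -
    have "T \<omega> < ennreal r \<longleftrightarrow> (\<exists>q\<in>\<rat> \<inter> {0..}. q < r \<and> T \<omega> \<le> ennreal q)" if "0 \<le> r" for r \<omega>
    proof
      assume *: "T \<omega> < ennreal r"
      then obtain x where x: "0 \<le> x" "T \<omega> = ennreal x" by (cases "T \<omega>") auto
      then have "x < r" using * by (simp add: ennreal_less_iff)
      then obtain q where "q \<in> \<rat>" "x < q" "q < r" using Rats_dense_in_real by blast
      then show "\<exists>q\<in>\<rat> \<inter> {0..}. q < r \<and> T \<omega> \<le> ennreal q" using x by (intro bexI[of _ q]) (auto intro: ennreal_leI)
    next
      assume "\<exists>q\<in>\<rat> \<inter> {0..}. q < r \<and> T \<omega> \<le> ennreal q"
      then show "T \<omega> < ennreal r" using that by (auto simp: ennreal_less_iff intro: order.strict_trans1)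
    qed
    then show ?thesis by (fastforce simp: not_le[symmetric])
  qed
  moreover have "countable (\<rat> \<inter> {0..} :: real set)" by (intro countable_Int1 countable_rat)
  ultimately show ?thesis
    using 1 by (simp del: space_PS) (intro sets.Diff sets.top sets.countable_UN'', auto)
qed

end

section \<open>Optional stopping\<close>

text \<open>A Vitali-type convergence theorem in which uniform integrability comes from a fixed integrable
  \<open>G\<close> that dominates each \<open>Y k\<close> on all events determined by \<open>Y k\<close>.\<close>

lemma (in prob_space) integral_limit_of_dominated_tails:
  fixes Y :: "nat \<Rightarrow> 'a \<Rightarrow> real"
  assumes Yk: "\<And>k. integrable M (Y k)" and Y [measurable]: "Y' \<in> borel_measurable M"
    and lim: "AE \<omega> in M. (\<lambda>k. Y k \<omega>) \<longlonglongrightarrow> Y' \<omega>"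
    and G: "integrable M G"
    and tail: "\<And>k B. B \<in> sets borel \<Longrightarrow> (LINT \<omega>|M. indicator B (Y k \<omega>) * \<bar>Y k \<omega>\<bar>) \<le> (LINT \<omega>|M. indicator B (Y k \<omega>) * \<bar>G \<omega>\<bar>)"
    and A [measurable]: "A \<in> sets M"
  shows "integrable M Y'"
    and "(\<lambda>k. LINT \<omega>|M. indicator A \<omega> * Y k \<omega>) \<longlonglongrightarrow> (LINT \<omega>|M. indicator A \<omega> * Y' \<omega>)"
proof -
  have Ym [measurable]: "Y k \<in> borel_measurable M" for k using Yk by auto
  have Gm [measurable]: "G \<in> borel_measurable M" using G by auto
  have iG: "integrable M (\<lambda>\<omega>. f \<omega> * \<bar>G \<omega>\<bar>)" if "f \<in> borel_measurable M" "\<And>\<omega>. \<bar>f \<omega>\<bar> \<le> 1" for f :: "'a \<Rightarrow> real"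
    by (rule Bochner_Integration.integrable_bound[OF G]) (use that in \<open>auto simp: abs_mult intro!: AE_I2 mult_left_le_one_le\<close>)
  show iY: "integrable M Y'"
  proof (rule integrableI_bounded)
    have "(\<integral>\<^sup>+\<omega>. ennreal (norm (Y' \<omega>)) \<partial>M) = (\<integral>\<^sup>+\<omega>. liminf (\<lambda>k. ennreal (norm (Y k \<omega>))) \<partial>M)"
    proof (rule nn_integral_cong_AE)
      show "AE \<omega> in M. ennreal (norm (Y' \<omega>)) = liminf (\<lambda>k. ennreal (norm (Y k \<omega>)))"
        using lim
      proof eventually_elim
        case (elim \<omega>)
        then have "(\<lambda>k. ennreal (norm (Y k \<omega>))) \<longlonglongrightarrow> ennreal (norm (Y' \<omega>))"
          by (intro tendsto_intros)
        then show ?case by (metis lim_imp_Liminf trivial_limit_sequentially)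
      qed
    qed
    also have "\<dots> \<le> liminf (\<lambda>k. \<integral>\<^sup>+\<omega>. ennreal (norm (Y k \<omega>)) \<partial>M)"
      by (rule nn_integral_liminf) auto
    also have "\<dots> \<le> ennreal (LINT \<omega>|M. \<bar>G \<omega>\<bar>)"
    proof -
      have "(\<integral>\<^sup>+\<omega>. ennreal (norm (Y k \<omega>)) \<partial>M) \<le> ennreal (LINT \<omega>|M. \<bar>G \<omega>\<bar>)" for k
      proof -
        have "(\<integral>\<^sup>+\<omega>. ennreal (norm (Y k \<omega>)) \<partial>M) = ennreal (LINT \<omega>|M. \<bar>Y k \<omega>\<bar>)"
          using Yk[of k] by (subst nn_integral_eq_integral) auto
        also have "\<dots> \<le> ennreal (LINT \<omega>|M. \<bar>G \<omega>\<bar>)"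
          using tail[of UNIV k] by (intro ennreal_leI) simp
        finally show ?thesis .
      qed
      then show ?thesis by (intro Liminf_le) (auto intro: always_eventually)
    qed
    finally show "(\<integral>\<^sup>+\<omega>. ennreal (norm (Y' \<omega>)) \<partial>M) < \<infinity>" by (rule le_less_trans) simp
  qed simp
  (* a continuous majorant of the indicator of the tail {c < |x|}, and the truncation at level c *)
  define \<phi> where "\<phi> c x = min 1 (max 0 (\<bar>x\<bar> - c + 1))" for c x :: real
  define \<tau> where "\<tau> c x = max (- c) (min c x)" for c x :: real
  have [measurable]: "\<phi> c \<in> borel_measurable borel" "\<tau> c \<in> borel_measurable borel" for c
    unfolding \<phi>_def \<tau>_def by measurable
  have \<phi>1: "0 \<le> \<phi> c x" "\<phi> c x \<le> 1" for c x by (auto simp: \<phi>_def)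
  have \<tau>b: "\<bar>\<tau> c x\<bar> \<le> c" if "0 \<le> c" for c x using that by (auto simp: \<tau>_def)
  have \<tau>x: "\<bar>\<tau> c x\<bar> \<le> \<bar>x\<bar>" if "0 \<le> c" for c x using that by (auto simp: \<tau>_def)
  have \<tau>d: "\<bar>x - \<tau> c x\<bar> \<le> indicator {y. c < \<bar>y\<bar>} x * \<bar>x\<bar>" if "0 \<le> c" for c x
    using that by (auto simp: \<tau>_def indicator_def)
  have \<tau>i: "integrable M (\<lambda>\<omega>. \<tau> c (Z \<omega>))" if "0 \<le> c" "Z \<in> borel_measurable M" for c Z
    using that \<tau>b by (intro integrable_const_bound[of _ c]) auto
  have l1: "(\<lambda>n. LINT \<omega>|M. \<phi> (real n) (Y' \<omega>) * \<bar>G \<omega>\<bar>) \<longlonglongrightarrow> (LINT \<omega>|M. 0)"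
  proof (rule integral_dominated_convergence[where w="\<lambda>\<omega>. \<bar>G \<omega>\<bar>"])
    show "AE x in M. (\<lambda>n. \<phi> (real n) (Y' x) * \<bar>G x\<bar>) \<longlonglongrightarrow> 0"
    proof (rule AE_I2, rule tendsto_eventually)
      fix x
      obtain n0 where "\<bar>Y' x\<bar> + 1 < real n0" using reals_Archimedean2 by blast
      then show "\<forall>\<^sub>F n in sequentially. \<phi> (real n) (Y' x) * \<bar>G x\<bar> = 0"
        by (auto simp: \<phi>_def eventually_sequentially intro!: exI[of _ n0])
    qed
    show "AE x in M. norm (\<phi> (real n) (Y' x) * \<bar>G x\<bar>) \<le> \<bar>G x\<bar>" for n
      using \<phi>1 by (auto simp: abs_mult intro!: AE_I2 mult_left_le_one_le)
  qed (use G in auto)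
  have l2: "(\<lambda>n. LINT \<omega>|M. \<bar>Y' \<omega> - \<tau> (real n) (Y' \<omega>)\<bar>) \<longlonglongrightarrow> (LINT \<omega>|M. 0)"
  proof (rule integral_dominated_convergence[where w="\<lambda>\<omega>. 2 * \<bar>Y' \<omega>\<bar>"])
    show "AE x in M. (\<lambda>n. \<bar>Y' x - \<tau> (real n) (Y' x)\<bar>) \<longlonglongrightarrow> 0"
    proof (rule AE_I2, rule tendsto_eventually)
      fix x
      obtain n0 where "\<bar>Y' x\<bar> < real n0" using reals_Archimedean2 by blast
      then show "\<forall>\<^sub>F n in sequentially. \<bar>Y' x - \<tau> (real n) (Y' x)\<bar> = 0"
        by (auto simp: \<tau>_def eventually_sequentially intro!: exI[of _ n0])
    qed
    show "AE x in M. norm \<bar>Y' x - \<tau> (real n) (Y' x)\<bar> \<le> 2 * \<bar>Y' x\<bar>" for n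
      using \<tau>x[of "real n"] by (auto intro!: AE_I2) (smt (verit) of_nat_0_le_iff)
  qed (use iY in auto)
  show "(\<lambda>k. LINT \<omega>|M. indicator A \<omega> * Y k \<omega>) \<longlonglongrightarrow> (LINT \<omega>|M. indicator A \<omega> * Y' \<omega>)"
  proof (rule LIMSEQ_I)
    fix r :: real assume "0 < r"
    define e where "e = r / 4"
    have e: "0 < e" using \<open>0 < r\<close> by (simp add: e_def)
    obtain n where n: "(LINT \<omega>|M. \<phi> (real n) (Y' \<omega>) * \<bar>G \<omega>\<bar>) < e" "(LINT \<omega>|M. \<bar>Y' \<omega> - \<tau> (real n) (Y' \<omega>)\<bar>) < e"
    proof -
      have "\<forall>\<^sub>F n in sequentially. (LINT \<omega>|M. \<phi> (real n) (Y' \<omega>) * \<bar>G \<omega>\<bar>) < e"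
        by (rule order_tendstoD(2)[OF l1]) (use e in simp)
      moreover have "\<forall>\<^sub>F n in sequentially. (LINT \<omega>|M. \<bar>Y' \<omega> - \<tau> (real n) (Y' \<omega>)\<bar>) < e"
        by (rule order_tendstoD(2)[OF l2]) (use e in simp)
      ultimately have "\<forall>\<^sub>F n in sequentially. (LINT \<omega>|M. \<phi> (real n) (Y' \<omega>) * \<bar>G \<omega>\<bar>) < e \<and> (LINT \<omega>|M. \<bar>Y' \<omega> - \<tau> (real n) (Y' \<omega>)\<bar>) < e"
        by eventually_elim simp
      then show ?thesis using that by (auto simp: eventually_sequentially)
    qed
    define c where "c = real n"
    have c: "0 \<le> c" by (simp add: c_def)
    have l3: "(\<lambda>k. LINT \<omega>|M. \<phi> c (Y k \<omega>) * \<bar>G \<omega>\<bar>) \<longlonglongrightarrow> (LINT \<omega>|M. \<phi> c (Y' \<omega>) * \<bar>G \<omega>\<bar>)"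
    proof (rule integral_dominated_convergence[where w="\<lambda>\<omega>. \<bar>G \<omega>\<bar>"])
      show "AE x in M. (\<lambda>k. \<phi> c (Y k x) * \<bar>G x\<bar>) \<longlonglongrightarrow> \<phi> c (Y' x) * \<bar>G x\<bar>"
        using lim unfolding \<phi>_def by eventually_elim (intro tendsto_intros)
      show "AE x in M. norm (\<phi> c (Y k x) * \<bar>G x\<bar>) \<le> \<bar>G x\<bar>" for k
        using \<phi>1 by (auto simp: abs_mult intro!: AE_I2 mult_left_le_one_le)
    qed (use G in auto)
    have l4: "(\<lambda>k. LINT \<omega>|M. indicator A \<omega> * \<tau> c (Y k \<omega>)) \<longlonglongrightarrow> (LINT \<omega>|M. indicator A \<omega> * \<tau> c (Y' \<omega>))"
    proof (rule integral_dominated_convergence[where w="\<lambda>\<omega>. c"])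
      show "AE x in M. (\<lambda>k. indicator A x * \<tau> c (Y k x)) \<longlonglongrightarrow> indicator A x * \<tau> c (Y' x)"
        using lim unfolding \<tau>_def by eventually_elim (intro tendsto_intros)
      show "AE x in M. norm (indicator A x * \<tau> c (Y k x)) \<le> c" for k
        using \<tau>b[OF c] c by (auto intro!: AE_I2 simp: indicator_def)
    qed auto
    have "\<forall>\<^sub>F k in sequentially. (LINT \<omega>|M. \<phi> c (Y k \<omega>) * \<bar>G \<omega>\<bar>) < e"
      using order_tendstoD(2)[OF l3] n(1) by (simp add: c_def)
    moreover have "\<forall>\<^sub>F k in sequentially. dist (LINT \<omega>|M. indicator A \<omega> * \<tau> c (Y k \<omega>)) (LINT \<omega>|M. indicator A \<omega> * \<tau> c (Y' \<omega>)) < e"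
      by (rule tendstoD[OF l4 e])
    ultimately have "\<forall>\<^sub>F k in sequentially. norm ((LINT \<omega>|M. indicator A \<omega> * Y k \<omega>) - (LINT \<omega>|M. indicator A \<omega> * Y' \<omega>)) < r"
    proof eventually_elim
      case (elim k)
      have iA: "integrable M (\<lambda>\<omega>. indicator A \<omega> * Z \<omega>)" if "integrable M Z" for Z :: "'a \<Rightarrow> real"
        using integrable_mult_indicator[OF A that] by simp
      have d: "\<bar>(LINT \<omega>|M. indicator A \<omega> * Z \<omega>) - (LINT \<omega>|M. indicator A \<omega> * \<tau> c (Z \<omega>))\<bar> \<le> (LINT \<omega>|M. \<bar>Z \<omega> - \<tau> c (Z \<omega>)\<bar>)"
        if Z: "integrable M Z" for Z
      proof -
        have Zt: "integrable M (\<lambda>\<omega>. \<tau> c (Z \<omega>))" using Z c by (intro \<tau>i) auto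
        have "(LINT \<omega>|M. indicator A \<omega> * Z \<omega>) - (LINT \<omega>|M. indicator A \<omega> * \<tau> c (Z \<omega>)) = (LINT \<omega>|M. indicator A \<omega> * Z \<omega> - indicator A \<omega> * \<tau> c (Z \<omega>))"
          by (rule Bochner_Integration.integral_diff[symmetric]) (intro iA Z Zt)+
        also have "\<bar>\<dots>\<bar> \<le> (LINT \<omega>|M. \<bar>indicator A \<omega> * Z \<omega> - indicator A \<omega> * \<tau> c (Z \<omega>)\<bar>)"
          by (rule integral_abs_bound)
        also have "\<dots> \<le> (LINT \<omega>|M. \<bar>Z \<omega> - \<tau> c (Z \<omega>)\<bar>)"
          using Z Zt iA[OF Z] iA[OF Zt] by (intro integral_mono) (auto simp: indicator_def)
        finally show ?thesis .
      qed
      have "(LINT \<omega>|M. \<bar>Y k \<omega> - \<tau> c (Y k \<omega>)\<bar>) \<le> (LINT \<omega>|M. indicator {y. c < \<bar>y\<bar>} (Y k \<omega>) * \<bar>Y k \<omega>\<bar>)"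
        using Yk[of k] \<tau>i[OF c Ym[of k]] \<tau>d[OF c]
        by (intro integral_mono) (auto intro!: integrable_real_mult_indicator Bochner_Integration.integrable_bound[OF Yk[of k]] simp: indicator_def)
      also have "\<dots> \<le> (LINT \<omega>|M. indicator {y. c < \<bar>y\<bar>} (Y k \<omega>) * \<bar>G \<omega>\<bar>)"
        by (rule tail) measurable
      also have "\<dots> \<le> (LINT \<omega>|M. \<phi> c (Y k \<omega>) * \<bar>G \<omega>\<bar>)"
        using \<phi>1 by (intro integral_mono iG mult_right_mono) (auto simp: indicator_def \<phi>_def)
      finally have "(LINT \<omega>|M. \<bar>Y k \<omega> - \<tau> c (Y k \<omega>)\<bar>) < e" using elim by simp
      then show ?case
        using d[OF Yk[of k]] d[OF iY] n(2) elim(2) unfolding c_def[symmetric] dist_real_def real_norm_def e_def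
        by linarith
    qed
    then show "\<exists>no. \<forall>k\<ge>no. norm ((LINT \<omega>|M. indicator A \<omega> * Y k \<omega>) - (LINT \<omega>|M. indicator A \<omega> * Y' \<omega>)) < r"
      by (auto simp: eventually_sequentially)
  qed
qed

lemma (in complete_measure) borel_measurable_AE_limit:
  fixes Y :: "nat \<Rightarrow> 'a \<Rightarrow> real"
  assumes [measurable]: "\<And>k. Y k \<in> borel_measurable M" and lim: "AE \<omega> in M. (\<lambda>k. Y k \<omega>) \<longlonglongrightarrow> Z \<omega>"
  shows "Z \<in> borel_measurable M"
proof (rule measurableI)
  fix B :: "real set" assume [measurable]: "B \<in> sets borel"
  define L where "L \<omega> = lim (\<lambda>k. Y k \<omega>)" for \<omega>
  have [measurable]: "L \<in> borel_measurable M" unfolding L_def by measurable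
  have 1: "L -` B \<inter> space M \<in> sets M" by measurable
  have "AE \<omega> in M. L \<omega> = Z \<omega>" using lim by eventually_elim (simp add: L_def limI)
  then have "AE \<omega> in M. \<omega> \<in> L -` B \<inter> space M \<longleftrightarrow> \<omega> \<in> Z -` B \<inter> space M"
    using AE_space by eventually_elim auto
  from in_sets_AE[OF this 1] show "Z -` B \<inter> space M \<in> sets M" by simp
qed simp

context usual_filtered_prob_space
begin

lemma sigma_finite_subalgebra_F: "sigma_finite_subalgebra P (F t)"
  by (rule finite_measure_subalgebra_is_sigma_finite)
     (simp add: finite_measure_subalgebra_def finite_measure_subalgebra_axioms_def subalgebra_F finite_measure_axioms)

lemma martingale_set_integral:
  assumes X: "martingale P F X" and st: "0 \<le> s" "s \<le> t" and A: "A \<in> sets (F (ennreal s))"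
  shows "(LINT \<omega>|P. indicator A \<omega> * X t \<omega>) = (LINT \<omega>|P. indicator A \<omega> * X s \<omega>)"
proof -
  have int: "integrable P (X t)" "integrable P (X s)" using X st unfolding martingale_def by auto
  have ae: "AE \<omega> in P. real_cond_exp P (F (ennreal s)) (X t) \<omega> = X s \<omega>"
    using X st unfolding martingale_def by blast
  have AP: "A \<in> sets P" using A by (rule sets_F_P)
  have "(LINT \<omega>:A|P. X t \<omega>) = (LINT \<omega>:A|P. real_cond_exp P (F (ennreal s)) (X t) \<omega>)"
    by (rule sigma_finite_subalgebra.real_cond_exp_intA[OF sigma_finite_subalgebra_F int(1) A])
  also have "\<dots> = (LINT \<omega>:A|P. X s \<omega>)"
    unfolding set_lebesgue_integral_def
  proof (rule integral_cong_AE)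
    have "real_cond_exp P (F (ennreal s)) (X t) \<in> borel_measurable P" by simp
    then show "(\<lambda>x. indicat_real A x *\<^sub>R real_cond_exp P (F (ennreal s)) (X t) x) \<in> borel_measurable P"
      using AP by measurable
    show "(\<lambda>x. indicat_real A x *\<^sub>R X s x) \<in> borel_measurable P"
      using AP int(2) by measurable
    show "AE x in P. indicat_real A x *\<^sub>R real_cond_exp P (F (ennreal s)) (X t) x = indicat_real A x *\<^sub>R X s x"
      using ae by eventually_elim simp
  qed
  finally show ?thesis by (simp add: set_lebesgue_integral_def)
qed

lemma martingale_abs_set_integral:
  assumes X: "martingale P F X" and st: "0 \<le> s" "s \<le> t" and B: "B \<in> sets (F (ennreal s))"
  shows "(LINT \<omega>|P. indicator B \<omega> * \<bar>X s \<omega>\<bar>) \<le> (LINT \<omega>|P. indicator B \<omega> * \<bar>X t \<omega>\<bar>)"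
proof -
  have int: "integrable P (X t)" "integrable P (X s)" using X st unfolding martingale_def by auto
  have Xs: "X s \<in> borel_measurable (F (ennreal s))" using X st unfolding martingale_def adapted_def by auto
  define Bp where "Bp = B \<inter> {\<omega> \<in> space (F (ennreal s)). 0 \<le> X s \<omega>}"
  define Bn where "Bn = B \<inter> {\<omega> \<in> space (F (ennreal s)). X s \<omega> < 0}"
  have [measurable]: "Bp \<in> sets (F (ennreal s))" "Bn \<in> sets (F (ennreal s))"
    unfolding Bp_def Bn_def using B Xs by measurable
  then have P: "Bp \<in> sets P" "Bn \<in> sets P" "B \<in> sets P" using sets_F_P B by blast+
  have i: "integrable P (\<lambda>\<omega>. indicator A \<omega> * Z \<omega>)" if "A \<in> sets P" "integrable P Z" for A and Z :: "'a \<Rightarrow> real"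
    using integrable_mult_indicator[OF that] by simp
  have "(LINT \<omega>|P. indicator B \<omega> * \<bar>X s \<omega>\<bar>) = (LINT \<omega>|P. indicator Bp \<omega> * X s \<omega> - indicator Bn \<omega> * X s \<omega>)"
    by (intro Bochner_Integration.integral_cong refl) (auto simp: Bp_def Bn_def space_F indicator_def)
  also have "\<dots> = (LINT \<omega>|P. indicator Bp \<omega> * X s \<omega>) - (LINT \<omega>|P. indicator Bn \<omega> * X s \<omega>)"
    by (intro Bochner_Integration.integral_diff i P int)
  also have "\<dots> = (LINT \<omega>|P. indicator Bp \<omega> * X t \<omega>) - (LINT \<omega>|P. indicator Bn \<omega> * X t \<omega>)"
    using martingale_set_integral[OF X st, of Bp] martingale_set_integral[OF X st, of Bn] by simp
  also have "\<dots> = (LINT \<omega>|P. indicator Bp \<omega> * X t \<omega> - indicator Bn \<omega> * X t \<omega>)"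
    by (intro Bochner_Integration.integral_diff[symmetric] i P int)
  also have "\<dots> \<le> (LINT \<omega>|P. indicator B \<omega> * \<bar>X t \<omega>\<bar>)"
    using int by (intro integral_mono Bochner_Integration.integrable_diff i P integrable_abs)
      (auto simp: Bp_def Bn_def space_F indicator_def)
  finally show ?thesis .
qed

text \<open>Optional stopping for a stopping time \<open>p \<circ> idx\<close> with finitely many values in \<open>{s..t}\<close>; the last claim
  gives the uniform integrability needed to pass to general stopping times.\<close>

lemma discrete_stopping:
  fixes p :: "nat \<Rightarrow> real" and idx :: "'a \<Rightarrow> nat"
  assumes X: "martingale P F X" and s: "0 \<le> s"
    and p: "\<And>j. j \<le> m \<Longrightarrow> s \<le> p j \<and> p j \<le> t"
    and idx: "\<And>\<omega>. \<omega> \<in> space P \<Longrightarrow> idx \<omega> \<le> m"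
    and E: "\<And>j. j \<le> m \<Longrightarrow> {\<omega> \<in> space P. idx \<omega> = j} \<in> sets (F (ennreal (p j)))"
  shows "integrable P (\<lambda>\<omega>. X (p (idx \<omega>)) \<omega>)"
    and "A \<in> sets (F (ennreal s)) \<Longrightarrow> (LINT \<omega>|P. indicator A \<omega> * X (p (idx \<omega>)) \<omega>) = (LINT \<omega>|P. indicator A \<omega> * X t \<omega>)"
    and "B \<in> sets borel \<Longrightarrow> (LINT \<omega>|P. indicator B (X (p (idx \<omega>)) \<omega>) * \<bar>X (p (idx \<omega>)) \<omega>\<bar>)
       \<le> (LINT \<omega>|P. indicator B (X (p (idx \<omega>)) \<omega>) * \<bar>X t \<omega>\<bar>)"
proof -
  define E' where "E' j = {\<omega> \<in> space P. idx \<omega> = j}" for j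
  have EF: "E' j \<in> sets (F (ennreal (p j)))" if "j \<le> m" for j using E[OF that] by (simp add: E'_def)
  have EP: "E' j \<in> sets P" if "j \<le> m" for j using EF[OF that] by (rule sets_F_P)
  have st: "s \<le> t" using p[of 0] by auto
  have int: "integrable P (X r)" if "0 \<le> r" for r using X that unfolding martingale_def by auto
  have Xm: "X r \<in> borel_measurable (F (ennreal r))" if "0 \<le> r" for r using X that unfolding martingale_def adapted_def by auto
  have p0: "0 \<le> p j" if "j \<le> m" for j using p[OF that] s by simp
  have i: "integrable P (\<lambda>\<omega>. indicator A \<omega> * Z \<omega>)" if "A \<in> sets P" "integrable P Z" for A and Z :: "'a \<Rightarrow> real"
    using integrable_mult_indicator[OF that] by simp
  have dec: "f (idx \<omega>) \<omega> = (\<Sum>j\<le>m. indicator (E' j) \<omega> * f j \<omega>)" if "\<omega> \<in> space P" for f :: "nat \<Rightarrow> 'a \<Rightarrow> real" and \<omega>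
  proof -
    have "(\<Sum>j\<le>m. indicator (E' j) \<omega> * f j \<omega>) = (\<Sum>j\<le>m. if j = idx \<omega> then f j \<omega> else 0)"
      using that by (intro sum.cong) (auto simp: E'_def)
    then show ?thesis using idx[OF that] by simp
  qed
  have ie: "integrable P (\<lambda>\<omega>. \<Sum>j\<le>m. indicator (E' j) \<omega> * X (p j) \<omega>)"
    by (intro Bochner_Integration.integrable_sum i EP int p0) auto
  show "integrable P (\<lambda>\<omega>. X (p (idx \<omega>)) \<omega>)"
    by (rule Bochner_Integration.integrable_cong[THEN iffD1, OF refl _ ie]) (rule dec[symmetric, of _ "\<lambda>j. X (p j)"])
  {
    assume A: "A \<in> sets (F (ennreal s))"
    have AE: "A \<inter> E' j \<in> sets (F (ennreal (p j)))" if "j \<le> m" for j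
      using EF[OF that] A p[OF that] by (auto intro!: sets.Int intro: sets_F_mono' ennreal_leI)
    have AEP: "A \<inter> E' j \<in> sets P" if "j \<le> m" for j using AE[OF that] by (rule sets_F_P)
    have "(LINT \<omega>|P. indicator A \<omega> * X (p (idx \<omega>)) \<omega>) = (LINT \<omega>|P. (\<Sum>j\<le>m. indicator (A \<inter> E' j) \<omega> * X (p j) \<omega>))"
      using dec[of _ "\<lambda>j. X (p j)"]
      by (intro Bochner_Integration.integral_cong refl) (simp add: sum_distrib_left indicator_inter_arith ac_simps)
    also have "\<dots> = (\<Sum>j\<le>m. LINT \<omega>|P. indicator (A \<inter> E' j) \<omega> * X (p j) \<omega>)"
      by (intro Bochner_Integration.integral_sum i AEP int p0) auto
    also have "\<dots> = (\<Sum>j\<le>m. LINT \<omega>|P. indicator (A \<inter> E' j) \<omega> * X t \<omega>)"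
      using martingale_set_integral[OF X p0 _ AE, symmetric] p by (intro sum.cong) auto
    also have "\<dots> = (LINT \<omega>|P. (\<Sum>j\<le>m. indicator (A \<inter> E' j) \<omega> * X t \<omega>))"
      using s st by (intro Bochner_Integration.integral_sum[symmetric] i AEP int) auto
    also have "\<dots> = (LINT \<omega>|P. indicator A \<omega> * X t \<omega>)"
    proof (intro Bochner_Integration.integral_cong refl)
      fix \<omega> assume "\<omega> \<in> space P"
      then have "X t \<omega> = (\<Sum>j\<le>m. indicator (E' j) \<omega> * X t \<omega>)" by (rule dec[of _ "\<lambda>j. X t"])
      then have "indicator A \<omega> * X t \<omega> = indicator A \<omega> * (\<Sum>j\<le>m. indicator (E' j) \<omega> * X t \<omega>)" by (rule arg_cong)
      then show "(\<Sum>j\<le>m. indicator (A \<inter> E' j) \<omega> * X t \<omega>) = indicator A \<omega> * X t \<omega>"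
        by (simp only: sum_distrib_left indicator_inter_arith mult.assoc)
    qed
    finally show "(LINT \<omega>|P. indicator A \<omega> * X (p (idx \<omega>)) \<omega>) = (LINT \<omega>|P. indicator A \<omega> * X t \<omega>)" .
  }
  {
    assume B: "B \<in> sets borel"
    define C where "C j = E' j \<inter> (X (p j) -` B \<inter> space P)" for j
    have CF: "C j \<in> sets (F (ennreal (p j)))" if "j \<le> m" for j
      using EF[OF that] measurable_sets[OF Xm[OF p0[OF that]] B] by (auto simp: C_def space_F)
    have CP: "C j \<in> sets P" if "j \<le> m" for j using CF[OF that] by (rule sets_F_P)
    have "(LINT \<omega>|P. indicator B (X (p (idx \<omega>)) \<omega>) * \<bar>X (p (idx \<omega>)) \<omega>\<bar>) = (LINT \<omega>|P. (\<Sum>j\<le>m. indicator (C j) \<omega> * \<bar>X (p j) \<omega>\<bar>))"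
      using dec[of _ "\<lambda>j \<omega>. indicator B (X (p j) \<omega>) * \<bar>X (p j) \<omega>\<bar>"]
      by (intro Bochner_Integration.integral_cong refl) (auto intro!: sum.cong simp: C_def indicator_def)
    also have "\<dots> = (\<Sum>j\<le>m. LINT \<omega>|P. indicator (C j) \<omega> * \<bar>X (p j) \<omega>\<bar>)"
      by (intro Bochner_Integration.integral_sum i CP integrable_abs int p0) auto
    also have "\<dots> \<le> (\<Sum>j\<le>m. LINT \<omega>|P. indicator (C j) \<omega> * \<bar>X t \<omega>\<bar>)"
      using martingale_abs_set_integral[OF X p0 _ CF] p by (intro sum_mono) auto
    also have "\<dots> = (LINT \<omega>|P. (\<Sum>j\<le>m. indicator (C j) \<omega> * \<bar>X t \<omega>\<bar>))"
      using s st by (intro Bochner_Integration.integral_sum[symmetric] i CP integrable_abs int) auto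
    also have "\<dots> = (LINT \<omega>|P. indicator B (X (p (idx \<omega>)) \<omega>) * \<bar>X t \<omega>\<bar>)"
    proof (intro Bochner_Integration.integral_cong refl)
      fix \<omega> assume \<omega>: "\<omega> \<in> space P"
      have "(\<Sum>j\<le>m. indicator (C j) \<omega> * \<bar>X t \<omega>\<bar>) = (\<Sum>j\<le>m. indicator (E' j) \<omega> * (indicator B (X (p j) \<omega>) * \<bar>X t \<omega>\<bar>))"
        using \<omega> by (intro sum.cong) (auto simp: C_def indicator_def)
      also have "\<dots> = indicator B (X (p (idx \<omega>)) \<omega>) * \<bar>X t \<omega>\<bar>"
        by (rule dec[OF \<omega>, of "\<lambda>j \<omega>. indicator B (X (p j) \<omega>) * \<bar>X t \<omega>\<bar>", symmetric])
      finally show "(\<Sum>j\<le>m. indicator (C j) \<omega> * \<bar>X t \<omega>\<bar>) = indicator B (X (p (idx \<omega>)) \<omega>) * \<bar>X t \<omega>\<bar>" .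
    qed
    finally show "(LINT \<omega>|P. indicator B (X (p (idx \<omega>)) \<omega>) * \<bar>X (p (idx \<omega>)) \<omega>\<bar>)
       \<le> (LINT \<omega>|P. indicator B (X (p (idx \<omega>)) \<omega>) * \<bar>X t \<omega>\<bar>)" .
  }
qed

text \<open>Optional stopping at \<open>min t S\<close>, seen from time \<open>s\<close>.\<close>

lemma optional_stopping:
  assumes X: "martingale P F X" and rc: "AE \<omega> in P. \<forall>r\<ge>0. ((\<lambda>r. X r \<omega>) \<longlongrightarrow> X r \<omega>) (at_right r)"
    and S: "stopping_time F S" and st: "0 \<le> s" "s < t" and A: "A \<in> sets (F (ennreal s))"
  defines "\<sigma> \<equiv> (\<lambda>\<omega>. max s (enn2real (min (ennreal t) (S \<omega>))))"
  shows "integrable P (\<lambda>\<omega>. X (\<sigma> \<omega>) \<omega>)"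
    and "(LINT \<omega>|P. indicator A \<omega> * X (\<sigma> \<omega>) \<omega>) = (LINT \<omega>|P. indicator A \<omega> * X s \<omega>)"
proof -
  have \<sigma>: "s \<le> \<sigma> \<omega>" "\<sigma> \<omega> \<le> t" for \<omega>
    using st by (auto simp: \<sigma>_def intro!: enn2real_leI)
  have \<sigma>_le: "{\<omega> \<in> space P. \<sigma> \<omega> \<le> q} \<in> sets (F (ennreal q))" if "s \<le> q" for q
  proof (cases "t \<le> q")
    case True
    then have "{\<omega> \<in> space P. \<sigma> \<omega> \<le> q} = space (F (ennreal q))" using \<sigma>(2) by (auto simp: space_F intro: order.trans)
    then show ?thesis by simp
  next
    case False
    have "\<sigma> \<omega> \<le> q \<longleftrightarrow> S \<omega> \<le> ennreal q" for \<omega>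
      using False that st by (cases "S \<omega>") (auto simp: \<sigma>_def min_def ennreal_le_iff top_unique)
    then show ?thesis using stopping_timeD[OF S, of "ennreal q"] by (simp add: pred_def space_F)
  qed
  (* p k (idx k w) is the first point of the grid with mesh (t - s) / (k + 1) that is not before \<sigma> w *)
  define p where "p k j = s + (t - s) * real j / real (Suc k)" for k j :: nat
  define idx where "idx k \<omega> = nat \<lceil>(\<sigma> \<omega> - s) * real (Suc k) / (t - s)\<rceil>" for k :: nat and \<omega>
  have idx_iff: "idx k \<omega> \<le> j \<longleftrightarrow> \<sigma> \<omega> \<le> p k j" for k j \<omega>
  proof -
    have "idx k \<omega> \<le> j \<longleftrightarrow> (\<sigma> \<omega> - s) * real (Suc k) / (t - s) \<le> real j"
      unfolding idx_def by (simp add: nat_le_iff ceiling_le_iff)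
    also have "\<dots> \<longleftrightarrow> \<sigma> \<omega> \<le> p k j"
      using st unfolding p_def by (simp add: divide_le_eq le_divide_eq field_simps del: of_nat_Suc)
    finally show ?thesis .
  qed
  have p_bd: "s \<le> p k j" "j \<le> Suc k \<Longrightarrow> p k j \<le> t" for k j
  proof -
    show "s \<le> p k j" using st by (simp add: p_def)
    assume "j \<le> Suc k"
    then have "(t - s) * real j / real (Suc k) \<le> (t - s) * 1"
      using st unfolding times_divide_eq_right[symmetric] by (intro mult_left_mono) auto
    then show "p k j \<le> t" by (simp add: p_def)
  qed
  have pm: "p k j \<le> p k (Suc j)" "p k (Suc j) = p k j + (t - s) / real (Suc k)" for k j
  proof -
    have "(t - s) * real (Suc j) / K = (t - s) * real j / K + (t - s) / K" for K :: real
      by (simp add: distrib_left add_divide_distrib del: left_diff_distrib_numeral)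
    then show "p k (Suc j) = p k j + (t - s) / real (Suc k)" unfolding p_def by (simp only:)
    then show "p k j \<le> p k (Suc j)" using st by simp
  qed
  have idx_le: "idx k \<omega> \<le> Suc k" for k \<omega>
    unfolding idx_iff using \<sigma>(2)[of \<omega>] st by (simp add: p_def)
  have E: "{\<omega> \<in> space P. idx k \<omega> = j} \<in> sets (F (ennreal (p k j)))" for k j
  proof (cases j)
    case 0
    then have "{\<omega> \<in> space P. idx k \<omega> = j} = {\<omega> \<in> space P. \<sigma> \<omega> \<le> p k j}"
      using idx_iff[of k _ 0] by auto
    then show ?thesis using \<sigma>_le p_bd by simp
  next
    case (Suc i)
    have "{\<omega> \<in> space P. idx k \<omega> = j} = {\<omega> \<in> space P. \<sigma> \<omega> \<le> p k j} - {\<omega> \<in> space P. \<sigma> \<omega> \<le> p k i}"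
      using idx_iff[of k _ j] idx_iff[of k _ i] Suc by (auto simp: idx_iff[symmetric])
    moreover have "{\<omega> \<in> space P. \<sigma> \<omega> \<le> p k i} \<in> sets (F (ennreal (p k j)))"
      using sets_F_mono'[OF \<sigma>_le[OF p_bd(1)[of k i]]] pm(1)[of k i] Suc by (auto intro: ennreal_leI)
    ultimately show ?thesis using \<sigma>_le[OF p_bd(1)[of k j]] by auto
  qed
  define Y where "Y k \<omega> = X (p k (idx k \<omega>)) \<omega>" for k \<omega>
  have near: "\<sigma> \<omega> \<le> p k (idx k \<omega>)" "p k (idx k \<omega>) \<le> \<sigma> \<omega> + (t - s) / real (Suc k)" for k \<omega>
  proof -
    show "\<sigma> \<omega> \<le> p k (idx k \<omega>)" using idx_iff by blast
    show "p k (idx k \<omega>) \<le> \<sigma> \<omega> + (t - s) / real (Suc k)"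
    proof (cases "idx k \<omega>")
      case 0
      have "0 \<le> (t - s) / real (Suc k)" using st by simp
      then show ?thesis using \<sigma>(1)[of \<omega>] unfolding 0 p_def by simp
    next
      case (Suc i)
      then have "\<not> idx k \<omega> \<le> i" by simp
      then have "p k i < \<sigma> \<omega>" by (simp add: idx_iff)
      then show ?thesis unfolding Suc pm(2) by simp
    qed
  qed
  have lim: "AE \<omega> in P. (\<lambda>k. Y k \<omega>) \<longlonglongrightarrow> X (\<sigma> \<omega>) \<omega>"
    using rc
  proof eventually_elim
    case (elim \<omega>)
    then have "((\<lambda>r. X r \<omega>) \<longlongrightarrow> X (\<sigma> \<omega>) \<omega>) (at_right (\<sigma> \<omega>))" using \<sigma>(1)[of \<omega>] st by auto
    then have "((\<lambda>r. X r \<omega>) \<longlongrightarrow> X (\<sigma> \<omega>) \<omega>) (at (\<sigma> \<omega>) within {\<sigma> \<omega>..})"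
      by (simp add: at_within_Ici_at_right)
    then have c: "continuous (at (\<sigma> \<omega>) within {\<sigma> \<omega>..}) (\<lambda>r. X r \<omega>)" by (simp add: continuous_within)
    have "(\<lambda>k. p k (idx k \<omega>)) \<longlonglongrightarrow> \<sigma> \<omega>"
    proof (rule tendsto_sandwich)
      show "(\<lambda>k. \<sigma> \<omega>) \<longlonglongrightarrow> \<sigma> \<omega>" by simp
      have "(\<lambda>k. \<sigma> \<omega> + (t - s) * inverse (real (Suc k))) \<longlonglongrightarrow> \<sigma> \<omega> + (t - s) * 0"
        by (intro tendsto_intros LIMSEQ_inverse_real_of_nat)
      then show "(\<lambda>k. \<sigma> \<omega> + (t - s) / real (Suc k)) \<longlonglongrightarrow> \<sigma> \<omega>" by (simp add: divide_inverse)
    qed (use near in \<open>auto intro!: always_eventually\<close>)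
    then show ?case
      unfolding Y_def using near(1)
      by (intro continuous_within_tendsto_compose[OF c]) (auto intro!: always_eventually)
  qed
  have pbd: "s \<le> p k j \<and> p k j \<le> t" if "j \<le> Suc k" for k j using p_bd that by auto
  have Yi: "integrable P (Y k)" for k
    unfolding Y_def by (rule discrete_stopping(1)[OF X st(1), of "Suc k" "p k" t "idx k"]) (use pbd idx_le E in auto)
  have YA: "(LINT \<omega>|P. indicator A \<omega> * Y k \<omega>) = (LINT \<omega>|P. indicator A \<omega> * X t \<omega>)" for k
    unfolding Y_def by (rule discrete_stopping(2)[OF X st(1), of "Suc k" "p k" t "idx k"]) (use pbd idx_le E A in auto)
  have Yt: "(LINT \<omega>|P. indicator B (Y k \<omega>) * \<bar>Y k \<omega>\<bar>) \<le> (LINT \<omega>|P. indicator B (Y k \<omega>) * \<bar>X t \<omega>\<bar>)" if "B \<in> sets borel" for k B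
    unfolding Y_def by (rule discrete_stopping(3)[OF X st(1), of "Suc k" "p k" t "idx k"]) (use pbd idx_le E that in auto)
  have m: "(\<lambda>\<omega>. X (\<sigma> \<omega>) \<omega>) \<in> borel_measurable P"
    by (rule borel_measurable_AE_limit[OF _ lim]) (use Yi in auto)
  have Xt: "integrable P (X t)" using X st unfolding martingale_def by auto
  note ui = integral_limit_of_dominated_tails[OF Yi m lim Xt Yt sets_F_P[OF A]]
  show "integrable P (\<lambda>\<omega>. X (\<sigma> \<omega>) \<omega>)" by (rule ui(1))
  have "(LINT \<omega>|P. indicator A \<omega> * X (\<sigma> \<omega>) \<omega>) = (LINT \<omega>|P. indicator A \<omega> * X t \<omega>)"
    using ui(2) unfolding YA by (intro LIMSEQ_unique[OF _ tendsto_const]) (auto simp: LIMSEQ_const_iff)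
  also have "\<dots> = (LINT \<omega>|P. indicator A \<omega> * X s \<omega>)"
    by (rule martingale_set_integral[OF X _ _ A]) (use st in auto)
  finally show "(LINT \<omega>|P. indicator A \<omega> * X (\<sigma> \<omega>) \<omega>) = (LINT \<omega>|P. indicator A \<omega> * X s \<omega>)" .
qed

end

section \<open>The compensation formula\<close>

text \<open>A counting process \<open>N\<close> together with its intensity \<open>lam\<close>.\<close>

locale intensity_setup = usual_filtered_prob_space P F
  for P :: "'a measure" and F :: "ennreal \<Rightarrow> 'a measure" +
  fixes N lam :: "real \<Rightarrow> 'a \<Rightarrow> real^'d"
  assumes N: "counting_process P F N"
    and lam_nonneg: "nonneg_process P lam"
    and lam_predictable: "predictable P F lam"
    and lam_locally_bounded: "locally_bounded P F lam"
    and intensity: "has_intensity P F N lam"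
begin

text \<open>The jump times of the \<open>i\<close>-th coordinate.\<close>

definition J :: "'d \<Rightarrow> 'a \<Rightarrow> real set" where
  "J i \<omega> = jump_times (\<lambda>t. N t \<omega> $ i)"

lemma J_pos: "s \<in> J i \<omega> \<Longrightarrow> 0 < s"
  by (simp add: J_def jump_times_def)

lemma N_path:
  assumes "\<omega> \<in> space P"
  shows "cadlag (\<lambda>t. N t \<omega> $ i)" "piecewise_constant (\<lambda>t. N t \<omega> $ i)"
    "\<And>t. 0 < t \<Longrightarrow> jump (\<lambda>t. N t \<omega> $ i) t \<in> {0, 1}"
  using N assms unfolding counting_process_def by blast+

lemma finite_J: "\<omega> \<in> space P \<Longrightarrow> finite (J i \<omega> \<inter> {0<..t})"
  unfolding J_def by (rule finite_jump_times[OF N_path]) 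

lemma finite_J': "\<omega> \<in> space P \<Longrightarrow> 0 \<le> s \<Longrightarrow> finite (J i \<omega> \<inter> {s<..t})"
  by (rule finite_subset[OF _ finite_J[of \<omega> i t]]) auto

lemma N_increment: "\<omega> \<in> space P \<Longrightarrow> 0 \<le> s \<Longrightarrow> s \<le> t \<Longrightarrow> N t \<omega> $ i - N s \<omega> $ i = card (J i \<omega> \<inter> {s<..t})"
  unfolding J_def by (rule counting_path_increment[OF N_path])

lemma J_disjoint: "\<omega> \<in> space P \<Longrightarrow> i \<noteq> j \<Longrightarrow> J i \<omega> \<inter> J j \<omega> = {}"
proof -
  assume *: "\<omega> \<in> space P" "i \<noteq> j"
  then have "\<forall>t>0. jump (\<lambda>t. N t \<omega> $ i) t = 0 \<or> jump (\<lambda>t. N t \<omega> $ j) t = 0"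
    using N unfolding counting_process_def by blast
  then show ?thesis by (fastforce simp: J_def jump_times_def)
qed

lemma measurable_nth: "(\<lambda>x :: real^'d. x $ i) \<in> borel_measurable borel"
  by (intro borel_measurable_continuous_onI continuous_intros)

lemma N_adapted: "0 \<le> t \<Longrightarrow> (\<lambda>\<omega>. N t \<omega> $ i) \<in> borel_measurable (F (ennreal t))"
  using N unfolding counting_process_def adapted_def by (auto intro: measurable_compose[OF _ measurable_nth])

lemma predictable_nth: "predictable P F X \<Longrightarrow> (\<lambda>(s, \<omega>). X s \<omega> $ i) \<in> borel_measurable PS" for X :: "real \<Rightarrow> 'a \<Rightarrow> real^'d"
  unfolding predictable_def by (auto dest!: measurable_compose[OF _ measurable_nth[of i]] simp: case_prod_beta')

lemma lam_nn: "0 \<le> t \<Longrightarrow> \<omega> \<in> space P \<Longrightarrow> 0 \<le> lam t \<omega> $ i"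
  using lam_nonneg unfolding nonneg_process_def by blast

lemma lam_measurable: "(\<lambda>(s, \<omega>). lam s \<omega> $ i) \<in> borel_measurable PS"
  by (rule predictable_nth[OF lam_predictable])

lemma locally_bounded_paths:
  fixes X :: "real \<Rightarrow> 'a \<Rightarrow> real^'d"
  assumes "locally_bounded P F X"
  shows "AE \<omega> in P. \<forall>t. \<exists>C. \<forall>s\<in>{0..t}. norm (X s \<omega>) \<le> C"
proof -
  obtain T where T: "localizing P F T" "\<And>n. bounded ((\<lambda>(t, \<omega>). stopped_pos (T n) X t \<omega>) ` ({0..} \<times> space P))"
    using assms unfolding locally_bounded_def by blast
  have "AE \<omega> in P. (\<lambda>n. T n \<omega>) \<longlonglongrightarrow> \<infinity>" using T(1) unfolding localizing_def by auto
  then show ?thesis using AE_space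
  proof eventually_elim
    case (elim \<omega>)
    show ?case
    proof
      fix t
      have "\<forall>\<^sub>F n in sequentially. ennreal (max 0 t) < T n \<omega>"
        by (rule order_tendstoD(1)[OF elim(1)]) simp
      then obtain n where n: "ennreal (max 0 t) < T n \<omega>" by (auto simp: eventually_sequentially)
      obtain C where C: "\<And>s. 0 \<le> s \<Longrightarrow> norm (stopped_pos (T n) X s \<omega>) \<le> C"
        using T(2)[of n] elim(2) unfolding bounded_iff by force
      have "norm (X s \<omega>) \<le> C" if "s \<in> {0..t}" for s
      proof -
        have "ennreal s \<le> ennreal (max 0 t)" using that by (intro ennreal_leI) auto
        then have "ennreal s \<le> T n \<omega>" using n by (meson less_imp_le order_trans)
        moreover have "0 < T n \<omega>" using n by (rule le_less_trans[rotated]) simp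
        ultimately have "stopped_pos (T n) X s \<omega> = X s \<omega>"
          using that by (simp add: stopped_pos_def stopped_def min_absorb1)
        then show ?thesis using C[of s] that by simp
      qed
      then show "\<exists>C. \<forall>s\<in>{0..t}. norm (X s \<omega>) \<le> C" by blast
    qed
  qed
qed

lemma section_set_integrable:
  assumes K: "(\<lambda>(s, \<omega>). K s \<omega>) \<in> borel_measurable PS" and \<omega>: "\<omega> \<in> space P"
    and C: "\<And>s. s \<in> {0..t} \<Longrightarrow> \<bar>K s \<omega>\<bar> \<le> C" and u: "0 \<le> u"
  shows "set_integrable lborel {u..t} (\<lambda>s. K s \<omega> :: real)"
proof -
  have "set_integrable lborel {u..t} (\<lambda>s. if 0 \<le> s then K s \<omega> else 0)"
    by (rule bounded_set_integrable[OF predictable_section[OF K \<omega>], of u t C]) (use C u in auto)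
  then show ?thesis
    by (rule set_integrable_cong[THEN iffD1, rotated -1]) (use u in auto)
qed

text \<open>Sums over the jump times in \<open>{0<..t}\<close> are integrals against counting measure.\<close>

definition jump_sum :: "'d \<Rightarrow> real \<Rightarrow> (real \<times> 'a \<Rightarrow> ennreal) \<Rightarrow> 'a \<Rightarrow> ennreal" where
  "jump_sum i t K \<omega> = (\<integral>\<^sup>+s. K (s, \<omega>) \<partial>count_space (J i \<omega> \<inter> {0<..t}))"

lemma jump_sum_eq: "\<omega> \<in> space P \<Longrightarrow> jump_sum i t K \<omega> = (\<Sum>s\<in>J i \<omega> \<inter> {0<..t}. K (s, \<omega>))"
  unfolding jump_sum_def by (rule nn_integral_count_space_finite[OF finite_J])

lemma jump_sum_rectangle:
  assumes \<omega>: "\<omega> \<in> space P" and ab: "0 \<le> a" "a \<le> b"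
  shows "jump_sum i t (indicator ({a<..b} \<times> A)) \<omega> = (if a \<le> t then indicator A \<omega> * ennreal (N (min b t) \<omega> $ i - N a \<omega> $ i) else 0)"
proof -
  have "jump_sum i t (indicator ({a<..b} \<times> A)) \<omega> = indicator A \<omega> * of_nat (card (J i \<omega> \<inter> {0<..t} \<inter> {a<..b}))"
  proof -
    have "(\<Sum>s\<in>J i \<omega> \<inter> {0<..t}. indicator ({a<..b} \<times> A) (s, \<omega>) :: ennreal) = (\<Sum>s\<in>J i \<omega> \<inter> {0<..t}. if s \<in> {a<..b} then indicator A \<omega> else 0)"
      by (intro sum.cong) (auto simp: indicator_def)
    also have "\<dots> = (\<Sum>s\<in>J i \<omega> \<inter> {0<..t} \<inter> {a<..b}. indicator A \<omega>)"
      by (rule sum.inter_restrict[OF finite_J[OF \<omega>], symmetric])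
    finally show ?thesis by (simp add: jump_sum_eq[OF \<omega>] mult.commute)
  qed
  also have "\<dots> = (if a \<le> t then indicator A \<omega> * ennreal (N (min b t) \<omega> $ i - N a \<omega> $ i) else 0)"
  proof (cases "a \<le> t")
    case True
    have "J i \<omega> \<inter> {0<..t} \<inter> {a<..b} = J i \<omega> \<inter> {a<..min b t}" using ab by auto
    then show ?thesis using True N_increment[OF \<omega>, of a "min b t" i] ab by (simp add: ennreal_of_nat_eq_real_of_nat)
  next
    case False
    then have "J i \<omega> \<inter> {0<..t} \<inter> {a<..b} = {}" by auto
    then show ?thesis using False by simp
  qed
  finally show ?thesis .
qed

lemma jump_sum_add: "jump_sum i t (\<lambda>x. K x + K' x) \<omega> = jump_sum i t K \<omega> + jump_sum i t K' \<omega>"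
  unfolding jump_sum_def by (rule nn_integral_add) auto

lemma jump_sum_cmult: "jump_sum i t (\<lambda>x. c * K x) \<omega> = c * jump_sum i t K \<omega>"
  unfolding jump_sum_def by (rule nn_integral_cmult) auto

lemma jump_sum_suminf: "jump_sum i t (\<lambda>x. \<Sum>n. K n x) \<omega> = (\<Sum>n. jump_sum i t (K n) \<omega>)"
  unfolding jump_sum_def by (rule nn_integral_suminf) auto

lemma jump_sum_SUP: "(\<And>s. incseq (\<lambda>n. K n (s, \<omega>))) \<Longrightarrow> jump_sum i t (\<lambda>x. SUP n. K n x) \<omega> = (SUP n. jump_sum i t (K n) \<omega>)"
  unfolding jump_sum_def by (rule nn_integral_monotone_convergence_SUP) (auto simp: incseq_def le_fun_def)

lemma jump_sum_cong: "(\<And>s. s \<in> J i \<omega> \<Longrightarrow> 0 < s \<Longrightarrow> s \<le> t \<Longrightarrow> K (s, \<omega>) = K' (s, \<omega>)) \<Longrightarrow> jump_sum i t K \<omega> = jump_sum i t K' \<omega>"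
  unfolding jump_sum_def by (intro nn_integral_cong) auto

lemma jump_sum_all:
  assumes \<omega>: "\<omega> \<in> space P" and t: "0 \<le> t"
  shows "jump_sum i t (indicator ({0..} \<times> space P)) \<omega> = ennreal (N t \<omega> $ i - N 0 \<omega> $ i)"
proof -
  have "jump_sum i t (indicator ({0..} \<times> space P)) \<omega> = jump_sum i t (indicator ({0<..t} \<times> space P)) \<omega>"
    by (rule jump_sum_cong) (auto simp: indicator_def)
  then show ?thesis using jump_sum_rectangle[OF \<omega>, of 0 t i t "space P"] \<omega> t by simp
qed

lemma jump_sum_measurable:
  assumes K: "K \<in> borel_measurable PS" and t: "0 \<le> t"
  shows "jump_sum i t K \<in> borel_measurable (F (ennreal t))"
proof -
  have sets: "jump_sum i t (indicator C) \<in> borel_measurable (F (ennreal t))" if C: "C \<in> sets PS" for C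
    using Int_stable_predictable_rectangles predictable_rectangles_Pow C[unfolded sets_PS]
  proof (induction rule: sigma_sets_induct_disjoint)
    case (basic R)
    then consider A where "R = {0::real} \<times> A" "A \<in> sets (F 0)" | a b A where "R = {a<..b::real} \<times> A" "0 \<le> a" "a \<le> b" "A \<in> sets (F (ennreal a))"
      unfolding predictable_rectangles_def by blast
    then show ?case
    proof cases
      case 1
      have "jump_sum i t (indicator R) \<omega> = 0" if "\<omega> \<in> space P" for \<omega>
        using that J_pos[of _ i \<omega>] by (auto simp: jump_sum_eq 1 intro!: sum.neutral)
      then show ?thesis by (subst measurable_cong[of _ _ "\<lambda>_. 0"]) (auto simp: space_F)
    next
      case 2
      show ?thesis
      proof (cases "a \<le> t")
        case True
        have "A \<in> sets (F (ennreal t))" using 2 True by (auto intro: sets_F_mono' ennreal_leI)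
        moreover have "(\<lambda>\<omega>. N (min b t) \<omega> $ i) \<in> borel_measurable (F (ennreal t))" "(\<lambda>\<omega>. N a \<omega> $ i) \<in> borel_measurable (F (ennreal t))"
          using 2 True t by (auto intro!: measurable_F_mono[OF N_adapted] ennreal_leI)
        ultimately have "(\<lambda>\<omega>. indicator A \<omega> * ennreal (N (min b t) \<omega> $ i - N a \<omega> $ i)) \<in> borel_measurable (F (ennreal t))"
          by measurable
        then show ?thesis
          by (subst measurable_cong) (use True in \<open>auto simp: space_F 2(1) jump_sum_rectangle[OF _ 2(2,3)]\<close>)
      next
        case False
        then show ?thesis
          by (subst measurable_cong[of _ _ "\<lambda>_. 0"]) (auto simp: space_F 2(1) jump_sum_rectangle[OF _ 2(2,3)])
      qed
    qed
  next
    case empty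
    have eq: "jump_sum i t (indicator {}) = (\<lambda>_. 0)" by (auto simp: jump_sum_def)
    show ?case unfolding eq by simp
  next
    case (compl C)
    have eq: "jump_sum i t (indicator ({0..} \<times> space P - C)) \<omega> = ennreal (N t \<omega> $ i - N 0 \<omega> $ i) - jump_sum i t (indicator C) \<omega>"
      if \<omega>: "\<omega> \<in> space P" for \<omega>
    proof -
      have "jump_sum i t (indicator C) \<omega> + jump_sum i t (indicator ({0..} \<times> space P - C)) \<omega> = jump_sum i t (indicator ({0..} \<times> space P)) \<omega>"
        unfolding jump_sum_add[symmetric]
      proof (rule jump_sum_cong)
        fix s :: real assume "0 < s"
        then have "(s, \<omega>) \<in> {0..} \<times> space P" using \<omega> by simp
        then show "indicator C (s, \<omega>) + indicator ({0..} \<times> space P - C) (s, \<omega>) = (indicator ({0..} \<times> space P) (s, \<omega>) :: ennreal)"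
          by (auto simp: indicator_def)
      qed
      moreover have "jump_sum i t (indicator C) \<omega> \<noteq> \<infinity>"
        unfolding jump_sum_eq[OF \<omega>] by (auto simp: ennreal_sum_eq_top finite_J[OF \<omega>] indicator_def)
      ultimately show ?thesis
        using jump_sum_all[OF \<omega> t, of i] by (metis ennreal_add_diff_cancel_left infinity_ennreal_def)
    qed
    have "(\<lambda>\<omega>. N t \<omega> $ i) \<in> borel_measurable (F (ennreal t))" "(\<lambda>\<omega>. N 0 \<omega> $ i) \<in> borel_measurable (F (ennreal t))"
      using t by (auto intro!: measurable_F_mono[OF N_adapted])
    with compl.IH have "(\<lambda>\<omega>. ennreal (N t \<omega> $ i - N 0 \<omega> $ i) - jump_sum i t (indicator C) \<omega>) \<in> borel_measurable (F (ennreal t))"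
      by measurable
    then show ?case by (subst measurable_cong) (auto simp: space_F eq)
  next
    case (union C)
    have "jump_sum i t (indicator (\<Union>n. C n)) \<omega> = (\<Sum>n. jump_sum i t (indicator (C n)) \<omega>)" for \<omega>
      unfolding jump_sum_suminf[symmetric] by (rule jump_sum_cong) (simp add: suminf_indicator[OF union(1)])
    then show ?case using union by (simp cong: measurable_cong)
  qed
  show ?thesis
    using K
  proof (induction rule: borel_measurable_induct)
    case (cong f g)
    then have "jump_sum i t f \<omega> = jump_sum i t g \<omega>" if "\<omega> \<in> space P" for \<omega>
      using that by (intro jump_sum_cong) (auto simp: space_PS)
    then show ?case using cong(4) by (subst measurable_cong[symmetric]) (auto simp: space_F)
  next
    case (set A) then show ?case by (rule sets)
  next
    case (mult u c)
    then have "jump_sum i t (\<lambda>x. c * u x) = (\<lambda>\<omega>. c * jump_sum i t u \<omega>)" by (auto simp: jump_sum_cmult)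
    then show ?case using mult by simp
  next
    case (add u v)
    have "jump_sum i t (\<lambda>x. v x + u x) = (\<lambda>\<omega>. jump_sum i t v \<omega> + jump_sum i t u \<omega>)" by (auto simp: jump_sum_add)
    then show ?case using add by simp
  next
    case (seq U)
    have eq: "jump_sum i t (SUP n. U n) = (\<lambda>\<omega>. SUP n. jump_sum i t (U n) \<omega>)"
      using seq(3) by (auto simp: SUP_apply[abs_def] incseq_def le_fun_def intro!: jump_sum_SUP)
    have "(\<lambda>\<omega>. SUP n. jump_sum i t (U n) \<omega>) \<in> borel_measurable (F (ennreal t))"
      using seq.IH by measurable
    then have "jump_sum i t (SUP n. U n) \<in> borel_measurable (F (ennreal t))" unfolding eq .
    then show ?case using \<open>K = (SUP n. U n)\<close> by metis
  qed
qed

lemma enn2real_jump_sum: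
  assumes \<omega>: "\<omega> \<in> space P"
  shows "enn2real (jump_sum i t (\<lambda>x. ennreal (q (fst x) (snd x))) \<omega>) = (\<Sum>s\<in>J i \<omega> \<inter> {0<..t}. max 0 (q s \<omega>))"
proof -
  have "jump_sum i t (\<lambda>x. ennreal (q (fst x) (snd x))) \<omega> = (\<Sum>s\<in>J i \<omega> \<inter> {0<..t}. ennreal (max 0 (q s \<omega>)))"
    unfolding jump_sum_eq[OF \<omega>] by (intro sum.cong) (auto simp: max_def ennreal_neg)
  also have "\<dots> = ennreal (\<Sum>s\<in>J i \<omega> \<inter> {0<..t}. max 0 (q s \<omega>))" by (rule sum_ennreal) simp
  finally show ?thesis by (simp add: sum_nonneg)
qed


text \<open>The integral of a nonnegative predictable process against \<open>lam dt\<close>.\<close>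

definition lam_integral :: "'d \<Rightarrow> real \<Rightarrow> (real \<times> 'a \<Rightarrow> ennreal) \<Rightarrow> 'a \<Rightarrow> ennreal" where
  "lam_integral i t K \<omega> = (\<integral>\<^sup>+s\<in>{0..t}. (K (s, \<omega>) * ennreal (lam s \<omega> $ i)) \<partial>lborel)"

lemma lam_integral_measurable:
  assumes K: "K \<in> borel_measurable PS" and t: "0 \<le> t"
  shows "lam_integral i t K \<in> borel_measurable (F (ennreal t))"
proof -
  have "(\<lambda>(s, \<omega>). K (s, \<omega>) * ennreal (lam s \<omega> $ i)) \<in> borel_measurable PS"
    using K lam_measurable[of i] by (simp add: case_prod_beta') 
  from predictable_nn_integral_measurable[OF this t] show ?thesis
    unfolding lam_integral_def[abs_def] .
qed

lemma section_ennreal_measurable: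
  assumes K: "K \<in> borel_measurable PS" and \<omega>: "\<omega> \<in> space P"
  shows "(\<lambda>s. K (s, \<omega>) * ennreal (lam s \<omega> $ i) * indicator {0..t} s) \<in> borel_measurable lborel"
proof (cases "0 \<le> t")
  case True
  have m: "(\<lambda>(s, \<omega>). K (s, \<omega>) * ennreal (lam s \<omega> $ i)) \<in> borel_measurable PS"
    using K lam_measurable[of i] by (simp add: case_prod_beta')
  have "(\<lambda>s. (s, \<omega>)) \<in> borel \<rightarrow>\<^sub>M borel \<Otimes>\<^sub>M F (ennreal t)" using \<omega> by (intro measurable_Pair) (auto simp: space_F)
  from measurable_compose[OF this predictable_progressive_ennreal[OF m True]]
  have "(\<lambda>s. if s \<in> {0..t} then K (s, \<omega>) * ennreal (lam s \<omega> $ i) else 0) \<in> borel_measurable borel" by simp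
  moreover have "(\<lambda>s. if s \<in> {0..t} then K (s, \<omega>) * ennreal (lam s \<omega> $ i) else 0) = (\<lambda>s. K (s, \<omega>) * ennreal (lam s \<omega> $ i) * indicator {0..t} s)"
    by (auto simp: indicator_def)
  ultimately show ?thesis by simp
qed simp

lemma lam_integral_add:
  assumes "K \<in> borel_measurable PS" "K' \<in> borel_measurable PS" "\<omega> \<in> space P"
  shows "lam_integral i t (\<lambda>x. K x + K' x) \<omega> = lam_integral i t K \<omega> + lam_integral i t K' \<omega>"
  unfolding lam_integral_def using section_ennreal_measurable assms
  by (subst nn_integral_add[symmetric]) (auto intro!: nn_integral_cong simp: distrib_right)

lemma lam_integral_cmult:
  assumes "K \<in> borel_measurable PS" "\<omega> \<in> space P"
  shows "lam_integral i t (\<lambda>x. c * K x) \<omega> = c * lam_integral i t K \<omega>"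
  unfolding lam_integral_def using section_ennreal_measurable assms
  by (subst nn_integral_cmult[symmetric]) (auto intro!: nn_integral_cong simp: mult.assoc)

lemma lam_integral_suminf:
  assumes "\<And>n. K n \<in> borel_measurable PS" "\<omega> \<in> space P"
  shows "lam_integral i t (\<lambda>x. \<Sum>n. K n x) \<omega> = (\<Sum>n. lam_integral i t (K n) \<omega>)"
  unfolding lam_integral_def using section_ennreal_measurable assms
  by (subst nn_integral_suminf[symmetric]) (auto intro!: nn_integral_cong simp: ennreal_suminf_multc)

lemma lam_integral_SUP:
  assumes "\<And>n. K n \<in> borel_measurable PS" "\<And>s. incseq (\<lambda>n. K n (s, \<omega>))" "\<omega> \<in> space P"
  shows "lam_integral i t (\<lambda>x. SUP n. K n x) \<omega> = (SUP n. lam_integral i t (K n) \<omega>)"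
  unfolding lam_integral_def using section_ennreal_measurable assms
  by (subst nn_integral_monotone_convergence_SUP[symmetric])
     (auto intro!: nn_integral_cong mult_right_mono simp: SUP_mult_right_ennreal incseq_def le_fun_def)

lemma lam_integral_cong:
  "(\<And>s. 0 \<le> s \<Longrightarrow> s \<le> t \<Longrightarrow> K (s, \<omega>) = K' (s, \<omega>)) \<Longrightarrow> lam_integral i t K \<omega> = lam_integral i t K' \<omega>"
  unfolding lam_integral_def by (intro nn_integral_cong) (auto simp: indicator_def)

lemma nn_integral_eq_if_difference_centered:
  assumes f [measurable]: "f \<in> borel_measurable P" and g [measurable]: "g \<in> borel_measurable P"
    and d: "integrable P d" "(LINT \<omega>|P. d \<omega>) = (0::real)"
    and gc: "AE \<omega> in P. g \<omega> \<le> ennreal c" and ff: "AE \<omega> in P. f \<omega> < \<infinity>"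
    and eq: "AE \<omega> in P. enn2real (f \<omega>) = enn2real (g \<omega>) + d \<omega>"
  shows "(\<integral>\<^sup>+\<omega>. f \<omega> \<partial>P) = (\<integral>\<^sup>+\<omega>. g \<omega> \<partial>P)"
proof -
  have gi: "integrable P (\<lambda>\<omega>. enn2real (g \<omega>))"
  proof (rule integrable_const_bound[of _ "max 0 c"])
    show "AE \<omega> in P. norm (enn2real (g \<omega>)) \<le> max 0 c"
      using gc
    proof eventually_elim
      case (elim \<omega>)
      have "g \<omega> \<le> ennreal (max 0 c)" using elim by (rule order.trans) (auto intro: ennreal_leI)
      then show ?case by (simp add: enn2real_leI)
    qed
  qed simp
  have fi: "integrable P (\<lambda>\<omega>. enn2real (f \<omega>))"
    by (rule integrable_cong_AE[THEN iffD2, OF _ _ eq]) (use gi d in auto)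
  have "(\<integral>\<^sup>+\<omega>. f \<omega> \<partial>P) = (\<integral>\<^sup>+\<omega>. ennreal (enn2real (f \<omega>)) \<partial>P)"
    using ff by (intro nn_integral_cong_AE) (auto elim!: eventually_mono)
  also have "\<dots> = ennreal (LINT \<omega>|P. enn2real (f \<omega>))"
    by (rule nn_integral_eq_integral[OF fi]) simp
  also have "(LINT \<omega>|P. enn2real (f \<omega>)) = (LINT \<omega>|P. enn2real (g \<omega>) + d \<omega>)"
    by (rule integral_cong_AE[OF _ _ eq]) (use d in auto)
  also have "\<dots> = (LINT \<omega>|P. enn2real (g \<omega>))" using gi d by simp
  also have "ennreal \<dots> = (\<integral>\<^sup>+\<omega>. ennreal (enn2real (g \<omega>)) \<partial>P)"
    by (rule nn_integral_eq_integral[OF gi, symmetric]) simp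
  also have "\<dots> = (\<integral>\<^sup>+\<omega>. g \<omega> \<partial>P)"
    using gc by (intro nn_integral_cong_AE) (auto elim!: eventually_mono intro!: ennreal_enn2real dest: le_less_trans[OF _ ennreal_less_top])
  finally show ?thesis .
qed

lemma stopped_pos_right_limit:
  fixes f :: "real \<Rightarrow> 'a \<Rightarrow> real"
  assumes "cadlag (\<lambda>t. f t \<omega>)" "0 \<le> r"
  shows "((\<lambda>r. stopped_pos T f r \<omega>) \<longlongrightarrow> stopped_pos T f r \<omega>) (at_right r)"
proof (cases "0 < T \<omega>")
  case True
  show ?thesis
  proof (cases "ennreal r < T \<omega>")
    case less: True
    obtain q where q: "r < q" "ennreal q \<le> T \<omega>"
    proof (cases "T \<omega>")
      case (real x)
      then show ?thesis using less that[of x] assms(2) by (simp add: ennreal_less_iff)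
    next
      case top then show ?thesis using that[of "r + 1"] by simp
    qed
    have eq: "stopped_pos T f s \<omega> = f s \<omega>" if "0 \<le> s" "s \<le> q" for s
    proof -
      have "ennreal s \<le> T \<omega>" using q(2) ennreal_leI[OF that(2)] by (rule order.trans[rotated])
      then show ?thesis using True that by (simp add: stopped_pos_def stopped_def min_absorb1)
    qed
    have "eventually (\<lambda>s. f s \<omega> = stopped_pos T f s \<omega>) (at_right r)"
      using eventually_at_right_real[OF q(1)] by eventually_elim (use eq assms(2) in auto)
    moreover have "((\<lambda>s. f s \<omega>) \<longlongrightarrow> stopped_pos T f r \<omega>) (at_right r)"
      using assms q eq[of r] by (auto simp: cadlag_def)
    ultimately show ?thesis using tendsto_cong by fastforce
  next
    case ge: False
    have "eventually (\<lambda>s. stopped_pos T f s \<omega> = stopped_pos T f r \<omega>) (at_right r)"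
      using eventually_at_right_less[of r]
    proof eventually_elim
      case (elim s)
      have "ennreal r \<le> ennreal s" using elim by (intro ennreal_leI) auto
      then show ?case using ge True by (simp add: stopped_pos_def stopped_def min_absorb2)
    qed
    then show ?thesis by (rule tendsto_eventually)
  qed
next
  case False
  then show ?thesis by (simp add: stopped_pos_def)
qed

lemma lam_integral_rectangle:
  assumes \<omega>: "\<omega> \<in> space P" and C: "\<And>s. s \<in> {0..t} \<Longrightarrow> \<bar>lam s \<omega> $ i\<bar> \<le> C" and pq: "0 \<le> p" "p \<le> q" "q \<le> t"
  shows "enn2real (lam_integral i t (\<lambda>(s, \<omega>'). indicator {p<..q} s)  \<omega>) = (LINT s:{0..q}|lborel. lam s \<omega> $ i) - (LINT s:{0..p}|lborel. lam s \<omega> $ i)"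
proof -
  have i: "set_integrable lborel {u..v} (\<lambda>s. lam s \<omega> $ i)" if "0 \<le> u" "v \<le> t" for u v
    by (rule section_set_integrable[OF lam_measurable \<omega> _ that(1), of _ _ C]) (use C that in auto)
  have "lam_integral i t (\<lambda>(s, \<omega>'). indicator {p<..q} s) \<omega> = (\<integral>\<^sup>+s. ennreal (indicator {p..q} s * (lam s \<omega> $ i)) \<partial>lborel)"
    unfolding lam_integral_def
  proof (rule nn_integral_cong_AE)
    show "AE s in lborel. (case (s, \<omega>) of (s, \<omega>') \<Rightarrow> indicator {p<..q} s) * ennreal (lam s \<omega> $ i) * indicator {0..t} s = ennreal (indicator {p..q} s * (lam s \<omega> $ i))"
      using AE_lborel_singleton[of p] by eventually_elim (use pq in \<open>auto simp: indicator_def\<close>)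
  qed
  also have "\<dots> = ennreal (LINT s:{p..q}|lborel. lam s \<omega> $ i)"
    using i[of p q] pq unfolding set_lebesgue_integral_def set_integrable_def
    by (subst nn_integral_eq_integral) (auto simp: indicator_def intro!: AE_I2 lam_nn[OF _ \<omega>])
  finally have "enn2real (lam_integral i t (\<lambda>(s, \<omega>'). indicator {p<..q} s) \<omega>) = (LINT s:{p..q}|lborel. lam s \<omega> $ i)"
  proof (simp, intro enn2real_ennreal)
    show "0 \<le> (LINT s:{p..q}|lborel. lam s \<omega> $ i)"
      unfolding set_lebesgue_integral_def
    proof (intro integral_nonneg_AE AE_I2)
      fix r show "0 \<le> indicator {p..q} r *\<^sub>R (lam r \<omega> $ i)"
        using lam_nn[OF _ \<omega>, of r i] pq by (auto simp: indicator_def)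
    qed
  qed
  also have "\<dots> = (LINT s:{0..q}|lborel. lam s \<omega> $ i) - (LINT s:{0..p}|lborel. lam s \<omega> $ i)"
    using set_integral_split[OF i[of 0 q], of p] pq by simp
  finally show ?thesis .
qed

text \<open>The times up to which neither \<open>T\<close> nor \<open>S\<close> has passed, as a predictable set.\<close>

definition before :: "('a \<Rightarrow> ennreal) \<Rightarrow> ('a \<Rightarrow> ennreal) \<Rightarrow> (real \<times> 'a) set" where
  "before T S = {(r, \<omega>). 0 \<le> r \<and> \<omega> \<in> space P \<and> ennreal r \<le> T \<omega>} \<inter> {(r, \<omega>). 0 \<le> r \<and> \<omega> \<in> space P \<and> ennreal r \<le> S \<omega>}"

lemma before_in_PS: "stopping_time F T \<Longrightarrow> stopping_time F S \<Longrightarrow> before T S \<in> sets PS"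
  unfolding before_def by (intro sets.Int predictable_before_stopping_time)

text \<open>The compensation formula on a rectangle, stopped at a time \<open>T\<close> that reduces \<open>N - \<integral>lam\<close> and at
  a time \<open>S\<close> up to which \<open>lam\<close> is bounded.\<close>

lemma compensation_stopped_rectangle:
  assumes T: "stopping_time F T" "martingale P F (stopped_pos T (\<lambda>t \<omega>. compensated N lam t \<omega> $ i))"
    and S: "stopping_time F S" "\<And>s \<omega>. 0 < s \<Longrightarrow> \<omega> \<in> space P \<Longrightarrow> ennreal s \<le> S \<omega> \<Longrightarrow> \<bar>lam s \<omega> $ i\<bar> \<le> C"
    and st: "0 \<le> s" "s < t" "t \<le> t0" and A: "A \<in> sets (F (ennreal s))"
  shows "(\<integral>\<^sup>+\<omega>. jump_sum i t0 (indicator ({s<..t} \<times> A \<inter> before T S)) \<omega> \<partial>P) = (\<integral>\<^sup>+\<omega>. lam_integral i t0 (indicator ({s<..t} \<times> A \<inter> before T S)) \<omega> \<partial>P)"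
proof -
  define X where "X = stopped_pos T (\<lambda>t \<omega>. compensated N lam t \<omega> $ i)"
  (* on A' the formula is the increment of the stopped martingale; off A' both sides vanish *)
  define A' where "A' = A \<inter> {\<omega> \<in> space P. ennreal s < S \<omega>}"
  have A': "A' \<in> sets (F (ennreal s))"
    using A stopping_timeD2[OF S(1), of "ennreal s"] by (simp add: A'_def pred_def space_F)
  define \<sigma> where "\<sigma> \<omega> = max s (enn2real (min (ennreal t) (S \<omega>)))" for \<omega>
  have cad: "AE \<omega> in P. cadlag (\<lambda>t. compensated N lam t \<omega> $ i)"
    using intensity unfolding has_intensity_def local_martingale_def by blast
  have rc: "AE \<omega> in P. \<forall>r\<ge>0. ((\<lambda>r. X r \<omega>) \<longlongrightarrow> X r \<omega>) (at_right r)"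
    using cad unfolding X_def by eventually_elim (auto intro!: stopped_pos_right_limit)
  have X: "martingale P F X" using T(2) by (simp add: X_def)
  note os = optional_stopping[OF X rc S(1) st(1,2) A', folded \<sigma>_def]
  define d where "d \<omega> = indicator A' \<omega> * X (\<sigma> \<omega>) \<omega> - indicator A' \<omega> * X s \<omega>" for \<omega>
  have A'P: "A' \<in> sets P" using A' by (rule sets_F_P)
  have Xs: "integrable P (X s)" using X st unfolding martingale_def by auto
  have i1: "integrable P (\<lambda>\<omega>. indicator A' \<omega> * X (\<sigma> \<omega>) \<omega>)" "integrable P (\<lambda>\<omega>. indicator A' \<omega> * X s \<omega>)"
    using integrable_mult_indicator[OF A'P os(1)] integrable_mult_indicator[OF A'P Xs] by simp_all
  have t0: "0 \<le> t0" using st by simp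
  have C0: "C \<ge> 0 \<or> (\<forall>\<omega>\<in>A'. False)"
  proof (rule disjCI)
    assume "\<not> (\<forall>\<omega>\<in>A'. False)"
    then obtain \<omega> where w: "\<omega> \<in> space P" "ennreal s < S \<omega>" by (auto simp: A'_def)
    obtain q where "0 < q" "ennreal q \<le> S \<omega>"
    proof (cases "S \<omega>")
      case (real x) then show ?thesis using w(2) st that[of x] by (auto simp: ennreal_less_iff)
    next
      case top then show ?thesis using that[of 1] by simp
    qed
    then show "0 \<le> C" using S(2)[of q \<omega>] w(1) by (meson abs_ge_zero order.trans)
  qed
  have R: "{s<..t} \<times> A \<in> sets PS"
  proof (rule rectangle_in_PS)
    have "s \<le> t" using st by simp
    then show "{s<..t} \<times> A \<in> predictable_rectangles"
      using st(1) A unfolding predictable_rectangles_def by blast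
  qed
  have B: "{s<..t} \<times> A \<inter> before T S \<in> sets PS" using R before_in_PS[OF T(1) S(1)] by auto
  have AsubP: "A \<subseteq> space P" using sets.sets_into_space[OF A] by (simp add: space_F)
  define f where "f = jump_sum i t0 (indicator ({s<..t} \<times> A \<inter> before T S))"
  define g where "g = lam_integral i t0 (indicator ({s<..t} \<times> A \<inter> before T S))"
  have "f \<in> borel_measurable (F (ennreal t0))" "g \<in> borel_measurable (F (ennreal t0))"
    unfolding f_def g_def using B t0 by (auto intro!: jump_sum_measurable lam_integral_measurable)
  then have fm: "f \<in> borel_measurable P" "g \<in> borel_measurable P" by (auto intro: measurable_F_P)
  have main: "AE \<omega> in P. enn2real (f \<omega>) = enn2real (g \<omega>) + d \<omega>"
    using locally_bounded_paths[OF lam_locally_bounded] AE_space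
  proof eventually_elim
    case (elim \<omega>)
    then have \<omega>: "\<omega> \<in> space P" by simp
    from elim(1) obtain D where "\<forall>s\<in>{0..t0}. norm (lam s \<omega>) \<le> D" by blast
    then have D: "\<And>s. s \<in> {0..t0} \<Longrightarrow> \<bar>lam s \<omega> $ i\<bar> \<le> D" by (meson component_le_norm_cart order.trans)
    show ?case
    proof (cases "\<omega> \<in> A' \<and> 0 < T \<omega>")
      case False
      have empty: "({s<..t} \<times> A \<inter> before T S) \<inter> {0<..} \<times> {\<omega>} = {}"
      proof -
        have "\<not> (r \<in> {s<..t} \<and> \<omega> \<in> A \<and> ennreal r \<le> T \<omega> \<and> ennreal r \<le> S \<omega> \<and> 0 < r)" for r
        proof
          assume *: "r \<in> {s<..t} \<and> \<omega> \<in> A \<and> ennreal r \<le> T \<omega> \<and> ennreal r \<le> S \<omega> \<and> 0 < r"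
          have "ennreal s < ennreal r" "0 < ennreal r" using * st by (simp_all add: ennreal_less_iff)
          then have "ennreal s < S \<omega>" "0 < T \<omega>"
            using * order.strict_trans2[of "ennreal s" "ennreal r" "S \<omega>"] order.strict_trans2[of 0 "ennreal r" "T \<omega>"] by blast+
          then show False using False * \<omega> by (auto simp: A'_def)
        qed
        then show ?thesis by (auto simp: before_def)
      qed
      then have z: "indicator ({s<..t} \<times> A \<inter> before T S) (r, \<omega>) = (0::ennreal)" if "0 < r" for r
      proof -
        have "(r, \<omega>) \<in> {0<..} \<times> {\<omega>}" using that by simp
        then have "(r, \<omega>) \<notin> {s<..t} \<times> A \<inter> before T S" using empty by blast
        then show ?thesis by (rule indicator_simps(2))
      qed
      have "f \<omega> = 0" unfolding f_def jump_sum_eq[OF \<omega>] using z J_pos by (intro sum.neutral) auto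
      moreover have "g \<omega> = 0"
        unfolding g_def lam_integral_def
      proof (subst nn_integral_0_iff_AE)
        show "(\<lambda>sa. indicator ({s<..t} \<times> A \<inter> before T S) (sa, \<omega>) * ennreal (lam sa \<omega> $ i) * indicator {0..t0} sa) \<in> borel_measurable lborel"
          by (rule section_ennreal_measurable) (use B \<omega> in auto)
        show "AE sa in lborel. indicator ({s<..t} \<times> A \<inter> before T S) (sa, \<omega>) * ennreal (lam sa \<omega> $ i) * indicator {0..t0} sa = 0"
          using AE_lborel_singleton[of 0] by eventually_elim (use z in \<open>auto simp: indicator_def\<close>)
      qed
      moreover have "d \<omega> = 0"
        using False by (auto simp: d_def X_def stopped_pos_def)
      ultimately show ?thesis by simp
    next
      case True
      then have w: "\<omega> \<in> A" "ennreal s < S \<omega>" "0 < T \<omega>" "\<omega> \<in> A'" by (auto simp: A'_def)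
      define m where "m = enn2real (min (ennreal t) (S \<omega>))"
      have m: "ennreal m = min (ennreal t) (S \<omega>)" unfolding m_def by (rule ennreal_enn2real) (simp add: min_less_iff_disj)
      have sm: "s < m"
      proof -
        have "ennreal s < ennreal m" unfolding m using w(2) st by (simp add: ennreal_less_iff)
        then show ?thesis using st by (simp add: ennreal_less_iff)
      qed
      have \<sigma>m: "\<sigma> \<omega> = m" using sm by (simp add: \<sigma>_def m_def)
      define p q where "p = enn2real (min (ennreal s) (T \<omega>))" and "q = enn2real (min (ennreal m) (T \<omega>))"
      have p: "ennreal p = min (ennreal s) (T \<omega>)" unfolding p_def by (rule ennreal_enn2real) (simp add: min_less_iff_disj)
      have q: "ennreal q = min (ennreal m) (T \<omega>)" unfolding q_def by (rule ennreal_enn2real) (simp add: min_less_iff_disj)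
      have p0: "0 \<le> p" "0 \<le> q" by (simp_all add: p_def q_def)
      have "ennreal p \<le> ennreal q" unfolding p q using sm by (intro min.mono ennreal_leI) auto
      then have pq: "p \<le> q" using p0 by simp
      have "ennreal m \<le> ennreal t" by (simp add: m)
      then have mt: "m \<le> t" using st by (simp add: ennreal_le_iff)
      have "ennreal q \<le> ennreal m" by (simp add: q)
      then have qt: "q \<le> t0" using mt st sm by (simp add: ennreal_le_iff)
      have iff: "(r, \<omega>) \<in> {s<..t} \<times> A \<inter> before T S \<longleftrightarrow> r \<in> {p<..q}" if r: "0 \<le> r" for r
      proof -
        have e1: "r \<le> q \<longleftrightarrow> ennreal r \<le> ennreal q" using p0 by (simp add: ennreal_le_iff)
        have e2: "p < r \<longleftrightarrow> ennreal p < ennreal r" using p0 by (simp add: ennreal_less_iff)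
        have e3: "r \<le> t \<longleftrightarrow> ennreal r \<le> ennreal t" "s < r \<longleftrightarrow> ennreal s < ennreal r" using st by (simp_all add: ennreal_le_iff ennreal_less_iff)
        have "r \<in> {p<..q} \<longleftrightarrow> (ennreal s < ennreal r \<or> T \<omega> < ennreal r) \<and> ennreal r \<le> ennreal t \<and> ennreal r \<le> S \<omega> \<and> ennreal r \<le> T \<omega>"
          unfolding greaterThanAtMost_iff e1 e2 p q m by (simp only: min_less_iff_disj min.bounded_iff conj_assoc)
        also have "\<dots> \<longleftrightarrow> (ennreal s < ennreal r \<and> ennreal r \<le> ennreal t) \<and> ennreal r \<le> T \<omega> \<and> ennreal r \<le> S \<omega>"
          using not_less[of "T \<omega>" "ennreal r"] by blast
        also have "\<dots> \<longleftrightarrow> (r, \<omega>) \<in> {s<..t} \<times> A \<inter> before T S"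
          unfolding before_def using w(1) \<omega> r by (simp only: Int_iff mem_Sigma_iff mem_Collect_eq case_prod_conv greaterThanAtMost_iff e3) blast
        finally show ?thesis by (rule sym)
      qed
      have "f \<omega> = jump_sum i t0 (indicator ({p<..q} \<times> space P)) \<omega>"
        unfolding f_def by (rule jump_sum_cong) (use iff \<omega> in \<open>auto simp: indicator_def\<close>)
      then have fw: "enn2real (f \<omega>) = N q \<omega> $ i - N p \<omega> $ i"
        using jump_sum_rectangle[OF \<omega> p0(1) pq, of i t0 "space P"] \<omega> pq qt N_increment[OF \<omega> p0(1) pq, of i]
        by (simp add: min_absorb1)
      have "g \<omega> = lam_integral i t0 (\<lambda>(s, \<omega>'). indicator {p<..q} s) \<omega>"
        unfolding g_def by (rule lam_integral_cong) (use iff in \<open>auto simp: indicator_def\<close>)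
      then have gw: "enn2real (g \<omega>) = (LINT s:{0..q}|lborel. lam s \<omega> $ i) - (LINT s:{0..p}|lborel. lam s \<omega> $ i)"
        using lam_integral_rectangle[OF \<omega> D p0(1) pq qt] by simp
      have "d \<omega> = compensated N lam q \<omega> $ i - compensated N lam p \<omega> $ i"
        using w by (simp add: d_def \<sigma>m X_def stopped_pos_def stopped_def p_def q_def)
      then show ?thesis unfolding fw gw compensated_def by simp
    qed
  qed
  have "(\<integral>\<^sup>+\<omega>. f \<omega> \<partial>P) = (\<integral>\<^sup>+\<omega>. g \<omega> \<partial>P)"
  proof (rule nn_integral_eq_if_difference_centered[OF fm _ _ _ _ main])
    show "integrable P d" using i1 unfolding d_def by simp
    show "(LINT \<omega>|P. d \<omega>) = 0" using i1 os(2) unfolding d_def by simp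
    show "AE \<omega> in P. f \<omega> < \<infinity>"
      using AE_space by eventually_elim (simp add: f_def jump_sum_eq finite_J indicator_def ennreal_of_nat_eq_real_of_nat)
    show "AE \<omega> in P. g \<omega> \<le> ennreal (\<bar>C\<bar> * t0)"
      using AE_space
    proof eventually_elim
      case (elim \<omega>)
      have "g \<omega> \<le> (\<integral>\<^sup>+sa. ennreal \<bar>C\<bar> * indicator {0..t0} sa \<partial>lborel)"
        unfolding g_def lam_integral_def
      proof (rule nn_integral_mono)
        fix r :: real
        show "indicator ({s<..t} \<times> A \<inter> before T S) (r, \<omega>) * ennreal (lam r \<omega> $ i) * indicator {0..t0} r \<le> ennreal \<bar>C\<bar> * indicator {0..t0} r"
        proof (cases "(r, \<omega>) \<in> {s<..t} \<times> A \<inter> before T S")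
          case True
          then have "\<bar>lam r \<omega> $ i\<bar> \<le> C" using S(2)[of r \<omega>] st by (auto simp: before_def)
          then have "ennreal (lam r \<omega> $ i) \<le> ennreal \<bar>C\<bar>" by (intro ennreal_leI) auto
          then show ?thesis using True by (auto simp: indicator_def)
        qed simp
      qed
      also have "\<dots> = ennreal (\<bar>C\<bar> * t0)" using t0 by (simp add: nn_integral_cmult ennreal_mult)
      finally show ?case .
    qed
  qed
  then show ?thesis by (simp add: f_def g_def)
qed

lemma jump_sum_measurable_P: "K \<in> borel_measurable PS \<Longrightarrow> 0 \<le> t \<Longrightarrow> jump_sum i t K \<in> borel_measurable P"
  by (rule measurable_F_P[OF jump_sum_measurable])

lemma lam_integral_measurable_P: "K \<in> borel_measurable PS \<Longrightarrow> 0 \<le> t \<Longrightarrow> lam_integral i t K \<in> borel_measurable P"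
  by (rule measurable_F_P[OF lam_integral_measurable])

lemma lam_integral_null:
  assumes "\<omega> \<in> space P" "\<And>s. 0 < s \<Longrightarrow> s \<le> t \<Longrightarrow> K (s, \<omega>) = 0"
  shows "lam_integral i t K \<omega> = 0"
proof -
  have "lam_integral i t K \<omega> = (\<integral>\<^sup>+s. 0 \<partial>(lborel :: real measure))"
    unfolding lam_integral_def
  proof (rule nn_integral_cong_AE)
    show "AE s in lborel. K (s, \<omega>) * ennreal (lam s \<omega> $ i) * indicator {0..t} s = 0"
      using AE_lborel_singleton[of 0] by eventually_elim (use assms(2) in \<open>auto simp: indicator_def\<close>)
  qed
  then show ?thesis by simp
qed

lemma jump_sum_null:
  assumes "\<And>s. 0 < s \<Longrightarrow> s \<le> t \<Longrightarrow> K (s, \<omega>) = 0"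
  shows "jump_sum i t K \<omega> = 0"
  using jump_sum_cong[of i \<omega> t K "\<lambda>_. 0"] assms by (simp add: jump_sum_def)

text \<open>From rectangles to predictable sets by Dynkin's lemma; stopping makes both sides finite.\<close>

lemma compensation_stopped:
  assumes T: "stopping_time F T" "martingale P F (stopped_pos T (\<lambda>t \<omega>. compensated N lam t \<omega> $ i))"
    and S: "stopping_time F S" "\<And>s \<omega>. 0 < s \<Longrightarrow> \<omega> \<in> space P \<Longrightarrow> ennreal s \<le> S \<omega> \<Longrightarrow> \<bar>lam s \<omega> $ i\<bar> \<le> c"
    and t0: "0 \<le> t0" and C: "C \<in> sets PS"
  shows "(\<integral>\<^sup>+\<omega>. jump_sum i t0 (indicator (C \<inter> before T S)) \<omega> \<partial>P) = (\<integral>\<^sup>+\<omega>. lam_integral i t0 (indicator (C \<inter> before T S)) \<omega> \<partial>P)"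
  using Int_stable_predictable_rectangles predictable_rectangles_Pow C[unfolded sets_PS]
proof (induction rule: sigma_sets_induct_disjoint)
  let ?B = "before T S"
  have B: "?B \<in> sets PS" by (rule before_in_PS[OF T(1) S(1)])
  have rect: "(\<integral>\<^sup>+\<omega>. jump_sum i t0 (indicator ({a<..b} \<times> A \<inter> ?B)) \<omega> \<partial>P) = (\<integral>\<^sup>+\<omega>. lam_integral i t0 (indicator ({a<..b} \<times> A \<inter> ?B)) \<omega> \<partial>P)"
    if R: "0 \<le> a" "A \<in> sets (F (ennreal a))" for a b A
  proof (cases "a < min b t0")
    case True
    have eq: "indicator ({a<..b} \<times> A \<inter> ?B) (s, \<omega>) = (indicator ({a<..min b t0} \<times> A \<inter> ?B) (s, \<omega>) :: ennreal)" if "s \<le> t0" for s \<omega>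
      using that by (auto simp: indicator_def)
    have "jump_sum i t0 (indicator ({a<..b} \<times> A \<inter> ?B)) \<omega> = jump_sum i t0 (indicator ({a<..min b t0} \<times> A \<inter> ?B)) \<omega>"
      "lam_integral i t0 (indicator ({a<..b} \<times> A \<inter> ?B)) \<omega> = lam_integral i t0 (indicator ({a<..min b t0} \<times> A \<inter> ?B)) \<omega>" for \<omega>
      using eq by (auto intro!: jump_sum_cong lam_integral_cong)
    then show ?thesis
      using compensation_stopped_rectangle[OF T S R(1) True _ R(2)] by simp
  next
    case False
    then have z: "indicator ({a<..b} \<times> A \<inter> ?B) (s, \<omega>) = (0 :: ennreal)" if "0 < s" "s \<le> t0" for s \<omega>
      using that by (auto simp: indicator_def)
    have "(\<integral>\<^sup>+\<omega>. jump_sum i t0 (indicator ({a<..b} \<times> A \<inter> ?B)) \<omega> \<partial>P) = (\<integral>\<^sup>+\<omega>. 0 \<partial>P)"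
      using z by (intro nn_integral_cong jump_sum_null)
    moreover have "(\<integral>\<^sup>+\<omega>. lam_integral i t0 (indicator ({a<..b} \<times> A \<inter> ?B)) \<omega> \<partial>P) = (\<integral>\<^sup>+\<omega>. 0 \<partial>P)"
      using z by (intro nn_integral_cong lam_integral_null)
    ultimately show ?thesis by simp
  qed
  {
    case (basic R)
    then consider A where "R = {0::real} \<times> A" "A \<in> sets (F 0)" | a b A where "R = {a<..b::real} \<times> A" "0 \<le> a" "a \<le> b" "A \<in> sets (F (ennreal a))"
      unfolding predictable_rectangles_def by blast
    then show ?case
    proof cases
      case 1
      have z: "indicator ({0} \<times> A \<inter> ?B) (s, \<omega>) = (0 :: ennreal)" if "0 < s" "s \<le> t0" for s \<omega>
        using that by (auto simp: indicator_def)
      have "(\<integral>\<^sup>+\<omega>. jump_sum i t0 (indicator (R \<inter> ?B)) \<omega> \<partial>P) = (\<integral>\<^sup>+\<omega>. 0 \<partial>P)"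
        unfolding 1 using z by (intro nn_integral_cong jump_sum_null)
      moreover have "(\<integral>\<^sup>+\<omega>. lam_integral i t0 (indicator (R \<inter> ?B)) \<omega> \<partial>P) = (\<integral>\<^sup>+\<omega>. 0 \<partial>P)"
        unfolding 1 using z by (intro nn_integral_cong lam_integral_null)
      ultimately show ?thesis by simp
    next
      case 2 then show ?thesis using rect by simp
    qed
  next
    case empty
    have "(\<integral>\<^sup>+\<omega>. jump_sum i t0 (indicator ({} \<inter> ?B)) \<omega> \<partial>P) = (\<integral>\<^sup>+\<omega>. 0 \<partial>P)"
      by (intro nn_integral_cong jump_sum_null) simp
    moreover have "(\<integral>\<^sup>+\<omega>. lam_integral i t0 (indicator ({} \<inter> ?B)) \<omega> \<partial>P) = (\<integral>\<^sup>+\<omega>. 0 \<partial>P)"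
      by (intro nn_integral_cong lam_integral_null) simp_all
    ultimately show ?case by (rule trans[OF _ sym])
  next
    case (compl C)
    let ?C' = "{0..} \<times> space P - C"
    have Cs: "C \<in> sets PS" using compl.hyps unfolding sets_PS .
    have C's: "?C' \<in> sets PS" using sets.Diff[OF sets.top Cs] by simp
    have m: "indicator (C \<inter> ?B) \<in> borel_measurable PS" "indicator (?C' \<inter> ?B) \<in> borel_measurable PS"
      using Cs C's B by (auto intro!: borel_measurable_indicator)
    have split: "indicator (C \<inter> ?B) (s, \<omega>) + indicator (?C' \<inter> ?B) (s, \<omega>) = (indicator ({0<..t0} \<times> space P \<inter> ?B) (s, \<omega>) :: ennreal)"
      if "\<omega> \<in> space P" "0 < s" "s \<le> t0" for s \<omega>
      using that by (auto simp: indicator_def)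
    have e1: "(\<integral>\<^sup>+\<omega>. jump_sum i t0 (indicator (C \<inter> ?B)) \<omega> \<partial>P) + (\<integral>\<^sup>+\<omega>. jump_sum i t0 (indicator (?C' \<inter> ?B)) \<omega> \<partial>P)
       = (\<integral>\<^sup>+\<omega>. jump_sum i t0 (indicator ({0<..t0} \<times> space P \<inter> ?B)) \<omega> \<partial>P)"
      using jump_sum_measurable_P[OF m(1) t0] jump_sum_measurable_P[OF m(2) t0]
      by (subst nn_integral_add[symmetric])
         (auto simp: jump_sum_add[symmetric] intro!: nn_integral_cong jump_sum_cong split)
    have e2: "(\<integral>\<^sup>+\<omega>. lam_integral i t0 (indicator (C \<inter> ?B)) \<omega> \<partial>P) + (\<integral>\<^sup>+\<omega>. lam_integral i t0 (indicator (?C' \<inter> ?B)) \<omega> \<partial>P)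
       = (\<integral>\<^sup>+\<omega>. lam_integral i t0 (indicator ({0<..t0} \<times> space P \<inter> ?B)) \<omega> \<partial>P)"
    proof (subst nn_integral_add[symmetric])
      show "(\<integral>\<^sup>+\<omega>. lam_integral i t0 (indicator (C \<inter> ?B)) \<omega> + lam_integral i t0 (indicator (?C' \<inter> ?B)) \<omega> \<partial>P)
       = (\<integral>\<^sup>+\<omega>. lam_integral i t0 (indicator ({0<..t0} \<times> space P \<inter> ?B)) \<omega> \<partial>P)"
      proof (rule nn_integral_cong)
        fix \<omega> assume \<omega>: "\<omega> \<in> space P"
        have "lam_integral i t0 (indicator (C \<inter> ?B)) \<omega> + lam_integral i t0 (indicator (?C' \<inter> ?B)) \<omega>
          = lam_integral i t0 (\<lambda>x. indicator (C \<inter> ?B) x + indicator (?C' \<inter> ?B) x) \<omega>"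
          by (rule lam_integral_add[OF m \<omega>, symmetric])
        also have "\<dots> = lam_integral i t0 (indicator ({0<..t0} \<times> space P \<inter> ?B)) \<omega>"
          unfolding lam_integral_def
        proof (rule nn_integral_cong_AE)
          show "AE s in lborel. (indicator (C \<inter> ?B) (s, \<omega>) + indicator (?C' \<inter> ?B) (s, \<omega>)) * ennreal (lam s \<omega> $ i) * indicator {0..t0} s
            = indicator ({0<..t0} \<times> space P \<inter> ?B) (s, \<omega>) * ennreal (lam s \<omega> $ i) * indicator {0..t0} s"
            using AE_lborel_singleton[of 0]
          proof eventually_elim
            case (elim s)
            show ?case
            proof (cases "s \<in> {0..t0}")
              case True
              then have "0 < s" "s \<le> t0" using elim by auto
              then show ?thesis by (simp only: split[OF \<omega>])
            qed simp
          qed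
        qed
        finally show "lam_integral i t0 (indicator (C \<inter> ?B)) \<omega> + lam_integral i t0 (indicator (?C' \<inter> ?B)) \<omega> = lam_integral i t0 (indicator ({0<..t0} \<times> space P \<inter> ?B)) \<omega>" .
      qed
    qed (use lam_integral_measurable_P[OF m(1) t0] lam_integral_measurable_P[OF m(2) t0] in auto)
    have tot: "(\<integral>\<^sup>+\<omega>. jump_sum i t0 (indicator ({0<..t0} \<times> space P \<inter> ?B)) \<omega> \<partial>P) = (\<integral>\<^sup>+\<omega>. lam_integral i t0 (indicator ({0<..t0} \<times> space P \<inter> ?B)) \<omega> \<partial>P)"
      by (rule rect) (use sets.top[of "F (ennreal 0)"] in \<open>auto simp: space_F\<close>)
    have "(\<integral>\<^sup>+\<omega>. lam_integral i t0 (indicator (C \<inter> ?B)) \<omega> \<partial>P) \<le> (\<integral>\<^sup>+\<omega>. ennreal (\<bar>c\<bar> * t0) \<partial>P)"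
    proof (rule nn_integral_mono)
      fix \<omega> assume \<omega>: "\<omega> \<in> space P"
      have "lam_integral i t0 (indicator (C \<inter> ?B)) \<omega> \<le> (\<integral>\<^sup>+s. ennreal \<bar>c\<bar> * indicator {0..t0} s \<partial>lborel)"
        unfolding lam_integral_def
      proof (rule nn_integral_mono_AE)
        show "AE s in lborel. indicator (C \<inter> ?B) (s, \<omega>) * ennreal (lam s \<omega> $ i) * indicator {0..t0} s \<le> ennreal \<bar>c\<bar> * indicator {0..t0} s"
          using AE_lborel_singleton[of 0]
        proof eventually_elim
          case (elim s)
          show ?case
          proof (cases "(s, \<omega>) \<in> C \<inter> ?B")
            case True
            then have "\<bar>lam s \<omega> $ i\<bar> \<le> c" using S(2)[of s \<omega>] elim by (auto simp: before_def)
            then have "ennreal (lam s \<omega> $ i) \<le> ennreal \<bar>c\<bar>" by (intro ennreal_leI) auto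
            then show ?thesis using True by (auto simp: indicator_def)
          qed simp
        qed
      qed
      also have "\<dots> = ennreal (\<bar>c\<bar> * t0)" using t0 by (simp add: nn_integral_cmult ennreal_mult)
      finally show "lam_integral i t0 (indicator (C \<inter> ?B)) \<omega> \<le> ennreal (\<bar>c\<bar> * t0)" .
    qed
    then have fin: "(\<integral>\<^sup>+\<omega>. lam_integral i t0 (indicator (C \<inter> ?B)) \<omega> \<partial>P) \<noteq> \<infinity>"
      by (auto simp: emeasure_space_1 top_unique)
    note e1[unfolded compl.IH tot, folded e2]
    then show ?case using fin unfolding ennreal_add_left_cancel by (elim disjE) (rule notE, assumption+)
  next
    case (union C)
    have Cs: "C n \<in> sets PS" for n using union.hyps unfolding sets_PS by auto
    have m: "indicator (C n \<inter> ?B) \<in> borel_measurable PS" for n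
      using Cs B by (auto intro!: borel_measurable_indicator)
    have ind: "indicator ((\<Union>n. C n) \<inter> ?B) x = (\<Sum>n. indicator (C n \<inter> ?B) x :: ennreal)" for x
    proof -
      have "disjoint_family (\<lambda>n. C n \<inter> ?B)" using union(1) by (auto simp: disjoint_family_on_def)
      from suminf_indicator[OF this, of x] show ?thesis by simp
    qed
    have "(\<integral>\<^sup>+\<omega>. jump_sum i t0 (indicator ((\<Union>n. C n) \<inter> ?B)) \<omega> \<partial>P) = (\<integral>\<^sup>+\<omega>. (\<Sum>n. jump_sum i t0 (indicator (C n \<inter> ?B)) \<omega>) \<partial>P)"
      unfolding jump_sum_suminf[symmetric] by (intro nn_integral_cong jump_sum_cong ind)
    also have "\<dots> = (\<Sum>n. \<integral>\<^sup>+\<omega>. jump_sum i t0 (indicator (C n \<inter> ?B)) \<omega> \<partial>P)"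
      by (rule nn_integral_suminf[OF jump_sum_measurable_P[OF m t0]])
    also have "\<dots> = (\<Sum>n. \<integral>\<^sup>+\<omega>. lam_integral i t0 (indicator (C n \<inter> ?B)) \<omega> \<partial>P)"
      using union.IH by simp
    also have "\<dots> = (\<integral>\<^sup>+\<omega>. (\<Sum>n. lam_integral i t0 (indicator (C n \<inter> ?B)) \<omega>) \<partial>P)"
      by (rule nn_integral_suminf[OF lam_integral_measurable_P[OF m t0], symmetric])
    also have "\<dots> = (\<integral>\<^sup>+\<omega>. lam_integral i t0 (indicator ((\<Union>n. C n) \<inter> ?B)) \<omega> \<partial>P)"
      by (intro nn_integral_cong) (simp add: lam_integral_suminf[OF m, symmetric] ind[abs_def])
    finally show ?case .
  }
qed

text \<open>Letting the stopping times tend to infinity.\<close>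

lemma compensation_set:
  assumes t: "0 \<le> t" and C: "C \<in> sets PS"
  shows "(\<integral>\<^sup>+\<omega>. jump_sum i t (indicator C) \<omega> \<partial>P) = (\<integral>\<^sup>+\<omega>. lam_integral i t (indicator C) \<omega> \<partial>P)"
proof -
  obtain T where T: "localizing P F T" "\<And>n. martingale P F (stopped_pos (T n) (\<lambda>t \<omega>. compensated N lam t \<omega> $ i))"
    using intensity unfolding has_intensity_def local_martingale_def by blast
  obtain S where S: "localizing P F S" "\<And>n. bounded ((\<lambda>(t, \<omega>). stopped_pos (S n) lam t \<omega>) ` ({0..} \<times> space P))"
    using lam_locally_bounded unfolding locally_bounded_def by blast
  have st: "stopping_time F (T n)" "stopping_time F (S n)" for n using T(1) S(1) by (auto simp: localizing_def)
  have bd: "\<exists>c. \<forall>s \<omega>. 0 < s \<longrightarrow> \<omega> \<in> space P \<longrightarrow> ennreal s \<le> S n \<omega> \<longrightarrow> \<bar>lam s \<omega> $ i\<bar> \<le> c" for n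
  proof -
    obtain c where c: "\<And>s \<omega>. 0 \<le> s \<Longrightarrow> \<omega> \<in> space P \<Longrightarrow> norm (stopped_pos (S n) lam s \<omega>) \<le> c"
      using S(2)[of n] unfolding bounded_iff by force
    have "\<bar>lam s \<omega> $ i\<bar> \<le> c" if "0 < s" "\<omega> \<in> space P" "ennreal s \<le> S n \<omega>" for s \<omega>
    proof -
      have "0 < S n \<omega>" using that by (auto intro: order.strict_trans2[of _ "ennreal s"])
      then have "stopped_pos (S n) lam s \<omega> = lam s \<omega>" using that by (simp add: stopped_pos_def stopped_def min_absorb1)
      then show ?thesis using c[of s \<omega>] that component_le_norm_cart[of "lam s \<omega>" i] by simp
    qed
    then show ?thesis by blast
  qed
  have eq: "(\<integral>\<^sup>+\<omega>. jump_sum i t (indicator (C \<inter> before (T n) (S n))) \<omega> \<partial>P) = (\<integral>\<^sup>+\<omega>. lam_integral i t (indicator (C \<inter> before (T n) (S n))) \<omega> \<partial>P)" for n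
  proof -
    obtain c where "\<And>s \<omega>. 0 < s \<Longrightarrow> \<omega> \<in> space P \<Longrightarrow> ennreal s \<le> S n \<omega> \<Longrightarrow> \<bar>lam s \<omega> $ i\<bar> \<le> c" using bd[of n] by blast
    then show ?thesis by (intro compensation_stopped[OF st(1) T(2) st(2) _ t C])
  qed
  have m: "indicator (C \<inter> before (T n) (S n)) \<in> borel_measurable PS" for n
    using C before_in_PS[OF st, of n n] by (auto intro!: borel_measurable_indicator)
  have good: "AE \<omega> in P. \<omega> \<in> space P \<and> (\<forall>s. incseq (\<lambda>n. indicator (C \<inter> before (T n) (S n)) (s, \<omega>) :: ennreal)) \<and>
      (\<forall>s\<ge>0. (SUP n. indicator (C \<inter> before (T n) (S n)) (s, \<omega>) :: ennreal) = indicator C (s, \<omega>))"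
  proof -
    have "AE \<omega> in P. incseq (\<lambda>n. T n \<omega>) \<and> (\<lambda>n. T n \<omega>) \<longlonglongrightarrow> \<infinity>" "AE \<omega> in P. incseq (\<lambda>n. S n \<omega>) \<and> (\<lambda>n. S n \<omega>) \<longlonglongrightarrow> \<infinity>"
      using T(1) S(1) by (auto simp: localizing_def)
    then show ?thesis using AE_space
    proof eventually_elim
      case (elim \<omega>)
      have inc: "incseq (\<lambda>n. indicator (C \<inter> before (T n) (S n)) (s, \<omega>) :: ennreal)" for s
      proof (rule incseq_SucI)
        fix n
        have "T n \<omega> \<le> T (Suc n) \<omega>" "S n \<omega> \<le> S (Suc n) \<omega>" using elim by (auto simp: incseq_Suc_iff)
        then show "indicator (C \<inter> before (T n) (S n)) (s, \<omega>) \<le> (indicator (C \<inter> before (T (Suc n)) (S (Suc n))) (s, \<omega>) :: ennreal)"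
          by (auto simp: indicator_def before_def intro: order.trans)
      qed
      have "(SUP n. indicator (C \<inter> before (T n) (S n)) (s, \<omega>) :: ennreal) = indicator C (s, \<omega>)" if s: "0 \<le> s" for s
      proof -
        have "\<forall>\<^sub>F n in sequentially. ennreal s < T n \<omega>" "\<forall>\<^sub>F n in sequentially. ennreal s < S n \<omega>"
          using elim by (auto intro!: order_tendstoD(1))
        then have "\<forall>\<^sub>F n in sequentially. indicator (C \<inter> before (T n) (S n)) (s, \<omega>) = (indicator C (s, \<omega>) :: ennreal)"
          by eventually_elim (use s elim in \<open>auto simp: before_def indicator_def\<close>)
        then have "(\<lambda>n. indicator (C \<inter> before (T n) (S n)) (s, \<omega>) :: ennreal) \<longlonglongrightarrow> indicator C (s, \<omega>)"
          by (rule tendsto_eventually)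
        with LIMSEQ_SUP[OF inc] show ?thesis by (rule LIMSEQ_unique)
      qed
      then show ?case using inc elim by blast
    qed
  qed
  have L: "(\<integral>\<^sup>+\<omega>. X (indicator C) \<omega> \<partial>P) = (SUP n. \<integral>\<^sup>+\<omega>. X (indicator (C \<inter> before (T n) (S n))) \<omega> \<partial>P)"
    if Xm: "\<And>n. X (indicator (C \<inter> before (T n) (S n))) \<in> borel_measurable P"
      and Xs: "\<And>\<omega>. \<omega> \<in> space P \<Longrightarrow> (\<And>s. incseq (\<lambda>n. indicator (C \<inter> before (T n) (S n)) (s, \<omega>) :: ennreal)) \<Longrightarrow>
         (\<And>s. 0 \<le> s \<Longrightarrow> (SUP n. indicator (C \<inter> before (T n) (S n)) (s, \<omega>) :: ennreal) = indicator C (s, \<omega>)) \<Longrightarrow>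
         X (indicator C) \<omega> = (SUP n. X (indicator (C \<inter> before (T n) (S n))) \<omega>) \<and> incseq (\<lambda>n. X (indicator (C \<inter> before (T n) (S n))) \<omega>)"
    for X :: "(real \<times> 'a \<Rightarrow> ennreal) \<Rightarrow> 'a \<Rightarrow> ennreal"
  proof -
    have ae: "AE \<omega> in P. X (indicator C) \<omega> = (SUP n. X (indicator (C \<inter> before (T n) (S n))) \<omega>) \<and> incseq (\<lambda>n. X (indicator (C \<inter> before (T n) (S n))) \<omega>)"
      using good by eventually_elim (rule Xs, blast+)
    have "(\<integral>\<^sup>+\<omega>. X (indicator C) \<omega> \<partial>P) = (\<integral>\<^sup>+\<omega>. (SUP n. X (indicator (C \<inter> before (T n) (S n))) \<omega>) \<partial>P)"
      using ae by (intro nn_integral_cong_AE) (auto elim!: eventually_mono)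
    also have "\<dots> = (SUP n. \<integral>\<^sup>+\<omega>. X (indicator (C \<inter> before (T n) (S n))) \<omega> \<partial>P)"
    proof (rule nn_integral_monotone_convergence_SUP_AE)
      show "AE \<omega> in P. X (indicator (C \<inter> before (T n) (S n))) \<omega> \<le> X (indicator (C \<inter> before (T (Suc n)) (S (Suc n)))) \<omega>" for n
        using ae by eventually_elim (simp add: incseq_Suc_iff)
    qed (rule Xm)
    finally show ?thesis .
  qed
  have "(\<integral>\<^sup>+\<omega>. jump_sum i t (indicator C) \<omega> \<partial>P) = (SUP n. \<integral>\<^sup>+\<omega>. jump_sum i t (indicator (C \<inter> before (T n) (S n))) \<omega> \<partial>P)"
  proof (rule L)
    show "jump_sum i t (indicator (C \<inter> before (T n) (S n))) \<in> borel_measurable P" for n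
      by (rule jump_sum_measurable_P[OF m t])
    fix \<omega>
    assume inc: "\<And>s. incseq (\<lambda>n. indicator (C \<inter> before (T n) (S n)) (s, \<omega>) :: ennreal)"
      and sup: "\<And>s. 0 \<le> s \<Longrightarrow> (SUP n. indicator (C \<inter> before (T n) (S n)) (s, \<omega>) :: ennreal) = indicator C (s, \<omega>)"
    have "jump_sum i t (indicator C) \<omega> = jump_sum i t (\<lambda>x. SUP n. indicator (C \<inter> before (T n) (S n)) x) \<omega>"
      by (rule jump_sum_cong) (use sup in auto)
    moreover have "incseq (\<lambda>n. jump_sum i t (indicator (C \<inter> before (T n) (S n))) \<omega>)"
      using inc unfolding jump_sum_def by (auto simp: incseq_def intro!: nn_integral_mono)
    ultimately show "jump_sum i t (indicator C) \<omega> = (SUP n. jump_sum i t (indicator (C \<inter> before (T n) (S n))) \<omega>) \<and>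
      incseq (\<lambda>n. jump_sum i t (indicator (C \<inter> before (T n) (S n))) \<omega>)"
      using jump_sum_SUP[where K="\<lambda>n. indicator (C \<inter> before (T n) (S n))", OF inc, of i t] by simp
  qed
  moreover have "(\<integral>\<^sup>+\<omega>. lam_integral i t (indicator C) \<omega> \<partial>P) = (SUP n. \<integral>\<^sup>+\<omega>. lam_integral i t (indicator (C \<inter> before (T n) (S n))) \<omega> \<partial>P)"
  proof (rule L)
    show "lam_integral i t (indicator (C \<inter> before (T n) (S n))) \<in> borel_measurable P" for n
      by (rule lam_integral_measurable_P[OF m t])
    fix \<omega>
    assume \<omega>: "\<omega> \<in> space P" and inc: "\<And>s. incseq (\<lambda>n. indicator (C \<inter> before (T n) (S n)) (s, \<omega>) :: ennreal)"
      and sup: "\<And>s. 0 \<le> s \<Longrightarrow> (SUP n. indicator (C \<inter> before (T n) (S n)) (s, \<omega>) :: ennreal) = indicator C (s, \<omega>)"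
    have "lam_integral i t (indicator C) \<omega> = lam_integral i t (\<lambda>x. SUP n. indicator (C \<inter> before (T n) (S n)) x) \<omega>"
      by (rule lam_integral_cong) (use sup in auto)
    moreover have "incseq (\<lambda>n. lam_integral i t (indicator (C \<inter> before (T n) (S n))) \<omega>)"
      using inc unfolding lam_integral_def by (auto simp: incseq_def intro!: nn_integral_mono mult_right_mono)
    ultimately show "lam_integral i t (indicator C) \<omega> = (SUP n. lam_integral i t (indicator (C \<inter> before (T n) (S n))) \<omega>) \<and>
      incseq (\<lambda>n. lam_integral i t (indicator (C \<inter> before (T n) (S n))) \<omega>)"
      using lam_integral_SUP[where K="\<lambda>n. indicator (C \<inter> before (T n) (S n))", OF m inc \<omega>, of i t] by simp
  qed
  ultimately show ?thesis using eq by simp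
qed

text \<open>\<open>\<integral>lam\<close> compensates \<open>N\<close>: both integrals of a nonnegative predictable integrand have the same expectation.\<close>

theorem compensation_formula:
  assumes K: "K \<in> borel_measurable PS" and t: "0 \<le> t"
  shows "(\<integral>\<^sup>+\<omega>. jump_sum i t K \<omega> \<partial>P) = (\<integral>\<^sup>+\<omega>. lam_integral i t K \<omega> \<partial>P)"
  using K
proof (induction rule: borel_measurable_induct)
  case (cong f g)
  have "(\<integral>\<^sup>+\<omega>. jump_sum i t f \<omega> \<partial>P) = (\<integral>\<^sup>+\<omega>. jump_sum i t g \<omega> \<partial>P)"
    by (intro nn_integral_cong jump_sum_cong) (use cong in auto)
  moreover have "(\<integral>\<^sup>+\<omega>. lam_integral i t f \<omega> \<partial>P) = (\<integral>\<^sup>+\<omega>. lam_integral i t g \<omega> \<partial>P)"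
    by (intro nn_integral_cong lam_integral_cong) (use cong in auto)
  ultimately show ?case using cong by simp
next
  case (set A) then show ?case by (rule compensation_set[OF t])
next
  case (mult u c)
  have "(\<integral>\<^sup>+\<omega>. jump_sum i t (\<lambda>x. c * u x) \<omega> \<partial>P) = c * (\<integral>\<^sup>+\<omega>. jump_sum i t u \<omega> \<partial>P)"
    using jump_sum_measurable_P[OF mult(2) t] by (simp add: jump_sum_cmult nn_integral_cmult)
  moreover have "(\<integral>\<^sup>+\<omega>. lam_integral i t (\<lambda>x. c * u x) \<omega> \<partial>P) = (\<integral>\<^sup>+\<omega>. c * lam_integral i t u \<omega> \<partial>P)"
    by (intro nn_integral_cong lam_integral_cmult mult)
  ultimately show ?case using mult lam_integral_measurable_P[OF mult(2) t] by (simp add: nn_integral_cmult)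
next
  case (add u v)
  have "(\<integral>\<^sup>+\<omega>. jump_sum i t (\<lambda>x. v x + u x) \<omega> \<partial>P) = (\<integral>\<^sup>+\<omega>. jump_sum i t v \<omega> \<partial>P) + (\<integral>\<^sup>+\<omega>. jump_sum i t u \<omega> \<partial>P)"
    using add jump_sum_measurable_P[OF _ t] by (simp add: jump_sum_add nn_integral_add)
  moreover have "(\<integral>\<^sup>+\<omega>. lam_integral i t (\<lambda>x. v x + u x) \<omega> \<partial>P) = (\<integral>\<^sup>+\<omega>. lam_integral i t v \<omega> + lam_integral i t u \<omega> \<partial>P)"
    by (intro nn_integral_cong lam_integral_add add)
  ultimately show ?case using add lam_integral_measurable_P[OF _ t] by (simp add: nn_integral_add)
next
  case (seq U)
  have inc: "incseq (\<lambda>n. U n (s, \<omega>))" for s \<omega> using seq(3) by (auto simp: incseq_def le_fun_def)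
  have KU: "K = (\<lambda>x. SUP n. U n x)" using seq(4) by (auto simp: SUP_apply[abs_def])
  have "(\<integral>\<^sup>+\<omega>. jump_sum i t K \<omega> \<partial>P) = (\<integral>\<^sup>+\<omega>. (SUP n. jump_sum i t (U n) \<omega>) \<partial>P)"
    unfolding KU by (intro nn_integral_cong jump_sum_SUP inc)
  also have "\<dots> = (SUP n. \<integral>\<^sup>+\<omega>. jump_sum i t (U n) \<omega> \<partial>P)"
  proof (rule nn_integral_monotone_convergence_SUP)
    show "incseq (\<lambda>n. jump_sum i t (U n))"
      using inc unfolding jump_sum_def by (auto simp: incseq_def le_fun_def intro!: nn_integral_mono)
  qed (rule jump_sum_measurable_P[OF seq(1) t])
  also have "\<dots> = (SUP n. \<integral>\<^sup>+\<omega>. lam_integral i t (U n) \<omega> \<partial>P)"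
    using seq.IH by simp
  also have "\<dots> = (\<integral>\<^sup>+\<omega>. (SUP n. lam_integral i t (U n) \<omega>) \<partial>P)"
  proof (rule nn_integral_monotone_convergence_SUP[symmetric])
    show "incseq (\<lambda>n. lam_integral i t (U n))"
      using inc unfolding lam_integral_def by (auto simp: incseq_def le_fun_def intro!: nn_integral_mono mult_right_mono)
  qed (rule lam_integral_measurable_P[OF seq(1) t])
  also have "\<dots> = (\<integral>\<^sup>+\<omega>. lam_integral i t K \<omega> \<partial>P)"
    unfolding KU by (intro nn_integral_cong lam_integral_SUP[symmetric] seq(1) inc)
  finally have *: "(\<integral>\<^sup>+\<omega>. jump_sum i t K \<omega> \<partial>P) = (\<integral>\<^sup>+\<omega>. lam_integral i t K \<omega> \<partial>P)" .
  show ?case using * unfolding seq(4) .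
qed

end

section \<open>Exponentials of predictable intensity ratios\<close>

context intensity_setup
begin

text \<open>A coordinatewise factor by which the intensity is to be multiplied: predictable and nonnegative.\<close>

definition intensity_factor :: "('d \<Rightarrow> real \<Rightarrow> 'a \<Rightarrow> real) \<Rightarrow> bool" where
  "intensity_factor g \<longleftrightarrow> (\<forall>i. (\<lambda>(s, \<omega>). g i s \<omega>) \<in> borel_measurable PS) \<and>
     (\<forall>i. \<forall>s\<ge>0. \<forall>\<omega>\<in>space P. 0 \<le> g i s \<omega>)"

text \<open>The drift subtracted in the logarithm of the exponential; \<open>0\<close> at negative times, so that its paths are
  Borel functions on the whole line.\<close>

definition drift :: "('d \<Rightarrow> real \<Rightarrow> 'a \<Rightarrow> real) \<Rightarrow> real \<Rightarrow> 'a \<Rightarrow> real" where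
  "drift g s \<omega> = (if 0 \<le> s then \<Sum>i\<in>UNIV. (g i s \<omega> - 1) * lam s \<omega> $ i else 0)"

text \<open>The jump times of all coordinates together.\<close>

definition all_jumps :: "'a \<Rightarrow> real set" where
  "all_jumps \<omega> = (\<Union>i. J i \<omega>)"

text \<open>The factor applied at time \<open>s\<close>. Distinct coordinates do not jump together, so that at most one index
  contributes.\<close>

definition jump_factor :: "('d \<Rightarrow> real \<Rightarrow> 'a \<Rightarrow> real) \<Rightarrow> real \<Rightarrow> 'a \<Rightarrow> real" where
  "jump_factor g s \<omega> = (\<Prod>i\<in>UNIV. if s \<in> J i \<omega> then g i s \<omega> else 1)"

text \<open>The explicit exponential
  \<open>exp (- \<Sum>\<^sub>i \<integral>\<^sub>0\<^sup>t (g\<^sub>i - 1) lam\<^sub>i ds) * \<Prod>\<^sub>i \<Prod>\<^sub>s g\<^sub>i s\<close>, with \<open>s\<close> over the jump times in \<open>{0<..t}\<close>, and its left limits.\<close>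

definition Z :: "('d \<Rightarrow> real \<Rightarrow> 'a \<Rightarrow> real) \<Rightarrow> real \<Rightarrow> 'a \<Rightarrow> real" where
  "Z g t \<omega> = path_exp (all_jumps \<omega>) (\<lambda>s. jump_factor g s \<omega>) (\<lambda>s. drift g s \<omega>) t"

definition Z_left :: "('d \<Rightarrow> real \<Rightarrow> 'a \<Rightarrow> real) \<Rightarrow> real \<Rightarrow> 'a \<Rightarrow> real" where
  "Z_left g t \<omega> = path_exp_left (all_jumps \<omega>) (\<lambda>s. jump_factor g s \<omega>) (\<lambda>s. drift g s \<omega>) t"

text \<open>Boundedness of the drift terms along one path up to time \<open>t\<close>.\<close>

definition drift_bounded :: "('d \<Rightarrow> real \<Rightarrow> 'a \<Rightarrow> real) \<Rightarrow> real \<Rightarrow> 'a \<Rightarrow> bool" where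
  "drift_bounded g t \<omega> \<longleftrightarrow> (\<exists>C. \<forall>i. \<forall>s\<in>{0..t}. \<bar>(g i s \<omega> - 1) * lam s \<omega> $ i\<bar> \<le> C)"

lemma factor_measurable: "intensity_factor g \<Longrightarrow> (\<lambda>(s, \<omega>). g i s \<omega>) \<in> borel_measurable PS"
  by (simp add: intensity_factor_def)

lemma factor_nonneg: "intensity_factor g \<Longrightarrow> 0 \<le> s \<Longrightarrow> \<omega> \<in> space P \<Longrightarrow> 0 \<le> g i s \<omega>"
  by (simp add: intensity_factor_def)

lemma finite_all_jumps: "\<omega> \<in> space P \<Longrightarrow> finite (all_jumps \<omega> \<inter> {0<..t})"
proof -
  assume \<omega>: "\<omega> \<in> space P"
  have "all_jumps \<omega> \<inter> {0<..t} = (\<Union>i. J i \<omega> \<inter> {0<..t})" by (auto simp: all_jumps_def)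
  then show ?thesis by (simp only: finite_UN_I[OF finite finite_J[OF \<omega>]])
qed

lemma drift_term_measurable:
  assumes "intensity_factor g"
  shows "(\<lambda>(s, \<omega>). (g i s \<omega> - 1) * lam s \<omega> $ i) \<in> borel_measurable PS"
  using factor_measurable[OF assms, of i] lam_measurable[of i] by (simp add: case_prod_beta')

lemma drift_measurable:
  assumes g: "intensity_factor g"
  shows "(\<lambda>(s, \<omega>). drift g s \<omega>) \<in> borel_measurable PS"
proof -
  have "(\<lambda>x. \<Sum>i\<in>UNIV. (g i (fst x) (snd x) - 1) * lam (fst x) (snd x) $ i) \<in> borel_measurable PS"
    using drift_term_measurable[OF g] by (intro borel_measurable_sum) (simp add: case_prod_beta')
  then show ?thesis by (rule measurable_cong[THEN iffD1, rotated]) (auto simp: drift_def)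
qed

lemma drift_section: 
  assumes g: "intensity_factor g" and \<omega>: "\<omega> \<in> space P"
  shows "(\<lambda>s. drift g s \<omega>) \<in> borel_measurable borel"
proof -
  have "(\<lambda>s. if 0 \<le> s then drift g s \<omega> else 0) = (\<lambda>s. drift g s \<omega>)" by (auto simp: drift_def)
  with predictable_section[OF drift_measurable[OF g] \<omega>] show ?thesis by simp
qed

lemma drift_bound:
  assumes "drift_bounded g t \<omega>"
  shows "\<exists>C. \<forall>s\<in>{0..t}. \<bar>drift g s \<omega>\<bar> \<le> C"
proof -
  obtain C where C: "\<And>i s. s \<in> {0..t} \<Longrightarrow> \<bar>(g i s \<omega> - 1) * lam s \<omega> $ i\<bar> \<le> C"
    using assms unfolding drift_bounded_def by blast
  have "\<bar>drift g s \<omega>\<bar> \<le> real CARD('d) * C" if "s \<in> {0..t}" for s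
  proof -
    have "\<bar>drift g s \<omega>\<bar> \<le> (\<Sum>i\<in>UNIV. \<bar>(g i s \<omega> - 1) * lam s \<omega> $ i\<bar>)"
      using that by (simp add: drift_def sum_abs)
    also have "\<dots> \<le> (\<Sum>i\<in>(UNIV::'d set). C)" using C that by (intro sum_mono) auto
    finally show ?thesis by simp
  qed
  then show ?thesis by blast
qed

lemma drift_terms_integrable:
  assumes g: "intensity_factor g" and \<omega>: "\<omega> \<in> space P" and bd: "drift_bounded g t \<omega>" and u: "0 \<le> u"
  shows "set_integrable lborel {u..t} (\<lambda>s. (g i s \<omega> - 1) * lam s \<omega> $ i)"
proof -
  obtain C where C: "\<And>i s. s \<in> {0..t} \<Longrightarrow> \<bar>(g i s \<omega> - 1) * lam s \<omega> $ i\<bar> \<le> C"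
    using bd unfolding drift_bounded_def by blast
  show ?thesis by (rule section_set_integrable[OF drift_term_measurable[OF g] \<omega> _ u, of _ _ C]) (rule C)
qed

lemma drift_integral:
  assumes g: "intensity_factor g" and \<omega>: "\<omega> \<in> space P" and bd: "drift_bounded g t \<omega>" and u: "0 \<le> u"
  shows "(LINT s:{u..t}|lborel. drift g s \<omega>) = (\<Sum>i\<in>UNIV. LINT s:{u..t}|lborel. (g i s \<omega> - 1) * lam s \<omega> $ i)"
proof -
  have "(LINT s:{u..t}|lborel. drift g s \<omega>) = (LINT s:{u..t}|lborel. \<Sum>i\<in>UNIV. (g i s \<omega> - 1) * lam s \<omega> $ i)"
    by (rule set_lebesgue_integral_cong) (use u in \<open>auto simp: drift_def\<close>)
  also have "\<dots> = (\<Sum>i\<in>UNIV. LINT s:{u..t}|lborel. (g i s \<omega> - 1) * lam s \<omega> $ i)"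
    by (rule set_integral_finite_sum(2)) (rule drift_terms_integrable[OF g \<omega> bd u])
  finally show ?thesis .
qed

lemma jump_factor_eq:
  assumes \<omega>: "\<omega> \<in> space P" and s: "s \<in> J i \<omega>"
  shows "jump_factor g s \<omega> = g i s \<omega>"
proof -
  have "s \<notin> J j \<omega>" if "j \<noteq> i" for j using J_disjoint[OF \<omega> that] s by blast
  then have "jump_factor g s \<omega> = (\<Prod>j\<in>UNIV. if j = i then g i s \<omega> else 1)"
    unfolding jump_factor_def using s by (intro prod.cong) auto
  then show ?thesis by simp
qed

lemma sum_all_jumps:
  assumes \<omega>: "\<omega> \<in> space P" and u: "0 \<le> u"
  shows "(\<Sum>s\<in>all_jumps \<omega> \<inter> {u<..t}. f s) = (\<Sum>i\<in>UNIV. \<Sum>s\<in>J i \<omega> \<inter> {u<..t}. f s)"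
proof -
  have "all_jumps \<omega> \<inter> {u<..t} = (\<Union>i\<in>UNIV. J i \<omega> \<inter> {u<..t})" by (auto simp: all_jumps_def)
  then show ?thesis
  proof (simp only:, intro sum.UNION_disjoint ballI impI)
    fix i j :: 'd assume "i \<noteq> j"
    then show "J i \<omega> \<inter> {u<..t} \<inter> (J j \<omega> \<inter> {u<..t}) = {}" using J_disjoint[OF \<omega>, of i j] by blast
  qed (use finite_J'[OF \<omega> u] in auto)
qed

lemma prod_all_jumps:
  assumes \<omega>: "\<omega> \<in> space P" and u: "0 \<le> u"
  shows "(\<Prod>s\<in>all_jumps \<omega> \<inter> {u<..t}. jump_factor g s \<omega>) = (\<Prod>i\<in>UNIV. \<Prod>s\<in>J i \<omega> \<inter> {u<..t}. g i s \<omega>)"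
proof -
  have "all_jumps \<omega> \<inter> {u<..t} = (\<Union>i\<in>UNIV. J i \<omega> \<inter> {u<..t})" by (auto simp: all_jumps_def)
  then have "(\<Prod>s\<in>all_jumps \<omega> \<inter> {u<..t}. jump_factor g s \<omega>) = (\<Prod>i\<in>UNIV. \<Prod>s\<in>J i \<omega> \<inter> {u<..t}. jump_factor g s \<omega>)"
  proof (simp only:, intro prod.UNION_disjoint ballI impI)
    fix i j :: 'd assume "i \<noteq> j"
    then show "J i \<omega> \<inter> {u<..t} \<inter> (J j \<omega> \<inter> {u<..t}) = {}" using J_disjoint[OF \<omega>, of i j] by blast
  qed (use finite_J'[OF \<omega> u] in auto)
  also have "\<dots> = (\<Prod>i\<in>UNIV. \<Prod>s\<in>J i \<omega> \<inter> {u<..t}. g i s \<omega>)"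
    using jump_factor_eq[OF \<omega>] by (intro prod.cong) auto
  finally show ?thesis .
qed

lemma Z_eq:
  assumes "\<omega> \<in> space P"
  shows "Z g t \<omega> = exp (- (LINT s:{0..t}|lborel. drift g s \<omega>)) * (\<Prod>i\<in>UNIV. \<Prod>s\<in>J i \<omega> \<inter> {0<..t}. g i s \<omega>)"
  unfolding Z_def path_exp_def using prod_all_jumps[OF assms, of 0 g t] by simp

lemma Z_nonneg:
  assumes g: "intensity_factor g" and \<omega>: "\<omega> \<in> space P"
  shows "0 \<le> Z g t \<omega>"
  unfolding Z_eq[OF \<omega>] using factor_nonneg[OF g _ \<omega>] by (intro mult_nonneg_nonneg prod_nonneg) auto

lemma Z_0:
  assumes \<omega>: "\<omega> \<in> space P"
  shows "Z g 0 \<omega> = 1" "Z_left g 0 \<omega> = 1"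
proof -
  have "(LINT s:{0..0::real}|lborel. drift g s \<omega>) = 0"
  proof -
    have "AE x in lborel. indicator {0..0::real} x *\<^sub>R drift g x \<omega> = 0"
      using AE_lborel_singleton[of 0] by eventually_elim auto
    then show ?thesis unfolding set_lebesgue_integral_def by (rule integral_eq_zero_AE)
  qed
  then show "Z g 0 \<omega> = 1" "Z_left g 0 \<omega> = 1"
    by (auto simp: Z_def Z_left_def path_exp_def path_exp_left_def)
qed

lemma prod_jumps_measurable:
  assumes g: "intensity_factor g" and t: "0 \<le> t"
  shows "(\<lambda>\<omega>. \<Prod>s\<in>J i \<omega> \<inter> {0<..t}. g i s \<omega>) \<in> borel_measurable (F (ennreal t))"
proof -
  (* the product is read off from sums over the jumps: the number of zero factors and the sum of logarithms *)
  define Kz where "Kz x = (indicator {y. g i (fst y) (snd y) = 0} x :: ennreal)" for x :: "real \<times> 'a"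
  define Kp where "Kp x = ennreal (ln (g i (fst x) (snd x)))" for x :: "real \<times> 'a"
  define Kn where "Kn x = ennreal (- ln (g i (fst x) (snd x)))" for x :: "real \<times> 'a"
  have gm: "(\<lambda>x. g i (fst x) (snd x)) \<in> borel_measurable PS"
    using factor_measurable[OF g, of i] by (simp add: case_prod_beta')
  have "(\<lambda>x. if g i (fst x) (snd x) = 0 then 1 else 0 :: ennreal) \<in> borel_measurable PS"
    using gm by measurable
  then have m: "Kz \<in> borel_measurable PS" "Kp \<in> borel_measurable PS" "Kn \<in> borel_measurable PS"
    using gm unfolding Kz_def[abs_def] Kp_def[abs_def] Kn_def[abs_def] by (simp_all add: indicator_def of_bool_def)
  have eq: "(\<Prod>s\<in>J i \<omega> \<inter> {0<..t}. g i s \<omega>) = (if jump_sum i t Kz \<omega> = 0 then exp (enn2real (jump_sum i t Kp \<omega>) - enn2real (jump_sum i t Kn \<omega>)) else 0)"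
    if \<omega>: "\<omega> \<in> space P" for \<omega>
  proof (cases "\<exists>s\<in>J i \<omega> \<inter> {0<..t}. g i s \<omega> = 0")
    case True
    then obtain s where s: "s \<in> J i \<omega> \<inter> {0<..t}" "g i s \<omega> = 0" by blast
    then have "Kz (s, \<omega>) \<noteq> 0" by (simp add: Kz_def)
    then have "jump_sum i t Kz \<omega> \<noteq> 0"
      unfolding jump_sum_eq[OF \<omega>] sum_eq_0_iff[OF finite_J[OF \<omega>]] using s(1) by blast
    moreover have "(\<Prod>s\<in>J i \<omega> \<inter> {0<..t}. g i s \<omega>) = 0" using True finite_J[OF \<omega>, of i t] by (auto simp: prod_zero_iff)
    ultimately show ?thesis by simp
  next
    case False
    then have pos: "0 < g i s \<omega>" if "s \<in> J i \<omega> \<inter> {0<..t}" for s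
      using that factor_nonneg[OF g _ \<omega>, of s i] by force
    have z: "jump_sum i t Kz \<omega> = 0" using False by (auto simp: jump_sum_eq[OF \<omega>] Kz_def intro!: sum.neutral)
    have "enn2real (jump_sum i t Kp \<omega>) - enn2real (jump_sum i t Kn \<omega>) = (\<Sum>s\<in>J i \<omega> \<inter> {0<..t}. ln (g i s \<omega>))"
      using enn2real_jump_sum[OF \<omega>, of i t "\<lambda>s \<omega>. ln (g i s \<omega>)"] enn2real_jump_sum[OF \<omega>, of i t "\<lambda>s \<omega>. - ln (g i s \<omega>)"]
      unfolding Kp_def[abs_def] Kn_def[abs_def] by (simp add: sum_subtractf[symmetric]) (intro sum.cong, auto simp: max_def)
    moreover have "exp (\<Sum>s\<in>J i \<omega> \<inter> {0<..t}. ln (g i s \<omega>)) = (\<Prod>s\<in>J i \<omega> \<inter> {0<..t}. g i s \<omega>)"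
      using pos finite_J[OF \<omega>, of i t] by (subst exp_sum) (auto intro!: prod.cong)
    ultimately show ?thesis using z by simp
  qed
  have "(\<lambda>\<omega>. if jump_sum i t Kz \<omega> = 0 then exp (enn2real (jump_sum i t Kp \<omega>) - enn2real (jump_sum i t Kn \<omega>)) else 0) \<in> borel_measurable (F (ennreal t))"
    using jump_sum_measurable[OF m(1) t, of i] jump_sum_measurable[OF m(2) t, of i] jump_sum_measurable[OF m(3) t, of i] by measurable
  then show ?thesis by (rule measurable_cong[THEN iffD1, rotated]) (simp add: eq space_F)
qed

lemma Z_adapted:
  assumes g: "intensity_factor g" and t: "0 \<le> t"
  shows "Z g t \<in> borel_measurable (F (ennreal t))"
proof -
  have 1: "(\<lambda>\<omega>. LINT s:{0..t}|lborel. drift g s \<omega>) \<in> borel_measurable (F (ennreal t))"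
    by (rule predictable_lebesgue_integral_measurable[OF drift_measurable[OF g] t]) simp
  have 2: "(\<lambda>\<omega>. \<Prod>i\<in>UNIV. \<Prod>s\<in>J i \<omega> \<inter> {0<..t}. g i s \<omega>) \<in> borel_measurable (F (ennreal t))"
    by (rule borel_measurable_prod) (rule prod_jumps_measurable[OF g t])
  have "(\<lambda>\<omega>. exp (- (LINT s:{0..t}|lborel. drift g s \<omega>)) * (\<Prod>i\<in>UNIV. \<Prod>s\<in>J i \<omega> \<inter> {0<..t}. g i s \<omega>)) \<in> borel_measurable (F (ennreal t))"
    using 1 2 by measurable
  then show ?thesis by (rule measurable_cong[THEN iffD1, rotated]) (simp add: Z_eq space_F)
qed

lemma Z_measurable: "intensity_factor g \<Longrightarrow> 0 \<le> t \<Longrightarrow> Z g t \<in> borel_measurable P"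
  by (rule measurable_F_P[OF Z_adapted])

lemma Z_left_limit:
  assumes g: "intensity_factor g" and \<omega>: "\<omega> \<in> space P" and bd: "drift_bounded g t \<omega>" and t: "0 < t"
  shows "((\<lambda>s. Z g s \<omega>) \<longlongrightarrow> Z_left g t \<omega>) (at_left t)"
proof -
  obtain C where C: "\<And>s. s \<in> {0..t} \<Longrightarrow> \<bar>drift g s \<omega>\<bar> \<le> C" using drift_bound[OF bd] by blast
  show ?thesis unfolding Z_def[abs_def] Z_left_def
    by (rule path_exp_left_limit[OF drift_section[OF g \<omega>] C finite_all_jumps[OF \<omega>] t order_refl])
qed

lemma Z_right_limit:
  assumes g: "intensity_factor g" and \<omega>: "\<omega> \<in> space P" and bd: "drift_bounded g T \<omega>" and t: "0 \<le> t" "t < T"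
  shows "((\<lambda>s. Z g s \<omega>) \<longlongrightarrow> Z g t \<omega>) (at_right t)"
proof -
  obtain C where C: "\<And>s. s \<in> {0..T} \<Longrightarrow> \<bar>drift g s \<omega>\<bar> \<le> C" using drift_bound[OF bd] by blast
  show ?thesis unfolding Z_def[abs_def]
    by (rule path_exp_right_limit[OF drift_section[OF g \<omega>] C finite_all_jumps[OF \<omega>] t])
qed

lemma Z_equation:
  assumes g: "intensity_factor g" and \<omega>: "\<omega> \<in> space P" and bd: "drift_bounded g t \<omega>" and t: "0 \<le> t"
  shows "set_integrable lborel {0..t} (\<lambda>s. Z_left g s \<omega> * drift g s \<omega>)" (is ?A)
    and "Z g t \<omega> = 1 + (\<Sum>i\<in>UNIV. \<Sum>s\<in>J i \<omega> \<inter> {0<..t}. Z_left g s \<omega> * (g i s \<omega> - 1))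
      - (LINT s:{0..t}|lborel. Z_left g s \<omega> * drift g s \<omega>)" (is ?B)
proof -
  obtain C where C: "\<And>s. s \<in> {0..t} \<Longrightarrow> \<bar>drift g s \<omega>\<bar> \<le> C" using drift_bound[OF bd] by blast
  note eq = path_exp_equation[OF drift_section[OF g \<omega>] C finite_all_jumps[OF \<omega>] t order_refl,
      of "\<lambda>s. jump_factor g s \<omega>", folded Z_def Z_left_def]
  show ?A using eq(1) by simp
  have "(\<Sum>s\<in>all_jumps \<omega> \<inter> {0<..t}. Z_left g s \<omega> * (jump_factor g s \<omega> - 1)) = (\<Sum>i\<in>UNIV. \<Sum>s\<in>J i \<omega> \<inter> {0<..t}. Z_left g s \<omega> * (g i s \<omega> - 1))"
    unfolding sum_all_jumps[OF \<omega> order_refl] using jump_factor_eq[OF \<omega>] by (intro sum.cong) auto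
  then show ?B using eq(2) by simp
qed

subsection \<open>Factors that are active only while everything is bounded\<close>

text \<open>The number of jumps strictly before \<open>s\<close>; this makes it predictable.\<close>

definition jump_count :: "'d \<Rightarrow> real \<Rightarrow> 'a \<Rightarrow> real" where
  "jump_count i s \<omega> = real (card (J i \<omega> \<inter> {0<..<s}))"

text \<open>The factor differs from \<open>1\<close> only when it, the intensity and the number of earlier jumps are at most \<open>n\<close>.
  At most \<open>n + 1\<close> jumps of each coordinate then carry a factor other than \<open>1\<close>, so the exponential is bounded on
  bounded time intervals.\<close>

definition tame :: "nat \<Rightarrow> ('d \<Rightarrow> real \<Rightarrow> 'a \<Rightarrow> real) \<Rightarrow> bool" where
  "tame n g \<longleftrightarrow> intensity_factor g \<and> (\<forall>i. \<forall>s\<ge>0. \<forall>\<omega>\<in>space P. g i s \<omega> = 1 \<or>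
     (g i s \<omega> \<le> real n \<and> lam s \<omega> $ i \<le> real n \<and> jump_count i s \<omega> \<le> real n))"

context
  fixes n :: nat and g :: "'d \<Rightarrow> real \<Rightarrow> 'a \<Rightarrow> real"
  assumes tame: "tame n g" and n: "1 \<le> n"
begin

lemma tame_factor: "intensity_factor g"
  using tame by (simp add: tame_def)

lemma tame_drift_term:
  assumes "0 \<le> s" "\<omega> \<in> space P"
  shows "\<bar>g i s \<omega> - 1\<bar> * lam s \<omega> $ i \<le> real n * real n"
proof -
  have g0: "0 \<le> g i s \<omega>" by (rule factor_nonneg[OF tame_factor assms])
  have l0: "0 \<le> lam s \<omega> $ i" by (rule lam_nn[OF assms])
  have "g i s \<omega> = 1 \<or> (g i s \<omega> \<le> real n \<and> lam s \<omega> $ i \<le> real n)"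
    using tame assms unfolding tame_def by blast
  then show ?thesis
  proof
    assume "g i s \<omega> \<le> real n \<and> lam s \<omega> $ i \<le> real n"
    moreover from this have "\<bar>g i s \<omega> - 1\<bar> \<le> real n" using g0 n by auto
    ultimately show ?thesis using l0 by (intro mult_mono) auto
  qed simp
qed

lemma tame_drift_bounded: "\<omega> \<in> space P \<Longrightarrow> drift_bounded g t \<omega>"
  unfolding drift_bounded_def
  using tame_drift_term lam_nn by (intro exI[of _ "real n * real n"]) (auto simp: abs_mult)

lemma tame_drift_bound: 
  assumes "\<omega> \<in> space P"
  shows "\<bar>drift g s \<omega>\<bar> \<le> real CARD('d) * (real n * real n)"
proof (cases "0 \<le> s")
  case True
  have "\<bar>drift g s \<omega>\<bar> \<le> (\<Sum>i\<in>UNIV. \<bar>(g i s \<omega> - 1) * lam s \<omega> $ i\<bar>)"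
    using True by (simp add: drift_def sum_abs)
  also have "\<dots> \<le> (\<Sum>i\<in>(UNIV::'d set). real n * real n)"
    using tame_drift_term[OF True assms] lam_nn[OF True assms] by (intro sum_mono) (auto simp: abs_mult)
  finally show ?thesis by simp
qed (simp add: drift_def)

lemma tame_prod_bound:
  assumes \<omega>: "\<omega> \<in> space P"
  shows "(\<Prod>s\<in>J i \<omega> \<inter> {0<..t}. g i s \<omega>) \<le> real n ^ Suc n"
proof -
  define U where "U = J i \<omega> \<inter> {0<..t}"
  define V where "V = {s \<in> U. jump_count i s \<omega> \<le> real n}"
  have fU: "finite U" unfolding U_def by (rule finite_J[OF \<omega>])
  then have fV: "finite V" by (simp add: V_def)
  have "(\<Prod>s\<in>U. g i s \<omega>) \<le> (\<Prod>s\<in>U. if s \<in> V then real n else 1)"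
  proof (rule prod_mono)
    fix s assume s: "s \<in> U"
    then have s0: "0 \<le> s" by (auto simp: U_def)
    have "g i s \<omega> = 1 \<or> (g i s \<omega> \<le> real n \<and> jump_count i s \<omega> \<le> real n)"
      using tame s0 \<omega> unfolding tame_def by blast
    then show "0 \<le> g i s \<omega> \<and> g i s \<omega> \<le> (if s \<in> V then real n else 1)"
      using factor_nonneg[OF tame_factor s0 \<omega>, of i] n s by (auto simp: V_def)
  qed
  also have "\<dots> = real n ^ card V"
  proof -
    have "(\<Prod>s\<in>U. if s \<in> V then real n else 1) = (\<Prod>s\<in>U \<inter> V. real n)" by (rule prod.inter_restrict[OF fU, symmetric])
    moreover have "U \<inter> V = V" by (auto simp: V_def)
    ultimately show ?thesis by simp
  qed
  also have "\<dots> \<le> real n ^ Suc n"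
  proof (rule power_increasing)
    have inj: "inj_on (\<lambda>s. card (J i \<omega> \<inter> {0<..<s})) V"
    proof (rule linorder_inj_onI)
      fix x y assume xy: "x < y" "x \<in> V" "y \<in> V"
      have "finite (J i \<omega> \<inter> {0<..<y})" by (rule finite_subset[OF _ finite_J[OF \<omega>, of i y]]) auto
      moreover have "J i \<omega> \<inter> {0<..<x} \<subset> J i \<omega> \<inter> {0<..<y}" using xy by (auto simp: V_def U_def)
      ultimately have "card (J i \<omega> \<inter> {0<..<x}) < card (J i \<omega> \<inter> {0<..<y})" by (rule psubset_card_mono)
      then show "card (J i \<omega> \<inter> {0<..<x}) \<noteq> card (J i \<omega> \<inter> {0<..<y})" by simp
    qed auto
    have "card V = card ((\<lambda>s. card (J i \<omega> \<inter> {0<..<s})) ` V)" using inj by (simp add: card_image)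
    also have "\<dots> \<le> card {..n}" by (rule card_mono) (auto simp: V_def jump_count_def)
    finally show "card V \<le> Suc n" by simp
    show "1 \<le> real n" using n by simp
  qed
  finally show ?thesis by (simp add: U_def)
qed

text \<open>A bound for the exponential of a tame factor on \<open>{0..t}\<close>.\<close>

definition tame_bound :: "real \<Rightarrow> real" where
  "tame_bound t = exp (real CARD('d) * (real n * real n) * t) * (real n ^ Suc n) ^ CARD('d)"

lemma tame_Z_bound:
  assumes \<omega>: "\<omega> \<in> space P" and s: "0 \<le> s" "s \<le> t"
  shows "Z g s \<omega> \<le> tame_bound t"
proof -
  let ?D = "real CARD('d) * (real n * real n)"
  have "\<bar>LINT r:{0..s}|lborel. drift g r \<omega>\<bar> \<le> ?D * (s - 0)"
    using tame_drift_bound[OF \<omega>] s by (intro set_integral_abs_bound) auto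
  also have "\<dots> \<le> ?D * t" using s by (intro mult_left_mono) auto
  finally have 1: "exp (- (LINT r:{0..s}|lborel. drift g r \<omega>)) \<le> exp (?D * t)" by simp
  have "(\<Prod>i\<in>UNIV. \<Prod>s\<in>J i \<omega> \<inter> {0<..s}. g i s \<omega>) \<le> (\<Prod>i\<in>(UNIV::'d set). real n ^ Suc n)"
    using tame_prod_bound[OF \<omega>] factor_nonneg[OF tame_factor _ \<omega>]
    by (intro prod_mono conjI prod_nonneg) auto
  then have 2: "(\<Prod>i\<in>UNIV. \<Prod>s\<in>J i \<omega> \<inter> {0<..s}. g i s \<omega>) \<le> (real n ^ Suc n) ^ CARD('d)" by simp
  show ?thesis
    unfolding Z_eq[OF \<omega>] tame_bound_def using 1 2 factor_nonneg[OF tame_factor _ \<omega>]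
    by (intro mult_mono prod_nonneg) (auto intro!: prod_nonneg)
qed

lemma tame_Z_left_bound:
  assumes \<omega>: "\<omega> \<in> space P" and s: "0 \<le> s" "s \<le> t"
  shows "0 \<le> Z_left g s \<omega>" "Z_left g s \<omega> \<le> tame_bound t"
proof -
  have "0 \<le> Z_left g s \<omega> \<and> Z_left g s \<omega> \<le> tame_bound t"
  proof (cases "s = 0")
    case True
    have "Z g 0 \<omega> \<le> tame_bound t" using tame_Z_bound[OF \<omega>, of 0 t] s by simp
    then show ?thesis using Z_0[OF \<omega>] True by simp
  next
    case False
    then have s0: "0 < s" using s by simp
    have lim: "((\<lambda>r. Z g r \<omega>) \<longlongrightarrow> Z_left g s \<omega>) (at_left s)"
      by (rule Z_left_limit[OF tame_factor \<omega> tame_drift_bounded[OF \<omega>] s0])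
    have "eventually (\<lambda>r. 0 \<le> Z g r \<omega> \<and> Z g r \<omega> \<le> tame_bound t) (at_left s)"
      using eventually_at_left_real[OF s0]
    proof eventually_elim
      case (elim r)
      then show ?case using tame_Z_bound[OF \<omega>, of r t] Z_nonneg[OF tame_factor \<omega>] s by auto
    qed
    then have e: "eventually (\<lambda>r. 0 \<le> Z g r \<omega>) (at_left s)" "eventually (\<lambda>r. Z g r \<omega> \<le> tame_bound t) (at_left s)"
      by (auto elim: eventually_mono)
    show ?thesis
      using tendsto_lowerbound[OF lim e(1)] tendsto_upperbound[OF lim e(2)] by simp
  qed
  then show "0 \<le> Z_left g s \<omega>" "Z_left g s \<omega> \<le> tame_bound t" by auto
qed

lemma tame_Z_left_measurable: "(\<lambda>(s, \<omega>). Z_left g s \<omega>) \<in> borel_measurable PS"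
  by (rule predictable_left_limit[where Y = "Z g" and c = 1])
     (auto intro!: Z_adapted Z_left_limit tame_factor tame_drift_bounded Z_0)

text \<open>Insert the equation for \<open>Z\<close> and apply the compensation formula to the positive and the negative part of
  \<open>Z\<^sub>- (g - 1)\<close>; boundedness makes all terms integrable.\<close>

lemma tame_expectation:
  assumes t: "0 \<le> t"
  shows "integrable P (Z g t)" "(LINT \<omega>|P. Z g t \<omega>) = 1"
proof -
  define B where "B = tame_bound t"
  have B0: "0 \<le> B" by (simp add: B_def tame_bound_def)
  define Kp where "Kp i x = ennreal (Z_left g (fst x) (snd x) * (g i (fst x) (snd x) - 1))" for i and x :: "real \<times> 'a"
  define Kn where "Kn i x = ennreal (Z_left g (fst x) (snd x) * (1 - g i (fst x) (snd x)))" for i and x :: "real \<times> 'a"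
  have zm: "(\<lambda>x. Z_left g (fst x) (snd x)) \<in> borel_measurable PS" "(\<lambda>x. g i (fst x) (snd x)) \<in> borel_measurable PS" for i
    using tame_Z_left_measurable factor_measurable[OF tame_factor, of i] by (simp_all add: case_prod_beta')
  have Km: "Kp i \<in> borel_measurable PS" "Kn i \<in> borel_measurable PS" for i
    unfolding Kp_def[abs_def] Kn_def[abs_def] using zm by measurable
  let ?c = "B * (real n * real n)"
  have lamb: "lam_integral i t K \<omega> \<le> ennreal (?c * t)"
    if K: "\<And>s. 0 \<le> s \<Longrightarrow> s \<le> t \<Longrightarrow> K (s, \<omega>) \<le> ennreal (Z_left g s \<omega> * \<bar>g i s \<omega> - 1\<bar>)" and \<omega>: "\<omega> \<in> space P" for i K \<omega>
  proof -
    have "lam_integral i t K \<omega> \<le> (\<integral>\<^sup>+s. ennreal ?c * indicator {0..t} s \<partial>lborel)"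
      unfolding lam_integral_def
    proof (rule nn_integral_mono)
      fix s :: real
      show "K (s, \<omega>) * ennreal (lam s \<omega> $ i) * indicator {0..t} s \<le> ennreal ?c * indicator {0..t} s"
      proof (cases "s \<in> {0..t}")
        case True
        then have s: "0 \<le> s" "s \<le> t" by auto
        have "K (s, \<omega>) * ennreal (lam s \<omega> $ i) \<le> ennreal (Z_left g s \<omega> * \<bar>g i s \<omega> - 1\<bar>) * ennreal (lam s \<omega> $ i)"
          by (intro mult_right_mono K s) simp
        also have "\<dots> = ennreal (Z_left g s \<omega> * (\<bar>g i s \<omega> - 1\<bar> * lam s \<omega> $ i))"
          using tame_Z_left_bound(1)[OF \<omega> s] lam_nn[OF s(1) \<omega>, of i] by (subst ennreal_mult[symmetric]) (auto simp: mult.assoc)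
        also have "\<dots> \<le> ennreal ?c"
          using tame_Z_left_bound[OF \<omega> s] tame_drift_term[OF s(1) \<omega>, of i] lam_nn[OF s(1) \<omega>, of i]
          by - (rule ennreal_leI, rule mult_mono, auto simp: B_def B0[unfolded B_def])
        finally show ?thesis using True by simp
      qed simp
    qed
    also have "\<dots> = ennreal (?c * t)" using t B0 by (simp add: nn_integral_cmult ennreal_mult)
    finally show ?thesis .
  qed
  have Kb: "lam_integral i t (Kp i) \<omega> \<le> ennreal (?c * t)" "lam_integral i t (Kn i) \<omega> \<le> ennreal (?c * t)" if \<omega>: "\<omega> \<in> space P" for i \<omega>
  proof -
    show "lam_integral i t (Kp i) \<omega> \<le> ennreal (?c * t)"
      by (rule lamb[OF _ \<omega>]) (use tame_Z_left_bound(1)[OF \<omega>] in \<open>auto simp: Kp_def intro!: ennreal_leI mult_left_mono\<close>)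
    show "lam_integral i t (Kn i) \<omega> \<le> ennreal (?c * t)"
      by (rule lamb[OF _ \<omega>]) (use tame_Z_left_bound(1)[OF \<omega>] in \<open>auto simp: Kn_def intro!: ennreal_leI mult_left_mono\<close>)
  qed
  have R: "integrable P (\<lambda>\<omega>. enn2real (jump_sum i t K \<omega>)) \<and> integrable P (\<lambda>\<omega>. enn2real (lam_integral i t K \<omega>)) \<and>
      (LINT \<omega>|P. enn2real (jump_sum i t K \<omega>)) = (LINT \<omega>|P. enn2real (lam_integral i t K \<omega>))"
    if Km: "K \<in> borel_measurable PS" and Kb: "\<And>\<omega>. \<omega> \<in> space P \<Longrightarrow> lam_integral i t K \<omega> \<le> ennreal (?c * t)" for i K
  proof -
    note cf = compensation_formula[OF Km t, of i]
    have m: "jump_sum i t K \<in> borel_measurable P" "lam_integral i t K \<in> borel_measurable P"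
      by (rule jump_sum_measurable_P[OF Km t], rule lam_integral_measurable_P[OF Km t])
    have "(\<integral>\<^sup>+\<omega>. lam_integral i t K \<omega> \<partial>P) \<le> (\<integral>\<^sup>+\<omega>. ennreal (?c * t) \<partial>P)"
      by (rule nn_integral_mono) (rule Kb)
    also have "\<dots> < \<infinity>" by (simp add: emeasure_space_1)
    finally have fin: "(\<integral>\<^sup>+\<omega>. lam_integral i t K \<omega> \<partial>P) < \<infinity>" .
    have E: "integrable P (\<lambda>\<omega>. enn2real (f \<omega>)) \<and> ennreal (LINT \<omega>|P. enn2real (f \<omega>)) = (\<integral>\<^sup>+\<omega>. f \<omega> \<partial>P)"
      if f: "f \<in> borel_measurable P" "(\<integral>\<^sup>+\<omega>. f \<omega> \<partial>P) < \<infinity>" for f :: "'a \<Rightarrow> ennreal"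
    proof -
      have "AE \<omega> in P. f \<omega> \<noteq> \<infinity>" using nn_integral_noteq_infinite[OF f(1)] f(2) by auto
      then have eq: "(\<integral>\<^sup>+\<omega>. ennreal (enn2real (f \<omega>)) \<partial>P) = (\<integral>\<^sup>+\<omega>. f \<omega> \<partial>P)"
        by (intro nn_integral_cong_AE) (auto elim!: eventually_mono simp: less_top)
      have i: "integrable P (\<lambda>\<omega>. enn2real (f \<omega>))"
        by (rule integrableI_nonneg) (use f eq in auto)
      moreover have "ennreal (LINT \<omega>|P. enn2real (f \<omega>)) = (\<integral>\<^sup>+\<omega>. ennreal (enn2real (f \<omega>)) \<partial>P)"
        by (rule nn_integral_eq_integral[OF i, symmetric]) simp
      ultimately show ?thesis using eq by simp
    qed
    have "ennreal (LINT \<omega>|P. enn2real (jump_sum i t K \<omega>)) = ennreal (LINT \<omega>|P. enn2real (lam_integral i t K \<omega>))"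
      using E[OF m(1)] E[OF m(2) fin] cf fin by simp
    then have "(LINT \<omega>|P. enn2real (jump_sum i t K \<omega>)) = (LINT \<omega>|P. enn2real (lam_integral i t K \<omega>))"
      by (subst (asm) ennreal_inj) (auto intro!: integral_nonneg_AE)
    then show ?thesis using E[OF m(1)] E[OF m(2) fin] cf fin by simp
  qed
  note Rp = R[OF Km(1) Kb(1)] and Rn = R[OF Km(2) Kb(2)]
  have rep: "Z g t \<omega> = 1 + (\<Sum>i\<in>UNIV. (enn2real (jump_sum i t (Kp i) \<omega>) - enn2real (jump_sum i t (Kn i) \<omega>))
      - (enn2real (lam_integral i t (Kp i) \<omega>) - enn2real (lam_integral i t (Kn i) \<omega>)))" if \<omega>: "\<omega> \<in> space P" for \<omega>
  proof -
    have j: "enn2real (jump_sum i t (Kp i) \<omega>) - enn2real (jump_sum i t (Kn i) \<omega>) = (\<Sum>s\<in>J i \<omega> \<inter> {0<..t}. Z_left g s \<omega> * (g i s \<omega> - 1))" for i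
      unfolding Kp_def[abs_def] Kn_def[abs_def]
        enn2real_jump_sum[OF \<omega>, of i t "\<lambda>s \<omega>. Z_left g s \<omega> * (g i s \<omega> - 1)"]
        enn2real_jump_sum[OF \<omega>, of i t "\<lambda>s \<omega>. Z_left g s \<omega> * (1 - g i s \<omega>)"] sum_subtractf[symmetric]
      by (intro sum.cong) (auto simp: max_def algebra_simps)
    have im: "(\<lambda>(s, \<omega>). Z_left g s \<omega> * ((g i s \<omega> - 1) * lam s \<omega> $ i)) \<in> borel_measurable PS" for i
      using tame_Z_left_measurable drift_term_measurable[OF tame_factor, of i] by (simp add: case_prod_beta')
    have bd: "\<bar>Z_left g s \<omega> * ((g i s \<omega> - 1) * lam s \<omega> $ i)\<bar> \<le> ?c" if "s \<in> {0..t}" for s i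
      using that tame_Z_left_bound[OF \<omega>, of s t] tame_drift_term[OF _ \<omega>, of s i] lam_nn[OF _ \<omega>, of s i]
      unfolding abs_mult[of "Z_left g s \<omega>"] by - (rule mult_mono, use B0 in \<open>auto simp: B_def abs_mult\<close>)
    have si: "set_integrable lborel {0..t} (\<lambda>s. Z_left g s \<omega> * ((g i s \<omega> - 1) * lam s \<omega> $ i))" for i
      by (rule section_set_integrable[OF im \<omega> bd]) auto
    have l: "enn2real (lam_integral i t (Kp i) \<omega>) - enn2real (lam_integral i t (Kn i) \<omega>) = (LINT s:{0..t}|lborel. Z_left g s \<omega> * ((g i s \<omega> - 1) * lam s \<omega> $ i))" for i
    proof -
      let ?f = "\<lambda>s. indicator {0..t} s * (Z_left g s \<omega> * ((g i s \<omega> - 1) * lam s \<omega> $ i))"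
      have fi: "integrable lborel ?f" using si[of i] by (simp add: set_integrable_def)
      have "lam_integral i t (Kp i) \<omega> = (\<integral>\<^sup>+s. ennreal (?f s) \<partial>lborel)"
        unfolding lam_integral_def
      proof (rule nn_integral_cong)
        fix s show "Kp i (s, \<omega>) * ennreal (lam s \<omega> $ i) * indicator {0..t} s = ennreal (?f s)"
          using lam_nn[OF _ \<omega>, of s i] by (auto simp: Kp_def indicator_def ennreal_mult''[symmetric] mult.assoc)
      qed
      moreover have "lam_integral i t (Kn i) \<omega> = (\<integral>\<^sup>+s. ennreal (- ?f s) \<partial>lborel)"
        unfolding lam_integral_def
      proof (rule nn_integral_cong)
        fix s
        have "Z_left g s \<omega> * (1 - g i s \<omega>) * lam s \<omega> $ i = - (Z_left g s \<omega> * ((g i s \<omega> - 1) * lam s \<omega> $ i))"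
          by (simp add: algebra_simps)
        then show "Kn i (s, \<omega>) * ennreal (lam s \<omega> $ i) * indicator {0..t} s = ennreal (- ?f s)"
          using lam_nn[OF _ \<omega>, of s i] by (auto simp: Kn_def indicator_def ennreal_mult''[symmetric])
      qed
      ultimately show ?thesis
        using real_lebesgue_integral_def[OF fi] by (simp add: set_lebesgue_integral_def)
    qed
    have "(LINT s:{0..t}|lborel. Z_left g s \<omega> * drift g s \<omega>) = (LINT s:{0..t}|lborel. \<Sum>i\<in>UNIV. Z_left g s \<omega> * ((g i s \<omega> - 1) * lam s \<omega> $ i))"
      by (rule set_lebesgue_integral_cong) (auto simp: drift_def sum_distrib_left)
    also have "\<dots> = (\<Sum>i\<in>UNIV. LINT s:{0..t}|lborel. Z_left g s \<omega> * ((g i s \<omega> - 1) * lam s \<omega> $ i))"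
      by (rule set_integral_finite_sum(2)) (rule si)
    finally show ?thesis
      using Z_equation(2)[OF tame_factor \<omega> tame_drift_bounded[OF \<omega>] t] by (simp add: j l sum_subtractf)
  qed
  have Zb: "AE \<omega> in P. norm (Z g t \<omega>) \<le> B"
    using AE_space by eventually_elim (use tame_Z_bound[of _ t t] Z_nonneg[OF tame_factor] t in \<open>auto simp: B_def\<close>)
  show "integrable P (Z g t)"
    by (rule integrable_const_bound[OF Zb Z_measurable[OF tame_factor t]])
  have ii: "integrable P (\<lambda>\<omega>. (enn2real (jump_sum i t (Kp i) \<omega>) - enn2real (jump_sum i t (Kn i) \<omega>))
      - (enn2real (lam_integral i t (Kp i) \<omega>) - enn2real (lam_integral i t (Kn i) \<omega>)))" for i
    using Rp[of i] Rn[of i] by (intro Bochner_Integration.integrable_diff) auto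
  have "(LINT \<omega>|P. Z g t \<omega>) = (LINT \<omega>|P. 1 + (\<Sum>i\<in>UNIV. (enn2real (jump_sum i t (Kp i) \<omega>) - enn2real (jump_sum i t (Kn i) \<omega>))
      - (enn2real (lam_integral i t (Kp i) \<omega>) - enn2real (lam_integral i t (Kn i) \<omega>))))"
    by (rule Bochner_Integration.integral_cong[OF refl rep])
  also have "\<dots> = 1 + (\<Sum>i\<in>UNIV. LINT \<omega>|P. (enn2real (jump_sum i t (Kp i) \<omega>) - enn2real (jump_sum i t (Kn i) \<omega>))
      - (enn2real (lam_integral i t (Kp i) \<omega>) - enn2real (lam_integral i t (Kn i) \<omega>)))"
    using ii by (subst Bochner_Integration.integral_add) (auto simp: prob_space Bochner_Integration.integral_sum)
  also have "\<dots> = 1"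
    using Rp Rn by simp
  finally show "(LINT \<omega>|P. Z g t \<omega>) = 1" .
qed

end

end

section \<open>Truncation and the moment conditions\<close>

text \<open>The integrand \<open>x log x - (x - 1)\<close> of the entropy condition.\<close>

definition entropy_rate :: "real \<Rightarrow> real" where
  "entropy_rate x = x * ln x - (x - 1)"

lemma entropy_rate_nonneg: "0 \<le> x \<Longrightarrow> 0 \<le> entropy_rate x"
proof (cases "x = 0")
  case False
  assume "0 \<le> x"
  then have x: "0 < x" using False by simp
  then have "ln (1 / x) \<le> 1 / x - 1" by (intro ln_le_minus_one) simp
  then have "x * (- ln x) \<le> x * (1 / x - 1)" using x by (intro mult_left_mono) (auto simp: ln_div)
  then show ?thesis using x by (simp add: entropy_rate_def algebra_simps)
qed (simp add: entropy_rate_def)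

lemma entropy_rate_le: "0 \<le> x \<Longrightarrow> entropy_rate x \<le> (x - 1)\<^sup>2"
proof (cases "x = 0")
  case False
  assume "0 \<le> x"
  then have x: "0 < x" using False by simp
  then have "x * ln x \<le> x * (x - 1)" by (intro mult_left_mono ln_le_minus_one) auto
  then show ?thesis by (simp add: entropy_rate_def power2_eq_square algebra_simps)
qed (simp add: entropy_rate_def)

text \<open>For \<open>x > 0\<close>, after division by \<open>x\<close>, this is \<open>1 - y \<le> exp (- y)\<close> with \<open>y = (1 - a) ln x\<close>.\<close>

lemma powr_entropy_bound:
  assumes "0 < a" "a < 1" "0 \<le> x"
  shows "a * (x - 1) - (1 - a) * entropy_rate x \<le> x powr a - 1"
proof (cases "x = 0")
  case False
  then have x: "0 < x" using assms by simp
  have "1 + (- (1 - a) * ln x) \<le> exp (- (1 - a) * ln x)" by (rule exp_ge_add_one_self)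
  then have "x * (1 + (- (1 - a) * ln x)) \<le> x * exp (- (1 - a) * ln x)" using x by (intro mult_left_mono) auto
  also have "\<dots> = x powr a"
  proof -
    have "x powr a = exp (ln x + (- (1 - a) * ln x))" using x by (simp add: powr_def algebra_simps)
    also have "\<dots> = x * exp (- (1 - a) * ln x)" using x by (simp only: exp_add exp_ln)
    finally show ?thesis by simp
  qed
  finally show ?thesis by (simp add: entropy_rate_def algebra_simps)
qed (use assms in \<open>simp add: entropy_rate_def\<close>)

lemma Young_powr:
  assumes "0 < a" "a < 1" "0 \<le> x" "0 < y"
  shows "x powr a * y powr (1 - a) \<le> a * x + (1 - a) * (y::real)"
proof (cases "x = 0")
  case False
  then show ?thesis using assms by (intro Youngs_inequality_0) auto
qed (use assms in simp)

lemma Young_powr_scaled: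
  assumes "0 < a" "a < 1" "0 \<le> x" "0 < y" "0 < \<delta>"
  shows "x powr a * y powr (1 - a) \<le> a * \<delta> * x + (1 - a) * \<delta> powr (- a / (1 - a)) * (y::real)"
proof -
  have "x powr a * y powr (1 - a) = (\<delta> * x) powr a * (\<delta> powr (- a / (1 - a)) * y) powr (1 - a)"
  proof -
    have "(- a / (1 - a)) * (1 - a) = - a" using assms by simp
    then have "(\<delta> powr (- a / (1 - a)) * y) powr (1 - a) = \<delta> powr (- a) * y powr (1 - a)"
      using assms by (simp only: powr_mult powr_powr powr_ge_zero less_imp_le)
    moreover have "(\<delta> * x) powr a = \<delta> powr a * x powr a" using assms by (simp add: powr_mult)
    moreover have "\<delta> powr a * \<delta> powr (- a) = 1" using assms by (simp add: powr_add[symmetric])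
    ultimately show ?thesis by (simp add: mult_ac)
  qed
  also have "\<dots> \<le> a * (\<delta> * x) + (1 - a) * (\<delta> powr (- a / (1 - a)) * y)"
    using assms by (intro Young_powr) auto
  finally show ?thesis by (simp add: mult.assoc)
qed

context intensity_setup
begin

lemma jump_count_measurable: "(\<lambda>(s, \<omega>). jump_count i s \<omega>) \<in> borel_measurable PS"
proof (rule predictable_left_limit)
  show "(\<lambda>\<omega>. N t \<omega> $ i - N 0 \<omega> $ i) \<in> borel_measurable (F (ennreal t))" if "0 \<le> t" for t
    using N_adapted[OF that, of i] measurable_F_mono[OF N_adapted[of 0 i], of "ennreal t"] that by auto
  show "jump_count i 0 \<omega> = 0" for \<omega> by (simp add: jump_count_def)
  fix \<omega> t assume \<omega>: "\<omega> \<in> space P" and t: "(0::real) < t"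
  have "eventually (\<lambda>s. N s \<omega> $ i - N 0 \<omega> $ i = jump_count i t \<omega>) (at_left t)"
    using eventually_no_jump_before[OF finite_J[OF \<omega>, of i t] t]
  proof eventually_elim
    case (elim s)
    then show ?case using N_increment[OF \<omega> order_refl, of s i] by (simp add: jump_count_def)
  qed
  then show "((\<lambda>s. N s \<omega> $ i - N 0 \<omega> $ i) \<longlongrightarrow> jump_count i t \<omega>) (at_left t)" by (rule tendsto_eventually)
qed

text \<open>For each coordinate the factor, the intensity and the number of jumps before \<open>s\<close> are at most \<open>n\<close>.\<close>

definition active :: "nat \<Rightarrow> ('d \<Rightarrow> real \<Rightarrow> 'a \<Rightarrow> real) \<Rightarrow> real \<Rightarrow> 'a \<Rightarrow> bool" where
  "active n g s \<omega> \<longleftrightarrow> (\<forall>j. g j s \<omega> \<le> real n \<and> lam s \<omega> $ j \<le> real n \<and> jump_count j s \<omega> \<le> real n)"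

text \<open>The factor replaced by \<open>1\<close> whenever, for some coordinate, it, the intensity or the number of earlier jumps
  exceeds \<open>n\<close>.\<close>

definition trunc :: "nat \<Rightarrow> ('d \<Rightarrow> real \<Rightarrow> 'a \<Rightarrow> real) \<Rightarrow> 'd \<Rightarrow> real \<Rightarrow> 'a \<Rightarrow> real" where
  "trunc n g i s \<omega> = (if active n g s \<omega> then g i s \<omega> else 1)"

lemma trunc_factor:
  assumes g: "intensity_factor g"
  shows "intensity_factor (trunc n g)"
  unfolding intensity_factor_def
proof (intro conjI allI impI ballI)
  fix i
  have "(\<lambda>x. g j (fst x) (snd x)) \<in> borel_measurable PS" "(\<lambda>x. lam (fst x) (snd x) $ j) \<in> borel_measurable PS"
    "(\<lambda>x. jump_count j (fst x) (snd x)) \<in> borel_measurable PS" for j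
    using factor_measurable[OF g, of j] lam_measurable[of j] jump_count_measurable[of j] by (simp_all add: case_prod_beta')
  then have "(\<lambda>x. if \<forall>j\<in>UNIV. g j (fst x) (snd x) \<le> real n \<and> lam (fst x) (snd x) $ j \<le> real n \<and> jump_count j (fst x) (snd x) \<le> real n
      then g i (fst x) (snd x) else 1) \<in> borel_measurable PS"
    by measurable
  then show "(\<lambda>(s, \<omega>). trunc n g i s \<omega>) \<in> borel_measurable PS"
    by (simp add: trunc_def active_def case_prod_beta')
next
  fix i \<omega> and s :: real assume "0 \<le> s" "\<omega> \<in> space P"
  then show "0 \<le> trunc n g i s \<omega>" using factor_nonneg[OF g] by (simp add: trunc_def)
qed

lemma powr_factor:
  assumes g: "intensity_factor g"
  shows "intensity_factor (\<lambda>i s \<omega>. g i s \<omega> powr a)"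
  unfolding intensity_factor_def using factor_measurable[OF g] by (simp add: case_prod_beta')

lemma tame_trunc: "intensity_factor g \<Longrightarrow> tame n (trunc n g)"
  unfolding tame_def by (auto simp: trunc_factor trunc_def active_def)

lemma tame_trunc_powr:
  assumes g: "intensity_factor g" and a: "0 < a" "a < 1" and n: "1 \<le> n"
  shows "tame n (\<lambda>i s \<omega>. trunc n g i s \<omega> powr a)"
  unfolding tame_def
proof (intro conjI allI impI ballI)
  show "intensity_factor (\<lambda>i s \<omega>. trunc n g i s \<omega> powr a)" by (rule powr_factor[OF trunc_factor[OF g]])
  fix i \<omega> and s :: real assume s: "0 \<le> s" "\<omega> \<in> space P"
  show "trunc n g i s \<omega> powr a = 1 \<or> trunc n g i s \<omega> powr a \<le> real n \<and> lam s \<omega> $ i \<le> real n \<and> jump_count i s \<omega> \<le> real n"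
  proof (cases "active n g s \<omega>")
    case True
    have "g i s \<omega> powr a \<le> real n"
    proof (cases "g i s \<omega> \<le> 1")
      case True
      then have "g i s \<omega> powr a \<le> 1 powr a" using a factor_nonneg[OF g s] by (intro powr_mono2) auto
      then show ?thesis using n by simp
    next
      case False
      then have "g i s \<omega> powr a \<le> g i s \<omega> powr 1" using a by (intro powr_mono) auto
      then show ?thesis using \<open>active n g s \<omega>\<close> False by (simp add: active_def) (meson order.trans)
    qed
    then show ?thesis using True by (auto simp: trunc_def active_def)
  qed (simp add: trunc_def)
qed

lemma Z_cong:
  assumes "\<omega> \<in> space P" "\<And>i s. s \<in> {0..t} \<Longrightarrow> g i s \<omega> = g' i s \<omega>"
  shows "Z g t \<omega> = Z g' t \<omega>"
proof -
  have "(LINT s:{0..t}|lborel. drift g s \<omega>) = (LINT s:{0..t}|lborel. drift g' s \<omega>)"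
    by (rule set_lebesgue_integral_cong) (use assms in \<open>auto simp: drift_def\<close>)
  moreover have "(\<Prod>i\<in>UNIV. \<Prod>s\<in>J i \<omega> \<inter> {0<..t}. g i s \<omega>) = (\<Prod>i\<in>UNIV. \<Prod>s\<in>J i \<omega> \<inter> {0<..t}. g' i s \<omega>)"
    using assms by (intro prod.cong) auto
  ultimately show ?thesis using assms by (simp add: Z_eq)
qed

text \<open>A common upper bound for the factor and the intensity along one path up to time \<open>t\<close>; both are nonnegative.\<close>

definition bounded_on :: "('d \<Rightarrow> real \<Rightarrow> 'a \<Rightarrow> real) \<Rightarrow> real \<Rightarrow> 'a \<Rightarrow> bool" where
  "bounded_on g t \<omega> \<longleftrightarrow> (\<exists>C. \<forall>i. \<forall>s\<in>{0..t}. g i s \<omega> \<le> C \<and> lam s \<omega> $ i \<le> C)"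

lemma bounded_on_drift_bounded:
  assumes g: "intensity_factor g" and \<omega>: "\<omega> \<in> space P" and b: "bounded_on g t \<omega>"
  shows "drift_bounded g t \<omega>"
proof -
  obtain C where C: "\<And>i s. s \<in> {0..t} \<Longrightarrow> g i s \<omega> \<le> C \<and> lam s \<omega> $ i \<le> C" using b unfolding bounded_on_def by blast
  have "\<bar>(g i s \<omega> - 1) * lam s \<omega> $ i\<bar> \<le> (\<bar>C\<bar> + 1) * \<bar>C\<bar>" if s: "s \<in> {0..t}" for i s
    unfolding abs_mult using C[OF s, of i] factor_nonneg[OF g _ \<omega>, of s i] lam_nn[OF _ \<omega>, of s i] s
    by (intro mult_mono) auto
  then show ?thesis unfolding drift_bounded_def by blast
qed

text \<open>Along a bounded path the truncation is inactive on \<open>{0..t}\<close> once its level is high enough.\<close>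

lemma eventually_trunc:
  assumes \<omega>: "\<omega> \<in> space P" and b: "bounded_on g t \<omega>"
  shows "\<forall>\<^sub>F n in sequentially. Z (trunc n g) t \<omega> = Z g t \<omega>"
proof -
  obtain C where C: "\<And>i s. s \<in> {0..t} \<Longrightarrow> g i s \<omega> \<le> C \<and> lam s \<omega> $ i \<le> C" using b unfolding bounded_on_def by blast
  define D where "D = \<bar>C\<bar> + (\<Sum>j\<in>UNIV. jump_count j t \<omega>)"
  have jc: "jump_count j s \<omega> \<le> D" if "s \<in> {0..t}" for j s
  proof -
    have "finite (J j \<omega> \<inter> {0<..<t})" by (rule finite_subset[OF _ finite_J[OF \<omega>, of j t]]) auto
    then have "jump_count j s \<omega> \<le> jump_count j t \<omega>"
      unfolding jump_count_def of_nat_le_iff by (rule card_mono) (use that in auto)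
    also have "\<dots> \<le> (\<Sum>j\<in>UNIV. jump_count j t \<omega>)" by (rule member_le_sum) (auto simp: jump_count_def)
    finally show ?thesis by (simp add: D_def)
  qed
  have S0: "0 \<le> (\<Sum>j\<in>UNIV. jump_count j t \<omega>)" by (intro sum_nonneg) (simp add: jump_count_def)
  obtain n0 where n0: "D < real n0" using reals_Archimedean2 by blast
  have "Z (trunc n g) t \<omega> = Z g t \<omega>" if n: "n0 \<le> n" for n
  proof (rule Z_cong[OF \<omega>])
    fix i s assume s: "s \<in> {0..t}"
    have Dn: "D \<le> real n" using n0 n by linarith
    have "active n g s \<omega>" unfolding active_def
    proof (intro allI conjI)
      fix j
      have "C \<le> real n" using Dn S0 by (simp add: D_def)
      then show "g j s \<omega> \<le> real n" "lam s \<omega> $ j \<le> real n" using C[OF s, of j] by auto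
      show "jump_count j s \<omega> \<le> real n" using jc[OF s, of j] Dn by simp
    qed
    then show "trunc n g i s \<omega> = g i s \<omega>" by (simp add: trunc_def)
  qed
  then show ?thesis by (auto simp: eventually_sequentially)
qed

text \<open>Fatou's lemma along the truncations.\<close>

lemma Z_integrable_le_1:
  assumes g: "intensity_factor g" and b: "AE \<omega> in P. bounded_on g t \<omega>" and t: "0 \<le> t"
  shows "integrable P (Z g t)" "(LINT \<omega>|P. Z g t \<omega>) \<le> 1"
proof -
  have m: "Z (trunc n g) t \<in> borel_measurable P" for n by (rule Z_measurable[OF trunc_factor[OF g] t])
  have nn: "(\<integral>\<^sup>+\<omega>. ennreal (Z g t \<omega>) \<partial>P) \<le> 1"
  proof -
    have "(\<integral>\<^sup>+\<omega>. ennreal (Z g t \<omega>) \<partial>P) = (\<integral>\<^sup>+\<omega>. liminf (\<lambda>n. ennreal (Z (trunc (Suc n) g) t \<omega>)) \<partial>P)"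
    proof (rule nn_integral_cong_AE)
      show "AE \<omega> in P. ennreal (Z g t \<omega>) = liminf (\<lambda>n. ennreal (Z (trunc (Suc n) g) t \<omega>))"
        using b AE_space
      proof eventually_elim
        case (elim \<omega>)
        have "\<forall>\<^sub>F n in sequentially. Z (trunc (Suc n) g) t \<omega> = Z g t \<omega>"
          using eventually_trunc[OF elim(2,1)] by (rule eventually_sequentially_Suc[THEN iffD2])
        then have "(\<lambda>n. ennreal (Z (trunc (Suc n) g) t \<omega>)) \<longlonglongrightarrow> ennreal (Z g t \<omega>)"
          by (intro tendsto_eventually) (auto elim!: eventually_mono)
        then show ?case by (metis lim_imp_Liminf trivial_limit_sequentially)
      qed
    qed
    also have "\<dots> \<le> liminf (\<lambda>n. \<integral>\<^sup>+\<omega>. ennreal (Z (trunc (Suc n) g) t \<omega>) \<partial>P)"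
      by (rule nn_integral_liminf) (use m in auto)
    also have "\<dots> = liminf (\<lambda>n. 1)"
    proof -
      have "(\<integral>\<^sup>+\<omega>. ennreal (Z (trunc (Suc n) g) t \<omega>) \<partial>P) = 1" for n
        using tame_expectation[OF tame_trunc[OF g, of "Suc n"] _ t] Z_nonneg[OF trunc_factor[OF g]]
        by (subst nn_integral_eq_integral) auto
      then show ?thesis by simp
    qed
    finally show ?thesis by (simp add: Liminf_const)
  qed
  show i: "integrable P (Z g t)"
    by (rule integrableI_nonneg) (use Z_measurable[OF g t] Z_nonneg[OF g] nn in \<open>auto intro: le_less_trans\<close>)
  have "ennreal (LINT \<omega>|P. Z g t \<omega>) \<le> 1"
    using nn nn_integral_eq_integral[OF i] Z_nonneg[OF g] by simp
  then show "(LINT \<omega>|P. Z g t \<omega>) \<le> 1" by (simp add: ennreal_le_1)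
qed

lemma Z_expectation_dominated:
  assumes g: "intensity_factor g" and b: "AE \<omega> in P. bounded_on g t \<omega>" and t: "0 \<le> t"
    and W: "integrable P W" and dom: "\<And>n. AE \<omega> in P. Z (trunc n g) t \<omega> \<le> W \<omega>"
  shows "(LINT \<omega>|P. Z g t \<omega>) = 1"
proof -
  have "(\<lambda>n. LINT \<omega>|P. Z (trunc (Suc n) g) t \<omega>) \<longlonglongrightarrow> (LINT \<omega>|P. Z g t \<omega>)"
  proof (rule integral_dominated_convergence[where w=W])
    show "Z g t \<in> borel_measurable P" by (rule Z_measurable[OF g t])
    show "Z (trunc (Suc n) g) t \<in> borel_measurable P" for n by (rule Z_measurable[OF trunc_factor[OF g] t])
    show "AE \<omega> in P. (\<lambda>n. Z (trunc (Suc n) g) t \<omega>) \<longlonglongrightarrow> Z g t \<omega>"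
      using b AE_space
    proof eventually_elim
      case (elim \<omega>)
      have "\<forall>\<^sub>F n in sequentially. Z (trunc (Suc n) g) t \<omega> = Z g t \<omega>"
        using eventually_trunc[OF elim(2,1)] by (rule eventually_sequentially_Suc[THEN iffD2])
      then show ?case by (rule tendsto_eventually)
    qed
    show "AE \<omega> in P. norm (Z (trunc (Suc n) g) t \<omega>) \<le> W \<omega>" for n
      using dom[of "Suc n"] AE_space by eventually_elim (simp add: Z_nonneg[OF trunc_factor[OF g]])
  qed (rule W)
  moreover have "(LINT \<omega>|P. Z (trunc (Suc n) g) t \<omega>) = 1" for n
    by (rule tame_expectation(2)[OF tame_trunc[OF g] _ t]) simp
  ultimately show ?thesis by (simp add: LIMSEQ_const_iff)
qed

text \<open>The entropy condition enters through \<open>E(Z\<^sup>a Y\<^sup>1\<^sup>-\<^sup>a)\<close>, \<open>a < 1\<close>, with Young's inequality; then \<open>a \<rightarrow> 1\<close>.\<close>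

lemma Z_expectation_entropy:
  assumes g: "intensity_factor g" and b: "AE \<omega> in P. bounded_on g t \<omega>" and t: "0 \<le> t"
    and Y: "integrable P Y" "\<And>\<omega>. 0 < Y \<omega>"
    and dom: "\<And>n a. 0 < a \<Longrightarrow> a < 1 \<Longrightarrow> 1 \<le> n \<Longrightarrow>
      AE \<omega> in P. Z (\<lambda>i s \<omega>. trunc n g i s \<omega> powr a) t \<omega> \<le> Z (trunc n g) t \<omega> powr a * Y \<omega> powr (1 - a)"
  shows "(LINT \<omega>|P. Z g t \<omega>) = 1"
proof -
  define z where "z = (LINT \<omega>|P. Z g t \<omega>)"
  define y where "y = (LINT \<omega>|P. Y \<omega>)"
  have iZ: "integrable P (Z g t)" by (rule Z_integrable_le_1(1)[OF g b t])
  have Ym [measurable]: "Y \<in> borel_measurable P" using Y(1) by auto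
  have Zm [measurable]: "Z g t \<in> borel_measurable P" "Z (trunc n g) t \<in> borel_measurable P" for n
    by (rule Z_measurable[OF g t], rule Z_measurable[OF trunc_factor[OF g] t])
  have bound: "1 \<le> a * z + (1 - a) * y + a * \<delta>" if a: "0 < a" "a < 1" and \<delta>: "0 < \<delta>" for a \<delta>
  proof -
    define c where "c = (1 - a) * \<delta> powr (- a / (1 - a))"
    define Q where "Q n \<omega> = (if Z (trunc n g) t \<omega> = Z g t \<omega> then 0 else Y \<omega>)" for n \<omega>
    have Qm [measurable]: "Q n \<in> borel_measurable P" for n unfolding Q_def by measurable
    have Qi: "integrable P (Q n)" for n
      by (rule Bochner_Integration.integrable_bound[OF Y(1)]) (auto simp: Q_def)
    have Qlim: "(\<lambda>n. LINT \<omega>|P. Q (Suc n) \<omega>) \<longlonglongrightarrow> (LINT \<omega>|P. 0)"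
    proof (rule integral_dominated_convergence[where w=Y])
      show "AE \<omega> in P. (\<lambda>n. Q (Suc n) \<omega>) \<longlonglongrightarrow> 0"
        using b AE_space
      proof eventually_elim
        case (elim \<omega>)
        have "\<forall>\<^sub>F n in sequentially. Z (trunc (Suc n) g) t \<omega> = Z g t \<omega>"
          using eventually_trunc[OF elim(2,1)] by (rule eventually_sequentially_Suc[THEN iffD2])
        then have "\<forall>\<^sub>F n in sequentially. Q (Suc n) \<omega> = 0" by eventually_elim (simp add: Q_def)
        then show ?case by (rule tendsto_eventually)
      qed
      show "AE \<omega> in P. norm (Q (Suc n) \<omega>) \<le> Y \<omega>" for n using Y(2) by (auto simp: Q_def less_imp_le)
    qed (use Y in auto)
    have step: "1 \<le> a * z + (1 - a) * y + a * \<delta> + c * (LINT \<omega>|P. Q (Suc n) \<omega>)" for n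
    proof -
      let ?n = "Suc n"
      note tp = tame_expectation[OF tame_trunc_powr[OF g a, of ?n] _ t]
      note t1 = tame_expectation[OF tame_trunc[OF g, of ?n] _ t]
      have i1: "integrable P (Z (\<lambda>i s \<omega>. trunc ?n g i s \<omega> powr a) t)" using tp(1) by simp
      have i2: "integrable P (Z (trunc ?n g) t)" using t1(1) by simp
      have "1 = (LINT \<omega>|P. Z (\<lambda>i s \<omega>. trunc ?n g i s \<omega> powr a) t \<omega>)" using tp(2) by simp
      also have "\<dots> \<le> (LINT \<omega>|P. a * Z g t \<omega> + (1 - a) * Y \<omega> + a * \<delta> * Z (trunc ?n g) t \<omega> + c * Q ?n \<omega>)"
      proof (rule integral_mono_AE[OF i1])
        show "integrable P (\<lambda>\<omega>. a * Z g t \<omega> + (1 - a) * Y \<omega> + a * \<delta> * Z (trunc ?n g) t \<omega> + c * Q ?n \<omega>)"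
          using iZ Y(1) i2 Qi by auto
        have "AE \<omega> in P. Z (\<lambda>i s \<omega>. trunc ?n g i s \<omega> powr a) t \<omega> \<le> Z (trunc ?n g) t \<omega> powr a * Y \<omega> powr (1 - a)"
          by (rule dom[OF a]) simp
        then show "AE \<omega> in P. Z (\<lambda>i s \<omega>. trunc ?n g i s \<omega> powr a) t \<omega> \<le> a * Z g t \<omega> + (1 - a) * Y \<omega> + a * \<delta> * Z (trunc ?n g) t \<omega> + c * Q ?n \<omega>"
          using AE_space
        proof eventually_elim
          case (elim \<omega>)
          have z0: "0 \<le> Z (trunc ?n g) t \<omega>" "0 \<le> Z g t \<omega>"
            using Z_nonneg[OF trunc_factor[OF g] elim(2)] Z_nonneg[OF g elim(2)] by auto
          show ?case
          proof (cases "Z (trunc ?n g) t \<omega> = Z g t \<omega>")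
            case True
            have "Z (trunc ?n g) t \<omega> powr a * Y \<omega> powr (1 - a) \<le> a * Z g t \<omega> + (1 - a) * Y \<omega>"
              unfolding True by (rule Young_powr[OF a z0(2) Y(2)])
            moreover have "0 \<le> a * \<delta> * Z (trunc ?n g) t \<omega>" using a \<delta> z0 by simp
            ultimately show ?thesis using elim(1) True by (simp add: Q_def)
          next
            case False
            have "Z (trunc ?n g) t \<omega> powr a * Y \<omega> powr (1 - a) \<le> a * \<delta> * Z (trunc ?n g) t \<omega> + c * Y \<omega>"
              unfolding c_def by (rule Young_powr_scaled[OF a z0(1) Y(2) \<delta>])
            moreover have "0 \<le> a * Z g t \<omega>" "0 \<le> (1 - a) * Y \<omega>" using a z0 Y(2)[of \<omega>] by (auto intro!: mult_nonneg_nonneg)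
            ultimately show ?thesis using elim(1) False by (simp add: Q_def)
          qed
        qed
      qed
      also have "\<dots> = a * z + (1 - a) * y + a * \<delta> * 1 + c * (LINT \<omega>|P. Q ?n \<omega>)"
        using iZ Y(1) i2 Qi t1(2) by (simp add: z_def y_def)
      finally show ?thesis by simp
    qed
    have "(\<lambda>n. a * z + (1 - a) * y + a * \<delta> + c * (LINT \<omega>|P. Q (Suc n) \<omega>)) \<longlonglongrightarrow> a * z + (1 - a) * y + a * \<delta> + c * (LINT \<omega>|P. 0)"
      by (intro tendsto_intros Qlim)
    then have "1 \<le> a * z + (1 - a) * y + a * \<delta> + c * (LINT \<omega>|P. 0)"
      by (rule LIMSEQ_le_const) (use step in auto)
    then show ?thesis by simp
  qed
  have "((\<lambda>r. (1 - r) * z + (1 - (1 - r)) * y + (1 - r) * r) \<longlongrightarrow> (1 - 0) * z + (1 - (1 - 0)) * y + (1 - 0) * 0) (at_right 0)"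
    by (intro tendsto_intros)
  moreover have "eventually (\<lambda>r. 1 \<le> (1 - r) * z + (1 - (1 - r)) * y + (1 - r) * r) (at_right 0)"
    using eventually_at_right_real[OF zero_less_one]
  proof eventually_elim
    case (elim r)
    then show ?case using bound[of "1 - r" r] by simp
  qed
  ultimately have "1 \<le> (1 - 0) * z + (1 - (1 - 0)) * y + (1 - 0) * 0"
    by (intro tendsto_lowerbound) auto
  then show ?thesis using Z_integrable_le_1(2)[OF g b t] by (simp add: z_def)
qed

subsection \<open>Factors that start at a later time\<close>

context
  fixes \<gamma> :: "'d \<Rightarrow> real \<Rightarrow> 'a \<Rightarrow> real"
  assumes \<gamma>: "intensity_factor \<gamma>" and \<gamma>_bounded: "AE \<omega> in P. \<forall>t. bounded_on \<gamma> t \<omega>"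
begin

text \<open>The factor \<open>\<gamma>\<close> switched on after time \<open>u\<close>, and only on the event \<open>A\<close>.\<close>

definition start :: "real \<Rightarrow> 'a set \<Rightarrow> 'd \<Rightarrow> real \<Rightarrow> 'a \<Rightarrow> real" where
  "start u A i s \<omega> = (if u < s \<and> \<omega> \<in> A then \<gamma> i s \<omega> else 1)"

text \<open>The quotient of the exponentials at times \<open>t\<close> and \<open>u\<close>, which makes sense even where they vanish.\<close>

definition Z_ratio :: "real \<Rightarrow> real \<Rightarrow> 'a \<Rightarrow> real" where
  "Z_ratio u t \<omega> = exp (- (LINT s:{u..t}|lborel. drift \<gamma> s \<omega>)) * (\<Prod>i\<in>UNIV. \<Prod>s\<in>J i \<omega> \<inter> {u<..t}. \<gamma> i s \<omega>)"

lemma start_factor: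
  assumes u: "0 \<le> u" and A: "A \<in> sets (F (ennreal u))"
  shows "intensity_factor (start u A)"
  unfolding intensity_factor_def
proof (intro conjI allI impI ballI)
  fix i
  have S: "{u<..} \<times> A \<in> sets PS" by (rule rectangle_after_in_PS[OF u A])
  have "(\<lambda>x. \<gamma> i (fst x) (snd x)) \<in> borel_measurable PS"
    using factor_measurable[OF \<gamma>, of i] by (simp add: case_prod_beta')
  then have "(\<lambda>x. if x \<in> {u<..} \<times> A then \<gamma> i (fst x) (snd x) else 1) \<in> borel_measurable PS"
    using sets.Int[OF S sets.top] by (intro measurable_If_set) auto
  moreover have "(\<lambda>x. if x \<in> {u<..} \<times> A then \<gamma> i (fst x) (snd x) else 1) = (\<lambda>(s, \<omega>). start u A i s \<omega>)"
    by (auto simp: start_def fun_eq_iff)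
  ultimately show "(\<lambda>(s, \<omega>). start u A i s \<omega>) \<in> borel_measurable PS" by simp
next
  fix i \<omega> and s :: real assume "0 \<le> s" "\<omega> \<in> space P"
  then show "0 \<le> start u A i s \<omega>" using factor_nonneg[OF \<gamma>] by (simp add: start_def)
qed

lemma start_bounded: "AE \<omega> in P. bounded_on (start u A) t \<omega>"
  using \<gamma>_bounded
proof eventually_elim
  case (elim \<omega>)
  then obtain C where C: "\<forall>i. \<forall>s\<in>{0..t}. \<gamma> i s \<omega> \<le> C \<and> lam s \<omega> $ i \<le> C" unfolding bounded_on_def by blast
  then have "\<forall>i. \<forall>s\<in>{0..t}. start u A i s \<omega> \<le> max 1 C \<and> lam s \<omega> $ i \<le> max 1 C"
    by (auto simp: start_def le_max_iff_disj)
  then show ?case unfolding bounded_on_def by blast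
qed

lemma Z_split:
  assumes \<omega>: "\<omega> \<in> space P" and b: "bounded_on \<gamma> t \<omega>" and ut: "0 \<le> u" "u \<le> t"
  shows "Z \<gamma> t \<omega> = Z \<gamma> u \<omega> * Z_ratio u t \<omega>"
proof -
  note db = bounded_on_drift_bounded[OF \<gamma> \<omega> b]
  obtain C where C: "\<And>s. s \<in> {0..t} \<Longrightarrow> \<bar>drift \<gamma> s \<omega>\<bar> \<le> C" using drift_bound[OF db] by blast
  have "set_integrable lborel {0..t} (\<lambda>s. drift \<gamma> s \<omega>)"
    by (rule bounded_set_integrable[OF drift_section[OF \<gamma> \<omega>] C])
  from set_integral_split[OF this ut]
  have 1: "(LINT s:{0..t}|lborel. drift \<gamma> s \<omega>) = (LINT s:{0..u}|lborel. drift \<gamma> s \<omega>) + (LINT s:{u..t}|lborel. drift \<gamma> s \<omega>)" .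
  have 2: "(\<Prod>s\<in>J i \<omega> \<inter> {0<..t}. \<gamma> i s \<omega>) = (\<Prod>s\<in>J i \<omega> \<inter> {0<..u}. \<gamma> i s \<omega>) * (\<Prod>s\<in>J i \<omega> \<inter> {u<..t}. \<gamma> i s \<omega>)" for i
  proof -
    have "J i \<omega> \<inter> {0<..t} = (J i \<omega> \<inter> {0<..u}) \<union> (J i \<omega> \<inter> {u<..t})" using ut by auto
    then show ?thesis
      using finite_J[OF \<omega>] finite_J'[OF \<omega> ut(1)] by (simp only:) (rule prod.union_disjoint, auto)
  qed
  show ?thesis unfolding Z_eq[OF \<omega>] Z_ratio_def 1 2 prod.distrib by (simp add: exp_diff exp_minus divide_inverse)
qed

lemma Z_start:
  assumes \<omega>: "\<omega> \<in> space P" and b: "bounded_on \<gamma> t \<omega>" and ut: "0 \<le> u" "u \<le> t"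
  shows "Z (start u A) t \<omega> = (if \<omega> \<in> A then Z_ratio u t \<omega> else 1)"
proof -
  have d: "drift (start u A) s \<omega> = (if u < s \<and> \<omega> \<in> A then drift \<gamma> s \<omega> else 0)" for s
    by (auto simp: drift_def start_def)
  have 1: "(LINT s:{0..t}|lborel. drift (start u A) s \<omega>) = (if \<omega> \<in> A then (LINT s:{u..t}|lborel. drift \<gamma> s \<omega>) else 0)"
  proof (cases "\<omega> \<in> A")
    case True
    have "(LINT s:{0..t}|lborel. drift (start u A) s \<omega>) = (LINT s:{u..t}|lborel. drift \<gamma> s \<omega>)"
      unfolding set_lebesgue_integral_def
    proof (rule integral_cong_AE)
      have m: "(\<lambda>s. drift \<gamma> s \<omega>) \<in> borel_measurable borel" by (rule drift_section[OF \<gamma> \<omega>])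
      then show "(\<lambda>x. indicat_real {u..t} x *\<^sub>R drift \<gamma> x \<omega>) \<in> borel_measurable lborel" by simp
      show "(\<lambda>x. indicat_real {0..t} x *\<^sub>R drift (start u A) x \<omega>) \<in> borel_measurable lborel"
        unfolding d using m by simp
      show "AE x in lborel. indicat_real {0..t} x *\<^sub>R drift (start u A) x \<omega> = indicat_real {u..t} x *\<^sub>R drift \<gamma> x \<omega>"
        using AE_lborel_singleton[of u] by eventually_elim (use ut True in \<open>auto simp: indicator_def d\<close>)
    qed
    then show ?thesis using True by simp
  qed (simp add: d)
  have 2: "(\<Prod>s\<in>J i \<omega> \<inter> {0<..t}. start u A i s \<omega>) = (if \<omega> \<in> A then (\<Prod>s\<in>J i \<omega> \<inter> {u<..t}. \<gamma> i s \<omega>) else 1)" for i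
  proof (cases "\<omega> \<in> A")
    case True
    have "(\<Prod>s\<in>J i \<omega> \<inter> {0<..t}. start u A i s \<omega>) = (\<Prod>s\<in>J i \<omega> \<inter> {u<..t}. \<gamma> i s \<omega>)"
      by (rule prod.mono_neutral_cong_right[OF finite_J[OF \<omega>]]) (use ut True in \<open>auto simp: start_def\<close>)
    then show ?thesis using True by simp
  qed (simp add: start_def)
  show ?thesis unfolding Z_eq[OF \<omega>] 1 2 Z_ratio_def by simp
qed

lemma trunc_start_cases:
  "trunc n (start u A) i s \<omega> = 1 \<or> (u < s \<and> trunc n (start u A) i s \<omega> = \<gamma> i s \<omega>)"
  by (auto simp: trunc_def start_def)

text \<open>All truncations have the same majorant, whose expectation is finite under the condition on \<open>log\<^sub>+ \<gamma>\<close>.\<close>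

lemma start_log_bound:
  assumes \<omega>: "\<omega> \<in> space P" and b: "bounded_on \<gamma> t \<omega>" and ut: "0 \<le> u" "u \<le> t" and A: "A \<in> sets (F (ennreal u))"
  shows "Z (trunc n (start u A)) t \<omega> \<le> exp (\<Sum>i\<in>UNIV. (LINT s:{u..t}|lborel. lam s \<omega> $ i) + (\<Sum>s\<in>J i \<omega> \<inter> {u<..t}. log_plus (\<gamma> i s \<omega>)))"
proof -
  let ?h = "trunc n (start u A)"
  obtain C where C: "\<And>i s. s \<in> {0..t} \<Longrightarrow> \<gamma> i s \<omega> \<le> C \<and> lam s \<omega> $ i \<le> C" using b unfolding bounded_on_def by blast
  have h: "intensity_factor ?h" by (rule trunc_factor[OF start_factor[OF ut(1) A]])
  have hb: "drift_bounded ?h t \<omega>"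
  proof (rule bounded_on_drift_bounded[OF h \<omega>])
    have "?h i s \<omega> \<le> max 1 C \<and> lam s \<omega> $ i \<le> max 1 C" if "s \<in> {0..t}" for i s
      using C[OF that, of i] trunc_start_cases[of n u A i s \<omega>] by (auto simp: le_max_iff_disj)
    then show "bounded_on ?h t \<omega>" unfolding bounded_on_def by blast
  qed
  have t0: "0 \<le> t" using ut by simp
  have li: "set_integrable lborel {u..t} (\<lambda>s. lam s \<omega> $ i)" for i
    by (rule section_set_integrable[OF lam_measurable \<omega> _ ut(1), of _ _ C]) (use C lam_nn[OF _ \<omega>] in auto)
  have D: "- (LINT s:{0..t}|lborel. drift ?h s \<omega>) \<le> (\<Sum>i\<in>UNIV. LINT s:{u..t}|lborel. lam s \<omega> $ i)"
    unfolding drift_integral[OF h \<omega> hb order_refl] sum_negf[symmetric]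
  proof (rule sum_mono)
    fix i
    have "- (LINT s:{0..t}|lborel. (?h i s \<omega> - 1) * lam s \<omega> $ i) = (LINT s|lborel. - (indicator {0..t} s *\<^sub>R ((?h i s \<omega> - 1) * lam s \<omega> $ i)))"
      by (simp add: set_lebesgue_integral_def)
    also have "\<dots> \<le> (LINT s|lborel. indicator {u..t} s *\<^sub>R (lam s \<omega> $ i))"
    proof (rule integral_mono)
      show "integrable lborel (\<lambda>s. - (indicator {0..t} s *\<^sub>R ((?h i s \<omega> - 1) * lam s \<omega> $ i)))"
        using drift_terms_integrable[OF h \<omega> hb order_refl, of i] unfolding set_integrable_def by (rule Bochner_Integration.integrable_minus)
      show "integrable lborel (\<lambda>s. indicator {u..t} s *\<^sub>R (lam s \<omega> $ i))"
        using li[of i] by (simp add: set_integrable_def)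
      fix s
      show "- (indicator {0..t} s *\<^sub>R ((?h i s \<omega> - 1) * lam s \<omega> $ i)) \<le> indicator {u..t} s *\<^sub>R (lam s \<omega> $ i)"
      proof (cases "s \<in> {0..t}")
        case True
        then have l0: "0 \<le> lam s \<omega> $ i" "0 \<le> ?h i s \<omega>" using lam_nn[OF _ \<omega>] factor_nonneg[OF h _ \<omega>] by auto
        have "0 \<le> ?h i s \<omega> * lam s \<omega> $ i" using l0 by simp
        then show ?thesis
          using trunc_start_cases[of n u A i s \<omega>] True l0 by (auto simp: indicator_def algebra_simps)
      qed (use ut in \<open>auto simp: indicator_def\<close>)
    qed
    finally show "- (LINT s:{0..t}|lborel. (?h i s \<omega> - 1) * lam s \<omega> $ i) \<le> (LINT s:{u..t}|lborel. lam s \<omega> $ i)"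
      by (simp add: set_lebesgue_integral_def)
  qed
  have Pr: "(\<Prod>s\<in>J i \<omega> \<inter> {0<..t}. ?h i s \<omega>) \<le> exp (\<Sum>s\<in>J i \<omega> \<inter> {u<..t}. log_plus (\<gamma> i s \<omega>))" for i
  proof -
    have "(\<Prod>s\<in>J i \<omega> \<inter> {0<..t}. ?h i s \<omega>) \<le> (\<Prod>s\<in>J i \<omega> \<inter> {0<..t}. if s \<in> {u<..t} then exp (log_plus (\<gamma> i s \<omega>)) else 1)"
    proof (rule prod_mono)
      fix s assume s: "s \<in> J i \<omega> \<inter> {0<..t}"
      then have s0: "0 \<le> s" by auto
      have g0: "0 \<le> \<gamma> i s \<omega>" by (rule factor_nonneg[OF \<gamma> s0 \<omega>])
      have "1 \<le> exp (log_plus (\<gamma> i s \<omega>))" by (simp add: log_plus_def)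
      moreover have "\<gamma> i s \<omega> \<le> exp (log_plus (\<gamma> i s \<omega>))"
      proof (cases "\<gamma> i s \<omega> = 0")
        case False
        then have "\<gamma> i s \<omega> = exp (ln (\<gamma> i s \<omega>))" using g0 by simp
        also have "\<dots> \<le> exp (log_plus (\<gamma> i s \<omega>))" by (simp add: log_plus_def)
        finally show ?thesis .
      qed simp
      ultimately show "0 \<le> ?h i s \<omega> \<and> ?h i s \<omega> \<le> (if s \<in> {u<..t} then exp (log_plus (\<gamma> i s \<omega>)) else 1)"
        using trunc_start_cases[of n u A i s \<omega>] factor_nonneg[OF h s0 \<omega>, of i] s by auto
    qed
    also have "\<dots> = (\<Prod>s\<in>J i \<omega> \<inter> {0<..t} \<inter> {u<..t}. exp (log_plus (\<gamma> i s \<omega>)))"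
      by (rule prod.inter_restrict[OF finite_J[OF \<omega>], symmetric])
    also have "J i \<omega> \<inter> {0<..t} \<inter> {u<..t} = J i \<omega> \<inter> {u<..t}" using ut by auto
    also have "(\<Prod>s\<in>J i \<omega> \<inter> {u<..t}. exp (log_plus (\<gamma> i s \<omega>))) = exp (\<Sum>s\<in>J i \<omega> \<inter> {u<..t}. log_plus (\<gamma> i s \<omega>))"
      by (rule exp_sum[OF finite_J'[OF \<omega> ut(1)], symmetric])
    finally show ?thesis .
  qed
  have "Z ?h t \<omega> \<le> exp (\<Sum>i\<in>UNIV. LINT s:{u..t}|lborel. lam s \<omega> $ i) * (\<Prod>i\<in>UNIV. exp (\<Sum>s\<in>J i \<omega> \<inter> {u<..t}. log_plus (\<gamma> i s \<omega>)))"
    unfolding Z_eq[OF \<omega>] using D Pr factor_nonneg[OF h _ \<omega>]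
    by (intro mult_mono prod_mono conjI prod_nonneg) auto
  also have "\<dots> = exp (\<Sum>i\<in>UNIV. (LINT s:{u..t}|lborel. lam s \<omega> $ i) + (\<Sum>s\<in>J i \<omega> \<inter> {u<..t}. log_plus (\<gamma> i s \<omega>)))"
    by (simp add: sum.distrib exp_add exp_sum)
  finally show ?thesis .
qed

text \<open>Replacing the factor \<open>h\<close> by \<open>h\<^sup>a\<close> costs at most the power \<open>1 - a\<close> of the exponential in the entropy
  condition.\<close>

lemma start_entropy_bound:
  assumes \<omega>: "\<omega> \<in> space P" and b: "bounded_on \<gamma> t \<omega>" and ut: "0 \<le> u" "u \<le> t" and A: "A \<in> sets (F (ennreal u))"
    and a: "0 < a" "a < 1"
  shows "Z (\<lambda>i s \<omega>. trunc n (start u A) i s \<omega> powr a) t \<omega> \<le> Z (trunc n (start u A)) t \<omega> powr a *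
    exp (\<Sum>i\<in>UNIV. LINT s:{u..t}|lborel. entropy_rate (\<gamma> i s \<omega>) * lam s \<omega> $ i) powr (1 - a)"
proof -
  let ?h = "trunc n (start u A)"
  let ?k = "\<lambda>i s \<omega>. ?h i s \<omega> powr a"
  obtain C where C: "\<And>i s. s \<in> {0..t} \<Longrightarrow> \<gamma> i s \<omega> \<le> C \<and> lam s \<omega> $ i \<le> C" using b unfolding bounded_on_def by blast
  have h: "intensity_factor ?h" by (rule trunc_factor[OF start_factor[OF ut(1) A]])
  have k: "intensity_factor ?k" by (rule powr_factor[OF h])
  have hC: "?h i s \<omega> \<le> max 1 C \<and> lam s \<omega> $ i \<le> max 1 C" if "s \<in> {0..t}" for i s
    using C[OF that, of i] trunc_start_cases[of n u A i s \<omega>] by (auto simp: le_max_iff_disj)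
  have hb: "drift_bounded ?h t \<omega>"
    by (rule bounded_on_drift_bounded[OF h \<omega>]) (use hC in \<open>unfold bounded_on_def, blast\<close>)
  have kb: "drift_bounded ?k t \<omega>"
  proof (rule bounded_on_drift_bounded[OF k \<omega>])
    have "?k i s \<omega> \<le> max 1 C \<and> lam s \<omega> $ i \<le> max 1 C" if s: "s \<in> {0..t}" for i s
    proof -
      have h0: "0 \<le> ?h i s \<omega>" using factor_nonneg[OF h _ \<omega>] s by auto
      have "?h i s \<omega> powr a \<le> max 1 C powr a" using hC[OF s, of i] a h0 by (intro powr_mono2) auto
      also have "\<dots> \<le> max 1 C powr 1" using a by (intro powr_mono) auto
      finally show ?thesis using hC[OF s, of i] by simp
    qed
    then show "bounded_on ?k t \<omega>" unfolding bounded_on_def by blast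
  qed
  have em: "(\<lambda>(s, \<omega>). entropy_rate (\<gamma> i s \<omega>) * lam s \<omega> $ i) \<in> borel_measurable PS" for i
    using factor_measurable[OF \<gamma>, of i] lam_measurable[of i] by (simp add: case_prod_beta' entropy_rate_def)
  have ei: "set_integrable lborel {u..t} (\<lambda>s. entropy_rate (\<gamma> i s \<omega>) * lam s \<omega> $ i)" for i
  proof (rule section_set_integrable[OF em \<omega> _ ut(1)])
    fix s assume s: "s \<in> {0..t}"
    have g0: "0 \<le> \<gamma> i s \<omega>" "0 \<le> lam s \<omega> $ i" using factor_nonneg[OF \<gamma> _ \<omega>] lam_nn[OF _ \<omega>] s by auto
    have "entropy_rate (\<gamma> i s \<omega>) \<le> (\<gamma> i s \<omega> - 1)\<^sup>2" by (rule entropy_rate_le[OF g0(1)])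
    also have "\<dots> \<le> (\<bar>C\<bar> + 1)\<^sup>2" using C[OF s, of i] g0 by (intro power2_le_iff_abs_le[THEN iffD2]) auto
    finally show "\<bar>entropy_rate (\<gamma> i s \<omega>) * lam s \<omega> $ i\<bar> \<le> (\<bar>C\<bar> + 1)\<^sup>2 * \<bar>C\<bar>"
      unfolding abs_mult using C[OF s, of i] g0 entropy_rate_nonneg[OF g0(1)] by (intro mult_mono) auto
  qed
  have D: "- (LINT s:{0..t}|lborel. drift ?k s \<omega>) \<le> a * (- (LINT s:{0..t}|lborel. drift ?h s \<omega>)) + (1 - a) * (\<Sum>i\<in>UNIV. LINT s:{u..t}|lborel. entropy_rate (\<gamma> i s \<omega>) * lam s \<omega> $ i)"
  proof -
    have "- (LINT s:{0..t}|lborel. (?k i s \<omega> - 1) * lam s \<omega> $ i) \<le> a * (- (LINT s:{0..t}|lborel. (?h i s \<omega> - 1) * lam s \<omega> $ i)) + (1 - a) * (LINT s:{u..t}|lborel. entropy_rate (\<gamma> i s \<omega>) * lam s \<omega> $ i)" for i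
    proof -
      let ?K = "\<lambda>s. indicator {0..t} s *\<^sub>R ((?k i s \<omega> - 1) * lam s \<omega> $ i)"
      let ?H = "\<lambda>s. indicator {0..t} s *\<^sub>R ((?h i s \<omega> - 1) * lam s \<omega> $ i)"
      let ?E = "\<lambda>s. indicator {u..t} s *\<^sub>R (entropy_rate (\<gamma> i s \<omega>) * lam s \<omega> $ i)"
      have iK: "integrable lborel ?K" using drift_terms_integrable[OF k \<omega> kb order_refl, of i] by (simp add: set_integrable_def)
      have iH: "integrable lborel ?H" using drift_terms_integrable[OF h \<omega> hb order_refl, of i] by (simp add: set_integrable_def)
      have iE: "integrable lborel ?E" using ei[of i] by (simp add: set_integrable_def)
      have "(LINT s|lborel. a * ?H s - (1 - a) * ?E s) \<le> (LINT s|lborel. ?K s)"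
      proof (rule integral_mono[OF _ iK])
        show "integrable lborel (\<lambda>s. a * ?H s - (1 - a) * ?E s)" using iH iE by (intro Bochner_Integration.integrable_diff integrable_mult_right)
        fix s
        show "a * ?H s - (1 - a) * ?E s \<le> ?K s"
        proof (cases "s \<in> {0..t}")
          case True
          have l0: "0 \<le> lam s \<omega> $ i" "0 \<le> ?h i s \<omega>" "0 \<le> \<gamma> i s \<omega>"
            using lam_nn[OF _ \<omega>] factor_nonneg[OF h _ \<omega>] factor_nonneg[OF \<gamma> _ \<omega>] True by auto
          show ?thesis
          proof (cases "?h i s \<omega> = 1")
            case h1: True
            have "0 \<le> (1 - a) * (entropy_rate (\<gamma> i s \<omega>) * lam s \<omega> $ i)"
              using a l0 entropy_rate_nonneg[OF l0(3)] by (intro mult_nonneg_nonneg) auto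
            then show ?thesis using True h1 by (auto simp: indicator_def)
          next
            case False
            then have hs: "u < s" "?h i s \<omega> = \<gamma> i s \<omega>" using trunc_start_cases[of n u A i s \<omega>] by auto
            have "(a * (\<gamma> i s \<omega> - 1) - (1 - a) * entropy_rate (\<gamma> i s \<omega>)) * lam s \<omega> $ i \<le> (\<gamma> i s \<omega> powr a - 1) * lam s \<omega> $ i"
              using powr_entropy_bound[OF a l0(3)] l0(1) by (intro mult_right_mono)
            then show ?thesis using True hs by (simp add: indicator_def algebra_simps)
          qed
        qed (use ut in \<open>auto simp: indicator_def\<close>)
      qed
      moreover have "(LINT s|lborel. a * ?H s - (1 - a) * ?E s) = a * (LINT s|lborel. ?H s) - (1 - a) * (LINT s|lborel. ?E s)"
        using Bochner_Integration.integral_diff[OF integrable_mult_right[OF iH, of a] integrable_mult_right[OF iE, of "1 - a"]] by simp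
      ultimately show ?thesis unfolding set_lebesgue_integral_def by simp
    qed
    then have "(\<Sum>i\<in>UNIV. - (LINT s:{0..t}|lborel. (?k i s \<omega> - 1) * lam s \<omega> $ i)) \<le> (\<Sum>i\<in>UNIV. a * (- (LINT s:{0..t}|lborel. (?h i s \<omega> - 1) * lam s \<omega> $ i)) + (1 - a) * (LINT s:{u..t}|lborel. entropy_rate (\<gamma> i s \<omega>) * lam s \<omega> $ i))"
      by (rule sum_mono)
    then show ?thesis
      unfolding drift_integral[OF h \<omega> hb order_refl] drift_integral[OF k \<omega> kb order_refl]
      by (simp add: sum.distrib sum_negf sum_distrib_left sum_subtractf)
  qed
  have pw: "(\<Prod>i\<in>UNIV. \<Prod>s\<in>J i \<omega> \<inter> {0<..t}. ?k i s \<omega>) = (\<Prod>i\<in>UNIV. \<Prod>s\<in>J i \<omega> \<inter> {0<..t}. ?h i s \<omega>) powr a"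
  proof -
    have pp: "(\<Prod>x\<in>S. f x powr a) = (\<Prod>x\<in>S. f x) powr a" if "\<And>x. x \<in> S \<Longrightarrow> 0 \<le> f x" for S :: "'c set" and f :: "'c \<Rightarrow> real"
      using that by (induction S rule: infinite_finite_induct) (auto simp: powr_mult prod_nonneg)
    have h0: "0 \<le> ?h i s \<omega>" if "s \<in> J i \<omega> \<inter> {0<..t}" for i s
      by (rule factor_nonneg[OF h _ \<omega>]) (use that in auto)
    have "(\<Prod>s\<in>J i \<omega> \<inter> {0<..t}. ?k i s \<omega>) = (\<Prod>s\<in>J i \<omega> \<inter> {0<..t}. ?h i s \<omega>) powr a" for i
      by (rule pp[OF h0])
    then have "(\<Prod>i\<in>UNIV. \<Prod>s\<in>J i \<omega> \<inter> {0<..t}. ?k i s \<omega>) = (\<Prod>i\<in>UNIV. (\<Prod>s\<in>J i \<omega> \<inter> {0<..t}. ?h i s \<omega>) powr a)"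
      by simp
    also have "\<dots> = (\<Prod>i\<in>UNIV. \<Prod>s\<in>J i \<omega> \<inter> {0<..t}. ?h i s \<omega>) powr a"
      by (rule pp) (intro prod_nonneg h0)
    finally show ?thesis .
  qed
  have P0: "0 \<le> (\<Prod>i\<in>UNIV. \<Prod>s\<in>J i \<omega> \<inter> {0<..t}. ?h i s \<omega>)"
    by (intro prod_nonneg factor_nonneg[OF h _ \<omega>]) auto
  have "Z ?k t \<omega> \<le> exp (a * (- (LINT s:{0..t}|lborel. drift ?h s \<omega>)) + (1 - a) * (\<Sum>i\<in>UNIV. LINT s:{u..t}|lborel. entropy_rate (\<gamma> i s \<omega>) * lam s \<omega> $ i)) * (\<Prod>i\<in>UNIV. \<Prod>s\<in>J i \<omega> \<inter> {0<..t}. ?h i s \<omega>) powr a"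
    unfolding Z_eq[OF \<omega>] pw using D by (intro mult_right_mono) auto
  also have "\<dots> = Z ?h t \<omega> powr a * exp (\<Sum>i\<in>UNIV. LINT s:{u..t}|lborel. entropy_rate (\<gamma> i s \<omega>) * lam s \<omega> $ i) powr (1 - a)"
  proof -
    have "exp (a * (- d) + (1 - a) * e) * p powr a = (exp (- d) * p) powr a * exp e powr (1 - a)" if "0 \<le> p" for d e p :: real
    proof -
      have "exp (a * (- d) + (1 - a) * e) = exp (a * (- d)) * exp ((1 - a) * e)" by (rule exp_add)
      moreover have "(exp (- d) * p) powr a = exp (a * (- d)) * p powr a" using that by (simp add: powr_mult exp_powr_real mult.commute)
      moreover have "exp e powr (1 - a) = exp ((1 - a) * e)" by (simp add: exp_powr_real mult.commute)
      ultimately show ?thesis by (simp only: mult_ac)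
    qed
    then show ?thesis unfolding Z_eq[OF \<omega>, of ?h] using P0 by blast
  qed
  finally show ?thesis .
qed

lemma Z_ratio_measurable:
  assumes ut: "0 \<le> u" "u \<le> t"
  shows "AE \<omega> in P. Z (start u (space P)) t \<omega> = Z_ratio u t \<omega>"
  using \<gamma>_bounded AE_space by eventually_elim (simp add: Z_start[OF _ _ ut])

text \<open>One step: the ratio \<open>Z\<^sub>t / Z\<^sub>u\<close> has conditional expectation 1, if all factors started at \<open>u\<close> on an
  event of \<open>F u\<close> have expectation 1.\<close>

lemma Z_step:
  assumes ut: "0 \<le> u" "u \<le> t"
    and E: "\<And>A. A \<in> sets (F (ennreal u)) \<Longrightarrow> (LINT \<omega>|P. Z (start u A) t \<omega>) = 1"
    and A: "A \<in> sets (F (ennreal u))"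
  shows "(\<integral>\<^sup>+\<omega>. ennreal (indicator A \<omega> * Z \<gamma> t \<omega>) \<partial>P) = (\<integral>\<^sup>+\<omega>. ennreal (indicator A \<omega> * Z \<gamma> u \<omega>) \<partial>P)"
proof -
  have t0: "0 \<le> t" using ut by simp
  define R where "R = Z (start u (space P)) t"
  have top: "space P \<in> sets (F (ennreal u))" using sets.top[of "F (ennreal u)"] by (simp add: space_F)
  have Rm: "R \<in> borel_measurable P" unfolding R_def by (rule Z_measurable[OF start_factor[OF ut(1) top] t0])
  have R0: "0 \<le> R \<omega>" if "\<omega> \<in> space P" for \<omega> unfolding R_def by (rule Z_nonneg[OF start_factor[OF ut(1) top] that])
  have Req: "AE \<omega> in P. R \<omega> = Z_ratio u t \<omega>" unfolding R_def by (rule Z_ratio_measurable[OF ut])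
  have sets: "(\<integral>\<^sup>+\<omega>. indicator B \<omega> * ennreal (R \<omega>) \<partial>P) = emeasure P B" if B: "B \<in> sets (F (ennreal u))" for B
  proof -
    have BP: "B \<in> sets P" using B by (rule sets_F_P)
    note fB = start_factor[OF ut(1) B]
    have iB: "integrable P (Z (start u B) t)" by (rule Z_integrable_le_1(1)[OF fB start_bounded t0])
    have "1 = (\<integral>\<^sup>+\<omega>. ennreal (Z (start u B) t \<omega>) \<partial>P)"
      using E[OF B] nn_integral_eq_integral[OF iB] Z_nonneg[OF fB] by simp
    also have "\<dots> = (\<integral>\<^sup>+\<omega>. indicator B \<omega> * ennreal (R \<omega>) + indicator (space P - B) \<omega> \<partial>P)"
    proof (rule nn_integral_cong_AE)
      show "AE \<omega> in P. ennreal (Z (start u B) t \<omega>) = indicator B \<omega> * ennreal (R \<omega>) + indicator (space P - B) \<omega>"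
        using \<gamma>_bounded AE_space Req by eventually_elim (simp add: Z_start[OF _ _ ut] indicator_def)
    qed
    also have "\<dots> = (\<integral>\<^sup>+\<omega>. indicator B \<omega> * ennreal (R \<omega>) \<partial>P) + emeasure P (space P - B)"
      using BP Rm by (subst nn_integral_add) auto
    finally have 1: "emeasure P (space P - B) + (\<integral>\<^sup>+\<omega>. indicator B \<omega> * ennreal (R \<omega>) \<partial>P) = 1" by (simp add: add.commute)
    have "(space P - B) \<inter> B = {}" by blast
    then have 2: "emeasure P (space P - B) + emeasure P B = 1"
      using plus_emeasure[of "space P - B" P B] BP sets.sets_into_space[OF BP] by (simp add: Un_absorb2 emeasure_space_1)
    from 1 2 have "emeasure P (space P - B) + (\<integral>\<^sup>+\<omega>. indicator B \<omega> * ennreal (R \<omega>) \<partial>P) = emeasure P (space P - B) + emeasure P B"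
      by simp
    then show ?thesis unfolding ennreal_add_left_cancel by simp
  qed
  have weighted: "(\<integral>\<^sup>+\<omega>. W \<omega> * ennreal (R \<omega>) \<partial>P) = (\<integral>\<^sup>+\<omega>. W \<omega> \<partial>P)" if "W \<in> borel_measurable (F (ennreal u))" for W :: "'a \<Rightarrow> ennreal"
    using that
  proof (induction rule: borel_measurable_induct)
    case (cong f g)
    have "(\<integral>\<^sup>+\<omega>. f \<omega> * ennreal (R \<omega>) \<partial>P) = (\<integral>\<^sup>+\<omega>. g \<omega> * ennreal (R \<omega>) \<partial>P)" "(\<integral>\<^sup>+\<omega>. f \<omega> \<partial>P) = (\<integral>\<^sup>+\<omega>. g \<omega> \<partial>P)"
      using cong(3) by (auto intro!: nn_integral_cong simp: space_F)
    then show ?case using cong(4) by simp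
  next
    case (set B)
    then show ?case using sets[OF set] sets_F_P[OF set] by simp
  next
    case (mult w c)
    have "w \<in> borel_measurable P" by (rule measurable_F_P[OF mult(2)])
    then show ?case using mult Rm by (simp add: nn_integral_cmult mult.assoc)
  next
    case (add v w)
    have "w \<in> borel_measurable P" "v \<in> borel_measurable P" using add by (auto intro: measurable_F_P)
    then show ?case using add Rm by (simp add: nn_integral_add distrib_right)
  next
    case (seq U)
    have Um: "U n \<in> borel_measurable P" for n by (rule measurable_F_P[OF seq(1)])
    have inc: "incseq (\<lambda>n \<omega>. U n \<omega> * ennreal (R \<omega>))" using seq(3) by (auto simp: incseq_def le_fun_def intro!: mult_right_mono)
    have W: "W = (\<lambda>\<omega>. SUP n. U n \<omega>)" using seq(4) by (auto simp: SUP_apply[abs_def])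
    have "(\<integral>\<^sup>+\<omega>. W \<omega> * ennreal (R \<omega>) \<partial>P) = (\<integral>\<^sup>+\<omega>. (SUP n. U n \<omega> * ennreal (R \<omega>)) \<partial>P)"
      unfolding W by (simp add: SUP_mult_right_ennreal)
    also have "\<dots> = (SUP n. \<integral>\<^sup>+\<omega>. U n \<omega> * ennreal (R \<omega>) \<partial>P)"
      by (rule nn_integral_monotone_convergence_SUP[OF inc]) (use Um Rm in auto)
    also have "\<dots> = (SUP n. \<integral>\<^sup>+\<omega>. U n \<omega> \<partial>P)" using seq.IH by simp
    also have "\<dots> = (\<integral>\<^sup>+\<omega>. W \<omega> \<partial>P)"
      unfolding W by (rule nn_integral_monotone_convergence_SUP[OF seq(3) Um, symmetric])
    finally have *: "(\<integral>\<^sup>+\<omega>. W \<omega> * ennreal (R \<omega>) \<partial>P) = (\<integral>\<^sup>+\<omega>. W \<omega> \<partial>P)" .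
    show ?case using * unfolding seq(4) .
  qed
  have Wm: "(\<lambda>\<omega>. ennreal (indicator A \<omega> * Z \<gamma> u \<omega>)) \<in> borel_measurable (F (ennreal u))"
    using Z_adapted[OF \<gamma> ut(1)] A by measurable
  have "(\<integral>\<^sup>+\<omega>. ennreal (indicator A \<omega> * Z \<gamma> t \<omega>) \<partial>P) = (\<integral>\<^sup>+\<omega>. ennreal (indicator A \<omega> * Z \<gamma> u \<omega>) * ennreal (R \<omega>) \<partial>P)"
  proof (rule nn_integral_cong_AE)
    show "AE \<omega> in P. ennreal (indicator A \<omega> * Z \<gamma> t \<omega>) = ennreal (indicator A \<omega> * Z \<gamma> u \<omega>) * ennreal (R \<omega>)"
      using \<gamma>_bounded AE_space Req
    proof eventually_elim
      case (elim \<omega>)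
      have "Z \<gamma> t \<omega> = Z \<gamma> u \<omega> * R \<omega>" using Z_split[OF elim(2) _ ut] elim by simp
      then show ?case using Z_nonneg[OF \<gamma> elim(2), of u] R0[OF elim(2)]
        by (simp add: ennreal_mult[symmetric] mult.assoc)
    qed
  qed
  then show ?thesis using weighted[OF Wm] by simp
qed

end

end

section \<open>The Doleans-Dade exponential\<close>

lemma has_stieltjes_integral_cong:
  assumes "\<And>x. x \<in> {a<..b} \<Longrightarrow> f x = g x"
  shows "has_stieltjes_integral f A a b I \<longleftrightarrow> has_stieltjes_integral g A a b I"
proof -
  have "set_integrable (interval_measure B) {a<..b} f \<longleftrightarrow> set_integrable (interval_measure B) {a<..b} g"
    "(LINT s:{a<..b}|interval_measure B. f s) = (LINT s:{a<..b}|interval_measure B. g s)" for B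
    by (intro set_integrable_cong refl, rule assms, simp, intro set_lebesgue_integral_cong, use assms in auto)
  then show ?thesis unfolding has_stieltjes_integral_def by simp
qed

text \<open>The left-limit path, with the value \<open>0\<close> at time \<open>0\<close>, which integrals over \<open>{0<..t}\<close> do not see.\<close>

definition path_left :: "(real \<Rightarrow> real) \<Rightarrow> real \<Rightarrow> real" where
  "path_left f t = (if 0 < t then left_lim f t else 0)"

lemma path_left_bounded:
  assumes "cadlag f"
  shows "\<exists>K. \<forall>t\<le>T. \<bar>path_left f t\<bar> \<le> K"
proof -
  obtain K where K: "\<And>t. t \<in> {0..T} \<Longrightarrow> \<bar>f t\<bar> \<le> K" using cadlag_bounded[OF assms] by blast
  have "\<bar>path_left f t\<bar> \<le> \<bar>K\<bar>" if t: "t \<le> T" for t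
  proof (cases "0 < t")
    case True
    have "((\<lambda>s. \<bar>f s\<bar>) \<longlongrightarrow> \<bar>left_lim f t\<bar>) (at_left t)"
      using left_lim_tendsto[OF assms True] by (rule tendsto_rabs)
    moreover have "eventually (\<lambda>s. \<bar>f s\<bar> \<le> \<bar>K\<bar>) (at_left t)"
      using eventually_at_left_real[OF True]
    proof eventually_elim
      case (elim s)
      then show ?case using K[of s] t by auto
    qed
    ultimately have "\<bar>left_lim f t\<bar> \<le> \<bar>K\<bar>" by (rule tendsto_upperbound) simp
    then show ?thesis using True by (simp add: path_left_def)
  qed (simp add: path_left_def)
  then show ?thesis by blast
qed

context usual_filtered_prob_space
begin

text \<open>A deterministic process is adapted, so the result on predictable left limits applies to a single path.\<close>

lemma path_left_measurable:
  assumes f: "cadlag f"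
  shows "path_left f \<in> borel_measurable borel"
proof -
  obtain \<omega> where \<omega>: "\<omega> \<in> space P" using not_empty by blast
  have "(\<lambda>(t, \<omega>::'a). path_left f t) \<in> borel_measurable PS"
  proof (rule predictable_left_limit[where Y = "\<lambda>t \<omega>. f t" and c = 0])
    show "((\<lambda>s. f s) \<longlongrightarrow> path_left f t) (at_left t)" if "0 < t" for t
      using left_lim_tendsto[OF f that] that by (simp add: path_left_def)
  qed (auto simp: path_left_def)
  from predictable_section[OF this \<omega>] have "(\<lambda>s. if 0 \<le> s then path_left f s else 0) \<in> borel_measurable borel" .
  moreover have "(\<lambda>s. if 0 \<le> s then path_left f s else 0) = path_left f" by (auto simp: path_left_def fun_eq_iff)
  ultimately show ?thesis by simp
qed

end

context intensity_setup
begin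

context
  fixes \<gamma> :: "real \<Rightarrow> 'a \<Rightarrow> real^'d"
  assumes \<gamma>: "intensity_factor (\<lambda>i s \<omega>. \<gamma> s \<omega> $ i)"
    and \<gamma>_bounded: "AE \<omega> in P. \<forall>t. bounded_on (\<lambda>i s \<omega>. \<gamma> s \<omega> $ i) t \<omega>"
begin

text \<open>The factor as a function of the coordinate, and the integral process that drives the exponential.\<close>

abbreviation G :: "'d \<Rightarrow> real \<Rightarrow> 'a \<Rightarrow> real" where
  "G \<equiv> \<lambda>i s \<omega>. \<gamma> s \<omega> $ i"

abbreviation X :: "real \<Rightarrow> 'a \<Rightarrow> real" where
  "X \<equiv> integral_process (\<lambda>t \<omega>. \<chi> i. \<gamma> t \<omega> $ i - 1) (compensated N lam)"

lemma G_section: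
  assumes \<omega>: "\<omega> \<in> space P" and u: "0 \<le> u" and q: "q \<in> borel_measurable borel"
  shows "(\<lambda>x. indicator {u<..t} x * (q (\<gamma> x \<omega> $ i) :: real)) \<in> borel_measurable borel"
proof -
  have "(\<lambda>s. if 0 \<le> s then \<gamma> s \<omega> $ i else 0) \<in> borel_measurable borel"
    by (rule predictable_section[OF factor_measurable[OF \<gamma>] \<omega>])
  then have "(\<lambda>x. indicator {u<..t} x * q (if 0 \<le> x then \<gamma> x \<omega> $ i else 0)) \<in> borel_measurable borel"
    using q by measurable
  moreover have "(\<lambda>x. indicator {u<..t} x * q (if 0 \<le> x then \<gamma> x \<omega> $ i else 0)) = (\<lambda>x. indicator {u<..t} x * q (\<gamma> x \<omega> $ i))"
    using u by (auto simp: indicator_def fun_eq_iff)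
  ultimately show ?thesis by simp
qed

lemma N_jump_sum:
  assumes \<omega>: "\<omega> \<in> space P" and u: "0 \<le> u" and s: "s \<in> {u..t}"
  shows "N s \<omega> $ i = N u \<omega> $ i + (\<Sum>r\<in>(J i \<omega> \<inter> {u<..t}) \<inter> {..s}. 1)"
proof -
  have "(J i \<omega> \<inter> {u<..t}) \<inter> {..s} = J i \<omega> \<inter> {u<..s}" using s by auto
  then show ?thesis using N_increment[OF \<omega> u, of s i] s by simp
qed

lemma log_plus_stieltjes:
  assumes \<omega>: "\<omega> \<in> space P" and b: "bounded_on G t \<omega>" and u: "0 \<le> u"
  shows "stieltjes_integral (\<lambda>s. log_plus (\<gamma> s \<omega> $ i)) (\<lambda>s. N s \<omega> $ i) u t = (\<Sum>s\<in>J i \<omega> \<inter> {u<..t}. log_plus (\<gamma> s \<omega> $ i))"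
proof (rule stieltjes_integral_eqI)
  obtain C where C: "\<And>i s. s \<in> {0..t} \<Longrightarrow> \<gamma> s \<omega> $ i \<le> C \<and> lam s \<omega> $ i \<le> C" using b unfolding bounded_on_def by blast
  have "has_stieltjes_integral (\<lambda>s. log_plus (\<gamma> s \<omega> $ i)) (\<lambda>s. N s \<omega> $ i) u t
     ((\<Sum>r\<in>J i \<omega> \<inter> {u<..t}. 1 * log_plus (\<gamma> r \<omega> $ i)) - (LINT r:{u..t}|lborel. log_plus (\<gamma> r \<omega> $ i) * 0))"
  proof (rule has_stieltjes_integral_jumps_density)
    show "finite (J i \<omega> \<inter> {u<..t})" by (rule finite_J'[OF \<omega> u])
    show "set_integrable lborel {u..t} (\<lambda>_. 0::real)" by (simp add: set_integrable_def)
    show "(\<lambda>x. indicator {u<..t} x * log_plus (\<gamma> x \<omega> $ i)) \<in> borel_measurable borel"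
      by (rule G_section[OF \<omega> u]) (unfold log_plus_def, measurable)
    show "\<bar>log_plus (\<gamma> x \<omega> $ i)\<bar> \<le> \<bar>C\<bar>" if x: "x \<in> {u<..t}" for x
    proof -
      have g: "0 \<le> \<gamma> x \<omega> $ i" "\<gamma> x \<omega> $ i \<le> C" using factor_nonneg[OF \<gamma> _ \<omega>, of x i] C[of x i] x u by auto
      have "ln (\<gamma> x \<omega> $ i) \<le> \<gamma> x \<omega> $ i"
      proof (cases "\<gamma> x \<omega> $ i = 0")
        case False
        then show ?thesis using ln_le_minus_one[of "\<gamma> x \<omega> $ i"] g by simp
      qed simp
      then show ?thesis using g by (auto simp: log_plus_def)
    qed
    show "N s \<omega> $ i = N u \<omega> $ i + (\<Sum>r\<in>(J i \<omega> \<inter> {u<..t}) \<inter> {..s}. 1) - (LINT r:{u..s}|lborel. 0)" if "s \<in> {u..t}" for s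
      using N_jump_sum[OF \<omega> u that, of i] by (simp add: set_lebesgue_integral_def)
  qed auto
  then show "has_stieltjes_integral (\<lambda>s. log_plus (\<gamma> s \<omega> $ i)) (\<lambda>s. N s \<omega> $ i) u t (\<Sum>s\<in>J i \<omega> \<inter> {u<..t}. log_plus (\<gamma> s \<omega> $ i))"
    by (simp add: set_lebesgue_integral_def)
qed

text \<open>Along a bounded path the driving process has finitely many jumps and a bounded drift on \<open>{0..t}\<close>.\<close>

lemma driving_path:
  assumes \<omega>: "\<omega> \<in> space P" and b: "bounded_on G t \<omega>" and t: "0 \<le> t"
  shows "X t \<omega> = (\<Sum>s\<in>all_jumps \<omega> \<inter> {0<..t}. jump_factor G s \<omega> - 1) - (LINT s:{0..t}|lborel. drift G s \<omega>)"
proof -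
  obtain C where C: "\<And>i s. s \<in> {0..t} \<Longrightarrow> \<gamma> s \<omega> $ i \<le> C \<and> lam s \<omega> $ i \<le> C" using b unfolding bounded_on_def by blast
  have "stieltjes_integral (\<lambda>s. (\<chi> i. \<gamma> s \<omega> $ i - 1) $ i) (\<lambda>s. compensated N lam s \<omega> $ i) 0 t
      = (\<Sum>s\<in>J i \<omega> \<inter> {0<..t}. 1 * (\<gamma> s \<omega> $ i - 1)) - (LINT s:{0..t}|lborel. (\<gamma> s \<omega> $ i - 1) * lam s \<omega> $ i)" for i
  proof (rule stieltjes_integral_eqI, simp only: vec_lambda_beta, rule has_stieltjes_integral_jumps_density)
    show "finite (J i \<omega> \<inter> {0<..t})" by (rule finite_J[OF \<omega>])
    show "set_integrable lborel {0..t} (\<lambda>s. lam s \<omega> $ i)"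
      by (rule section_set_integrable[OF lam_measurable \<omega> _ order_refl, of _ _ C]) (use C lam_nn[OF _ \<omega>] in auto)
    show "(\<lambda>x. indicator {0<..t} x * (\<gamma> x \<omega> $ i - 1)) \<in> borel_measurable borel"
      by (rule G_section[OF \<omega> order_refl]) measurable
    show "\<bar>\<gamma> x \<omega> $ i - 1\<bar> \<le> \<bar>C\<bar> + 1" if "x \<in> {0<..t}" for x
      using C[of x i] factor_nonneg[OF \<gamma> _ \<omega>, of x i] that by auto
    show "compensated N lam s \<omega> $ i = N 0 \<omega> $ i + (\<Sum>r\<in>(J i \<omega> \<inter> {0<..t}) \<inter> {..s}. 1) - (LINT r:{0..s}|lborel. lam r \<omega> $ i)" if "s \<in> {0..t}" for s
      using N_jump_sum[OF \<omega> order_refl that, of i] by (simp add: compensated_def)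
  qed auto
  then have "X t \<omega> = (\<Sum>i\<in>UNIV. (\<Sum>s\<in>J i \<omega> \<inter> {0<..t}. \<gamma> s \<omega> $ i - 1)) - (\<Sum>i\<in>UNIV. LINT s:{0..t}|lborel. (\<gamma> s \<omega> $ i - 1) * lam s \<omega> $ i)"
    unfolding integral_process_def by (simp add: sum_subtractf)
  also have "(\<Sum>i\<in>UNIV. LINT s:{0..t}|lborel. (\<gamma> s \<omega> $ i - 1) * lam s \<omega> $ i) = (LINT s:{0..t}|lborel. drift G s \<omega>)"
    by (rule drift_integral[OF \<gamma> \<omega> bounded_on_drift_bounded[OF \<gamma> \<omega> b] order_refl, symmetric])
  also have "(\<Sum>i\<in>UNIV. (\<Sum>s\<in>J i \<omega> \<inter> {0<..t}. \<gamma> s \<omega> $ i - 1)) = (\<Sum>s\<in>all_jumps \<omega> \<inter> {0<..t}. jump_factor G s \<omega> - 1)"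
    unfolding sum_all_jumps[OF \<omega> order_refl] using jump_factor_eq[OF \<omega>, of _ _ G] by (intro sum.cong) auto
  finally show ?thesis .
qed

lemma integral_against_driving_path:
  assumes \<omega>: "\<omega> \<in> space P" and b: "\<And>t. bounded_on G t \<omega>" and t: "0 \<le> t" and z: "cadlag z"
  shows "has_stieltjes_integral (left_lim z) (\<lambda>s. X s \<omega>) 0 t
    ((\<Sum>s\<in>all_jumps \<omega> \<inter> {0<..t}. (jump_factor G s \<omega> - 1) * path_left z s) - (LINT s:{0..t}|lborel. path_left z s * drift G s \<omega>))"
proof -
  obtain K where K: "\<And>s. s \<le> t \<Longrightarrow> \<bar>path_left z s\<bar> \<le> K" using path_left_bounded[OF z] by blast
  obtain C where C: "\<And>s. s \<in> {0..t} \<Longrightarrow> \<bar>drift G s \<omega>\<bar> \<le> C" using drift_bound[OF bounded_on_drift_bounded[OF \<gamma> \<omega> b]] by blast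
  have "has_stieltjes_integral (path_left z) (\<lambda>s. X s \<omega>) 0 t
    ((\<Sum>s\<in>all_jumps \<omega> \<inter> {0<..t}. (jump_factor G s \<omega> - 1) * path_left z s) - (LINT s:{0..t}|lborel. path_left z s * drift G s \<omega>))"
  proof (rule has_stieltjes_integral_jumps_density)
    show "finite (all_jumps \<omega> \<inter> {0<..t})" by (rule finite_all_jumps[OF \<omega>])
    show "set_integrable lborel {0..t} (\<lambda>s. drift G s \<omega>)" by (rule bounded_set_integrable[OF drift_section[OF \<gamma> \<omega>] C])
    show "(\<lambda>x. indicator {0<..t} x * path_left z x) \<in> borel_measurable borel"
      using path_left_measurable[OF z] by measurable
    show "\<bar>path_left z x\<bar> \<le> K" if "x \<in> {0<..t}" for x using K[of x] that by auto
    show "X s \<omega> = 0 + (\<Sum>r\<in>(all_jumps \<omega> \<inter> {0<..t}) \<inter> {..s}. jump_factor G r \<omega> - 1) - (LINT r:{0..s}|lborel. drift G r \<omega>)" if s: "s \<in> {0..t}" for s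
    proof -
      have "(all_jumps \<omega> \<inter> {0<..t}) \<inter> {..s} = all_jumps \<omega> \<inter> {0<..s}" using s by auto
      then show ?thesis using driving_path[OF \<omega> b, of s] s by simp
    qed
  qed auto
  then show ?thesis
    by (rule has_stieltjes_integral_cong[THEN iffD1, rotated]) (auto simp: path_left_def)
qed

lemma path_left_integrable:
  assumes \<omega>: "\<omega> \<in> space P" and b: "\<And>t. bounded_on G t \<omega>" and z: "cadlag z"
  shows "set_integrable lborel {0..t} (\<lambda>s. path_left z s * drift G s \<omega>)"
proof -
  obtain K where K: "\<And>s. s \<le> t \<Longrightarrow> \<bar>path_left z s\<bar> \<le> K" using path_left_bounded[OF z] by blast
  obtain C where C: "\<And>s. s \<in> {0..t} \<Longrightarrow> \<bar>drift G s \<omega>\<bar> \<le> C" using drift_bound[OF bounded_on_drift_bounded[OF \<gamma> \<omega> b]] by blast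
  show ?thesis
  proof (rule bounded_set_integrable[where C = "\<bar>K\<bar> * \<bar>C\<bar>"])
    show "(\<lambda>s. path_left z s * drift G s \<omega>) \<in> borel_measurable borel"
      using path_left_measurable[OF z] drift_section[OF \<gamma> \<omega>] by measurable
    show "\<bar>path_left z x * drift G x \<omega>\<bar> \<le> \<bar>K\<bar> * \<bar>C\<bar>" if "x \<in> {0..t}" for x
      unfolding abs_mult using K[of x] C[OF that] that by (intro mult_mono) auto
  qed
qed

lemma Z_cadlag:
  assumes \<omega>: "\<omega> \<in> space P" and b: "\<And>t. bounded_on G t \<omega>"
  shows "cadlag (\<lambda>t. Z G t \<omega>)"
  unfolding cadlag_def
proof (intro conjI allI impI)
  note db = bounded_on_drift_bounded[OF \<gamma> \<omega> b]
  show "((\<lambda>t. Z G t \<omega>) \<longlongrightarrow> Z G t \<omega>) (at_right t)" if "0 \<le> t" for t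
    by (rule Z_right_limit[OF \<gamma> \<omega> db, of t "t + 1"]) (use that in auto)
  show "\<exists>l. ((\<lambda>t. Z G t \<omega>) \<longlongrightarrow> l) (at_left t)" if "0 < t" for t
    using Z_left_limit[OF \<gamma> \<omega> db that] by blast
qed

lemma Z_solves:
  assumes \<omega>: "\<omega> \<in> space P" and b: "\<And>t. bounded_on G t \<omega>" and t: "0 \<le> t"
  shows "has_stieltjes_integral (left_lim (\<lambda>s. Z G s \<omega>)) (\<lambda>s. X s \<omega>) 0 t (Z G t \<omega> - 1)"
proof -
  note db = bounded_on_drift_bounded[OF \<gamma> \<omega> b]
  let ?z = "\<lambda>s. Z G s \<omega>"
  note cad = Z_cadlag[OF \<omega> b]
  have pl: "path_left ?z s = Z_left G s \<omega>" if "0 < s" for s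
    using left_limI[OF Z_left_limit[OF \<gamma> \<omega> db that]] that by (simp add: path_left_def)
  have 1: "(\<Sum>s\<in>all_jumps \<omega> \<inter> {0<..t}. (jump_factor G s \<omega> - 1) * path_left ?z s) = (\<Sum>i\<in>UNIV. \<Sum>s\<in>J i \<omega> \<inter> {0<..t}. Z_left G s \<omega> * (\<gamma> s \<omega> $ i - 1))"
    unfolding sum_all_jumps[OF \<omega> order_refl] using jump_factor_eq[OF \<omega>, of _ _ G] pl by (intro sum.cong) (auto simp: mult.commute)
  have 2: "(LINT s:{0..t}|lborel. path_left ?z s * drift G s \<omega>) = (LINT s:{0..t}|lborel. Z_left G s \<omega> * drift G s \<omega>)"
    unfolding set_lebesgue_integral_def
  proof (rule integral_cong_AE)
    show "(\<lambda>s. indicat_real {0..t} s *\<^sub>R (path_left ?z s * drift G s \<omega>)) \<in> borel_measurable lborel"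
      using path_left_integrable[OF \<omega> b cad, of t] by (auto simp: set_integrable_def dest: borel_measurable_integrable)
    show "(\<lambda>s. indicat_real {0..t} s *\<^sub>R (Z_left G s \<omega> * drift G s \<omega>)) \<in> borel_measurable lborel"
      using Z_equation(1)[OF \<gamma> \<omega> db t] by (auto simp: set_integrable_def dest: borel_measurable_integrable)
    show "AE s in lborel. indicat_real {0..t} s *\<^sub>R (path_left ?z s * drift G s \<omega>) = indicat_real {0..t} s *\<^sub>R (Z_left G s \<omega> * drift G s \<omega>)"
      using AE_lborel_singleton[of 0] by eventually_elim (auto simp: indicator_def pl)
  qed
  show ?thesis
    using integral_against_driving_path[OF \<omega> b t cad] Z_equation(2)[OF \<gamma> \<omega> db t] unfolding 1 2 by simp
qed

lemma solution_unique:
  assumes \<omega>: "\<omega> \<in> space P" and b: "\<And>t. bounded_on G t \<omega>" and z: "cadlag z"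
    and eq: "\<And>t. 0 \<le> t \<Longrightarrow> has_stieltjes_integral (left_lim z) (\<lambda>s. X s \<omega>) 0 t (z t - 1)" and t: "0 \<le> t"
  shows "z t = Z G t \<omega>"
proof -
  let ?w = "\<lambda>s. Z G s \<omega>"
  note cad = Z_cadlag[OF \<omega> b]
  have ez: "z s - 1 = (\<Sum>r\<in>all_jumps \<omega> \<inter> {0<..s}. (jump_factor G r \<omega> - 1) * path_left z r) - (LINT r:{0..s}|lborel. path_left z r * drift G r \<omega>)" if "0 \<le> s" for s
    by (rule has_stieltjes_integral_unique[OF eq[OF that] integral_against_driving_path[OF \<omega> b that z]])
  have ew: "?w s - 1 = (\<Sum>r\<in>all_jumps \<omega> \<inter> {0<..s}. (jump_factor G r \<omega> - 1) * path_left ?w r) - (LINT r:{0..s}|lborel. path_left ?w r * drift G r \<omega>)" if "0 \<le> s" for s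
    by (rule has_stieltjes_integral_unique[OF Z_solves[OF \<omega> b that] integral_against_driving_path[OF \<omega> b that cad]])
  obtain C where C: "\<And>s. s \<in> {0..t} \<Longrightarrow> \<bar>drift G s \<omega>\<bar> \<le> C" using drift_bound[OF bounded_on_drift_bounded[OF \<gamma> \<omega> b]] by blast
  obtain K1 where K1: "\<And>s. s \<le> t \<Longrightarrow> \<bar>path_left z s\<bar> \<le> K1" using path_left_bounded[OF z] by blast
  obtain K2 where K2: "\<And>s. s \<le> t \<Longrightarrow> \<bar>path_left ?w s\<bar> \<le> K2" using path_left_bounded[OF cad] by blast
  have "(\<lambda>s. z s - ?w s) t = 0"
  proof (rule homogeneous_equation_zero[OF drift_section[OF \<gamma> \<omega>] C finite_all_jumps[OF \<omega>],
        where y = "\<lambda>s. z s - ?w s" and t = t and ym = "\<lambda>s. path_left z s - path_left ?w s" and c = "\<lambda>s. jump_factor G s \<omega> - 1" and K = "K1 + K2"])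
    show "z s - ?w s = (\<Sum>r\<in>all_jumps \<omega> \<inter> {0<..s}. (path_left z r - path_left ?w r) * (jump_factor G r \<omega> - 1))
       - (LINT r:{0..s}|lborel. (path_left z r - path_left ?w r) * drift G r \<omega>)" if s: "0 \<le> s" "s \<le> t" for s
    proof -
      have "(LINT r:{0..s}|lborel. (path_left z r - path_left ?w r) * drift G r \<omega>) = (LINT r:{0..s}|lborel. path_left z r * drift G r \<omega>) - (LINT r:{0..s}|lborel. path_left ?w r * drift G r \<omega>)"
        unfolding left_diff_distrib by (rule set_integral_diff(2)[OF path_left_integrable[OF \<omega> b z] path_left_integrable[OF \<omega> b cad]])
      moreover have "(\<Sum>r\<in>all_jumps \<omega> \<inter> {0<..s}. (path_left z r - path_left ?w r) * (jump_factor G r \<omega> - 1))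
        = (\<Sum>r\<in>all_jumps \<omega> \<inter> {0<..s}. (jump_factor G r \<omega> - 1) * path_left z r) - (\<Sum>r\<in>all_jumps \<omega> \<inter> {0<..s}. (jump_factor G r \<omega> - 1) * path_left ?w r)"
        unfolding sum_subtractf[symmetric] by (intro sum.cong) (auto simp: algebra_simps)
      ultimately show ?thesis using ez[OF s(1)] ew[OF s(1)] by simp
    qed
    show "((\<lambda>s. z s - ?w s) \<longlongrightarrow> path_left z s - path_left ?w s) (at_left s)" if "0 < s" "s \<le> t" for s
      using left_lim_tendsto[OF z that(1)] left_lim_tendsto[OF cad that(1)] that by (auto simp: path_left_def intro!: tendsto_diff)
    show "\<bar>path_left z s - path_left ?w s\<bar> \<le> K1 + K2" if "0 < s" "s \<le> t" for s
      using K1[OF that(2)] K2[OF that(2)] by linarith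
  qed (use t in auto)
  then show ?thesis by simp
qed

subsection \<open>Existence and the martingale property\<close>

lemma doleans_dade_exists: "\<exists>Y. doleans_dade P F X Y"
proof -
  define \<Omega> where "\<Omega> = {\<omega> \<in> space P. \<forall>t. bounded_on G t \<omega>}"
  (* off \<Omega> paths need not be cadlag; \<Omega> is in F 0 since the filtration contains all null sets *)
  define Y where "Y t \<omega> = (if \<omega> \<in> \<Omega> then Z G t \<omega> else 1)" for t \<omega>
  have "{\<omega> \<in> space P. \<not> (\<forall>t. bounded_on G t \<omega>)} \<in> null_sets P"
    using \<gamma>_bounded by (simp only: AE_iff_null_sets)
  then have "{\<omega> \<in> space P. \<not> (\<forall>t. bounded_on G t \<omega>)} \<in> sets (F 0)" using null_sets_F0 by blast
  then have "space (F 0) - {\<omega> \<in> space P. \<not> (\<forall>t. bounded_on G t \<omega>)} \<in> sets (F 0)" by (rule sets.compl_sets)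
  moreover have "space (F 0) - {\<omega> \<in> space P. \<not> (\<forall>t. bounded_on G t \<omega>)} = \<Omega>" by (auto simp: \<Omega>_def space_F)
  ultimately have \<Omega>0: "\<Omega> \<in> sets (F 0)" by simp
  have "doleans_dade P F X Y"
    unfolding doleans_dade_def
  proof (intro conjI ballI)
    show "adapted F Y"
      unfolding adapted_def
    proof (intro allI impI)
      fix t :: real assume t: "0 \<le> t"
      have "\<Omega> \<in> sets (F (ennreal t))" using \<Omega>0 by (rule sets_F_mono') simp
      then show "Y t \<in> borel_measurable (F (ennreal t))"
        unfolding Y_def[abs_def] using Z_adapted[OF \<gamma> t] sets.Int[OF \<open>\<Omega> \<in> sets (F (ennreal t))\<close> sets.top] by (intro measurable_If_set) auto
    qed
    show "cadlag (\<lambda>t. Y t \<omega>)" if "\<omega> \<in> space P" for \<omega>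
    proof (cases "\<omega> \<in> \<Omega>")
      case True
      then show ?thesis using Z_cadlag[of \<omega>] by (auto simp: Y_def \<Omega>_def)
    next
      case False then show ?thesis by (auto simp: Y_def cadlag_def)
    qed
    show "AE \<omega> in P. \<forall>t\<ge>0. has_stieltjes_integral (left_lim (\<lambda>s. Y s \<omega>)) (\<lambda>s. X s \<omega>) 0 t (Y t \<omega> - 1)"
      using \<gamma>_bounded AE_space
    proof eventually_elim
      case (elim \<omega>)
      then have "\<omega> \<in> \<Omega>" by (simp add: \<Omega>_def)
      then show ?case using Z_solves[OF elim(2)] elim(1) by (simp add: Y_def)
    qed
  qed
  then show ?thesis by blast
qed

lemma doleans_dade_eq_Z:
  assumes "doleans_dade P F X Y"
  shows "AE \<omega> in P. \<forall>t\<ge>0. Y t \<omega> = Z G t \<omega>"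
proof -
  have ae: "AE \<omega> in P. \<forall>t\<ge>0. has_stieltjes_integral (left_lim (\<lambda>s. Y s \<omega>)) (\<lambda>s. X s \<omega>) 0 t (Y t \<omega> - 1)"
    and cad: "\<And>\<omega>. \<omega> \<in> space P \<Longrightarrow> cadlag (\<lambda>t. Y t \<omega>)"
    using assms unfolding doleans_dade_def by auto
  show ?thesis using ae \<gamma>_bounded AE_space
  proof eventually_elim
    case (elim \<omega>)
    show ?case using solution_unique[OF elim(3) _ cad[OF elim(3)]] elim(1,2) by blast
  qed
qed

lemma martingale_of_steps:
  assumes \<epsilon>: "0 < \<epsilon>"
    and E: "\<And>u t A. 0 \<le> u \<Longrightarrow> u \<le> t \<Longrightarrow> t - u \<le> \<epsilon> \<Longrightarrow> A \<in> sets (F (ennreal u)) \<Longrightarrow> (LINT \<omega>|P. Z (start G u A) t \<omega>) = 1"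
    and Y: "adapted F Y" "AE \<omega> in P. \<forall>t\<ge>0. Y t \<omega> = Z G t \<omega>"
  shows "martingale P F Y"
proof -
  have chain: "(\<integral>\<^sup>+\<omega>. ennreal (indicator A \<omega> * Z G t \<omega>) \<partial>P) = (\<integral>\<^sup>+\<omega>. ennreal (indicator A \<omega> * Z G s \<omega>) \<partial>P)"
    if "0 \<le> s" "s \<le> t" "t - s \<le> real n * \<epsilon>" "A \<in> sets (F (ennreal s))" for n s t A
    using that
  proof (induction n arbitrary: t)
    case 0 then show ?case by simp
  next
    case (Suc n)
    (* one step back of length at most \<epsilon> *)
    define m where "m = max s (t - \<epsilon>)"
    have m: "s \<le> m" "m \<le> t" "t - m \<le> \<epsilon>" "m - s \<le> real n * \<epsilon>"
      using Suc.prems \<epsilon> by (auto simp: m_def max_def algebra_simps)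
    have Am: "A \<in> sets (F (ennreal m))" using Suc.prems(4) m(1) by (auto intro: sets_F_mono' ennreal_leI)
    have m0: "0 \<le> m" using m Suc.prems by simp
    have "(\<integral>\<^sup>+\<omega>. ennreal (indicator A \<omega> * Z G t \<omega>) \<partial>P) = (\<integral>\<^sup>+\<omega>. ennreal (indicator A \<omega> * Z G m \<omega>) \<partial>P)"
      by (rule Z_step[OF \<gamma> \<gamma>_bounded m0 m(2) E[OF m0 m(2,3)] Am])
    also have "\<dots> = (\<integral>\<^sup>+\<omega>. ennreal (indicator A \<omega> * Z G s \<omega>) \<partial>P)"
      by (rule Suc.IH) (use m Suc.prems in auto)
    finally show ?case .
  qed
  have iZ: "integrable P (Z G t)" if "0 \<le> t" for t
    by (rule Z_integrable_le_1(1)[OF \<gamma> _ that]) (use \<gamma>_bounded in \<open>auto elim!: eventually_mono\<close>)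
  have Yae: "AE \<omega> in P. Y t \<omega> = Z G t \<omega>" if "0 \<le> t" for t
    using Y(2) by eventually_elim (use that in auto)
  have Ym: "Y t \<in> borel_measurable (F (ennreal t))" if "0 \<le> t" for t using Y(1) that by (simp add: adapted_def)
  have iY: "integrable P (Y t)" if "0 \<le> t" for t
    by (rule integrable_cong_AE[THEN iffD2, OF measurable_F_P[OF Ym[OF that]] Z_measurable[OF \<gamma> that] Yae[OF that] iZ[OF that]])
  have set_int: "(LINT \<omega>:A|P. Y t \<omega>) = (LINT \<omega>:A|P. Y s \<omega>)" if st: "0 \<le> s" "s \<le> t" and A: "A \<in> sets (F (ennreal s))" for s t A
  proof -
    have AP: "A \<in> sets P" using A by (rule sets_F_P)
    have t0: "0 \<le> t" using st by simp
    obtain n where "(t - s) / \<epsilon> < real n" using reals_Archimedean2 by blast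
    then have "t - s \<le> real n * \<epsilon>" using \<epsilon> by (simp add: divide_less_eq)
    from chain[OF st this A]
    have eq: "(\<integral>\<^sup>+\<omega>. ennreal (indicator A \<omega> * Z G t \<omega>) \<partial>P) = (\<integral>\<^sup>+\<omega>. ennreal (indicator A \<omega> * Z G s \<omega>) \<partial>P)" .
    have nn: "(\<integral>\<^sup>+\<omega>. ennreal (indicator A \<omega> * Z G r \<omega>) \<partial>P) = ennreal (LINT \<omega>|P. indicator A \<omega> * Z G r \<omega>)"
      "0 \<le> (LINT \<omega>|P. indicator A \<omega> * Z G r \<omega>)" if "0 \<le> r" for r
    proof -
      have i: "integrable P (\<lambda>\<omega>. indicator A \<omega> * Z G r \<omega>)" using integrable_mult_indicator[OF AP iZ[OF that]] by simp
      have p: "AE \<omega> in P. 0 \<le> indicator A \<omega> * Z G r \<omega>" using AE_space by eventually_elim (simp add: Z_nonneg[OF \<gamma>])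
      show "(\<integral>\<^sup>+\<omega>. ennreal (indicator A \<omega> * Z G r \<omega>) \<partial>P) = ennreal (LINT \<omega>|P. indicator A \<omega> * Z G r \<omega>)" by (rule nn_integral_eq_integral[OF i p])
      show "0 \<le> (LINT \<omega>|P. indicator A \<omega> * Z G r \<omega>)" by (rule integral_nonneg_AE[OF p])
    qed
    have "(LINT \<omega>|P. indicator A \<omega> * Z G t \<omega>) = (LINT \<omega>|P. indicator A \<omega> * Z G s \<omega>)"
      using eq nn[OF st(1)] nn[OF t0] by simp
    moreover have "(LINT \<omega>:A|P. Y r \<omega>) = (LINT \<omega>|P. indicator A \<omega> * Z G r \<omega>)" if r: "0 \<le> r" for r
      unfolding set_lebesgue_integral_def
    proof (rule integral_cong_AE)
      show "(\<lambda>\<omega>. indicat_real A \<omega> *\<^sub>R Y r \<omega>) \<in> borel_measurable P" using AP measurable_F_P[OF Ym[OF r]] by measurable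
      show "(\<lambda>\<omega>. indicat_real A \<omega> * Z G r \<omega>) \<in> borel_measurable P" using AP Z_measurable[OF \<gamma> r] by measurable
      show "AE \<omega> in P. indicat_real A \<omega> *\<^sub>R Y r \<omega> = indicat_real A \<omega> * Z G r \<omega>" using Yae[OF r] by eventually_elim simp
    qed
    ultimately show ?thesis using st t0 by simp
  qed
  show ?thesis
    unfolding martingale_def
  proof (intro conjI allI impI)
    show "adapted F Y" by fact
    show "integrable P (Y t)" if "0 \<le> t" for t by (rule iY[OF that])
    fix s t :: real assume st: "0 \<le> s \<and> s \<le> t"
    show "AE \<omega> in P. real_cond_exp P (F (ennreal s)) (Y t) \<omega> = Y s \<omega>"
      by (rule sigma_finite_subalgebra.real_cond_exp_charact[OF sigma_finite_subalgebra_F])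
         (use st set_int iY Ym in auto)
  qed
qed

lemma expectation_entropy_condition:
  assumes ut: "0 \<le> u" "u \<le> t" and A: "A \<in> sets (F (ennreal u))"
    and fin: "(\<integral>\<^sup>+\<omega>. ennreal (exp (\<Sum>i\<in>UNIV. LINT s:{u..t}|lborel.
          (\<gamma> s \<omega> $ i * ln (\<gamma> s \<omega> $ i) - (\<gamma> s \<omega> $ i - 1)) * lam s \<omega> $ i)) \<partial>P) < \<infinity>"
  shows "(LINT \<omega>|P. Z (start G u A) t \<omega>) = 1"
proof -
  define Y where "Y \<omega> = exp (\<Sum>i\<in>UNIV. LINT s:{u..t}|lborel. entropy_rate (\<gamma> s \<omega> $ i) * lam s \<omega> $ i)" for \<omega>
  have t: "0 \<le> t" using ut by simp
  have em: "(\<lambda>(s, \<omega>). entropy_rate (\<gamma> s \<omega> $ i) * lam s \<omega> $ i) \<in> borel_measurable PS" for i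
    using factor_measurable[OF \<gamma>, of i] lam_measurable[of i] by (simp add: case_prod_beta' entropy_rate_def)
  have Ym: "Y \<in> borel_measurable P"
    unfolding Y_def[abs_def]
    using predictable_lebesgue_integral_measurable[OF em t ut(1), THEN measurable_F_P] by measurable
  have Yi: "integrable P Y"
    by (rule integrableI_nonneg[OF Ym]) (use fin in \<open>auto simp: Y_def entropy_rate_def\<close>)
  show ?thesis
  proof (rule Z_expectation_entropy[OF start_factor[OF \<gamma> \<gamma>_bounded ut(1) A] start_bounded[OF \<gamma> \<gamma>_bounded] t Yi])
    show "0 < Y \<omega>" for \<omega> by (simp add: Y_def)
    fix n :: nat and a :: real assume a: "0 < a" "a < 1"
    show "AE \<omega> in P. Z (\<lambda>i s \<omega>. trunc n (start G u A) i s \<omega> powr a) t \<omega> \<le> Z (trunc n (start G u A)) t \<omega> powr a * Y \<omega> powr (1 - a)"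
      using \<gamma>_bounded AE_space
    proof eventually_elim
      case (elim \<omega>)
      show ?case unfolding Y_def
        by (rule start_entropy_bound[OF \<gamma> \<gamma>_bounded elim(2) _ ut A a]) (use elim(1) in blast)
    qed
  qed
qed

lemma expectation_log_condition:
  assumes ut: "0 \<le> u" "u \<le> t" and A: "A \<in> sets (F (ennreal u))"
    and fin: "(\<integral>\<^sup>+\<omega>. ennreal (exp (\<Sum>i\<in>UNIV. (LINT s:{u..t}|lborel. lam s \<omega> $ i)
          + stieltjes_integral (\<lambda>s. log_plus (\<gamma> s \<omega> $ i)) (\<lambda>s. N s \<omega> $ i) u t)) \<partial>P) < \<infinity>"
  shows "(LINT \<omega>|P. Z (start G u A) t \<omega>) = 1"
proof -
  define W where "W \<omega> = exp (\<Sum>i\<in>UNIV. (LINT s:{u..t}|lborel. lam s \<omega> $ i) + (\<Sum>s\<in>J i \<omega> \<inter> {u<..t}. log_plus (\<gamma> s \<omega> $ i)))" for \<omega>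
  have t: "0 \<le> t" using ut by simp
  have jm: "(\<lambda>\<omega>. \<Sum>s\<in>J i \<omega> \<inter> {u<..t}. log_plus (\<gamma> s \<omega> $ i)) \<in> borel_measurable P" for i
  proof -
    define K where "K x = (if u < fst x then ennreal (log_plus (\<gamma> (fst x) (snd x) $ i)) else 0)" for x :: "real \<times> 'a"
    have "(\<lambda>x. \<gamma> (fst x) (snd x) $ i) \<in> borel_measurable PS" "(\<lambda>x. fst x) \<in> borel_measurable PS"
      using factor_measurable[OF \<gamma>, of i] predictable_time by (simp_all add: case_prod_beta')
    then have Km: "K \<in> borel_measurable PS"
      unfolding K_def[abs_def] log_plus_def by measurable
    have "(\<lambda>\<omega>. enn2real (jump_sum i t K \<omega>)) \<in> borel_measurable P"
      using jump_sum_measurable_P[OF Km t, of i] by measurable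
    moreover have "enn2real (jump_sum i t K \<omega>) = (\<Sum>s\<in>J i \<omega> \<inter> {u<..t}. log_plus (\<gamma> s \<omega> $ i))" if \<omega>: "\<omega> \<in> space P" for \<omega>
    proof -
      have "jump_sum i t K \<omega> = (\<Sum>s\<in>J i \<omega> \<inter> {0<..t}. if s \<in> {u<..} then ennreal (log_plus (\<gamma> s \<omega> $ i)) else 0)"
        unfolding jump_sum_eq[OF \<omega>] by (intro sum.cong) (auto simp: K_def)
      also have "\<dots> = (\<Sum>s\<in>J i \<omega> \<inter> {0<..t} \<inter> {u<..}. ennreal (log_plus (\<gamma> s \<omega> $ i)))"
        by (rule sum.inter_restrict[OF finite_J[OF \<omega>], symmetric])
      also have "J i \<omega> \<inter> {0<..t} \<inter> {u<..} = J i \<omega> \<inter> {u<..t}" using ut by auto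
      also have "(\<Sum>s\<in>J i \<omega> \<inter> {u<..t}. ennreal (log_plus (\<gamma> s \<omega> $ i))) = ennreal (\<Sum>s\<in>J i \<omega> \<inter> {u<..t}. log_plus (\<gamma> s \<omega> $ i))"
        by (rule sum_ennreal) (simp add: log_plus_def)
      finally show ?thesis by (simp add: sum_nonneg log_plus_def)
    qed
    ultimately show ?thesis by (rule measurable_cong[THEN iffD1, rotated])
  qed
  have Wm: "W \<in> borel_measurable P"
    unfolding W_def[abs_def]
    using jm predictable_lebesgue_integral_measurable[OF lam_measurable t ut(1), THEN measurable_F_P] by measurable
  have "(\<integral>\<^sup>+\<omega>. ennreal (W \<omega>) \<partial>P) = (\<integral>\<^sup>+\<omega>. ennreal (exp (\<Sum>i\<in>UNIV. (LINT s:{u..t}|lborel. lam s \<omega> $ i)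
          + stieltjes_integral (\<lambda>s. log_plus (\<gamma> s \<omega> $ i)) (\<lambda>s. N s \<omega> $ i) u t)) \<partial>P)"
  proof (rule nn_integral_cong_AE)
    show "AE \<omega> in P. ennreal (W \<omega>) = ennreal (exp (\<Sum>i\<in>UNIV. (LINT s:{u..t}|lborel. lam s \<omega> $ i)
          + stieltjes_integral (\<lambda>s. log_plus (\<gamma> s \<omega> $ i)) (\<lambda>s. N s \<omega> $ i) u t))"
      using \<gamma>_bounded AE_space
    proof eventually_elim
      case (elim \<omega>)
      then show ?case using log_plus_stieltjes[OF elim(2) _ ut(1), of t] by (simp add: W_def)
    qed
  qed
  then have Wi: "integrable P W"
    by (intro integrableI_nonneg[OF Wm]) (use fin in \<open>auto simp: W_def\<close>)
  show ?thesis
  proof (rule Z_expectation_dominated[OF start_factor[OF \<gamma> \<gamma>_bounded ut(1) A] start_bounded[OF \<gamma> \<gamma>_bounded] t Wi])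
    show "AE \<omega> in P. Z (trunc n (start G u A)) t \<omega> \<le> W \<omega>" for n
      using \<gamma>_bounded AE_space
    proof eventually_elim
      case (elim \<omega>)
      show ?case unfolding W_def
        by (rule start_log_bound[OF \<gamma> \<gamma>_bounded elim(2) _ ut A]) (use elim(1) in blast)
    qed
  qed
qed

end

end

theorem theorem2p4:
  fixes P :: "'a measure" and F :: "ennreal \<Rightarrow> 'a measure"
    and N lam \<mu> \<gamma> M H :: "real \<Rightarrow> 'a \<Rightarrow> real^'d"
    and \<epsilon> :: real
  assumes space: "usual_filtered_prob_space P F"
    and N: "counting_process P F N"
    and lam: "nonneg_process P lam" "predictable P F lam" "locally_bounded P F lam"
    and intensity: "has_intensity P F N lam"
    and mu: "nonneg_process P \<mu>" "predictable P F \<mu>" "locally_bounded P F \<mu>"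
    and compat: "compatible P F \<mu> lam"
    and M_eq: "M = compensated N lam"
    and gamma_eq: "\<gamma> = intensity_ratio \<mu> lam"
    and H_eq: "H = (\<lambda>t \<omega>. \<chi> i. \<gamma> t \<omega> $ i - 1)"
    and eps: "\<epsilon> > 0"
    and moment: "\<And>u t. \<lbrakk>0 \<le> u; u \<le> t; t - u \<le> \<epsilon>\<rbrakk> \<Longrightarrow>
      (\<integral>\<^sup>+\<omega>. ennreal (exp (\<Sum>i\<in>UNIV. LINT s:{u..t}|lborel.
          (\<gamma> s \<omega> $ i * ln (\<gamma> s \<omega> $ i) - (\<gamma> s \<omega> $ i - 1)) * lam s \<omega> $ i)) \<partial>P) < \<infinity>
      \<or> (\<integral>\<^sup>+\<omega>. ennreal (exp (\<Sum>i\<in>UNIV. (LINT s:{u..t}|lborel. lam s \<omega> $ i)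
          + stieltjes_integral (\<lambda>s. log_plus (\<gamma> s \<omega> $ i)) (\<lambda>s. N s \<omega> $ i) u t)) \<partial>P) < \<infinity>"
  shows "(\<exists>Z. doleans_dade P F (integral_process H M) Z) \<and>
    (\<forall>Z. doleans_dade P F (integral_process H M) Z \<longrightarrow> martingale P F Z)"
proof -
  interpret intensity_setup P F N lam
    by (rule intensity_setup.intro[OF space]) (unfold_locales; fact)
  let ?G = "\<lambda>i s \<omega>. \<gamma> s \<omega> $ i"
  have \<gamma>_eq: "\<gamma> s \<omega> $ i = (if \<mu> s \<omega> $ i = 0 \<and> lam s \<omega> $ i = 0 then 1 else \<mu> s \<omega> $ i / lam s \<omega> $ i)" for s \<omega> i
    by (simp add: gamma_eq intensity_ratio_def)
  have factor: "intensity_factor ?G"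
    unfolding intensity_factor_def
  proof (intro conjI allI impI ballI)
    fix i
    have "(\<lambda>x. \<mu> (fst x) (snd x) $ i) \<in> borel_measurable PS" "(\<lambda>x. lam (fst x) (snd x) $ i) \<in> borel_measurable PS"
      using predictable_nth[OF mu(2), of i] lam_measurable[of i] by (simp_all add: case_prod_beta')
    then have "(\<lambda>x. if \<mu> (fst x) (snd x) $ i = 0 \<and> lam (fst x) (snd x) $ i = 0 then 1 else \<mu> (fst x) (snd x) $ i / lam (fst x) (snd x) $ i) \<in> borel_measurable PS"
      by measurable
    then show "(\<lambda>(s, \<omega>). \<gamma> s \<omega> $ i) \<in> borel_measurable PS" by (simp add: \<gamma>_eq case_prod_beta')
  next
    fix i \<omega> and s :: real assume "0 \<le> s" "\<omega> \<in> space P"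
    then show "0 \<le> \<gamma> s \<omega> $ i"
      using mu(1) lam(1) unfolding nonneg_process_def \<gamma>_eq by simp
  qed
  have "locally_bounded P F \<gamma>" using compat by (simp add: compatible_def gamma_eq)
  then have "AE \<omega> in P. \<forall>t. \<exists>C. \<forall>s\<in>{0..t}. norm (\<gamma> s \<omega>) \<le> C" by (rule locally_bounded_paths)
  then have bounded: "AE \<omega> in P. \<forall>t. bounded_on ?G t \<omega>"
    using locally_bounded_paths[OF lam_locally_bounded]
  proof eventually_elim
    case (elim \<omega>)
    show ?case
    proof
      fix t
      obtain C D where C: "\<forall>s\<in>{0..t}. norm (\<gamma> s \<omega>) \<le> C" and D: "\<forall>s\<in>{0..t}. norm (lam s \<omega>) \<le> D"
        using elim by meson
      have "\<gamma> s \<omega> $ i \<le> max C D \<and> lam s \<omega> $ i \<le> max C D" if s: "s \<in> {0..t}" for i s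
      proof -
        have "\<bar>\<gamma> s \<omega> $ i\<bar> \<le> C" "\<bar>lam s \<omega> $ i\<bar> \<le> D"
          using component_le_norm_cart[of "\<gamma> s \<omega>" i] component_le_norm_cart[of "lam s \<omega>" i] C D s by (meson order.trans)+
        then show ?thesis by auto
      qed
      then show "bounded_on ?G t \<omega>" unfolding bounded_on_def by blast
    qed
  qed
  have HM: "integral_process H M = integral_process (\<lambda>t \<omega>. \<chi> i. \<gamma> t \<omega> $ i - 1) (compensated N lam)"
    by (simp add: H_eq M_eq)
  have E: "(LINT \<omega>|P. Z (start ?G u A) t \<omega>) = 1"
    if "0 \<le> u" "u \<le> t" "t - u \<le> \<epsilon>" "A \<in> sets (F (ennreal u))" for u t A
    using moment[OF that(1-3)]
    by (rule disjE) (rule expectation_entropy_condition[OF factor bounded that(1,2,4)], assumption,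
        rule expectation_log_condition[OF factor bounded that(1,2,4)], assumption)
  have "martingale P F Y" if Y: "doleans_dade P F (integral_process H M) Y" for Y
  proof (rule martingale_of_steps[OF factor bounded eps E])
    show "adapted F Y" using Y by (simp add: doleans_dade_def)
    show "AE \<omega> in P. \<forall>t\<ge>0. Y t \<omega> = Z ?G t \<omega>"
      using Y unfolding HM by (rule doleans_dade_eq_Z[OF factor bounded])
  qed
  then show ?thesis using doleans_dade_exists[OF factor bounded] unfolding HM by blast
qed

end
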